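(* Let $\mathscr{J}$ be a system of arities in a symmetric monoidal closed category $\mathscr{V}$ such that $\mathscr{V}_0$ has pullbacks, and let $\mathscr{C}$ be a $\mathscr{J}$-admissible $\mathscr{V}$-category. Given a bifold algebra $D$ in $\mathscr{C}$, the following are equivalent: (1) $D$ is a balanced bifold algebra; (2) $D$ is a commutant bifold algebra whose left and right faces $D_\ell$ and $D_r$ are both commutative; (3) $D\cong\langle A,A\rangle$ in $\mathrm{BAlg}^{\mathrm{sc}}(\mathscr{C})$ for some balanced algebra $A$ in $\mathscr{C}$; (4) $D$ is a commutant bifold algebra whose left and right faces are both balanced; (5) the algebras $D_\ell$, $D_r$, $D_\ell^\perp$, $D_r^\perp$ are all isomorphic in $\mathrm{Alg}(C)$, where $C=|D|$. Consequently, the full subcategory $\mathrm{BalBAlg}^{\mathrm{sc}}(\mathscr{C})\hookrightarrow\mathrm{BAlg}^{\mathrm{sc}}(\mathscr{C})$ is replete.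
   Context: Base setting. $\mathscr{V}$ is a symmetric monoidal closed category with unit object $I$ and underlying ordinary category $\mathscr{V}_0$. By universe enlargement, $\mathscr{V}$ is a full subcategory of a symmetric monoidal closed category $\mathscr{V}'$ that is complete and cocomplete relative to a universe in which everything considered is small, with $\mathscr{V}\hookrightarrow\mathscr{V}'$ preserving all limits that exist in $\mathscr{V}$; $\mathscr{V}$-functor categories exist as $\mathscr{V}'$-categories. A system of arities is a fully faithful symmetric strong monoidal $\mathscr{V}$-functor $\mathscr{J}\to\mathscr{V}$, written as the inclusion of a full sub-$\mathscr{V}$-category containing $I$ and closed under $\otimes$ ($\mathscr{J}$ need not be small). A $\mathscr{J}$-cotensor in a $\mathscr{V}$-category is a cotensor $[J,C]$ with $J\in\mathrm{ob}\,\mathscr{J}$; $\mathscr{V}$-categories with $\mathscr{J}$-cotensors are equipped with designated ones, with $[I,C]=C$ (and identity counit). A $\mathscr{J}$-theory is a $\mathscr{V}$-category $\mathscr{T}$ equipped with an identity-on-objects $\mathscr{V}$-functor $\tau:\mathscr{J}^{\mathrm{op}}\to\mathscr{T}$ that preserves $\mathscr{J}$-cotensors; equivalently, $\mathrm{ob}\,\mathscr{T}=\mathrm{ob}\,\mathscr{J}$ and each object $J$ is equipped with a morphism $J\to\mathscr{T}(J,I)$ exhibiting $J$ as a cotensor $[J,I]$ in $\mathscr{T}$, which for $J=I$ is the identity on $I$. A morphism of $\mathscr{J}$-theories is a $\mathscr{V}$-functor commuting with the structure $\mathscr{V}$-functors $\tau$. For a $\mathscr{V}$-category $\mathscr{C}$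 with $\mathscr{J}$-cotensors, a $\mathscr{T}$-algebra in $\mathscr{C}$ is a $\mathscr{V}$-functor $A:\mathscr{T}\to\mathscr{C}$ preserving $\mathscr{J}$-cotensors; its carrier is $|A|=A(I)$. $\mathscr{T}\text{-}\mathrm{Alg}(\mathscr{C})$ is the full sub-$\mathscr{V}'$-category of $[\mathscr{T},\mathscr{C}]$ on the $\mathscr{T}$-algebras; for a morphism $f$ in it, $|f|=f_I$. $\mathscr{C}$ is $\mathscr{J}$-admissible if it has $\mathscr{J}$-cotensors and for every $\mathscr{J}$-theory $\mathscr{T}$ the ends defining the hom-objects of $\mathscr{T}\text{-}\mathrm{Alg}(\mathscr{C})$ exist in $\mathscr{V}$ (so it is a $\mathscr{V}$-category). $\mathscr{J}$-cotensors in $\mathscr{T}\text{-}\mathrm{Alg}(\mathscr{C})$ are pointwise, with designated ones chosen so that evaluation at $I$ sends them to the designated ones in $\mathscr{C}$. Algebras and commutants. An algebra in $\mathscr{C}$ is a pair $(\mathscr{T},A)$ (also written $A$) with $\mathscr{T}$ a $\mathscr{J}$-theory and $A$ a $\mathscr{T}$-algebra in $\mathscr{C}$. For an object $C$ of $\mathscr{C}$, $\mathrm{Alg}(C)$ is the category of algebras with carrier $C$, where a morphism $(M,f):(\mathscr{T},A)\to(\mathscr{U},B)$ consists of a morphism of $\mathscr{J}$-theories $M:\mathscr{T}\to\mathscr{U}$ and an isomorphism $f:A\to BM$ of $\mathscr{T}$-algebras with $|f|=1_C$. The commutant of $(\mathscr{T},A)$ is the algebra $A^\perp=(\mathscr{T}^\perp_A,A^\perp)$,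 where $\mathscr{T}^\perp_A$ is the $\mathscr{J}$-theory with $\mathscr{T}^\perp_A(J,K)=\mathscr{T}\text{-}\mathrm{Alg}(\mathscr{C})([J,A],[K,A])$ ($J,K\in\mathrm{ob}\,\mathscr{J}$), with composition and identities as in $\mathscr{T}\text{-}\mathrm{Alg}(\mathscr{C})$ and structure morphisms $J\to\mathscr{T}\text{-}\mathrm{Alg}(\mathscr{C})([J,A],A)$ the cotensor counits, and $A^\perp:\mathscr{T}^\perp_A\to\mathscr{C}$ is the algebra on $|A|$ given by $J\mapsto[J,|A|]$ and on homs by evaluation at $I$. Given algebras $A,B$ on $C$, $A$ commutes with $B$ if there is a (necessarily unique) morphism $B\to A^\perp$ in $\mathrm{Alg}(C)$. An algebra $A$ with carrier $C$ is commutative if it commutes with itself, and balanced if $A\cong A^\perp$ in $\mathrm{Alg}(C)$ (balanced algebras are commutative). Bifold algebras. For $\mathscr{J}$-theories $\mathscr{T},\mathscr{U}$, a $(\mathscr{T},\mathscr{U})$-algebra in $\mathscr{C}$ is a $\mathscr{V}$-functor $D:\mathscr{T}\otimes\mathscr{U}\to\mathscr{C}$ preserving $\mathscr{J}$-cotensors in each variable separately. A bifold algebra is a triple $(\mathscr{T},\mathscr{U},D)$ with $D$ such (written $D$); its carrier is $|D|=D(I,I)$. Its left face is the algebra $(\mathscr{T},D_\ell)$ with $D_\ell=D(-,I)$, and its right face is $(\mathscr{U},D_r)$ with $D_r=D(I,-)$. $\mathrm{BAlg}^{\mathrm{sc}}(\mathscr{C})$ is the category of bifold algebras, where a (strong cross-)morphism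 $(M,N,f):(\mathscr{T},\mathscr{U},D)\to(\mathscr{T}',\mathscr{U}',D')$ consists of morphisms of $\mathscr{J}$-theories $M:\mathscr{T}\to\mathscr{T}'$ and $N:\mathscr{U}'\to\mathscr{U}$ and a $\mathscr{V}$-natural isomorphism $f_{JK}:D(J,NK)\to D'(MJ,K)$ ($J\in\mathscr{T}$, $K\in\mathscr{U}'$); the composite with $(M',N',f'):(\mathscr{T}',\mathscr{U}',D')\to(\mathscr{T}'',\mathscr{U}'',D'')$ is $(M'M,NN',g)$ with $g_{JK}=f'_{MJ,K}\cdot f_{J,N'K}$. If algebras $(\mathscr{T},A)$ and $(\mathscr{U},B)$ on $C$ commute, $\langle A,B\rangle$ denotes the $(\mathscr{T},\mathscr{U})$-algebra $E$ with $|E|=C$, $E_\ell\cong A$ in $\mathscr{T}\text{-}\mathrm{Alg}(\mathscr{C})$ and $E_r\cong B$ in $\mathscr{U}\text{-}\mathrm{Alg}(\mathscr{C})$ by isomorphisms restricting to $1_C$ on carriers; it exists and is unique up to isomorphism restricting to $1_C$. Definitions. With $C=|D|$, $D$ is commutant if $D_r\cong D_\ell^\perp$ and $D_\ell\cong D_r^\perp$ in $\mathrm{Alg}(C)$. A balanced bifold algebra is a commutant bifold algebra $D$ with $D_\ell\cong D_r$ in $\mathrm{Alg}(C)$. $\mathrm{BalBAlg}^{\mathrm{sc}}(\mathscr{C})$ is the full subcategory of $\mathrm{BAlg}^{\mathrm{sc}}(\mathscr{C})$ on the balanced bifold algebras. *)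

theory Defs
  imports Main "HOL-Library.FuncSet"
begin

section \<open>Ordinary categories\<close>

text \<open>
  Equality of arrows is equality in the type of arrows.  Hence all \<open>\<V>\<close>-functors and
  \<open>\<V>\<close>-natural families below are required to be extensional (\<open>undefined\<close> outside of their
  domain), so that two of them are equal as soon as they agree on their domain.
\<close>

record ('o, 'm) category =
  Ob :: "'o set"
  Arr :: "'m set"
  Dom :: "'m \<Rightarrow> 'o"
  Cod :: "'m \<Rightarrow> 'o"
  Id :: "'o \<Rightarrow> 'm"
  Comp :: "'m \<Rightarrow> 'm \<Rightarrow> 'm"  (infixr "\<cdot>\<index>" 65)

definition Hom :: "('o, 'm, 'z) category_scheme \<Rightarrow> 'o \<Rightarrow> 'o \<Rightarrow> 'm set" where
  "Hom X a b = {f \<in> Arr X. Dom X f = a \<and> Cod X f = b}"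

locale category =
  fixes X :: "('o, 'm, 'z) category_scheme" (structure)
  assumes Dom_in: "f \<in> Arr X \<Longrightarrow> Dom X f \<in> Ob X"
    and Cod_in: "f \<in> Arr X \<Longrightarrow> Cod X f \<in> Ob X"
    and Id_in: "a \<in> Ob X \<Longrightarrow> Id X a \<in> Hom X a a"
    and Comp_in: "\<lbrakk>f \<in> Hom X a b; g \<in> Hom X b c\<rbrakk> \<Longrightarrow> g \<cdot> f \<in> Hom X a c"
    and Id_left: "f \<in> Hom X a b \<Longrightarrow> Id X b \<cdot> f = f"
    and Id_right: "f \<in> Hom X a b \<Longrightarrow> f \<cdot> Id X a = f"
    and Comp_assoc: "\<lbrakk>f \<in> Hom X a b; g \<in> Hom X b c; h \<in> Hom X c d\<rbrakk>
      \<Longrightarrow> (h \<cdot> g) \<cdot> f = h \<cdot> (g \<cdot> f)"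

definition inverse_arrows :: "('o, 'm, 'z) category_scheme \<Rightarrow> 'm \<Rightarrow> 'm \<Rightarrow> bool" where
  "inverse_arrows X f g \<longleftrightarrow>
     f \<in> Arr X \<and> g \<in> Hom X (Cod X f) (Dom X f) \<and>
     Comp X g f = Id X (Dom X f) \<and> Comp X f g = Id X (Cod X f)"

definition is_iso :: "('o, 'm, 'z) category_scheme \<Rightarrow> 'm \<Rightarrow> bool" where
  "is_iso X f \<longleftrightarrow> (\<exists>g. inverse_arrows X f g)"

definition inv_arr :: "('o, 'm, 'z) category_scheme \<Rightarrow> 'm \<Rightarrow> 'm" where
  "inv_arr X f = (THE g. inverse_arrows X f g)"

definition isomorphic :: "('o, 'm, 'z) category_scheme \<Rightarrow> 'o \<Rightarrow> 'o \<Rightarrow> bool" where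
  "isomorphic X a b \<longleftrightarrow> a \<in> Ob X \<and> b \<in> Ob X \<and> (\<exists>f \<in> Hom X a b. is_iso X f)"

definition is_pullback ::
  "('o, 'm, 'z) category_scheme \<Rightarrow> 'm \<Rightarrow> 'm \<Rightarrow> 'm \<Rightarrow> 'm \<Rightarrow> bool" where
  "is_pullback X f g p q \<longleftrightarrow>
     (\<exists>d \<in> Ob X. p \<in> Hom X d (Dom X f) \<and> q \<in> Hom X d (Dom X g) \<and> Comp X f p = Comp X g q \<and>
       (\<forall>e \<in> Ob X. \<forall>r \<in> Hom X e (Dom X f). \<forall>s \<in> Hom X e (Dom X g).
          Comp X f r = Comp X g s \<longrightarrow>
          (\<exists>!h. h \<in> Hom X e d \<and> Comp X p h = r \<and> Comp X q h = s)))"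

definition has_pullbacks :: "('o, 'm, 'z) category_scheme \<Rightarrow> bool" where
  "has_pullbacks X \<longleftrightarrow>
     (\<forall>f \<in> Arr X. \<forall>g \<in> Arr X. Cod X f = Cod X g \<longrightarrow> (\<exists>p q. is_pullback X f g p q))"

definition full_subcat :: "('o, 'm) category \<Rightarrow> ('o \<Rightarrow> bool) \<Rightarrow> ('o, 'm) category" where
  "full_subcat X P =
     X\<lparr>Ob := {a \<in> Ob X. P a}, Arr := {f \<in> Arr X. P (Dom X f) \<and> P (Cod X f)}\<rparr>"

definition full_subcategory :: "('o, 'm) category \<Rightarrow> ('o, 'm) category \<Rightarrow> bool" where
  "full_subcategory S X \<longleftrightarrow>
     Ob S \<subseteq> Ob X \<and> Arr S = {f \<in> Arr X. Dom X f \<in> Ob S \<and> Cod X f \<in> Ob S} \<and>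
     Dom S = Dom X \<and> Cod S = Cod X \<and> Id S = Id X \<and> Comp S = Comp X"

definition replete_full_subcategory ::
  "('o, 'm) category \<Rightarrow> ('o, 'm) category \<Rightarrow> bool" where
  "replete_full_subcategory S X \<longleftrightarrow>
     full_subcategory S X \<and>
     (\<forall>f \<in> Arr X. Dom X f \<in> Ob S \<and> is_iso X f \<longrightarrow> Cod X f \<in> Ob S \<and> f \<in> Arr S)"

section \<open>Symmetric monoidal closed categories\<close>

text \<open>\<open>a \<otimes> b\<close> is the tensor product of objects, \<open>f \<odot> g\<close> that of arrows.\<close>

record ('o, 'm) smcat = "('o, 'm) category" +
  Tens :: "'o \<Rightarrow> 'o \<Rightarrow> 'o"  (infixr "\<otimes>\<index>" 75)
  TensA :: "'m \<Rightarrow> 'm \<Rightarrow> 'm"  (infixr "\<odot>\<index>" 75)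
  Unit :: "'o"  ("\<I>\<index>")
  Assoc :: "'o \<Rightarrow> 'o \<Rightarrow> 'o \<Rightarrow> 'm"
  LUnit :: "'o \<Rightarrow> 'm"
  RUnit :: "'o \<Rightarrow> 'm"
  Sym :: "'o \<Rightarrow> 'o \<Rightarrow> 'm"
  IHom :: "'o \<Rightarrow> 'o \<Rightarrow> 'o"
  Ev :: "'o \<Rightarrow> 'o \<Rightarrow> 'm"

locale symmetric_monoidal_closed_category = category V
  for V :: "('o, 'm) smcat" (structure) +
  assumes Tens_in: "\<lbrakk>a \<in> Ob V; b \<in> Ob V\<rbrakk> \<Longrightarrow> a \<otimes> b \<in> Ob V"
    and TensA_in: "\<lbrakk>f \<in> Hom V a b; g \<in> Hom V c d\<rbrakk> \<Longrightarrow> f \<odot> g \<in> Hom V (a \<otimes> c) (b \<otimes> d)"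
    and TensA_Id: "\<lbrakk>a \<in> Ob V; b \<in> Ob V\<rbrakk> \<Longrightarrow> Id V a \<odot> Id V b = Id V (a \<otimes> b)"
    and TensA_Comp: "\<lbrakk>f \<in> Hom V a b; g \<in> Hom V b c; f' \<in> Hom V a' b'; g' \<in> Hom V b' c'\<rbrakk>
      \<Longrightarrow> (g \<cdot> f) \<odot> (g' \<cdot> f') = (g \<odot> g') \<cdot> (f \<odot> f')"
    and Unit_in: "\<I> \<in> Ob V"
    and Assoc_in: "\<lbrakk>a \<in> Ob V; b \<in> Ob V; c \<in> Ob V\<rbrakk>
      \<Longrightarrow> Assoc V a b c \<in> Hom V ((a \<otimes> b) \<otimes> c) (a \<otimes> (b \<otimes> c))"
    and Assoc_iso: "\<lbrakk>a \<in> Ob V; b \<in> Ob V; c \<in> Ob V\<rbrakk> \<Longrightarrow> is_iso V (Assoc V a b c)"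
    and Assoc_natural: "\<lbrakk>f \<in> Hom V a a'; g \<in> Hom V b b'; h \<in> Hom V c c'\<rbrakk>
      \<Longrightarrow> Assoc V a' b' c' \<cdot> ((f \<odot> g) \<odot> h) = (f \<odot> (g \<odot> h)) \<cdot> Assoc V a b c"
    and LUnit_in: "a \<in> Ob V \<Longrightarrow> LUnit V a \<in> Hom V (\<I> \<otimes> a) a"
    and LUnit_iso: "a \<in> Ob V \<Longrightarrow> is_iso V (LUnit V a)"
    and LUnit_natural: "f \<in> Hom V a b \<Longrightarrow> LUnit V b \<cdot> (Id V \<I> \<odot> f) = f \<cdot> LUnit V a"
    and RUnit_in: "a \<in> Ob V \<Longrightarrow> RUnit V a \<in> Hom V (a \<otimes> \<I>) a"
    and RUnit_iso: "a \<in> Ob V \<Longrightarrow> is_iso V (RUnit V a)"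
    and RUnit_natural: "f \<in> Hom V a b \<Longrightarrow> RUnit V b \<cdot> (f \<odot> Id V \<I>) = f \<cdot> RUnit V a"
    and pentagon: "\<lbrakk>a \<in> Ob V; b \<in> Ob V; c \<in> Ob V; d \<in> Ob V\<rbrakk>
      \<Longrightarrow> Assoc V a b (c \<otimes> d) \<cdot> Assoc V (a \<otimes> b) c d =
          (Id V a \<odot> Assoc V b c d) \<cdot> Assoc V a (b \<otimes> c) d \<cdot> (Assoc V a b c \<odot> Id V d)"
    and triangle: "\<lbrakk>a \<in> Ob V; b \<in> Ob V\<rbrakk>
      \<Longrightarrow> (Id V a \<odot> LUnit V b) \<cdot> Assoc V a \<I> b = RUnit V a \<odot> Id V b"
    and Sym_in: "\<lbrakk>a \<in> Ob V; b \<in> Ob V\<rbrakk> \<Longrightarrow> Sym V a b \<in> Hom V (a \<otimes> b) (b \<otimes> a)"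
    and Sym_natural: "\<lbrakk>f \<in> Hom V a a'; g \<in> Hom V b b'\<rbrakk>
      \<Longrightarrow> Sym V a' b' \<cdot> (f \<odot> g) = (g \<odot> f) \<cdot> Sym V a b"
    and Sym_Sym: "\<lbrakk>a \<in> Ob V; b \<in> Ob V\<rbrakk> \<Longrightarrow> Sym V b a \<cdot> Sym V a b = Id V (a \<otimes> b)"
    and hexagon: "\<lbrakk>a \<in> Ob V; b \<in> Ob V; c \<in> Ob V\<rbrakk>
      \<Longrightarrow> Assoc V b c a \<cdot> Sym V a (b \<otimes> c) \<cdot> Assoc V a b c =
          (Id V b \<odot> Sym V a c) \<cdot> Assoc V b a c \<cdot> (Sym V a b \<odot> Id V c)"
    and IHom_in: "\<lbrakk>a \<in> Ob V; b \<in> Ob V\<rbrakk> \<Longrightarrow> IHom V a b \<in> Ob V"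
    and Ev_in: "\<lbrakk>a \<in> Ob V; b \<in> Ob V\<rbrakk> \<Longrightarrow> Ev V a b \<in> Hom V (IHom V a b \<otimes> a) b"
    and closed: "\<lbrakk>x \<in> Ob V; a \<in> Ob V; b \<in> Ob V; f \<in> Hom V (x \<otimes> a) b\<rbrakk>
      \<Longrightarrow> \<exists>!g. g \<in> Hom V x (IHom V a b) \<and> Ev V a b \<cdot> (g \<odot> Id V a) = f"

text \<open>A system of arities, given as a full sub-\<open>\<V>\<close>-category of \<open>\<V>\<close>, i.e. a set of objects.\<close>

definition system_of_arities :: "('o, 'm) smcat \<Rightarrow> 'o set \<Rightarrow> bool" where
  "system_of_arities V J \<longleftrightarrow>
     J \<subseteq> Ob V \<and> Unit V \<in> J \<and> (\<forall>j \<in> J. \<forall>k \<in> J. Tens V j k \<in> J)"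

section \<open>Enriched categories, functors and natural transformations\<close>

record ('c, 'o, 'm) vcat =
  VOb :: "'c set"
  VHom :: "'c \<Rightarrow> 'c \<Rightarrow> 'o"
  VId :: "'c \<Rightarrow> 'm"
  VComp :: "'c \<Rightarrow> 'c \<Rightarrow> 'c \<Rightarrow> 'm"

record ('c, 'd, 'm) vfun =
  FOb :: "'c \<Rightarrow> 'd"
  FHom :: "'c \<Rightarrow> 'c \<Rightarrow> 'm"

text \<open>
  A \<open>\<V>\<close>-category together with designated \<open>\<J>\<close>-cotensors: \<open>Cot C j x\<close> is the object
  \<open>[j,x]\<close> and \<open>Counit C j x : j \<rightarrow> C([j,x],x)\<close> its counit.
\<close>

record ('c, 'o, 'm) cvcat = "('c, 'o, 'm) vcat" +
  Cot :: "'o \<Rightarrow> 'c \<Rightarrow> 'c"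
  Counit :: "'o \<Rightarrow> 'c \<Rightarrow> 'm"

text \<open>
  A \<open>\<J>\<close>-theory \<open>T\<close> has \<open>VOb T = J\<close>; \<open>Gen T j : j \<rightarrow> T(j,\<I>)\<close> is the morphism exhibiting
  \<open>j\<close> as a cotensor \<open>[j,\<I>]\<close>.
\<close>

record ('o, 'm) jtheory = "('o, 'o, 'm) vcat" +
  Gen :: "'o \<Rightarrow> 'm"

type_synonym ('c, 'o, 'm) algebra = "('o, 'm) jtheory \<times> ('o, 'c, 'm) vfun"

type_synonym ('c, 'o, 'm) bifold =
  "('o, 'm) jtheory \<times> ('o, 'm) jtheory \<times> ('o \<times> 'o, 'c, 'm) vfun"

type_synonym ('c, 'o, 'm) alg_arrow =
  "('c, 'o, 'm) algebra \<times> (('o, 'o, 'm) vfun \<times> ('o \<Rightarrow> 'm)) \<times> ('c, 'o, 'm) algebra"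

type_synonym ('c, 'o, 'm) bifold_arrow =
  "('c, 'o, 'm) bifold \<times>
   (('o, 'o, 'm) vfun \<times> ('o, 'o, 'm) vfun \<times> ('o \<times> 'o \<Rightarrow> 'm)) \<times>
   ('c, 'o, 'm) bifold"

context
  fixes V :: "('o, 'm) smcat" (structure)
begin

definition transpose :: "'o \<Rightarrow> 'o \<Rightarrow> 'o \<Rightarrow> 'm \<Rightarrow> 'm" where
  "transpose x a b f = (THE g. g \<in> Hom V x (IHom V a b) \<and> Ev V a b \<cdot> (g \<odot> Id V a) = f)"

definition vcategory :: "('c, 'o, 'm, 'z) vcat_scheme \<Rightarrow> bool" where
  "vcategory C \<longleftrightarrow>
     (\<forall>a \<in> VOb C. \<forall>b \<in> VOb C. VHom C a b \<in> Ob V) \<and>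
     (\<forall>a \<in> VOb C. VId C a \<in> Hom V \<I> (VHom C a a)) \<and>
     (\<forall>a \<in> VOb C. \<forall>b \<in> VOb C. \<forall>c \<in> VOb C.
        VComp C a b c \<in> Hom V (VHom C b c \<otimes> VHom C a b) (VHom C a c)) \<and>
     (\<forall>a \<in> VOb C. \<forall>b \<in> VOb C. \<forall>c \<in> VOb C. \<forall>d \<in> VOb C.
        VComp C a b d \<cdot> (VComp C b c d \<odot> Id V (VHom C a b)) =
        VComp C a c d \<cdot> (Id V (VHom C c d) \<odot> VComp C a b c)
          \<cdot> Assoc V (VHom C c d) (VHom C b c) (VHom C a b)) \<and>
     (\<forall>a \<in> VOb C. \<forall>b \<in> VOb C.
        VComp C a b b \<cdot> (VId C b \<odot> Id V (VHom C a b)) = LUnit V (VHom C a b) \<and>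
        VComp C a a b \<cdot> (Id V (VHom C a b) \<odot> VId C a) = RUnit V (VHom C a b))"

definition vfunctor ::
  "('c, 'o, 'm, 'y) vcat_scheme \<Rightarrow> ('d, 'o, 'm, 'z) vcat_scheme \<Rightarrow> ('c, 'd, 'm) vfun \<Rightarrow> bool"
  where
  "vfunctor A B F \<longleftrightarrow>
     FOb F \<in> VOb A \<rightarrow>\<^sub>E VOb B \<and>
     (\<forall>a b. a \<notin> VOb A \<or> b \<notin> VOb A \<longrightarrow> FHom F a b = undefined) \<and>
     (\<forall>a \<in> VOb A. \<forall>b \<in> VOb A. FHom F a b \<in> Hom V (VHom A a b) (VHom B (FOb F a) (FOb F b))) \<and>
     (\<forall>a \<in> VOb A. FHom F a a \<cdot> VId A a = VId B (FOb F a)) \<and>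
     (\<forall>a \<in> VOb A. \<forall>b \<in> VOb A. \<forall>c \<in> VOb A.
        FHom F a c \<cdot> VComp A a b c =
        VComp B (FOb F a) (FOb F b) (FOb F c) \<cdot> (FHom F b c \<odot> FHom F a b))"

definition vid :: "('c, 'o, 'm, 'z) vcat_scheme \<Rightarrow> ('c, 'c, 'm) vfun" where
  "vid A = \<lparr>FOb = (\<lambda>a \<in> VOb A. a),
     FHom = (\<lambda>a b. if a \<in> VOb A \<and> b \<in> VOb A then Id V (VHom A a b) else undefined)\<rparr>"

text \<open>\<open>vcomp A G F\<close> is the composite \<open>GF\<close>, where \<open>A\<close> is the domain of \<open>F\<close>.\<close>

definition vcomp ::
  "('c, 'o, 'm, 'z) vcat_scheme \<Rightarrow> ('d, 'e, 'm) vfun \<Rightarrow> ('c, 'd, 'm) vfun \<Rightarrow> ('c, 'e, 'm) vfun"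
  where
  "vcomp A G F = \<lparr>FOb = (\<lambda>a \<in> VOb A. FOb G (FOb F a)),
     FHom = (\<lambda>a b. if a \<in> VOb A \<and> b \<in> VOb A
                     then FHom G (FOb F a) (FOb F b) \<cdot> FHom F a b else undefined)\<rparr>"

text \<open>Composition \<open>g f\<close> in the underlying category of \<open>C\<close>, for \<open>f : \<I> \<rightarrow> C(a,b)\<close> and \<open>g : \<I> \<rightarrow> C(b,c)\<close>.\<close>

definition ucomp ::
  "('c, 'o, 'm, 'z) vcat_scheme \<Rightarrow> 'c \<Rightarrow> 'c \<Rightarrow> 'c \<Rightarrow> 'm \<Rightarrow> 'm \<Rightarrow> 'm" where
  "ucomp C a b c g f = VComp C a b c \<cdot> (g \<odot> f) \<cdot> inv_arr V (LUnit V \<I>)"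

definition vnat ::
  "('c, 'o, 'm, 'y) vcat_scheme \<Rightarrow> ('d, 'o, 'm, 'z) vcat_scheme \<Rightarrow>
   ('c, 'd, 'm) vfun \<Rightarrow> ('c, 'd, 'm) vfun \<Rightarrow> ('c \<Rightarrow> 'm) \<Rightarrow> bool" where
  "vnat A B F G \<alpha> \<longleftrightarrow>
     \<alpha> \<in> extensional (VOb A) \<and>
     (\<forall>a \<in> VOb A. \<alpha> a \<in> Hom V \<I> (VHom B (FOb F a) (FOb G a))) \<and>
     (\<forall>a \<in> VOb A. \<forall>b \<in> VOb A.
        VComp B (FOb F a) (FOb F b) (FOb G b) \<cdot> (\<alpha> b \<odot> FHom F a b)
          \<cdot> inv_arr V (LUnit V (VHom A a b)) =
        VComp B (FOb F a) (FOb G a) (FOb G b) \<cdot> (FHom G a b \<odot> \<alpha> a)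
          \<cdot> inv_arr V (RUnit V (VHom A a b)))"

definition vnat_iso ::
  "('c, 'o, 'm, 'y) vcat_scheme \<Rightarrow> ('d, 'o, 'm, 'z) vcat_scheme \<Rightarrow>
   ('c, 'd, 'm) vfun \<Rightarrow> ('c, 'd, 'm) vfun \<Rightarrow> ('c \<Rightarrow> 'm) \<Rightarrow> bool" where
  "vnat_iso A B F G \<alpha> \<longleftrightarrow>
     vnat A B F G \<alpha> \<and>
     (\<exists>\<beta>. vnat A B G F \<beta> \<and>
        (\<forall>a \<in> VOb A.
           ucomp B (FOb F a) (FOb G a) (FOb F a) (\<beta> a) (\<alpha> a) = VId B (FOb F a) \<and>
           ucomp B (FOb G a) (FOb F a) (FOb G a) (\<alpha> a) (\<beta> a) = VId B (FOb G a)))"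

section \<open>Cotensors\<close>

text \<open>
  The comparison \<open>C(z,p) \<rightarrow> [j, C(z,x)]\<close> induced by \<open>\<kappa> : j \<rightarrow> C(p,x)\<close>; the pair \<open>(p,\<kappa>)\<close> is a
  cotensor of \<open>x\<close> by \<open>j\<close> iff it is invertible for all \<open>z\<close>.
\<close>

definition cot_cmp ::
  "('c, 'o, 'm, 'z) vcat_scheme \<Rightarrow> 'o \<Rightarrow> 'c \<Rightarrow> 'c \<Rightarrow> 'm \<Rightarrow> 'c \<Rightarrow> 'm" where
  "cot_cmp C j x p \<kappa> z =
     transpose (VHom C z p) j (VHom C z x)
       (VComp C z p x \<cdot> (\<kappa> \<odot> Id V (VHom C z p)) \<cdot> Sym V (VHom C z p) j)"

definition is_cotensor ::
  "('c, 'o, 'm, 'z) vcat_scheme \<Rightarrow> 'o \<Rightarrow> 'c \<Rightarrow> 'c \<Rightarrow> 'm \<Rightarrow> bool" where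
  "is_cotensor C j x p \<kappa> \<longleftrightarrow>
     j \<in> Ob V \<and> x \<in> VOb C \<and> p \<in> VOb C \<and> \<kappa> \<in> Hom V j (VHom C p x) \<and>
     (\<forall>z \<in> VOb C. is_iso V (cot_cmp C j x p \<kappa> z))"

definition preserves_cotensors ::
  "'o set \<Rightarrow> ('c, 'o, 'm, 'y) vcat_scheme \<Rightarrow> ('d, 'o, 'm, 'z) vcat_scheme \<Rightarrow>
   ('c, 'd, 'm) vfun \<Rightarrow> bool" where
  "preserves_cotensors J A B F \<longleftrightarrow>
     (\<forall>j \<in> J. \<forall>x p \<kappa>. is_cotensor A j x p \<kappa> \<longrightarrow>
        is_cotensor B j (FOb F x) (FOb F p) (FHom F p x \<cdot> \<kappa>))"

definition has_cotensors :: "'o set \<Rightarrow> ('c, 'o, 'm) cvcat \<Rightarrow> bool" where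
  "has_cotensors J C \<longleftrightarrow>
     (\<forall>j \<in> J. \<forall>x \<in> VOb C. is_cotensor C j x (Cot C j x) (Counit C j x)) \<and>
     (\<forall>x \<in> VOb C. Cot C \<I> x = x \<and> Counit C \<I> x = VId C x)"

text \<open>The action \<open>C(x,y) \<rightarrow> C([j,x],[j,y])\<close> of the \<open>\<V>\<close>-functor \<open>[j,-]\<close> on homs.\<close>

definition cot_map :: "('c, 'o, 'm) cvcat \<Rightarrow> 'o \<Rightarrow> 'c \<Rightarrow> 'c \<Rightarrow> 'm" where
  "cot_map C j x y =
     inv_arr V (cot_cmp C j y (Cot C j y) (Counit C j y) (Cot C j x))
     \<cdot> transpose (VHom C x y) j (VHom C (Cot C j x) y)
         (VComp C (Cot C j x) x y \<cdot> (Id V (VHom C x y) \<odot> Counit C j x))"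

section \<open>Theories and their algebras\<close>

definition is_theory :: "'o set \<Rightarrow> ('o, 'm) jtheory \<Rightarrow> bool" where
  "is_theory J T \<longleftrightarrow>
     vcategory T \<and> VOb T = J \<and>
     (\<forall>j \<in> J. is_cotensor T j \<I> j (Gen T j)) \<and> Gen T \<I> = VId T \<I>"

text \<open>
  The structure \<open>\<V>\<close>-functor \<open>\<tau> : J\<^sup>o\<^sup>p \<rightarrow> T\<close> on homs, \<open>J\<^sup>o\<^sup>p(j,k) = [k,j] \<rightarrow> T(j,k)\<close>.  It is
  determined by the morphisms \<open>Gen T j\<close> through \<open>T(j,k) \<cong> [k, T(j,\<I>)]\<close>.
\<close>

definition tau :: "('o, 'm) jtheory \<Rightarrow> 'o \<Rightarrow> 'o \<Rightarrow> 'm" where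
  "tau T j k =
     inv_arr V (cot_cmp T k \<I> k (Gen T k) j)
     \<cdot> transpose (IHom V k j) k (VHom T j \<I>) (Gen T j \<cdot> Ev V k j)"

definition theory_morphism ::
  "'o set \<Rightarrow> ('o, 'm) jtheory \<Rightarrow> ('o, 'm) jtheory \<Rightarrow> ('o, 'o, 'm) vfun \<Rightarrow> bool" where
  "theory_morphism J T U M \<longleftrightarrow>
     vfunctor T U M \<and> (\<forall>j \<in> J. FOb M j = j) \<and>
     (\<forall>j \<in> J. \<forall>k \<in> J. FHom M j k \<cdot> tau T j k = tau U j k)"

definition is_algebra ::
  "'o set \<Rightarrow> ('c, 'o, 'm) cvcat \<Rightarrow> ('o, 'm) jtheory \<Rightarrow> ('o, 'c, 'm) vfun \<Rightarrow> bool" where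
  "is_algebra J C T A \<longleftrightarrow> vfunctor T C A \<and> preserves_cotensors J T C A"

text \<open>
  The hom-object \<open>[T,C](A,B)\<close> is the end of \<open>C(Aj,Bj)\<close> over \<open>j \<in> T\<close>, i.e. a universal
  family \<open>\<pi> j : e \<rightarrow> C(Aj,Bj)\<close> that is \<open>\<V>\<close>-natural in \<open>j\<close>.
\<close>

definition vnat_family ::
  "('b, 'o, 'm, 'y) vcat_scheme \<Rightarrow> ('c, 'o, 'm, 'z) vcat_scheme \<Rightarrow>
   ('b, 'c, 'm) vfun \<Rightarrow> ('b, 'c, 'm) vfun \<Rightarrow> 'o \<Rightarrow> ('b \<Rightarrow> 'm) \<Rightarrow> bool" where
  "vnat_family T C A B x \<alpha> \<longleftrightarrow>
     \<alpha> \<in> extensional (VOb T) \<and>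
     (\<forall>j \<in> VOb T. \<alpha> j \<in> Hom V x (VHom C (FOb A j) (FOb B j))) \<and>
     (\<forall>j \<in> VOb T. \<forall>k \<in> VOb T.
        VComp C (FOb A j) (FOb A k) (FOb B k) \<cdot> (\<alpha> k \<odot> FHom A j k) =
        VComp C (FOb A j) (FOb B j) (FOb B k) \<cdot> (FHom B j k \<odot> \<alpha> j) \<cdot> Sym V x (VHom T j k))"

definition is_hom_end ::
  "('b, 'o, 'm, 'y) vcat_scheme \<Rightarrow> ('c, 'o, 'm, 'z) vcat_scheme \<Rightarrow>
   ('b, 'c, 'm) vfun \<Rightarrow> ('b, 'c, 'm) vfun \<Rightarrow> 'o \<Rightarrow> ('b \<Rightarrow> 'm) \<Rightarrow> bool" where
  "is_hom_end T C A B e \<pi> \<longleftrightarrow>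
     e \<in> Ob V \<and> vnat_family T C A B e \<pi> \<and>
     (\<forall>x \<in> Ob V. \<forall>\<alpha>. vnat_family T C A B x \<alpha> \<longrightarrow>
        (\<exists>!h. h \<in> Hom V x e \<and> (\<forall>j \<in> VOb T. \<pi> j \<cdot> h = \<alpha> j)))"

definition admissible :: "'o set \<Rightarrow> ('c, 'o, 'm) cvcat \<Rightarrow> bool" where
  "admissible J C \<longleftrightarrow>
     has_cotensors J C \<and>
     (\<forall>T A B. is_theory J T \<and> is_algebra J C T A \<and> is_algebra J C T B \<longrightarrow>
        (\<exists>e \<pi>. is_hom_end T C A B e \<pi>))"

text \<open>
  A choice of the ends defining the hom-objects of \<open>T-Alg(C)\<close>.  It is only used for
  admissible \<open>C\<close>, so no enlargement of \<open>\<V>\<close> is needed.  \<open>end_lift\<close> is the arrow into the chosen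
  end that is induced by a \<open>\<V>\<close>-natural family.
\<close>

definition hom_end ::
  "('o, 'm) jtheory \<Rightarrow> ('c, 'o, 'm) cvcat \<Rightarrow>
   ('o, 'c, 'm) vfun \<Rightarrow> ('o, 'c, 'm) vfun \<Rightarrow> 'o \<times> ('o \<Rightarrow> 'm)" where
  "hom_end T C A B = (SOME E. is_hom_end T C A B (fst E) (snd E))"

definition end_obj ::
  "('o, 'm) jtheory \<Rightarrow> ('c, 'o, 'm) cvcat \<Rightarrow> ('o, 'c, 'm) vfun \<Rightarrow> ('o, 'c, 'm) vfun \<Rightarrow> 'o" where
  "end_obj T C A B = fst (hom_end T C A B)"

definition end_proj ::
  "('o, 'm) jtheory \<Rightarrow> ('c, 'o, 'm) cvcat \<Rightarrow>
   ('o, 'c, 'm) vfun \<Rightarrow> ('o, 'c, 'm) vfun \<Rightarrow> 'o \<Rightarrow> 'm" where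
  "end_proj T C A B = snd (hom_end T C A B)"

definition end_lift ::
  "('o, 'm) jtheory \<Rightarrow> ('c, 'o, 'm) cvcat \<Rightarrow>
   ('o, 'c, 'm) vfun \<Rightarrow> ('o, 'c, 'm) vfun \<Rightarrow> 'o \<Rightarrow> ('o \<Rightarrow> 'm) \<Rightarrow> 'm" where
  "end_lift T C A B x \<alpha> =
     (THE h. h \<in> Hom V x (end_obj T C A B) \<and> (\<forall>j \<in> VOb T. end_proj T C A B j \<cdot> h = \<alpha> j))"

text \<open>
  The pointwise cotensor \<open>[j,A]\<close>, i.e. \<open>k \<mapsto> [j,Ak]\<close>; its value at \<open>\<I>\<close> is the designated
  cotensor \<open>[j,A\<I>]\<close> in \<open>C\<close>.
\<close>

definition alg_cot ::
  "('o, 'm) jtheory \<Rightarrow> ('c, 'o, 'm) cvcat \<Rightarrow> 'o \<Rightarrow> ('o, 'c, 'm) vfun \<Rightarrow> ('o, 'c, 'm) vfun" where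
  "alg_cot T C j A = \<lparr>FOb = (\<lambda>k \<in> VOb T. Cot C j (FOb A k)),
     FHom = (\<lambda>k l. if k \<in> VOb T \<and> l \<in> VOb T
                     then cot_map C j (FOb A k) (FOb A l) \<cdot> FHom A k l else undefined)\<rparr>"

definition TAlg ::
  "'o set \<Rightarrow> ('c, 'o, 'm) cvcat \<Rightarrow> ('o, 'm) jtheory \<Rightarrow> (('o, 'c, 'm) vfun, 'o, 'm) cvcat" where
  "TAlg J C T = \<lparr>
     VOb = {A. is_algebra J C T A},
     VHom = end_obj T C,
     VId = (\<lambda>A. end_lift T C A A \<I> (\<lambda>j \<in> VOb T. VId C (FOb A j))),
     VComp = (\<lambda>A B D. end_lift T C A D (end_obj T C B D \<otimes> end_obj T C A B)
       (\<lambda>j \<in> VOb T. VComp C (FOb A j) (FOb B j) (FOb D j)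
                       \<cdot> (end_proj T C B D j \<odot> end_proj T C A B j))),
     Cot = alg_cot T C,
     Counit = (\<lambda>j A. end_lift T C (alg_cot T C j A) A j (\<lambda>k \<in> VOb T. Counit C j (FOb A k)))\<rparr>"

definition carrier :: "('c, 'o, 'm) algebra \<Rightarrow> 'c" where
  "carrier A = FOb (snd A) \<I>"

definition algebra :: "'o set \<Rightarrow> ('c, 'o, 'm) cvcat \<Rightarrow> ('c, 'o, 'm) algebra \<Rightarrow> bool" where
  "algebra J C A \<longleftrightarrow> is_theory J (fst A) \<and> is_algebra J C (fst A) (snd A)"

definition Alg ::
  "'o set \<Rightarrow> ('c, 'o, 'm) cvcat \<Rightarrow> 'c \<Rightarrow> (('c, 'o, 'm) algebra, ('c, 'o, 'm) alg_arrow) category"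
  where
  "Alg J C c = \<lparr>
     Ob = {A. algebra J C A \<and> carrier A = c},
     Arr = {((T, A), (M, f), (U, B)) | T A M f U B.
       algebra J C (T, A) \<and> carrier (T, A) = c \<and>
       algebra J C (U, B) \<and> carrier (U, B) = c \<and>
       theory_morphism J T U M \<and>
       vnat_iso T C A (vcomp T B M) f \<and> f \<I> = VId C c},
     Dom = (\<lambda>(A, _, _). A),
     Cod = (\<lambda>(_, _, B). B),
     Id = (\<lambda>(T, A). ((T, A), (vid T, (\<lambda>j \<in> J. VId C (FOb A j))), (T, A))),
     Comp = (\<lambda>((U, B), (M', f'), (W, E)) ((T, A), (M, f), _).
       ((T, A),
        (vcomp T M' M,
         (\<lambda>j \<in> J. ucomp C (FOb A j) (FOb B (FOb M j)) (FOb E (FOb M' (FOb M j)))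
                     (f' (FOb M j)) (f j))),
        (W, E)))\<rparr>"

section \<open>Commutants\<close>

definition commutant_theory ::
  "'o set \<Rightarrow> ('c, 'o, 'm) cvcat \<Rightarrow> ('c, 'o, 'm) algebra \<Rightarrow> ('o, 'm) jtheory" where
  "commutant_theory J C = (\<lambda>(T, A).
     let K = TAlg J C T in \<lparr>
       VOb = J,
       VHom = (\<lambda>j k. VHom K (Cot K j A) (Cot K k A)),
       VId = (\<lambda>j. VId K (Cot K j A)),
       VComp = (\<lambda>j k l. VComp K (Cot K j A) (Cot K k A) (Cot K l A)),
       Gen = (\<lambda>j. Counit K j A)\<rparr>)"

definition commutant ::
  "'o set \<Rightarrow> ('c, 'o, 'm) cvcat \<Rightarrow> ('c, 'o, 'm) algebra \<Rightarrow> ('c, 'o, 'm) algebra" where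
  "commutant J C = (\<lambda>(T, A).
     (commutant_theory J C (T, A),
      \<lparr>FOb = (\<lambda>j \<in> J. Cot C j (FOb A \<I>)),
       FHom = (\<lambda>j k. if j \<in> J \<and> k \<in> J
                       then end_proj T C (alg_cot T C j A) (alg_cot T C k A) \<I>
                       else undefined)\<rparr>))"

text \<open>\<open>commutes J C A B\<close>: there is a morphism from \<open>B\<close> to the commutant of \<open>A\<close>.\<close>

definition commutes ::
  "'o set \<Rightarrow> ('c, 'o, 'm) cvcat \<Rightarrow> ('c, 'o, 'm) algebra \<Rightarrow> ('c, 'o, 'm) algebra \<Rightarrow> bool" where
  "commutes J C A B \<longleftrightarrow>
     algebra J C A \<and> algebra J C B \<and> carrier A = carrier B \<and>
     (\<exists>h. h \<in> Hom (Alg J C (carrier A)) B (commutant J C A))"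

definition commutative :: "'o set \<Rightarrow> ('c, 'o, 'm) cvcat \<Rightarrow> ('c, 'o, 'm) algebra \<Rightarrow> bool" where
  "commutative J C A \<longleftrightarrow> commutes J C A A"

definition balanced :: "'o set \<Rightarrow> ('c, 'o, 'm) cvcat \<Rightarrow> ('c, 'o, 'm) algebra \<Rightarrow> bool" where
  "balanced J C A \<longleftrightarrow> algebra J C A \<and> isomorphic (Alg J C (carrier A)) A (commutant J C A)"

section \<open>Bifold algebras\<close>

text \<open>The middle interchange \<open>(w \<otimes> x) \<otimes> (y \<otimes> z) \<rightarrow> (w \<otimes> y) \<otimes> (x \<otimes> z)\<close>.\<close>

definition middle :: "'o \<Rightarrow> 'o \<Rightarrow> 'o \<Rightarrow> 'o \<Rightarrow> 'm" where
  "middle w x y z =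
     inv_arr V (Assoc V w y (x \<otimes> z))
     \<cdot> (Id V w \<odot> (Assoc V y x z \<cdot> (Sym V x y \<odot> Id V z) \<cdot> inv_arr V (Assoc V x y z)))
     \<cdot> Assoc V w x (y \<otimes> z)"

definition vtensor ::
  "('a, 'o, 'm, 'y) vcat_scheme \<Rightarrow> ('b, 'o, 'm, 'z) vcat_scheme \<Rightarrow> ('a \<times> 'b, 'o, 'm) vcat" where
  "vtensor A B = \<lparr>
     VOb = VOb A \<times> VOb B,
     VHom = (\<lambda>(a, b) (a', b'). VHom A a a' \<otimes> VHom B b b'),
     VId = (\<lambda>(a, b). (VId A a \<odot> VId B b) \<cdot> inv_arr V (LUnit V \<I>)),
     VComp = (\<lambda>(a, b) (a', b') (a'', b'').
       (VComp A a a' a'' \<odot> VComp B b b' b'')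
       \<cdot> middle (VHom A a' a'') (VHom B b' b'') (VHom A a a') (VHom B b b'))\<rparr>"

definition vfun_tensor ::
  "('a, 'o, 'm, 'y) vcat_scheme \<Rightarrow> ('b, 'o, 'm, 'z) vcat_scheme \<Rightarrow>
   ('a, 'c, 'm) vfun \<Rightarrow> ('b, 'd, 'm) vfun \<Rightarrow> ('a \<times> 'b, 'c \<times> 'd, 'm) vfun" where
  "vfun_tensor A B F G = \<lparr>
     FOb = (\<lambda>(a, b) \<in> VOb A \<times> VOb B. (FOb F a, FOb G b)),
     FHom = (\<lambda>p q. if p \<in> VOb A \<times> VOb B \<and> q \<in> VOb A \<times> VOb B
                     then FHom F (fst p) (fst q) \<odot> FHom G (snd p) (snd q) else undefined)\<rparr>"

text \<open>The partial \<open>\<V>\<close>-functors \<open>F(-,b)\<close> and \<open>F(a,-)\<close> of \<open>F : A \<otimes> B \<rightarrow> C\<close>.\<close>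

definition fix_right ::
  "('a, 'o, 'm, 'y) vcat_scheme \<Rightarrow> ('b, 'o, 'm, 'z) vcat_scheme \<Rightarrow>
   ('a \<times> 'b, 'c, 'm) vfun \<Rightarrow> 'b \<Rightarrow> ('a, 'c, 'm) vfun" where
  "fix_right A B F b = \<lparr>
     FOb = (\<lambda>a \<in> VOb A. FOb F (a, b)),
     FHom = (\<lambda>a a'. if a \<in> VOb A \<and> a' \<in> VOb A
       then FHom F (a, b) (a', b) \<cdot> (Id V (VHom A a a') \<odot> VId B b)
              \<cdot> inv_arr V (RUnit V (VHom A a a'))
       else undefined)\<rparr>"

definition fix_left ::
  "('a, 'o, 'm, 'y) vcat_scheme \<Rightarrow> ('b, 'o, 'm, 'z) vcat_scheme \<Rightarrow>
   ('a \<times> 'b, 'c, 'm) vfun \<Rightarrow> 'a \<Rightarrow> ('b, 'c, 'm) vfun" where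
  "fix_left A B F a = \<lparr>
     FOb = (\<lambda>b \<in> VOb B. FOb F (a, b)),
     FHom = (\<lambda>b b'. if b \<in> VOb B \<and> b' \<in> VOb B
       then FHom F (a, b) (a, b') \<cdot> (VId A a \<odot> Id V (VHom B b b'))
              \<cdot> inv_arr V (LUnit V (VHom B b b'))
       else undefined)\<rparr>"

definition bifold_algebra :: "'o set \<Rightarrow> ('c, 'o, 'm) cvcat \<Rightarrow> ('c, 'o, 'm) bifold \<Rightarrow> bool" where
  "bifold_algebra J C = (\<lambda>(T, U, F).
     is_theory J T \<and> is_theory J U \<and> vfunctor (vtensor T U) C F \<and>
     (\<forall>k \<in> J. preserves_cotensors J T C (fix_right T U F k)) \<and>
     (\<forall>j \<in> J. preserves_cotensors J U C (fix_left T U F j)))"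

definition bcarrier :: "('c, 'o, 'm) bifold \<Rightarrow> 'c" where
  "bcarrier = (\<lambda>(T, U, F). FOb F (\<I>, \<I>))"

definition left_face :: "('c, 'o, 'm) bifold \<Rightarrow> ('c, 'o, 'm) algebra" where
  "left_face = (\<lambda>(T, U, F). (T, fix_right T U F \<I>))"

definition right_face :: "('c, 'o, 'm) bifold \<Rightarrow> ('c, 'o, 'm) algebra" where
  "right_face = (\<lambda>(T, U, F). (U, fix_left T U F \<I>))"

text \<open>
  The category \<open>BAlg\<^sup>s\<^sup>c(C)\<close> of bifold algebras and strong cross-morphisms: \<open>M : T \<rightarrow> T'\<close> and
  \<open>N : U' \<rightarrow> U\<close> go in opposite directions, and \<open>f\<close> is a \<open>\<V>\<close>-natural isomorphism
  \<open>F(j,Nk) \<rightarrow> F'(Mj,k)\<close> between \<open>\<V>\<close>-functors on \<open>T \<otimes> U'\<close>.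
\<close>

definition BAlg ::
  "'o set \<Rightarrow> ('c, 'o, 'm) cvcat \<Rightarrow> (('c, 'o, 'm) bifold, ('c, 'o, 'm) bifold_arrow) category"
  where
  "BAlg J C = \<lparr>
     Ob = {D. bifold_algebra J C D},
     Arr = {((T, U, F), (M, N, f), (T', U', F')) | T U F M N f T' U' F'.
       bifold_algebra J C (T, U, F) \<and> bifold_algebra J C (T', U', F') \<and>
       theory_morphism J T T' M \<and> theory_morphism J U' U N \<and>
       vnat_iso (vtensor T U') C
         (vcomp (vtensor T U') F (vfun_tensor T U' (vid T) N))
         (vcomp (vtensor T U') F' (vfun_tensor T U' M (vid U'))) f},
     Dom = (\<lambda>(D, _, _). D),
     Cod = (\<lambda>(_, _, D). D),
     Id = (\<lambda>(T, U, F).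
       ((T, U, F), (vid T, vid U, (\<lambda>p \<in> J \<times> J. VId C (FOb F p))), (T, U, F))),
     Comp = (\<lambda>((T', U', F'), (M', N', f'), (T'', U'', F'')) ((T, U, F), (M, N, f), _).
       ((T, U, F),
        (vcomp T M' M, vcomp U'' N N',
         (\<lambda>(j, k) \<in> J \<times> J.
            ucomp C (FOb F (j, FOb N (FOb N' k))) (FOb F' (FOb M j, FOb N' k))
                    (FOb F'' (FOb M' (FOb M j), k))
              (f' (FOb M j, k)) (f (j, FOb N' k)))),
        (T'', U'', F'')))\<rparr>"

text \<open>
  \<open>E\<close> is a bifold algebra \<open>\<langle>A,B\<rangle>\<close>, for commuting algebras \<open>A\<close> and \<open>B\<close>; this determines \<open>E\<close> up to
  an isomorphism that restricts to the identity on carriers.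
\<close>

definition is_pairing ::
  "'o set \<Rightarrow> ('c, 'o, 'm) cvcat \<Rightarrow> ('c, 'o, 'm) algebra \<Rightarrow> ('c, 'o, 'm) algebra \<Rightarrow>
   ('c, 'o, 'm) bifold \<Rightarrow> bool" where
  "is_pairing J C = (\<lambda>(T, A) (U, B) E.
     commutes J C (T, A) (U, B) \<and>
     bifold_algebra J C E \<and> fst (left_face E) = T \<and> fst (right_face E) = U \<and>
     bcarrier E = carrier (T, A) \<and>
     (\<exists>f. vnat_iso T C (snd (left_face E)) A f \<and> f \<I> = VId C (carrier (T, A))) \<and>
     (\<exists>g. vnat_iso U C (snd (right_face E)) B g \<and> g \<I> = VId C (carrier (T, A))))"

definition commutant_bifold :: "'o set \<Rightarrow> ('c, 'o, 'm) cvcat \<Rightarrow> ('c, 'o, 'm) bifold \<Rightarrow> bool" where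
  "commutant_bifold J C D \<longleftrightarrow>
     bifold_algebra J C D \<and>
     isomorphic (Alg J C (bcarrier D)) (right_face D) (commutant J C (left_face D)) \<and>
     isomorphic (Alg J C (bcarrier D)) (left_face D) (commutant J C (right_face D))"

definition balanced_bifold :: "'o set \<Rightarrow> ('c, 'o, 'm) cvcat \<Rightarrow> ('c, 'o, 'm) bifold \<Rightarrow> bool" where
  "balanced_bifold J C D \<longleftrightarrow>
     commutant_bifold J C D \<and>
     isomorphic (Alg J C (bcarrier D)) (left_face D) (right_face D)"

definition BalBAlg ::
  "'o set \<Rightarrow> ('c, 'o, 'm) cvcat \<Rightarrow> (('c, 'o, 'm) bifold, ('c, 'o, 'm) bifold_arrow) category"
  where
  "BalBAlg J C = full_subcat (BAlg J C) (balanced_bifold J C)"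

end

end

theory Submission
  imports Defs
begin

text \<open>
  Isomorphism in \<open>Alg(C)\<close>, for \<open>C = |D|\<close>, is an equivalence relation, which makes (1), (4) and (5) formally
  equivalent.  Morphisms of \<open>Alg(C)\<close> into a commutant \<open>A\<^sup>\<bottom>\<close> are unique, because a \<open>\<V>\<close>-natural family between
  algebras is determined by its component at \<open>\<I>\<close>; hence in (2) the composites
  \<open>D\<^sub>l \<rightarrow> D\<^sub>l\<^sup>\<bottom> \<cong> D\<^sub>r\<close> and \<open>D\<^sub>r \<rightarrow> D\<^sub>r\<^sup>\<bottom> \<cong> D\<^sub>l\<close> are mutually inverse.  An isomorphism of bifold algebras
  induces isomorphisms of left and of right faces over one and the same isomorphism \<open>\<phi>\<close> of carriers, and
  conjugation shows that taking commutants preserves isomorphisms over \<open>\<phi>\<close>.  So everything that defines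
  balancedness is transported along isomorphisms of bifold algebras, which gives repleteness and reduces (3)
  to \<open>\<langle>A,A\<rangle>\<close>, while for balanced \<open>D\<close> reindexing along \<open>D\<^sub>l \<cong> D\<^sub>r\<close> yields \<open>D \<cong> \<langle>D\<^sub>l,D\<^sub>l\<rangle>\<close>.
\<close>

section \<open>Categories and symmetric monoidal categories\<close>

text \<open>Isomorphisms of bifold algebras change the carrier, while \<open>Alg\<close> fixes it;
  hence the larger category \<open>algebras\<close>, and explicit inverse pairs in place of bare
  invertibility. A commutant is treated as an algebra only after an arrow of \<open>Alg\<close>
  shows that it is one, and this property is then carried along isomorphisms. The convention
  \<open>[\<I>,x] = x\<close> makes \<open>[\<I>,A]\<close> literally equal to \<open>A\<close>, so
  that a commutant has the same carrier as its algebra and components at \<open>\<I>\<close> contain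
  no cotensors. In a cross-morphism the two theory morphisms run in opposite directions; the
  comparison of right faces is therefore first obtained backwards, and uniqueness of inverses
  identifies its carrier part with that of the left faces. Calculations in hom-objects are made on
  arrows \<open>x \<rightarrow> C(a,b)\<close>. Composition with arrows out of the unit is strictly
  associative in this calculus, so the symmetry matters mainly for functoriality of cotensoring, for
  composites of natural families and for functors of two variables.\<close>

context category
begin

lemma in_Hom: "f \<in> Hom X a b \<longleftrightarrow> f \<in> Arr X \<and> Dom X f = a \<and> Cod X f = b"
  by (simp add: Hom_def)

lemma Dom_Ob [simp]: "f \<in> Arr X \<Longrightarrow> Dom X f \<in> Ob X"
  by (rule Dom_in)

lemma Cod_Ob [simp]: "f \<in> Arr X \<Longrightarrow> Cod X f \<in> Ob X"
  by (rule Cod_in)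

lemma Hom_ObD: "f \<in> Hom X a b \<Longrightarrow> a \<in> Ob X \<and> b \<in> Ob X"
  by (auto simp: in_Hom)

lemma Id_simps [simp]:
  assumes "a \<in> Ob X"
  shows "Id X a \<in> Arr X" "Dom X (Id X a) = a" "Cod X (Id X a) = a"
  using Id_in[OF assms] by (auto simp: in_Hom)

lemma Comp_simps [simp]:
  assumes "f \<in> Arr X" "g \<in> Arr X" "Dom X g = Cod X f"
  shows "g \<cdot> f \<in> Arr X" "Dom X (g \<cdot> f) = Dom X f" "Cod X (g \<cdot> f) = Cod X g"
  using Comp_in[of f "Dom X f" "Cod X f" g "Cod X g"] assms by (auto simp: in_Hom)

lemma Comp_Id_left [simp]: "\<lbrakk>f \<in> Arr X; Cod X f = b\<rbrakk> \<Longrightarrow> Id X b \<cdot> f = f"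
  using Id_left by (auto simp: in_Hom)

lemma Comp_Id_right [simp]: "\<lbrakk>f \<in> Arr X; Dom X f = a\<rbrakk> \<Longrightarrow> f \<cdot> Id X a = f"
  using Id_right by (auto simp: in_Hom)

lemma assoc [simp]:
  assumes "f \<in> Arr X" "g \<in> Arr X" "h \<in> Arr X" "Dom X g = Cod X f" "Dom X h = Cod X g"
  shows "(h \<cdot> g) \<cdot> f = h \<cdot> (g \<cdot> f)"
  using Comp_assoc[of f "Dom X f" "Cod X f" g "Cod X g" h "Cod X h"] assms by (auto simp: in_Hom)

text \<open>The simplifier nests composites to the right, so an equation for
  \<open>g \<cdot> f\<close> no longer matches once a further factor follows. This form rewrites the
  two leading factors of such a composite and is used for that throughout.\<close>

lemma comp_reduce:
  assumes "g \<cdot> f = h" "f \<in> Arr X" "g \<in> Arr X" "k \<in> Arr X" "Dom X g = Cod X f" "Dom X f = Cod X k"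
  shows "g \<cdot> (f \<cdot> k) = h \<cdot> k"
  using assms assoc[of k f g] by simp

section \<open>Inverses and cancellation of isomorphisms\<close>

lemma inverse_arrows_unique:
  assumes "inverse_arrows X f g" "inverse_arrows X f g'"
  shows "g = g'"
proof -
  have "g = g \<cdot> (f \<cdot> g')"
    using assms by (simp add: inverse_arrows_def in_Hom)
  also have "\<dots> = (g \<cdot> f) \<cdot> g'"
    using assms by (intro assoc[symmetric]) (auto simp add: inverse_arrows_def in_Hom)
  also have "\<dots> = g'"
    using assms by (simp add: inverse_arrows_def in_Hom)
  finally show ?thesis .
qed

lemma inv_arr_eqI: "inverse_arrows X f g \<Longrightarrow> inv_arr X f = g"
  unfolding inv_arr_def by (rule the_equality) (auto intro: inverse_arrows_unique)

lemma inverse_arrows_inv_arr: "is_iso X f \<Longrightarrow> inverse_arrows X f (inv_arr X f)"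
  unfolding is_iso_def using inv_arr_eqI by blast

lemma is_iso_Arr: "is_iso X f \<Longrightarrow> f \<in> Arr X"
  by (auto simp: is_iso_def inverse_arrows_def)

lemma inv_arr_simps [simp]:
  assumes "is_iso X f"
  shows "inv_arr X f \<in> Arr X" "Dom X (inv_arr X f) = Cod X f" "Cod X (inv_arr X f) = Dom X f"
    "inv_arr X f \<cdot> f = Id X (Dom X f)" "f \<cdot> inv_arr X f = Id X (Cod X f)"
  using inverse_arrows_inv_arr[OF assms] by (auto simp: inverse_arrows_def in_Hom)

lemma inv_arr_cancel [simp]:
  assumes "is_iso X f" "k \<in> Arr X"
  shows "Cod X k = Dom X f \<Longrightarrow> inv_arr X f \<cdot> (f \<cdot> k) = k"
    and "Cod X k = Cod X f \<Longrightarrow> f \<cdot> (inv_arr X f \<cdot> k) = k"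
  using assms is_iso_Arr[OF assms(1)]
    comp_reduce[OF inv_arr_simps(4)[OF assms(1)], of k]
    comp_reduce[OF inv_arr_simps(5)[OF assms(1)], of k] by auto

lemma is_isoI:
  assumes "f \<in> Arr X" "g \<in> Arr X" "Dom X g = Cod X f" "Cod X g = Dom X f"
    "g \<cdot> f = Id X (Dom X f)" "f \<cdot> g = Id X (Cod X f)"
  shows "is_iso X f" "inv_arr X f = g"
proof -
  have *: "inverse_arrows X f g"
    using assms by (auto simp: inverse_arrows_def in_Hom)
  show "is_iso X f"
    unfolding is_iso_def using * by (rule exI)
  show "inv_arr X f = g"
    by (rule inv_arr_eqI[OF *])
qed

lemma is_iso_inv_arr [simp]: "is_iso X f \<Longrightarrow> is_iso X (inv_arr X f)"
  by (rule is_isoI[where g = f]) (auto simp: is_iso_Arr)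

lemma is_iso_Id [simp]:
  assumes "a \<in> Ob X"
  shows "is_iso X (Id X a)" "inv_arr X (Id X a) = Id X a"
  by (rule is_isoI[where g = "Id X a"], use assms in auto)+

lemma is_iso_Comp:
  assumes "is_iso X f" "is_iso X g" "Dom X g = Cod X f"
  shows "is_iso X (g \<cdot> f)" "inv_arr X (g \<cdot> f) = inv_arr X f \<cdot> inv_arr X g"
  by (rule is_isoI[where g = "inv_arr X f \<cdot> inv_arr X g"], use assms is_iso_Arr in auto)+

lemma iso_cancel_right:
  assumes "is_iso X f" "g \<cdot> f = h \<cdot> f" "g \<in> Arr X" "h \<in> Arr X" "Dom X g = Cod X f" "Dom X h = Cod X f"
  shows "g = h"
proof -
  have "(g \<cdot> f) \<cdot> inv_arr X f = (h \<cdot> f) \<cdot> inv_arr X f"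
    by (simp only: assms(2))
  then show ?thesis
    using assms(1,3-) by (simp add: is_iso_Arr)
qed

lemma iso_cancel_left:
  assumes "is_iso X f" "f \<cdot> g = f \<cdot> h" "g \<in> Arr X" "h \<in> Arr X" "Cod X g = Dom X f" "Cod X h = Dom X f"
  shows "g = h"
proof -
  have "inv_arr X f \<cdot> (f \<cdot> g) = inv_arr X f \<cdot> (f \<cdot> h)"
    by (simp only: assms(2))
  then show ?thesis
    using assms(1,3-) by (simp add: is_iso_Arr)
qed

end

section \<open>Coherence in symmetric monoidal categories\<close>

context symmetric_monoidal_closed_category
begin

lemma Tens_Ob [simp]: "\<lbrakk>a \<in> Ob V; b \<in> Ob V\<rbrakk> \<Longrightarrow> a \<otimes> b \<in> Ob V"
  by (rule Tens_in)

lemma Unit_Ob [simp]: "\<I> \<in> Ob V"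
  by (rule Unit_in)

lemma TensA_simps [simp]:
  assumes "f \<in> Arr V" "g \<in> Arr V"
  shows "f \<odot> g \<in> Arr V" "Dom V (f \<odot> g) = Dom V f \<otimes> Dom V g" "Cod V (f \<odot> g) = Cod V f \<otimes> Cod V g"
  using TensA_in[of f "Dom V f" "Cod V f" g "Dom V g" "Cod V g"] assms by (auto simp: in_Hom)

lemma TensA_Ids [simp]: "\<lbrakk>a \<in> Ob V; b \<in> Ob V\<rbrakk> \<Longrightarrow> Id V a \<odot> Id V b = Id V (a \<otimes> b)"
  by (rule TensA_Id)

lemma interchange:
  assumes "f \<in> Arr V" "g \<in> Arr V" "f' \<in> Arr V" "g' \<in> Arr V" "Dom V g = Cod V f" "Dom V g' = Cod V f'"
  shows "(g \<odot> g') \<cdot> (f \<odot> f') = (g \<cdot> f) \<odot> (g' \<cdot> f')"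
  using TensA_Comp[of f "Dom V f" "Cod V f" g "Cod V g" f' "Dom V f'" "Cod V f'" g' "Cod V g'"] assms
  by (auto simp: in_Hom)

lemma interchange_reduce:
  assumes "f \<in> Arr V" "g \<in> Arr V" "f' \<in> Arr V" "g' \<in> Arr V" "Dom V g = Cod V f" "Dom V g' = Cod V f'"
    "k \<in> Arr V" "Cod V k = Dom V f \<otimes> Dom V f'"
  shows "(g \<odot> g') \<cdot> ((f \<odot> f') \<cdot> k) = ((g \<cdot> f) \<odot> (g' \<cdot> f')) \<cdot> k"
  using comp_reduce[OF interchange[of f g f' g'], of k] assms by simp

lemmas ichg = interchange interchange_reduce

lemma is_iso_TensA [simp]:
  assumes "is_iso V f" "is_iso V g"
  shows "is_iso V (f \<odot> g)" "inv_arr V (f \<odot> g) = inv_arr V f \<odot> inv_arr V g"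
  by (rule is_isoI[where g = "inv_arr V f \<odot> inv_arr V g"], use assms is_iso_Arr in \<open>auto simp: interchange\<close>)+

lemma Assoc_simps [simp]:
  assumes "a \<in> Ob V" "b \<in> Ob V" "c \<in> Ob V"
  shows "Assoc V a b c \<in> Arr V" "Dom V (Assoc V a b c) = (a \<otimes> b) \<otimes> c"
    "Cod V (Assoc V a b c) = a \<otimes> (b \<otimes> c)" "is_iso V (Assoc V a b c)"
  using Assoc_in[OF assms] Assoc_iso[OF assms] by (auto simp: in_Hom)

lemma LUnit_simps [simp]:
  assumes "a \<in> Ob V"
  shows "LUnit V a \<in> Arr V" "Dom V (LUnit V a) = \<I> \<otimes> a" "Cod V (LUnit V a) = a" "is_iso V (LUnit V a)"
  using LUnit_in[OF assms] LUnit_iso[OF assms] by (auto simp: in_Hom)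

lemma RUnit_simps [simp]:
  assumes "a \<in> Ob V"
  shows "RUnit V a \<in> Arr V" "Dom V (RUnit V a) = a \<otimes> \<I>" "Cod V (RUnit V a) = a" "is_iso V (RUnit V a)"
  using RUnit_in[OF assms] RUnit_iso[OF assms] by (auto simp: in_Hom)

lemma Sym_simps [simp]:
  assumes "a \<in> Ob V" "b \<in> Ob V"
  shows "Sym V a b \<in> Arr V" "Dom V (Sym V a b) = a \<otimes> b" "Cod V (Sym V a b) = b \<otimes> a"
    "Sym V b a \<cdot> Sym V a b = Id V (a \<otimes> b)"
  using Sym_in[OF assms] Sym_Sym[OF assms] by (auto simp: in_Hom)

lemma Sym_cancel [simp]:
  assumes "a \<in> Ob V" "b \<in> Ob V" "k \<in> Arr V" "Cod V k = a \<otimes> b"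
  shows "Sym V b a \<cdot> (Sym V a b \<cdot> k) = k"
  using comp_reduce[OF Sym_Sym[of a b], of k] assms by simp

lemma Sym_iso [simp]:
  assumes "a \<in> Ob V" "b \<in> Ob V"
  shows "is_iso V (Sym V a b)" "inv_arr V (Sym V a b) = Sym V b a"
  by (rule is_isoI[where g = "Sym V b a"], use assms in auto)+

lemma Sym_nat:
  assumes "f \<in> Arr V" "g \<in> Arr V" "Cod V f = a" "Cod V g = b"
  shows "Sym V a b \<cdot> (f \<odot> g) = (g \<odot> f) \<cdot> Sym V (Dom V f) (Dom V g)"
  using Sym_natural[of f "Dom V f" a g "Dom V g" b] assms by (simp add: in_Hom)

lemma Assoc_nat:
  assumes "f \<in> Arr V" "g \<in> Arr V" "h \<in> Arr V" "Cod V f = a" "Cod V g = b" "Cod V h = c"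
  shows "Assoc V a b c \<cdot> ((f \<odot> g) \<odot> h) = (f \<odot> (g \<odot> h)) \<cdot> Assoc V (Dom V f) (Dom V g) (Dom V h)"
  using Assoc_natural[of f "Dom V f" a g "Dom V g" b h "Dom V h" c] assms by (simp add: in_Hom)

lemma Assoc_inv_nat:
  assumes "f \<in> Arr V" "g \<in> Arr V" "h \<in> Arr V" "Cod V f = a" "Cod V g = b" "Cod V h = c"
  shows "inv_arr V (Assoc V a b c) \<cdot> (f \<odot> (g \<odot> h))
    = ((f \<odot> g) \<odot> h) \<cdot> inv_arr V (Assoc V (Dom V f) (Dom V g) (Dom V h))"
proof (rule iso_cancel_left[of "Assoc V a b c"])
  have "a \<in> Ob V" "b \<in> Ob V" "c \<in> Ob V"
    using assms by auto
  then show "Assoc V a b c \<cdot> (inv_arr V (Assoc V a b c) \<cdot> (f \<odot> g \<odot> h)) =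
    Assoc V a b c \<cdot> (((f \<odot> g) \<odot> h) \<cdot> inv_arr V (Assoc V (Dom V f) (Dom V g) (Dom V h)))"
    using comp_reduce[OF Assoc_nat[OF assms]] assms by simp
qed (use assms in auto)

lemma LUnit_nat: "\<lbrakk>f \<in> Arr V; Cod V f = b\<rbrakk> \<Longrightarrow> LUnit V b \<cdot> (Id V \<I> \<odot> f) = f \<cdot> LUnit V (Dom V f)"
  using LUnit_natural[of f "Dom V f" b] by (simp add: in_Hom)

lemma RUnit_nat: "\<lbrakk>f \<in> Arr V; Cod V f = b\<rbrakk> \<Longrightarrow> RUnit V b \<cdot> (f \<odot> Id V \<I>) = f \<cdot> RUnit V (Dom V f)"
  using RUnit_natural[of f "Dom V f" b] by (simp add: in_Hom)

lemma LUnit_inv_nat: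
  assumes "f \<in> Arr V" "Cod V f = b"
  shows "inv_arr V (LUnit V b) \<cdot> f = (Id V \<I> \<odot> f) \<cdot> inv_arr V (LUnit V (Dom V f))"
proof (rule iso_cancel_left[of "LUnit V b"])
  have "b \<in> Ob V"
    using assms by auto
  then show "LUnit V b \<cdot> (inv_arr V (LUnit V b) \<cdot> f) = LUnit V b \<cdot> ((Id V \<I> \<odot> f) \<cdot> inv_arr V (LUnit V (Dom V f)))"
    using comp_reduce[OF LUnit_nat[OF assms]] assms by simp
qed (use assms in auto)

lemma RUnit_inv_nat:
  assumes "f \<in> Arr V" "Cod V f = b"
  shows "inv_arr V (RUnit V b) \<cdot> f = (f \<odot> Id V \<I>) \<cdot> inv_arr V (RUnit V (Dom V f))"
proof (rule iso_cancel_left[of "RUnit V b"])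
  have "b \<in> Ob V"
    using assms by auto
  then show "RUnit V b \<cdot> (inv_arr V (RUnit V b) \<cdot> f) = RUnit V b \<cdot> ((f \<odot> Id V \<I>) \<cdot> inv_arr V (RUnit V (Dom V f)))"
    using comp_reduce[OF RUnit_nat[OF assms]] assms by simp
qed (use assms in auto)

text \<open>Naturality of \<open>LUnit\<close> makes \<open>\<I> \<otimes> -\<close> isomorphic to
  the identity functor, hence faithful. Coherence equations can thus be checked after tensoring with
  the unit, where the pentagon applies.\<close>

lemma Unit_Tens_faithful:
  assumes "Id V \<I> \<odot> f = Id V \<I> \<odot> g" "f \<in> Arr V" "g \<in> Arr V" "Dom V f = Dom V g" "Cod V f = Cod V g"
  shows "f = g"
proof (rule iso_cancel_right[of "LUnit V (Dom V f)"])
  show "f \<cdot> LUnit V (Dom V f) = g \<cdot> LUnit V (Dom V f)"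
    using LUnit_nat[of f "Cod V f"] LUnit_nat[of g "Cod V f"] assms by simp
qed (use assms in auto)

lemma Tens_Unit_faithful:
  assumes "f \<odot> Id V \<I> = g \<odot> Id V \<I>" "f \<in> Arr V" "g \<in> Arr V" "Dom V f = Dom V g" "Cod V f = Cod V g"
  shows "f = g"
proof (rule iso_cancel_right[of "RUnit V (Dom V f)"])
  show "f \<cdot> RUnit V (Dom V f) = g \<cdot> RUnit V (Dom V f)"
    using RUnit_nat[of f "Cod V f"] RUnit_nat[of g "Cod V f"] assms by simp
qed (use assms in auto)

text \<open>Kelly's derivation of the remaining unit coherences from the pentagon and the triangle.\<close>

lemma LUnit_Tens:
  assumes [simp]: "x \<in> Ob V" "y \<in> Ob V"
  shows "LUnit V (x \<otimes> y) \<cdot> Assoc V \<I> x y = LUnit V x \<odot> Id V y"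
proof (rule Unit_Tens_faithful)
  \<comment> \<open>\<open>?e\<close> is the part of the long side of the pentagon for
    \<open>\<I>\<close>, \<open>\<I>\<close>, \<open>x\<close>, \<open>y\<close> that precedes
    \<open>Id V \<I> \<odot> Assoc V \<I> x y\<close>. It is invertible, so the claim may be checked
    after composing with it.\<close>
  let ?e = "Assoc V \<I> (\<I> \<otimes> x) y \<cdot> (Assoc V \<I> \<I> x \<odot> Id V y)"
  have iso: "is_iso V ?e"
    by (rule is_iso_Comp) auto
  have 1: "(Id V \<I> \<odot> (LUnit V (x \<otimes> y) \<cdot> Assoc V \<I> x y)) \<cdot> ?e
    = Assoc V \<I> x y \<cdot> ((RUnit V \<I> \<odot> Id V x) \<odot> Id V y)"
  proof -
    have "(Id V \<I> \<odot> (LUnit V (x \<otimes> y) \<cdot> Assoc V \<I> x y)) \<cdot> ?e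
      = (Id V \<I> \<odot> LUnit V (x \<otimes> y)) \<cdot> (Id V \<I> \<odot> Assoc V \<I> x y) \<cdot> ?e"
      by (simp add: ichg)
    also have "\<dots> = (Id V \<I> \<odot> LUnit V (x \<otimes> y)) \<cdot> (Assoc V \<I> \<I> (x \<otimes> y) \<cdot> Assoc V (\<I> \<otimes> \<I>) x y)"
      by (simp only: pentagon[of \<I> \<I> x y, symmetric] Unit_Ob assms)
    also have "\<dots> = (RUnit V \<I> \<odot> Id V (x \<otimes> y)) \<cdot> Assoc V (\<I> \<otimes> \<I>) x y"
      using comp_reduce[OF triangle[of \<I> "x \<otimes> y"]] by simp
    also have "\<dots> = Assoc V \<I> x y \<cdot> ((RUnit V \<I> \<odot> Id V x) \<odot> Id V y)"
      by (simp add: Assoc_nat)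
    finally show ?thesis .
  qed
  have 2: "(Id V \<I> \<odot> (LUnit V x \<odot> Id V y)) \<cdot> ?e = Assoc V \<I> x y \<cdot> ((RUnit V \<I> \<odot> Id V x) \<odot> Id V y)"
  proof -
    have "(Id V \<I> \<odot> (LUnit V x \<odot> Id V y)) \<cdot> ?e
      = ((Id V \<I> \<odot> (LUnit V x \<odot> Id V y)) \<cdot> Assoc V \<I> (\<I> \<otimes> x) y) \<cdot> (Assoc V \<I> \<I> x \<odot> Id V y)"
      by simp
    also have "\<dots> = (Assoc V \<I> x y \<cdot> ((Id V \<I> \<odot> LUnit V x) \<odot> Id V y)) \<cdot> (Assoc V \<I> \<I> x \<odot> Id V y)"
      by (simp add: Assoc_nat[of "Id V \<I>" "LUnit V x" "Id V y" \<I> x y] del: assoc)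
    also have "\<dots> = Assoc V \<I> x y \<cdot> ((RUnit V \<I> \<odot> Id V x) \<odot> Id V y)"
      by (simp add: ichg triangle)
    finally show ?thesis .
  qed
  show "Id V \<I> \<odot> (LUnit V (x \<otimes> y) \<cdot> Assoc V \<I> x y) = Id V \<I> \<odot> (LUnit V x \<odot> Id V y)"
    by (rule iso_cancel_right[OF iso]) (use 1 2 in auto)
qed auto

text \<open>After tensoring with \<open>\<I>\<close> on the right, the triangle trades
  \<open>RUnit V y\<close> for \<open>LUnit V \<I>\<close>, the pentagon for \<open>x\<close>,
  \<open>y\<close>, \<open>\<I>\<close>, \<open>\<I>\<close> applies, and a second use of the
  triangle trades back.\<close>

lemma RUnit_Tens:
  assumes [simp]: "x \<in> Ob V" "y \<in> Ob V"
  shows "(Id V x \<odot> RUnit V y) \<cdot> Assoc V x y \<I> = RUnit V (x \<otimes> y)"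
proof (rule Tens_Unit_faithful)
  have "Assoc V x y \<I> \<cdot> (((Id V x \<odot> RUnit V y) \<cdot> Assoc V x y \<I>) \<odot> Id V \<I>)
    = (Assoc V x y \<I> \<cdot> ((Id V x \<odot> RUnit V y) \<odot> Id V \<I>)) \<cdot> (Assoc V x y \<I> \<odot> Id V \<I>)"
    by (simp add: ichg)
  also have "\<dots> = (Id V x \<odot> (RUnit V y \<odot> Id V \<I>)) \<cdot> Assoc V x (y \<otimes> \<I>) \<I> \<cdot> (Assoc V x y \<I> \<odot> Id V \<I>)"
    by (simp add: Assoc_nat)
  also have "\<dots> = (Id V x \<odot> (Id V y \<odot> LUnit V \<I>)) \<cdot>
     (Id V x \<odot> Assoc V y \<I> \<I>) \<cdot> Assoc V x (y \<otimes> \<I>) \<I> \<cdot> (Assoc V x y \<I> \<odot> Id V \<I>)"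
    by (simp add: ichg triangle)
  also have "\<dots> = (Id V x \<odot> (Id V y \<odot> LUnit V \<I>)) \<cdot> Assoc V x y (\<I> \<otimes> \<I>) \<cdot> Assoc V (x \<otimes> y) \<I> \<I>"
    by (simp only: pentagon[of x y \<I> \<I>, symmetric] Unit_Ob assms)
  also have "\<dots> = (Assoc V x y \<I> \<cdot> ((Id V x \<odot> Id V y) \<odot> LUnit V \<I>)) \<cdot> Assoc V (x \<otimes> y) \<I> \<I>"
    using Assoc_nat[of "Id V x" "Id V y" "LUnit V \<I>" x y \<I>] by (simp del: TensA_Ids)
  also have "\<dots> = Assoc V x y \<I> \<cdot> (RUnit V (x \<otimes> y) \<odot> Id V \<I>)"
    by (simp add: triangle)
  finally show "((Id V x \<odot> RUnit V y) \<cdot> Assoc V x y \<I>) \<odot> Id V \<I> = RUnit V (x \<otimes> y) \<odot> Id V \<I>"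
    by (rule iso_cancel_left[rotated]) auto
qed auto

text \<open>Naturality at the arrow \<open>LUnit V \<I>\<close> itself shows \<open>LUnit V (\<I>
  \<otimes> \<I>) = Id V \<I> \<odot> LUnit V \<I>\<close>. With this, \<open>LUnit_Tens\<close> and
  the triangle compute one and the same composite with the associator.\<close>

lemma LUnit_Unit: "LUnit V \<I> = RUnit V \<I>"
proof (rule Tens_Unit_faithful)
  have "LUnit V (\<I> \<otimes> \<I>) = Id V \<I> \<odot> LUnit V \<I>"
    by (rule iso_cancel_left[of "LUnit V \<I>"]) (auto simp: LUnit_nat)
  then show "LUnit V \<I> \<odot> Id V \<I> = RUnit V \<I> \<odot> Id V \<I>"
    using LUnit_Tens[of \<I> \<I>] triangle[of \<I> \<I>] by simp
qed auto

text \<open>This is the hexagon for \<open>a\<close>, \<open>\<I>\<close>, \<open>\<I>\<close>: by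
  the unit coherences it becomes the claim tensored with \<open>\<I>\<close> and followed by one
  symmetry, which cancels.\<close>

lemma LUnit_Sym:
  assumes [simp]: "a \<in> Ob V"
  shows "LUnit V a \<cdot> Sym V a \<I> = RUnit V a"
proof (rule Tens_Unit_faithful)
  have "Sym V a \<I> \<cdot> (RUnit V a \<odot> Id V \<I>) = Sym V a \<I> \<cdot> (Id V a \<odot> LUnit V \<I>) \<cdot> Assoc V a \<I> \<I>"
    by (simp add: triangle)
  also have "\<dots> = (LUnit V \<I> \<odot> Id V a) \<cdot> Sym V a (\<I> \<otimes> \<I>) \<cdot> Assoc V a \<I> \<I>"
    using comp_reduce[OF Sym_nat[of "Id V a" "LUnit V \<I>" a \<I>], of "Assoc V a \<I> \<I>"] by simp
  also have "\<dots> = LUnit V (\<I> \<otimes> a) \<cdot> Assoc V \<I> \<I> a \<cdot> Sym V a (\<I> \<otimes> \<I>) \<cdot> Assoc V a \<I> \<I>"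
    using comp_reduce[OF LUnit_Tens[of \<I> a], of "Sym V a (\<I> \<otimes> \<I>) \<cdot> Assoc V a \<I> \<I>"] by simp
  also have "\<dots> = LUnit V (\<I> \<otimes> a) \<cdot> (Id V \<I> \<odot> Sym V a \<I>) \<cdot> Assoc V \<I> a \<I> \<cdot> (Sym V a \<I> \<odot> Id V \<I>)"
    by (simp add: hexagon)
  also have "\<dots> = (Sym V a \<I> \<cdot> LUnit V (a \<otimes> \<I>)) \<cdot> Assoc V \<I> a \<I> \<cdot> (Sym V a \<I> \<odot> Id V \<I>)"
    using comp_reduce[OF LUnit_nat[of "Sym V a \<I>" "\<I> \<otimes> a"], of "Assoc V \<I> a \<I> \<cdot> (Sym V a \<I> \<odot> Id V \<I>)"] by simp
  also have "\<dots> = Sym V a \<I> \<cdot> ((LUnit V a \<odot> Id V \<I>) \<cdot> (Sym V a \<I> \<odot> Id V \<I>))"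
    using comp_reduce[OF LUnit_Tens[of a \<I>], of "Sym V a \<I> \<odot> Id V \<I>"] by simp
  finally have "Sym V a \<I> \<cdot> (RUnit V a \<odot> Id V \<I>) = Sym V a \<I> \<cdot> ((LUnit V a \<cdot> Sym V a \<I>) \<odot> Id V \<I>)"
    by (simp add: ichg)
  then show "(LUnit V a \<cdot> Sym V a \<I>) \<odot> Id V \<I> = RUnit V a \<odot> Id V \<I>"
    by (rule iso_cancel_left[rotated, OF sym]) auto
qed auto

lemma RUnit_Sym:
  assumes [simp]: "a \<in> Ob V"
  shows "RUnit V a \<cdot> Sym V \<I> a = LUnit V a"
  by (simp add: LUnit_Sym[symmetric])

text \<open>The hexagon axiom for \<open>z\<close>, \<open>x\<close>, \<open>y\<close>, inverted;
  inverting a symmetry only swaps its indices. In this form \<open>z\<close> moves leftwards past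
  \<open>y\<close> and then past \<open>x\<close>.\<close>

lemma hexagon_inv:
  assumes [simp]: "x \<in> Ob V" "y \<in> Ob V" "z \<in> Ob V"
  shows "Assoc V z x y \<cdot> (Sym V x z \<odot> Id V y) \<cdot> inv_arr V (Assoc V x z y) \<cdot> (Id V x \<odot> Sym V y z)
     \<cdot> Assoc V x y z = Sym V (x \<otimes> y) z"
proof -
  have "inv_arr V (Assoc V x y z \<cdot> Sym V z (x \<otimes> y) \<cdot> Assoc V z x y)
    = inv_arr V ((Id V x \<odot> Sym V z y) \<cdot> Assoc V x z y \<cdot> (Sym V z x \<odot> Id V y))"
    by (simp add: hexagon)
  then have "inv_arr V (Assoc V z x y) \<cdot> Sym V (x \<otimes> y) z \<cdot> inv_arr V (Assoc V x y z)
    = (Sym V x z \<odot> Id V y) \<cdot> inv_arr V (Assoc V x z y) \<cdot> (Id V x \<odot> Sym V y z)"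
    by (simp add: is_iso_Comp)
  then have "Assoc V z x y \<cdot> (inv_arr V (Assoc V z x y) \<cdot> Sym V (x \<otimes> y) z \<cdot> inv_arr V (Assoc V x y z))
      \<cdot> Assoc V x y z
    = Assoc V z x y \<cdot> ((Sym V x z \<odot> Id V y) \<cdot> inv_arr V (Assoc V x z y) \<cdot> (Id V x \<odot> Sym V y z))
      \<cdot> Assoc V x y z"
    by simp
  then show ?thesis
    by simp
qed

section \<open>Calculus of generalized elements\<close>

lemma vcategory_simps [simp]:
  assumes "vcategory V C" "a \<in> VOb C"
  shows "VId C a \<in> Arr V" "Dom V (VId C a) = \<I>" "Cod V (VId C a) = VHom C a a"
    "b \<in> VOb C \<Longrightarrow> VHom C a b \<in> Ob V"
    "\<lbrakk>b \<in> VOb C; c \<in> VOb C\<rbrakk> \<Longrightarrow> VComp C a b c \<in> Arr V"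
    "\<lbrakk>b \<in> VOb C; c \<in> VOb C\<rbrakk> \<Longrightarrow> Dom V (VComp C a b c) = VHom C b c \<otimes> VHom C a b"
    "\<lbrakk>b \<in> VOb C; c \<in> VOb C\<rbrakk> \<Longrightarrow> Cod V (VComp C a b c) = VHom C a c"
  using assms by (auto simp: vcategory_def in_Hom)

text \<open>
  Arrows \<open>x \<rightarrow> C(a,b)\<close> of \<open>V\<close> are treated as generalized elements of the hom-object:
  \<open>ecomp\<close> composes them (tensoring their domains), and \<open>lact\<close>, \<open>ract\<close> compose with an arrow
  \<open>\<I> \<rightarrow> C(a,b)\<close> of the underlying category without changing the domain.
\<close>

definition ecomp :: "('c, 'o, 'm, 'z) vcat_scheme \<Rightarrow> 'c \<Rightarrow> 'c \<Rightarrow> 'c \<Rightarrow> 'm \<Rightarrow> 'm \<Rightarrow> 'm" where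
  "ecomp C a b c g f = VComp C a b c \<cdot> (g \<odot> f)"

definition lact :: "('c, 'o, 'm, 'z) vcat_scheme \<Rightarrow> 'c \<Rightarrow> 'c \<Rightarrow> 'c \<Rightarrow> 'm \<Rightarrow> 'm \<Rightarrow> 'm" where
  "lact C a b c v f = ecomp C a b c v f \<cdot> inv_arr V (LUnit V (Dom V f))"

definition ract :: "('c, 'o, 'm, 'z) vcat_scheme \<Rightarrow> 'c \<Rightarrow> 'c \<Rightarrow> 'c \<Rightarrow> 'm \<Rightarrow> 'm \<Rightarrow> 'm" where
  "ract C a b c f u = ecomp C a b c f u \<cdot> inv_arr V (RUnit V (Dom V f))"

lemma ecomp_simps [simp]:
  assumes "vcategory V C" "a \<in> VOb C" "b \<in> VOb C" "c \<in> VOb C"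
    "f \<in> Arr V" "Cod V f = VHom C a b" "g \<in> Arr V" "Cod V g = VHom C b c"
  shows "ecomp C a b c g f \<in> Arr V" "Dom V (ecomp C a b c g f) = Dom V g \<otimes> Dom V f"
    "Cod V (ecomp C a b c g f) = VHom C a c"
  using assms by (auto simp: ecomp_def)

lemma ecomp_Comp:
  assumes "vcategory V C" "a \<in> VOb C" "b \<in> VOb C" "c \<in> VOb C"
    "f \<in> Arr V" "Cod V f = VHom C a b" "g \<in> Arr V" "Cod V g = VHom C b c"
    "u \<in> Arr V" "Cod V u = Dom V g" "v \<in> Arr V" "Cod V v = Dom V f"
  shows "ecomp C a b c g f \<cdot> (u \<odot> v) = ecomp C a b c (g \<cdot> u) (f \<cdot> v)"
  using assms by (auto simp: ecomp_def interchange)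

lemma ecomp_Comp_reduce:
  assumes "vcategory V C" "a \<in> VOb C" "b \<in> VOb C" "c \<in> VOb C"
    "f \<in> Arr V" "Cod V f = VHom C a b" "g \<in> Arr V" "Cod V g = VHom C b c"
    "u \<in> Arr V" "Cod V u = Dom V g" "v \<in> Arr V" "Cod V v = Dom V f"
    "k \<in> Arr V" "Cod V k = Dom V u \<otimes> Dom V v"
  shows "ecomp C a b c g f \<cdot> ((u \<odot> v) \<cdot> k) = ecomp C a b c (g \<cdot> u) (f \<cdot> v) \<cdot> k"
  using comp_reduce[OF ecomp_Comp[OF assms(1-12)], of k] assms by auto

lemma ecomp_Comp_left:
  assumes "vcategory V C" "a \<in> VOb C" "b \<in> VOb C" "c \<in> VOb C"
    "f \<in> Arr V" "Cod V f = VHom C a b" "g \<in> Arr V" "Cod V g = VHom C b c"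
    "u \<in> Arr V" "Cod V u = Dom V g" 
  shows "ecomp C a b c (g \<cdot> u) f = ecomp C a b c g f \<cdot> (u \<odot> Id V (Dom V f))"
  using assms by (auto simp: ecomp_def interchange)

lemma ecomp_Comp_right:
  assumes "vcategory V C" "a \<in> VOb C" "b \<in> VOb C" "c \<in> VOb C"
    "f \<in> Arr V" "Cod V f = VHom C a b" "g \<in> Arr V" "Cod V g = VHom C b c"
    "v \<in> Arr V" "Cod V v = Dom V f"
  shows "ecomp C a b c g (f \<cdot> v) = ecomp C a b c g f \<cdot> (Id V (Dom V g) \<odot> v)"
  using assms by (auto simp: ecomp_def interchange)

lemma ecomp_assoc:
  assumes "vcategory V C" "a \<in> VOb C" "b \<in> VOb C" "c \<in> VOb C" "d \<in> VOb C"
    "f \<in> Arr V" "Cod V f = VHom C a b" "g \<in> Arr V" "Cod V g = VHom C b c"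
    "h \<in> Arr V" "Cod V h = VHom C c d"
  shows "ecomp C a b d (ecomp C b c d h g) f =
    ecomp C a c d h (ecomp C a b c g f) \<cdot> Assoc V (Dom V h) (Dom V g) (Dom V f)"
proof -
  have "VComp C a b d \<cdot> (VComp C b c d \<odot> Id V (VHom C a b)) =
        VComp C a c d \<cdot> (Id V (VHom C c d) \<odot> VComp C a b c)
          \<cdot> Assoc V (VHom C c d) (VHom C b c) (VHom C a b)"
    using assms(1-5) by (simp add: vcategory_def)
  then have "(VComp C a b d \<cdot> (VComp C b c d \<odot> Id V (VHom C a b))) \<cdot> ((h \<odot> g) \<odot> f) =
        (VComp C a c d \<cdot> (Id V (VHom C c d) \<odot> VComp C a b c)
          \<cdot> Assoc V (VHom C c d) (VHom C b c) (VHom C a b)) \<cdot> ((h \<odot> g) \<odot> f)"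
    by (rule arg_cong)
  then show ?thesis
    using assms by (simp add: ecomp_def ichg Assoc_nat)
qed

lemma ecomp_assoc':
  assumes "vcategory V C" "a \<in> VOb C" "b \<in> VOb C" "c \<in> VOb C" "d \<in> VOb C"
    "f \<in> Arr V" "Cod V f = VHom C a b" "g \<in> Arr V" "Cod V g = VHom C b c"
    "h \<in> Arr V" "Cod V h = VHom C c d"
  shows "ecomp C a c d h (ecomp C a b c g f) = ecomp C a b d (ecomp C b c d h g) f
     \<cdot> inv_arr V (Assoc V (Dom V h) (Dom V g) (Dom V f))"
  using assms by (simp add: ecomp_assoc)

lemma ecomp_Id_left:
  assumes "vcategory V C" "a \<in> VOb C" "b \<in> VOb C" "f \<in> Arr V" "Cod V f = VHom C a b"
  shows "ecomp C a b b (VId C b) f = f \<cdot> LUnit V (Dom V f)"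
proof -
  have "VComp C a b b \<cdot> (VId C b \<odot> Id V (VHom C a b)) = LUnit V (VHom C a b)"
    using assms(1-3) by (simp add: vcategory_def)
  then have "(VComp C a b b \<cdot> (VId C b \<odot> Id V (VHom C a b))) \<cdot> (Id V \<I> \<odot> f)
    = LUnit V (VHom C a b) \<cdot> (Id V \<I> \<odot> f)"
    by (rule arg_cong)
  then show ?thesis
    using assms by (simp add: ecomp_def ichg LUnit_nat)
qed

lemma ecomp_Id_right:
  assumes "vcategory V C" "a \<in> VOb C" "b \<in> VOb C" "f \<in> Arr V" "Cod V f = VHom C a b"
  shows "ecomp C a a b f (VId C a) = f \<cdot> RUnit V (Dom V f)"
proof -
  have "VComp C a a b \<cdot> (Id V (VHom C a b) \<odot> VId C a) = RUnit V (VHom C a b)"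
    using assms(1-3) by (simp add: vcategory_def)
  then have "(VComp C a a b \<cdot> (Id V (VHom C a b) \<odot> VId C a)) \<cdot> (f \<odot> Id V \<I>)
    = RUnit V (VHom C a b) \<cdot> (f \<odot> Id V \<I>)"
    by (rule arg_cong)
  then show ?thesis
    using assms by (simp add: ecomp_def ichg RUnit_nat)
qed

lemma lact_simps [simp]:
  assumes "vcategory V C" "a \<in> VOb C" "b \<in> VOb C" "c \<in> VOb C"
    "f \<in> Arr V" "Cod V f = VHom C a b" "v \<in> Arr V" "Dom V v = \<I>" "Cod V v = VHom C b c"
  shows "lact C a b c v f \<in> Arr V" "Dom V (lact C a b c v f) = Dom V f"
    "Cod V (lact C a b c v f) = VHom C a c"
  using assms by (auto simp: lact_def)

lemma ract_simps [simp]: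
  assumes "vcategory V C" "a \<in> VOb C" "b \<in> VOb C" "c \<in> VOb C"
    "f \<in> Arr V" "Cod V f = VHom C b c" "u \<in> Arr V" "Dom V u = \<I>" "Cod V u = VHom C a b"
  shows "ract C a b c f u \<in> Arr V" "Dom V (ract C a b c f u) = Dom V f"
    "Cod V (ract C a b c f u) = VHom C a c"
  using assms by (auto simp: ract_def)

lemma lact_Comp:
  assumes "vcategory V C" "a \<in> VOb C" "b \<in> VOb C" "c \<in> VOb C"
    "f \<in> Arr V" "Cod V f = VHom C a b" "v \<in> Arr V" "Dom V v = \<I>" "Cod V v = VHom C b c"
    "w \<in> Arr V" "Cod V w = Dom V f"
  shows "lact C a b c v f \<cdot> w = lact C a b c v (f \<cdot> w)"
  using assms by (simp add: lact_def LUnit_inv_nat ecomp_Comp_reduce)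

lemma ract_Comp:
  assumes "vcategory V C" "a \<in> VOb C" "b \<in> VOb C" "c \<in> VOb C"
    "f \<in> Arr V" "Cod V f = VHom C b c" "u \<in> Arr V" "Dom V u = \<I>" "Cod V u = VHom C a b"
    "w \<in> Arr V" "Cod V w = Dom V f"
  shows "ract C a b c f u \<cdot> w = ract C a b c (f \<cdot> w) u"
  using assms by (simp add: ract_def RUnit_inv_nat ecomp_Comp_reduce)

lemma lact_Id [simp]:
  assumes "vcategory V C" "a \<in> VOb C" "b \<in> VOb C" "f \<in> Arr V" "Cod V f = VHom C a b"
  shows "lact C a b b (VId C b) f = f"
  using assms by (simp add: lact_def ecomp_Id_left)

lemma ract_Id [simp]:
  assumes "vcategory V C" "a \<in> VOb C" "b \<in> VOb C" "f \<in> Arr V" "Cod V f = VHom C a b"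
  shows "ract C a a b f (VId C a) = f"
  using assms by (simp add: ract_def ecomp_Id_right)

text \<open>Both sides are composition in the underlying category; they agree because the two unit
  isomorphisms coincide at \<open>\<I>\<close>.\<close>

lemma lact_eq_ract:
  assumes "Dom V f = \<I>" "Dom V v = \<I>"
  shows "lact C a b c v f = ract C a b c v f"
  using assms by (simp add: lact_def ract_def LUnit_Unit)

lemma LUnit_Tens_inv:
  assumes "x \<in> Ob V" "y \<in> Ob V"
  shows "Assoc V \<I> x y \<cdot> (inv_arr V (LUnit V x) \<odot> Id V y) = inv_arr V (LUnit V (x \<otimes> y))"
proof -
  have "inv_arr V (LUnit V (x \<otimes> y) \<cdot> Assoc V \<I> x y) = inv_arr V (LUnit V x) \<odot> Id V y"
    using assms by (simp add: LUnit_Tens)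
  then have "inv_arr V (LUnit V x) \<odot> Id V y = inv_arr V (Assoc V \<I> x y) \<cdot> inv_arr V (LUnit V (x \<otimes> y))"
    using assms by (simp add: is_iso_Comp)
  then show ?thesis
    using assms by simp
qed

lemma RUnit_Tens_inv:
  assumes "x \<in> Ob V" "y \<in> Ob V"
  shows "inv_arr V (Assoc V x y \<I>) \<cdot> (Id V x \<odot> inv_arr V (RUnit V y)) = inv_arr V (RUnit V (x \<otimes> y))"
proof -
  have "inv_arr V ((Id V x \<odot> RUnit V y) \<cdot> Assoc V x y \<I>) = inv_arr V (RUnit V (x \<otimes> y))"
    using assms by (simp add: RUnit_Tens)
  then show ?thesis
    using assms by (simp add: is_iso_Comp)
qed

lemma triangle_inv:
  assumes "x \<in> Ob V" "y \<in> Ob V"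
  shows "Assoc V x \<I> y \<cdot> (inv_arr V (RUnit V x) \<odot> Id V y) = Id V x \<odot> inv_arr V (LUnit V y)"
proof -
  have "inv_arr V ((Id V x \<odot> LUnit V y) \<cdot> Assoc V x \<I> y) = inv_arr V (RUnit V x) \<odot> Id V y"
    using assms by (simp add: triangle)
  then have "inv_arr V (RUnit V x) \<odot> Id V y = inv_arr V (Assoc V x \<I> y) \<cdot> (Id V x \<odot> inv_arr V (LUnit V y))"
    using assms by (simp add: is_iso_Comp)
  then show ?thesis
    using assms by simp
qed

text \<open>Here and in the next two lemmas the unit coherences cancel the associator of
  \<open>ecomp_assoc\<close>. As a result, composition with arrows out of \<open>\<I>\<close> is
  associative without any coherence isomorphism.\<close>

lemma ecomp_lact:
  assumes "vcategory V C" "a \<in> VOb C" "b \<in> VOb C" "c \<in> VOb C" "d \<in> VOb C"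
    "f \<in> Arr V" "Cod V f = VHom C a b" "g \<in> Arr V" "Cod V g = VHom C b c"
    "v \<in> Arr V" "Dom V v = \<I>" "Cod V v = VHom C c d"
  shows "ecomp C a b d (lact C b c d v g) f = lact C a c d v (ecomp C a b c g f)"
proof -
  have "ecomp C a b d (lact C b c d v g) f
    = ecomp C a b d (ecomp C b c d v g) f \<cdot> (inv_arr V (LUnit V (Dom V g)) \<odot> Id V (Dom V f))"
    using assms by (simp add: lact_def ecomp_Comp)
  then show ?thesis
    using assms by (simp add: ecomp_assoc LUnit_Tens_inv lact_def)
qed

lemma ecomp_ract:
  assumes "vcategory V C" "a \<in> VOb C" "b \<in> VOb C" "c \<in> VOb C" "d \<in> VOb C"
    "u \<in> Arr V" "Dom V u = \<I>" "Cod V u = VHom C a b" 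
    "f \<in> Arr V" "Cod V f = VHom C b c" "g \<in> Arr V" "Cod V g = VHom C c d"
  shows "ecomp C a c d g (ract C a b c f u) = ract C a b d (ecomp C b c d g f) u"
proof -
  have "ecomp C a c d g (ract C a b c f u)
    = ecomp C a c d g (ecomp C a b c f u) \<cdot> (Id V (Dom V g) \<odot> inv_arr V (RUnit V (Dom V f)))"
    using assms by (simp add: ract_def ecomp_Comp)
  then show ?thesis
    using assms by (simp add: ecomp_assoc' RUnit_Tens_inv ract_def)
qed

lemma ecomp_ract_lact:
  assumes "vcategory V C" "a \<in> VOb C" "b \<in> VOb C" "c \<in> VOb C" "d \<in> VOb C"
    "f \<in> Arr V" "Cod V f = VHom C a b"
    "v \<in> Arr V" "Dom V v = \<I>" "Cod V v = VHom C b c" "g \<in> Arr V" "Cod V g = VHom C c d"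
  shows "ecomp C a b d (ract C b c d g v) f = ecomp C a c d g (lact C a b c v f)"
proof -
  have "ecomp C a b d (ract C b c d g v) f
    = ecomp C a b d (ecomp C b c d g v) f \<cdot> (inv_arr V (RUnit V (Dom V g)) \<odot> Id V (Dom V f))"
    using assms by (simp add: ract_def ecomp_Comp)
  then show ?thesis
    using assms by (simp add: ecomp_assoc triangle_inv lact_def ecomp_Comp)
qed

lemma lact_ract:
  assumes "vcategory V C" "a \<in> VOb C" "b \<in> VOb C" "c \<in> VOb C" "d \<in> VOb C"
    "u \<in> Arr V" "Dom V u = \<I>" "Cod V u = VHom C a b" "f \<in> Arr V" "Cod V f = VHom C b c"
    "v \<in> Arr V" "Dom V v = \<I>" "Cod V v = VHom C c d"
  shows "lact C a c d v (ract C a b c f u) = ract C a b d (lact C b c d v f) u"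
  using assms by (simp add: ract_def ecomp_lact lact_Comp)

lemma lact_lact:
  assumes "vcategory V C" "a \<in> VOb C" "b \<in> VOb C" "c \<in> VOb C" "d \<in> VOb C"
    "f \<in> Arr V" "Cod V f = VHom C a b"
    "v \<in> Arr V" "Dom V v = \<I>" "Cod V v = VHom C b c" "w \<in> Arr V" "Dom V w = \<I>" "Cod V w = VHom C c d"
  shows "lact C a c d w (lact C a b c v f) = lact C a b d (lact C b c d w v) f"
  using assms by (simp add: lact_def[of C a _ d] ecomp_ract_lact[symmetric] lact_eq_ract)

lemma ract_ract:
  assumes "vcategory V C" "a \<in> VOb C" "b \<in> VOb C" "c \<in> VOb C" "d \<in> VOb C"
    "f \<in> Arr V" "Cod V f = VHom C c d"
    "u \<in> Arr V" "Dom V u = \<I>" "Cod V u = VHom C b c" "w \<in> Arr V" "Dom V w = \<I>" "Cod V w = VHom C a b"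
  shows "ract C a b d (ract C b c d f u) w = ract C a c d f (lact C a b c u w)"
  using assms by (simp add: ract_def[of C a _ d] ecomp_ract_lact)

lemma ucomp_eq_lact:
  assumes "vcategory V C" "a \<in> VOb C" "b \<in> VOb C" "c \<in> VOb C"
    "f \<in> Arr V" "Dom V f = \<I>" "Cod V f = VHom C a b" "v \<in> Arr V" "Dom V v = \<I>" "Cod V v = VHom C b c"
  shows "ucomp V C a b c v f = lact C a b c v f"
  using assms by (simp add: ucomp_def lact_def ecomp_def)

section \<open>Enriched functors and natural transformations\<close>

lemma vfunctorD:
  assumes "vfunctor V A B F"
  shows "FOb F \<in> VOb A \<rightarrow>\<^sub>E VOb B"
    "\<forall>a b. a \<notin> VOb A \<or> b \<notin> VOb A \<longrightarrow> FHom F a b = undefined"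
    "\<forall>a \<in> VOb A. \<forall>b \<in> VOb A. FHom F a b \<in> Hom V (VHom A a b) (VHom B (FOb F a) (FOb F b))"
    "\<forall>a \<in> VOb A. FHom F a a \<cdot> VId A a = VId B (FOb F a)"
    "\<forall>a \<in> VOb A. \<forall>b \<in> VOb A. \<forall>c \<in> VOb A. FHom F a c \<cdot> VComp A a b c =
       ecomp B (FOb F a) (FOb F b) (FOb F c) (FHom F b c) (FHom F a b)"
  using assms unfolding vfunctor_def ecomp_def by - (elim conjE, assumption)+

lemma vfunctor_simps [simp]:
  assumes "vfunctor V A B F" "a \<in> VOb A"
  shows "FOb F a \<in> VOb B" "FHom F a a \<cdot> VId A a = VId B (FOb F a)"
    "b \<in> VOb A \<Longrightarrow> FHom F a b \<in> Arr V"
    "b \<in> VOb A \<Longrightarrow> Dom V (FHom F a b) = VHom A a b"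
    "b \<in> VOb A \<Longrightarrow> Cod V (FHom F a b) = VHom B (FOb F a) (FOb F b)"
proof -
  show "FOb F a \<in> VOb B"
    using vfunctorD(1)[OF assms(1)] assms(2) by (rule PiE_mem)
  show "FHom F a a \<cdot> VId A a = VId B (FOb F a)"
    using vfunctorD(4)[OF assms(1)] assms(2) by (rule bspec)
  assume "b \<in> VOb A"
  then have "FHom F a b \<in> Hom V (VHom A a b) (VHom B (FOb F a) (FOb F b))"
    using vfunctorD(3)[OF assms(1)] assms(2) by blast
  then show "FHom F a b \<in> Arr V" "Dom V (FHom F a b) = VHom A a b"
    "Cod V (FHom F a b) = VHom B (FOb F a) (FOb F b)"
    by (simp_all add: in_Hom)
qed

lemma vfunctor_ecomp:
  assumes "vcategory V A" "vcategory V B" "vfunctor V A B F" "a \<in> VOb A" "b \<in> VOb A" "c \<in> VOb A"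
    "f \<in> Arr V" "Cod V f = VHom A a b" "g \<in> Arr V" "Cod V g = VHom A b c"
  shows "FHom F a c \<cdot> ecomp A a b c g f
    = ecomp B (FOb F a) (FOb F b) (FOb F c) (FHom F b c \<cdot> g) (FHom F a b \<cdot> f)"
proof -
  have "FHom F a c \<cdot> VComp A a b c =
        VComp B (FOb F a) (FOb F b) (FOb F c) \<cdot> (FHom F b c \<odot> FHom F a b)"
    using vfunctorD(5)[OF assms(3)] assms(4-6) unfolding ecomp_def by blast
  from comp_reduce[OF this, of "g \<odot> f"] show ?thesis
    using assms by (simp add: ecomp_def ichg)
qed

lemma vfunctorI:
  assumes "FOb F \<in> VOb A \<rightarrow>\<^sub>E VOb B"
    "\<And>a b. a \<notin> VOb A \<or> b \<notin> VOb A \<Longrightarrow> FHom F a b = undefined"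
    "\<And>a b. \<lbrakk>a \<in> VOb A; b \<in> VOb A\<rbrakk> \<Longrightarrow> FHom F a b \<in> Hom V (VHom A a b) (VHom B (FOb F a) (FOb F b))"
    "\<And>a. a \<in> VOb A \<Longrightarrow> FHom F a a \<cdot> VId A a = VId B (FOb F a)"
    "\<And>a b c. \<lbrakk>a \<in> VOb A; b \<in> VOb A; c \<in> VOb A\<rbrakk> \<Longrightarrow>
        FHom F a c \<cdot> VComp A a b c = ecomp B (FOb F a) (FOb F b) (FOb F c) (FHom F b c) (FHom F a b)"
  shows "vfunctor V A B F"
  unfolding vfunctor_def using assms unfolding ecomp_def by blast

lemma vfunctor_FOb_ext: "vfunctor V A B F \<Longrightarrow> FOb F \<in> extensional (VOb A)"
  using vfunctorD(1) by (auto simp: PiE_def)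

lemma vfunctor_FHom_ext: "\<lbrakk>vfunctor V A B F; a \<notin> VOb A \<or> b \<notin> VOb A\<rbrakk> \<Longrightarrow> FHom F a b = undefined"
  using vfunctorD(2) by blast

lemma vfun_eqI:
  assumes "vfunctor V A B F" "vfunctor V A B' G"
    "\<And>a. a \<in> VOb A \<Longrightarrow> FOb F a = FOb G a"
    "\<And>a b. \<lbrakk>a \<in> VOb A; b \<in> VOb A\<rbrakk> \<Longrightarrow> FHom F a b = FHom G a b"
  shows "F = G"
proof -
  have "FOb F = FOb G"
    by (rule extensionalityI[OF vfunctor_FOb_ext[OF assms(1)] vfunctor_FOb_ext[OF assms(2)]]) (rule assms(3))
  moreover have "FHom F = FHom G"
    using vfunctor_FHom_ext[OF assms(1)] vfunctor_FHom_ext[OF assms(2)] assms(4) by (metis ext)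
  ultimately show ?thesis
    by (cases F, cases G) simp
qed

lemma vid_simps [simp]:
  "a \<in> VOb A \<Longrightarrow> FOb (vid V A) a = a"
  "\<lbrakk>a \<in> VOb A; b \<in> VOb A\<rbrakk> \<Longrightarrow> FHom (vid V A) a b = Id V (VHom A a b)"
  by (auto simp: vid_def)

lemma vcomp_simps [simp]:
  "a \<in> VOb A \<Longrightarrow> FOb (vcomp V A G F) a = FOb G (FOb F a)"
  "\<lbrakk>a \<in> VOb A; b \<in> VOb A\<rbrakk> \<Longrightarrow> FHom (vcomp V A G F) a b = FHom G (FOb F a) (FOb F b) \<cdot> FHom F a b"
  by (auto simp: vcomp_def)

lemma vfunctor_vid:
  assumes "vcategory V A"
  shows "vfunctor V A A (vid V A)"
  by (rule vfunctorI) (use assms in \<open>auto simp: vid_def in_Hom ecomp_def\<close>)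

lemma vfunctor_vcomp:
  assumes "vcategory V A" "vcategory V B" "vcategory V C" "vfunctor V A B F" "vfunctor V B C G"
  shows "vfunctor V A C (vcomp V A G F)"
proof (rule vfunctorI)
  fix a b c assume [simp]: "a \<in> VOb A" "b \<in> VOb A" "c \<in> VOb A"
  have "FHom F a c \<cdot> VComp A a b c = ecomp B (FOb F a) (FOb F b) (FOb F c) (FHom F b c) (FHom F a b)"
    using vfunctorD(5)[OF assms(4)] by simp
  then show "FHom (vcomp V A G F) a c \<cdot> VComp A a b c = ecomp C (FOb (vcomp V A G F) a)
     (FOb (vcomp V A G F) b) (FOb (vcomp V A G F) c) (FHom (vcomp V A G F) b c) (FHom (vcomp V A G F) a b)"
    using assms vfunctor_ecomp[of B C G "FOb F a" "FOb F b" "FOb F c"] by simp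
qed (use assms in \<open>auto simp: vcomp_def in_Hom vfunctor_FHom_ext\<close>)

lemma vcomp_vid:
  assumes "vcategory V A" "vcategory V B" "vfunctor V A B F"
  shows "vcomp V A F (vid V A) = F" "vcomp V A (vid V B) F = F"
  using assms by (auto intro!: vfun_eqI[where A = A and B = B and B' = B] vfunctor_vcomp vfunctor_vid)

lemma vcomp_assoc:
  assumes "vcategory V A" "vcategory V B" "vcategory V C" "vcategory V D"
    "vfunctor V A B F" "vfunctor V B C G" "vfunctor V C D H"
  shows "vcomp V A (vcomp V B H G) F = vcomp V A H (vcomp V A G F)"
proof (rule vfun_eqI)
  show "vfunctor V A D (vcomp V A (vcomp V B H G) F)"
    using assms by (meson vfunctor_vcomp)
  show "vfunctor V A D (vcomp V A H (vcomp V A G F))"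
    using assms by (meson vfunctor_vcomp)
qed (use assms in auto)

text \<open>Naturality does not refer to composition in the domain, so of \<open>A\<close> only the
  hom-objects are assumed to lie in \<open>V\<close>. In this form the characterization applies to
  \<open>vtensor\<close>, whose hom-objects are tensor products of objects of
  \<open>V\<close>.\<close>

lemma vnat_iff_graph:
  assumes A: "\<forall>a \<in> VOb A. \<forall>b \<in> VOb A. VHom A a b \<in> Ob V"
    and B: "vcategory V B" "vfunctor V A B F" "vfunctor V A B G"
  shows "vnat V A B F G \<alpha> \<longleftrightarrow>
     \<alpha> \<in> extensional (VOb A) \<and>
     (\<forall>a \<in> VOb A. \<alpha> a \<in> Hom V \<I> (VHom B (FOb F a) (FOb G a))) \<and>
     (\<forall>a \<in> VOb A. \<forall>b \<in> VOb A. lact B (FOb F a) (FOb F b) (FOb G b) (\<alpha> b) (FHom F a b)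
       = ract B (FOb F a) (FOb G a) (FOb G b) (FHom G a b) (\<alpha> a))"
  using assms by (auto simp: vnat_def lact_def ract_def ecomp_def in_Hom)

lemma vnat_iff:
  assumes "vcategory V A" "vcategory V B" "vfunctor V A B F" "vfunctor V A B G"
  shows "vnat V A B F G \<alpha> \<longleftrightarrow>
     \<alpha> \<in> extensional (VOb A) \<and>
     (\<forall>a \<in> VOb A. \<alpha> a \<in> Hom V \<I> (VHom B (FOb F a) (FOb G a))) \<and>
     (\<forall>a \<in> VOb A. \<forall>b \<in> VOb A. lact B (FOb F a) (FOb F b) (FOb G b) (\<alpha> b) (FHom F a b)
       = ract B (FOb F a) (FOb G a) (FOb G b) (FHom G a b) (\<alpha> a))"
  by (rule vnat_iff_graph) (use assms in auto)

lemma vnat_simps: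
  assumes "vnat V A B F G \<alpha>" "a \<in> VOb A"
  shows "\<alpha> a \<in> Arr V" "Dom V (\<alpha> a) = \<I>" "Cod V (\<alpha> a) = VHom B (FOb F a) (FOb G a)"
  using assms by (auto simp: vnat_def in_Hom)

lemma vnat_eq:
  assumes "vcategory V A" "vcategory V B" "vfunctor V A B F" "vfunctor V A B G" "vnat V A B F G \<alpha>"
    "a \<in> VOb A" "b \<in> VOb A"
  shows "lact B (FOb F a) (FOb F b) (FOb G b) (\<alpha> b) (FHom F a b)
    = ract B (FOb F a) (FOb G a) (FOb G b) (FHom G a b) (\<alpha> a)"
  using assms vnat_iff by blast

lemma vnat_ext: "vnat V A B F G \<alpha> \<Longrightarrow> \<alpha> \<in> extensional (VOb A)"
  by (simp add: vnat_def)

text \<open>As both arrows start at \<open>\<I>\<close>, \<open>lact\<close> is composition in the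
  underlying ordinary category. The inverse is a second argument because conjugation uses an
  isomorphism together with its inverse.\<close>

definition vinverse :: "('c, 'o, 'm, 'z) vcat_scheme \<Rightarrow> 'c \<Rightarrow> 'c \<Rightarrow> 'm \<Rightarrow> 'm \<Rightarrow> bool" where
  "vinverse C a b u v \<longleftrightarrow> u \<in> Hom V \<I> (VHom C a b) \<and> v \<in> Hom V \<I> (VHom C b a) \<and>
     lact C a b a v u = VId C a \<and> lact C b a b u v = VId C b"

lemma vinverse_sym: "vinverse C a b u v \<Longrightarrow> vinverse C b a v u"
  by (simp add: vinverse_def)

lemma vinverse_simps:
  assumes "vinverse C a b u v"
  shows "u \<in> Arr V" "Dom V u = \<I>" "Cod V u = VHom C a b" "v \<in> Arr V" "Dom V v = \<I>" "Cod V v = VHom C b a"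
  using assms by (auto simp: vinverse_def in_Hom)

lemma vinverse_lact:
  assumes "vcategory V C" "vinverse C a b u v" "a \<in> VOb C" "b \<in> VOb C" "z \<in> VOb C"
    "f \<in> Arr V" "Cod V f = VHom C z a"
  shows "lact C z b a v (lact C z a b u f) = f"
  using assms by (subst lact_lact) (auto simp: vinverse_def in_Hom)

lemma vinverse_ract:
  assumes "vcategory V C" "vinverse C a b u v" "a \<in> VOb C" "b \<in> VOb C" "z \<in> VOb C"
    "f \<in> Arr V" "Cod V f = VHom C a z"
  shows "ract C a b z (ract C b a z f v) u = f"
  using assms by (subst ract_ract) (auto simp: vinverse_def in_Hom)

lemma vnat_iso_iff_graph:
  assumes A: "\<forall>a \<in> VOb A. \<forall>b \<in> VOb A. VHom A a b \<in> Ob V"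
    and B: "vcategory V B" "vfunctor V A B F" "vfunctor V A B G"
  shows "vnat_iso V A B F G \<alpha> \<longleftrightarrow>
    (\<exists>\<beta>. vnat V A B F G \<alpha> \<and> vnat V A B G F \<beta> \<and> (\<forall>a \<in> VOb A. vinverse B (FOb F a) (FOb G a) (\<alpha> a) (\<beta> a)))"
proof -
  have "(ucomp V B (FOb F a) (FOb G a) (FOb F a) (\<beta> a) (\<alpha> a) = VId B (FOb F a) \<and>
           ucomp V B (FOb G a) (FOb F a) (FOb G a) (\<alpha> a) (\<beta> a) = VId B (FOb G a))
    \<longleftrightarrow> vinverse B (FOb F a) (FOb G a) (\<alpha> a) (\<beta> a)"
    if "vnat V A B F G \<alpha>" "vnat V A B G F \<beta>" "a \<in> VOb A" for \<alpha> \<beta> a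
    using that B vnat_simps[OF that(1,3)] vnat_simps[OF that(2,3)]
    by (simp add: ucomp_eq_lact vinverse_def in_Hom)
  then show ?thesis
    unfolding vnat_iso_def by blast
qed

lemma vnat_iso_iff:
  assumes "vcategory V A" "vcategory V B" "vfunctor V A B F" "vfunctor V A B G"
  shows "vnat_iso V A B F G \<alpha> \<longleftrightarrow>
    (\<exists>\<beta>. vnat V A B F G \<alpha> \<and> vnat V A B G F \<beta> \<and> (\<forall>a \<in> VOb A. vinverse B (FOb F a) (FOb G a) (\<alpha> a) (\<beta> a)))"
  by (rule vnat_iso_iff_graph) (use assms in auto)

text \<open>Naturality solved for \<open>FHom G\<close>: acting with \<open>\<beta> a\<close>
  cancels \<open>\<alpha> a\<close>. So \<open>G\<close> is determined on homs by \<open>F\<close>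
  and an invertible \<open>\<alpha>\<close>, which underlies the later transport along
  isomorphisms.\<close>

lemma vnat_iso_conj:
  assumes "vcategory V A" "vcategory V B" "vfunctor V A B F" "vfunctor V A B G" "vnat V A B F G \<alpha>"
    "\<And>a. a \<in> VOb A \<Longrightarrow> vinverse B (FOb F a) (FOb G a) (\<alpha> a) (\<beta> a)" "a \<in> VOb A" "b \<in> VOb A"
  shows "ract B (FOb G a) (FOb F a) (FOb G b) (lact B (FOb F a) (FOb F b) (FOb G b) (\<alpha> b) (FHom F a b)) (\<beta> a)
    = FHom G a b"
  using vinverse_ract[OF assms(2) vinverse_sym[OF assms(6)[OF assms(7)]]] assms
  by (simp add: vnat_eq)

text \<open>Once \<open>FHom G\<close> is written as a conjugate of \<open>FHom F\<close>, the
  factor \<open>\<beta> b\<close> cancels \<open>\<alpha> b\<close> and the naturality square of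
  \<open>\<beta>\<close> remains.\<close>

lemma vnat_inverse:
  assumes "vcategory V A" "vcategory V B" "vfunctor V A B F" "vfunctor V A B G" "vnat V A B F G \<alpha>"
    "\<And>a. a \<in> VOb A \<Longrightarrow> vinverse B (FOb F a) (FOb G a) (\<alpha> a) (\<beta> a)"
    "\<beta> \<in> extensional (VOb A)"
  shows "vnat V A B G F \<beta>"
proof -
  have "lact B (FOb G a) (FOb G b) (FOb F b) (\<beta> b) (FHom G a b)
    = ract B (FOb G a) (FOb F a) (FOb F b) (FHom F a b) (\<beta> a)" if ab [simp]: "a \<in> VOb A" "b \<in> VOb A" for a b
  proof -
    note [simp] = vinverse_simps[OF assms(6)[OF ab(1)]] vinverse_simps[OF assms(6)[OF ab(2)]]
    have "lact B (FOb G a) (FOb G b) (FOb F b) (\<beta> b) (FHom G a b)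
      = lact B (FOb G a) (FOb G b) (FOb F b) (\<beta> b) (ract B (FOb G a) (FOb F a) (FOb G b)
          (lact B (FOb F a) (FOb F b) (FOb G b) (\<alpha> b) (FHom F a b)) (\<beta> a))"
      by (simp add: vnat_iso_conj[OF assms(1-6)])
    also have "\<dots> = ract B (FOb G a) (FOb F a) (FOb F b) (FHom F a b) (\<beta> a)"
      using assms(1-4) vinverse_lact[OF assms(2) assms(6)[OF ab(2)]] by (simp add: lact_ract)
    finally show ?thesis .
  qed
  then show ?thesis
    unfolding vnat_iff[OF assms(1,2,4,3)]
    using assms(6,7) unfolding vinverse_def by blast
qed

section \<open>Cotensors\<close>

lemma IHom_simps [simp]:
  assumes "a \<in> Ob V" "b \<in> Ob V"
  shows "IHom V a b \<in> Ob V" "Ev V a b \<in> Arr V" "Dom V (Ev V a b) = IHom V a b \<otimes> a" "Cod V (Ev V a b) = b"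
  using IHom_in[OF assms] Ev_in[OF assms] by (auto simp: in_Hom)

lemma transpose_simps:
  assumes "x \<in> Ob V" "a \<in> Ob V" "b \<in> Ob V" "f \<in> Arr V" "Dom V f = x \<otimes> a" "Cod V f = b"
  shows "transpose V x a b f \<in> Arr V" "Dom V (transpose V x a b f) = x"
    "Cod V (transpose V x a b f) = IHom V a b" "Ev V a b \<cdot> (transpose V x a b f \<odot> Id V a) = f"
proof -
  have "f \<in> Hom V (x \<otimes> a) b"
    using assms by (simp add: in_Hom)
  from theI'[OF closed[OF assms(1-3) this], folded transpose_def]
  show "transpose V x a b f \<in> Arr V" "Dom V (transpose V x a b f) = x"
    "Cod V (transpose V x a b f) = IHom V a b" "Ev V a b \<cdot> (transpose V x a b f \<odot> Id V a) = f"
    by (simp_all add: in_Hom)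
qed

lemma Ev_cancel:
  assumes "a \<in> Ob V" "b \<in> Ob V" "g \<in> Arr V" "h \<in> Arr V" "Dom V g = Dom V h"
    "Cod V g = IHom V a b" "Cod V h = IHom V a b"
    "Ev V a b \<cdot> (g \<odot> Id V a) = Ev V a b \<cdot> (h \<odot> Id V a)"
  shows "g = h"
proof -
  have "Ev V a b \<cdot> (h \<odot> Id V a) \<in> Hom V (Dom V h \<otimes> a) b"
    using assms by (simp add: in_Hom)
  from closed[OF _ assms(1,2) this]
  have "\<exists>!g. g \<in> Hom V (Dom V h) (IHom V a b) \<and> Ev V a b \<cdot> (g \<odot> Id V a) = Ev V a b \<cdot> (h \<odot> Id V a)"
    using assms by simp
  moreover have "g \<in> Hom V (Dom V h) (IHom V a b)" "h \<in> Hom V (Dom V h) (IHom V a b)"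
    using assms by (auto simp: in_Hom)
  ultimately show ?thesis
    using assms(8) by (blast elim: ex1E)
qed

lemma cot_cmp_simps:
  assumes "vcategory V C" "j \<in> Ob V" "x \<in> VOb C" "p \<in> VOb C" "z \<in> VOb C" "\<kappa> \<in> Hom V j (VHom C p x)"
  shows "cot_cmp V C j x p \<kappa> z \<in> Arr V" "Dom V (cot_cmp V C j x p \<kappa> z) = VHom C z p"
    "Cod V (cot_cmp V C j x p \<kappa> z) = IHom V j (VHom C z x)"
  using assms by (auto simp: cot_cmp_def transpose_simps in_Hom)

text \<open>Removes the transpose from the definition of \<open>cot_cmp\<close>: under evaluation it
  acts on a generalized element \<open>h\<close> as composition with \<open>\<kappa>\<close>. The
  elementwise form of the cotensor property is read off from this.\<close>

lemma Ev_cot_cmp: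
  assumes "vcategory V C" "j \<in> Ob V" "x \<in> VOb C" "p \<in> VOb C" "z \<in> VOb C" "\<kappa> \<in> Hom V j (VHom C p x)"
    "h \<in> Arr V" "Cod V h = VHom C z p"
  shows "Ev V j (VHom C z x) \<cdot> ((cot_cmp V C j x p \<kappa> z \<cdot> h) \<odot> Id V j) = ecomp C z p x \<kappa> h \<cdot> Sym V (Dom V h) j"
proof -
  have "Ev V j (VHom C z x) \<cdot> (cot_cmp V C j x p \<kappa> z \<odot> Id V j)
    = ecomp C z p x \<kappa> (Id V (VHom C z p)) \<cdot> Sym V (VHom C z p) j"
    unfolding cot_cmp_def using assms by (subst transpose_simps) (auto simp: in_Hom ecomp_def)
  then have "Ev V j (VHom C z x) \<cdot> ((cot_cmp V C j x p \<kappa> z \<odot> Id V j) \<cdot> (h \<odot> Id V j))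
    = (ecomp C z p x \<kappa> (Id V (VHom C z p)) \<cdot> Sym V (VHom C z p) j) \<cdot> (h \<odot> Id V j)"
    by (rule comp_reduce) (use assms cot_cmp_simps[OF assms(1-6)] in auto)
  moreover have "(cot_cmp V C j x p \<kappa> z \<odot> Id V j) \<cdot> (h \<odot> Id V j) = (cot_cmp V C j x p \<kappa> z \<cdot> h) \<odot> Id V j"
    using assms(2,7,8) cot_cmp_simps[OF assms(1-6)] by (simp add: ichg)
  moreover have "(ecomp C z p x \<kappa> (Id V (VHom C z p)) \<cdot> Sym V (VHom C z p) j) \<cdot> (h \<odot> Id V j)
     = ecomp C z p x \<kappa> h \<cdot> Sym V (Dom V h) j"
    using assms by (simp add: Sym_nat in_Hom ecomp_Comp_reduce)
  ultimately show ?thesis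
    by (simp only:)
qed

lemma is_cotensor_simps:
  assumes "is_cotensor V C j x p \<kappa>"
  shows "j \<in> Ob V" "x \<in> VOb C" "p \<in> VOb C" "\<kappa> \<in> Hom V j (VHom C p x)"
    "\<kappa> \<in> Arr V" "Dom V \<kappa> = j" "Cod V \<kappa> = VHom C p x"
    "z \<in> VOb C \<Longrightarrow> is_iso V (cot_cmp V C j x p \<kappa> z)"
  using assms by (auto simp: is_cotensor_def in_Hom)

text \<open>An invertible \<open>cot_cmp\<close> is monic, and arrows into an internal hom are
  determined by evaluation. Most later equations between elements with values in a cotensor are
  proved by this cancellation.\<close>

lemma cotensor_cancel:
  assumes C: "vcategory V C" "is_cotensor V C j x p \<kappa>" "z \<in> VOb C"
    and g: "g \<in> Arr V" "Cod V g = VHom C z p" and h: "h \<in> Arr V" "Cod V h = VHom C z p" "Dom V g = Dom V h"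
    and eq: "ecomp C z p x \<kappa> g = ecomp C z p x \<kappa> h"
  shows "g = h"
proof (rule iso_cancel_left)
  note cot = is_cotensor_simps[OF C(2)]
  note cmp = cot_cmp_simps[OF C(1) cot(1-3) C(3) cot(4)]
  show "is_iso V (cot_cmp V C j x p \<kappa> z)"
    by (rule cot(8)[OF C(3)])
  show "cot_cmp V C j x p \<kappa> z \<cdot> g = cot_cmp V C j x p \<kappa> z \<cdot> h"
  proof (rule Ev_cancel)
    show "Ev V j (VHom C z x) \<cdot> ((cot_cmp V C j x p \<kappa> z \<cdot> g) \<odot> Id V j)
      = Ev V j (VHom C z x) \<cdot> ((cot_cmp V C j x p \<kappa> z \<cdot> h) \<odot> Id V j)"
      using Ev_cot_cmp[OF C(1) cot(1-3) C(3) cot(4) g] Ev_cot_cmp[OF C(1) cot(1-3) C(3) cot(4) h(1,2)]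
        eq h(3) by simp
  qed (use C g h cot cmp in auto)
qed (use assms cot_cmp_simps[OF C(1) is_cotensor_simps(1-3)[OF C(2)] C(3) is_cotensor_simps(4)[OF C(2)]] in auto)

lemma cotensor_factor:
  assumes C: "vcategory V C" "is_cotensor V C j x p \<kappa>" "z \<in> VOb C"
    and y: "y \<in> Ob V" and m: "m \<in> Hom V (j \<otimes> y) (VHom C z x)"
  obtains h where "h \<in> Hom V y (VHom C z p)" "ecomp C z p x \<kappa> h = m"
proof
  note cot = is_cotensor_simps[OF C(2)]
  note cmp = cot_cmp_simps[OF C(1) cot(1-3) C(3) cot(4)] cot(8)[OF C(3)]
  let ?c = "cot_cmp V C j x p \<kappa> z" and ?t = "transpose V y j (VHom C z x) (m \<cdot> Sym V y j)"
  have m': "m \<in> Arr V" "Dom V m = j \<otimes> y" "Cod V m = VHom C z x"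
    using m by (auto simp: in_Hom)
  have t: "?t \<in> Arr V" "Dom V ?t = y" "Cod V ?t = IHom V j (VHom C z x)"
    "Ev V j (VHom C z x) \<cdot> (?t \<odot> Id V j) = m \<cdot> Sym V y j"
    using C(1,3) y m' cot(1-3) by (auto simp: transpose_simps)
  show h: "inv_arr V ?c \<cdot> ?t \<in> Hom V y (VHom C z p)"
    using cmp t by (simp add: in_Hom)
  have "ecomp C z p x \<kappa> (inv_arr V ?c \<cdot> ?t) \<cdot> Sym V y j = m \<cdot> Sym V y j"
    using Ev_cot_cmp[OF C(1) cot(1-3) C(3) cot(4), of "inv_arr V ?c \<cdot> ?t"] cmp t by simp
  then show "ecomp C z p x \<kappa> (inv_arr V ?c \<cdot> ?t) = m"
    by (rule iso_cancel_right[rotated]) (use y m' C cot cmp t in auto)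
qed

text \<open>Converse to \<open>cotensor_cancel\<close> and \<open>cotensor_factor\<close>. Unique
  factorization is enough because the inverse of \<open>cot_cmp\<close> arises from one universal
  case, in which \<open>y\<close> is an internal hom.\<close>

lemma is_cotensorI:
  assumes C: "vcategory V C" "j \<in> Ob V" "x \<in> VOb C" "p \<in> VOb C" "\<kappa> \<in> Hom V j (VHom C p x)"
    and inj: "\<And>z g h. \<lbrakk>z \<in> VOb C; g \<in> Arr V; Cod V g = VHom C z p; h \<in> Arr V; Cod V h = VHom C z p;
       Dom V g = Dom V h; ecomp C z p x \<kappa> g = ecomp C z p x \<kappa> h\<rbrakk> \<Longrightarrow> g = h"
    and surj: "\<And>z y m. \<lbrakk>z \<in> VOb C; y \<in> Ob V; m \<in> Hom V (j \<otimes> y) (VHom C z x)\<rbrakk> \<Longrightarrow>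
       \<exists>h \<in> Hom V y (VHom C z p). ecomp C z p x \<kappa> h = m"
  shows "is_cotensor V C j x p \<kappa>"
  unfolding is_cotensor_def
proof (intro conjI ballI C)
  fix z assume z: "z \<in> VOb C"
  let ?c = "cot_cmp V C j x p \<kappa> z" and ?y = "IHom V j (VHom C z x)"
  note cmp = cot_cmp_simps[OF C(1-4) z C(5)]
  have \<kappa>: "\<kappa> \<in> Arr V" "Dom V \<kappa> = j" "Cod V \<kappa> = VHom C p x"
    using C by (auto simp: in_Hom)
  \<comment> \<open>The universal case: evaluation is the generic element of the internal hom, and
    its factorization is the inverse of \<open>?c\<close>.\<close>
  obtain h where h: "h \<in> Arr V" "Dom V h = ?y" "Cod V h = VHom C z p"
    "ecomp C z p x \<kappa> h = Ev V j (VHom C z x) \<cdot> Sym V j ?y"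
    using surj[OF z, of ?y "Ev V j (VHom C z x) \<cdot> Sym V j ?y"] C z by (auto simp: in_Hom)
  have 1: "?c \<cdot> h = Id V ?y"
  proof (rule Ev_cancel)
    show "Ev V j (VHom C z x) \<cdot> ((?c \<cdot> h) \<odot> Id V j) = Ev V j (VHom C z x) \<cdot> (Id V ?y \<odot> Id V j)"
      using Ev_cot_cmp[OF C(1-4) z C(5) h(1,3)] h C z by simp
  qed (use C z cmp h in auto)
  have 2: "h \<cdot> ?c = Id V (VHom C z p)"
  proof (rule inj[OF z])
    have "ecomp C z p x \<kappa> (h \<cdot> ?c) \<cdot> Sym V (VHom C z p) j
      = Ev V j (VHom C z x) \<cdot> ((?c \<cdot> (h \<cdot> ?c)) \<odot> Id V j)"
      using Ev_cot_cmp[OF C(1-4) z C(5), of "h \<cdot> ?c"] cmp h by simp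
    also have "\<dots> = Ev V j (VHom C z x) \<cdot> ((?c \<cdot> Id V (VHom C z p)) \<odot> Id V j)"
      using comp_reduce[OF 1, of ?c] cmp h by simp
    also have "\<dots> = ecomp C z p x \<kappa> (Id V (VHom C z p)) \<cdot> Sym V (VHom C z p) j"
      using Ev_cot_cmp[OF C(1-4) z C(5), of "Id V (VHom C z p)"] cmp h C z by simp
    finally show "ecomp C z p x \<kappa> (h \<cdot> ?c) = ecomp C z p x \<kappa> (Id V (VHom C z p))"
      by (rule iso_cancel_right[rotated]) (use C z cmp h \<kappa> in auto)
  qed (use C z cmp h in auto)
  show "is_iso V ?c"
    by (rule is_isoI(1)[where g = h]) (use 1 2 h cmp in auto)
qed

section \<open>The action of \<open>[j,-]\<close> on hom-objects\<close>

lemma has_cotensors_simps: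
  assumes "has_cotensors V J C" "x \<in> VOb C"
  shows "j \<in> J \<Longrightarrow> is_cotensor V C j x (Cot C j x) (Counit C j x)"
    "Cot C \<I> x = x" "Counit C \<I> x = VId C x"
  using assms by (auto simp: has_cotensors_def)

lemma cot_map_simps:
  assumes C: "vcategory V C" "is_cotensor V C j x (Cot C j x) (Counit C j x)"
      "is_cotensor V C j y (Cot C j y) (Counit C j y)"
  shows "cot_map V C j x y \<in> Arr V" "Dom V (cot_map V C j x y) = VHom C x y"
    "Cod V (cot_map V C j x y) = VHom C (Cot C j x) (Cot C j y)"
    "ecomp C (Cot C j x) (Cot C j y) y (Counit C j y) (cot_map V C j x y)
      = ecomp C (Cot C j x) x y (Id V (VHom C x y)) (Counit C j x) \<cdot> Sym V j (VHom C x y)"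
proof -
  note x = is_cotensor_simps[OF C(2)] and y = is_cotensor_simps[OF C(3)]
  let ?c = "cot_cmp V C j y (Cot C j y) (Counit C j y) (Cot C j x)"
  let ?m = "ecomp C (Cot C j x) x y (Id V (VHom C x y)) (Counit C j x)"
  let ?t = "transpose V (VHom C x y) j (VHom C (Cot C j x) y) ?m"
  note cmp = cot_cmp_simps[OF C(1) y(1-3) x(3) y(4)] y(8)[OF x(3)]
  have m: "?m \<in> Arr V" "Dom V ?m = VHom C x y \<otimes> j" "Cod V ?m = VHom C (Cot C j x) y"
    using C(1) x y by auto
  have t: "?t \<in> Arr V" "Dom V ?t = VHom C x y" "Cod V ?t = IHom V j (VHom C (Cot C j x) y)"
    "Ev V j (VHom C (Cot C j x) y) \<cdot> (?t \<odot> Id V j) = ?m"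
    using C(1) m x(1-3) y(2) by (auto simp: transpose_simps)
  have eq: "cot_map V C j x y = inv_arr V ?c \<cdot> ?t"
    by (simp add: cot_map_def ecomp_def)
  show cm: "cot_map V C j x y \<in> Arr V" "Dom V (cot_map V C j x y) = VHom C x y"
    "Cod V (cot_map V C j x y) = VHom C (Cot C j x) (Cot C j y)"
    unfolding eq using cmp t by simp_all
  have "ecomp C (Cot C j x) (Cot C j y) y (Counit C j y) (cot_map V C j x y) \<cdot> Sym V (VHom C x y) j = ?m"
    unfolding eq using Ev_cot_cmp[OF C(1) y(1-3) x(3) y(4), of "inv_arr V ?c \<cdot> ?t"] cmp t by simp
  then have "(ecomp C (Cot C j x) (Cot C j y) y (Counit C j y) (cot_map V C j x y) \<cdot> Sym V (VHom C x y) j)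
      \<cdot> Sym V j (VHom C x y) = ?m \<cdot> Sym V j (VHom C x y)"
    by (rule arg_cong)
  then show "ecomp C (Cot C j x) (Cot C j y) y (Counit C j y) (cot_map V C j x y) = ?m \<cdot> Sym V j (VHom C x y)"
    using C(1) x(1-3,5-7) y(1-3,5-7) cm by simp
qed

text \<open>Naturality of the counit, tested on a generalized element \<open>h\<close>. Together
  with \<open>cotensor_cancel\<close> it takes the place of the definition of
  \<open>cot_map\<close>.\<close>

lemma ecomp_Counit_cot_map:
  assumes C: "vcategory V C" "is_cotensor V C j x (Cot C j x) (Counit C j x)"
      "is_cotensor V C j y (Cot C j y) (Counit C j y)"
    and h: "h \<in> Arr V" "Cod V h = VHom C x y"
  shows "ecomp C (Cot C j x) (Cot C j y) y (Counit C j y) (cot_map V C j x y \<cdot> h)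
      = ecomp C (Cot C j x) x y h (Counit C j x) \<cdot> Sym V j (Dom V h)"
proof -
  note x = is_cotensor_simps[OF C(2)] and y = is_cotensor_simps[OF C(3)] and cm = cot_map_simps[OF C]
  have "ecomp C (Cot C j x) (Cot C j y) y (Counit C j y) (cot_map V C j x y \<cdot> h)
    = ecomp C (Cot C j x) (Cot C j y) y (Counit C j y) (cot_map V C j x y) \<cdot> (Id V j \<odot> h)"
    using C(1) x(1-3,5-7) y(1-3,5-7) cm(1-3) h by (simp add: ecomp_Comp_right)
  also have "\<dots> = ecomp C (Cot C j x) x y h (Counit C j x) \<cdot> Sym V j (Dom V h)"
    unfolding cm(4) using C(1) x(1-3,5-7) y(1-3,5-7) h by (simp add: ecomp_Comp_reduce Sym_nat)
  finally show ?thesis .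
qed

text \<open>The functoriality of cotensoring is an instance of the hexagon.\<close>

lemma cot_map_ecomp:
  assumes C: "vcategory V C" "is_cotensor V C j x (Cot C j x) (Counit C j x)"
      "is_cotensor V C j y (Cot C j y) (Counit C j y)" "is_cotensor V C j z (Cot C j z) (Counit C j z)"
    and h: "h \<in> Arr V" "Cod V h = VHom C x y" and g: "g \<in> Arr V" "Cod V g = VHom C y z"
  shows "cot_map V C j x z \<cdot> ecomp C x y z g h
    = ecomp C (Cot C j x) (Cot C j y) (Cot C j z) (cot_map V C j y z \<cdot> g) (cot_map V C j x y \<cdot> h)"
proof (rule cotensor_cancel[OF C(1) C(4)])
  note x = is_cotensor_simps(1-3,5-7)[OF C(2)] and y = is_cotensor_simps(1-3,5-7)[OF C(3)]
    and z = is_cotensor_simps(1-3,5-7)[OF C(4)]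
  note xy = cot_map_simps(1-3)[OF C(1-3)] and xz = cot_map_simps(1-3)[OF C(1,2,4)]
    and yz = cot_map_simps(1-3)[OF C(1,3,4)]
  let ?x = "Cot C j x" and ?y = "Cot C j y" and ?z = "Cot C j z"
  have "ecomp C ?x ?z z (Counit C j z) (ecomp C ?x ?y ?z (cot_map V C j y z \<cdot> g) (cot_map V C j x y \<cdot> h))
     \<cdot> Assoc V j (Dom V g) (Dom V h)
    = ecomp C ?x ?y z (ecomp C ?y ?z z (Counit C j z) (cot_map V C j y z \<cdot> g)) (cot_map V C j x y \<cdot> h)"
    using C(1) x y z xy yz g h by (simp add: ecomp_assoc)
  also have "\<dots> = ecomp C ?x ?y z (ecomp C ?y y z g (Counit C j y) \<cdot> Sym V j (Dom V g)) (cot_map V C j x y \<cdot> h)"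
    by (simp only: ecomp_Counit_cot_map[OF C(1,3,4) g])
  also have "\<dots> = ecomp C ?x y z g (ecomp C ?x ?y y (Counit C j y) (cot_map V C j x y \<cdot> h))
     \<cdot> Assoc V (Dom V g) j (Dom V h) \<cdot> (Sym V j (Dom V g) \<odot> Id V (Dom V h))"
    using C(1) x y z xy yz g h by (simp add: ecomp_assoc ecomp_Comp_left)
  also have "\<dots> = ecomp C ?x y z g (ecomp C ?x x y h (Counit C j x) \<cdot> Sym V j (Dom V h))
     \<cdot> Assoc V (Dom V g) j (Dom V h) \<cdot> (Sym V j (Dom V g) \<odot> Id V (Dom V h))"
    by (simp only: ecomp_Counit_cot_map[OF C(1-3) h])
  also have "\<dots> = ecomp C ?x y z g (ecomp C ?x x y h (Counit C j x)) \<cdot> (Id V (Dom V g) \<odot> Sym V j (Dom V h))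
     \<cdot> Assoc V (Dom V g) j (Dom V h) \<cdot> (Sym V j (Dom V g) \<odot> Id V (Dom V h))"
    using C(1) x y z xy yz g h by (simp add: ecomp_Comp_right)
  \<comment> \<open>So far \<open>j\<close> has been moved past the domain of \<open>g\<close> and
    then past that of \<open>h\<close>; the hexagon merges the two moves into one past their tensor
    product.\<close>
  also have "\<dots> = ecomp C ?x y z g (ecomp C ?x x y h (Counit C j x))
     \<cdot> Assoc V (Dom V g) (Dom V h) j \<cdot> Sym V j (Dom V g \<otimes> Dom V h) \<cdot> Assoc V j (Dom V g) (Dom V h)"
    using x g h by (simp add: hexagon)
  also have "\<dots> = ecomp C ?x x z (ecomp C x y z g h) (Counit C j x) \<cdot> Sym V j (Dom V g \<otimes> Dom V h)
     \<cdot> Assoc V j (Dom V g) (Dom V h)"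
    using C(1) x y z xy yz g h by (simp add: ecomp_assoc)
  also have "\<dots> = ecomp C ?x ?z z (Counit C j z) (cot_map V C j x z \<cdot> ecomp C x y z g h)
     \<cdot> Assoc V j (Dom V g) (Dom V h)"
    using C(1) x y z xz g h by (simp add: ecomp_Counit_cot_map[OF C(1,2,4)])
  finally show "ecomp C ?x ?z z (Counit C j z) (cot_map V C j x z \<cdot> ecomp C x y z g h)
    = ecomp C ?x ?z z (Counit C j z) (ecomp C ?x ?y ?z (cot_map V C j y z \<cdot> g) (cot_map V C j x y \<cdot> h))"
    by (rule iso_cancel_right[rotated, OF sym]) (use C(1) x y z xy xz yz g h in auto)
qed (use assms cot_map_simps(1-3)[OF C(1-3)] cot_map_simps(1-3)[OF C(1,2,4)] cot_map_simps(1-3)[OF C(1,3,4)]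
       is_cotensor_simps(1-3)[OF C(2)] is_cotensor_simps(1-3)[OF C(3)] is_cotensor_simps(1-3)[OF C(4)] in auto)

lemma cot_map_VId:
  assumes C: "vcategory V C" "is_cotensor V C j x (Cot C j x) (Counit C j x)"
  shows "cot_map V C j x x \<cdot> VId C x = VId C (Cot C j x)"
proof (rule cotensor_cancel[OF C])
  note x = is_cotensor_simps(1-3,5-7)[OF C(2)] and cm = cot_map_simps(1-3)[OF C C(2)]
  show "ecomp C (Cot C j x) (Cot C j x) x (Counit C j x) (cot_map V C j x x \<cdot> VId C x)
    = ecomp C (Cot C j x) (Cot C j x) x (Counit C j x) (VId C (Cot C j x))"
    using C(1) x by (simp add: ecomp_Counit_cot_map[OF C C(2)] ecomp_Id_left ecomp_Id_right LUnit_Sym)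
qed (use C cot_map_simps(1-3)[OF C C(2)] is_cotensor_simps(1-3)[OF C(2)] in auto)

text \<open>Cotensors commute with cotensors. With \<open>p = [k,x]\<close>, a map
  \<open>y \<rightarrow> C(z,[j,p])\<close> amounts to one out of
  \<open>j \<otimes> (k \<otimes> y)\<close>, and a map
  \<open>y \<rightarrow> C(z,[k,[j,x]])\<close> to one out of
  \<open>k \<otimes> (j \<otimes> y)\<close>; \<open>?s\<close> exchanges \<open>j\<close> and
  \<open>k\<close>. This is why pointwise cotensors of algebras are algebras.\<close>

lemma cot_map_is_cotensor:
  assumes C: "vcategory V C" "is_cotensor V C j x (Cot C j x) (Counit C j x)"
      "is_cotensor V C j p (Cot C j p) (Counit C j p)"
    and p: "is_cotensor V C k x p \<kappa>"
  shows "is_cotensor V C k (Cot C j x) (Cot C j p) (cot_map V C j p x \<cdot> \<kappa>)"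
proof -
  note x = is_cotensor_simps(1-3,5-7)[OF C(2)] and y = is_cotensor_simps(1-3,5-7)[OF C(3)]
    and k = is_cotensor_simps(1-3,5-7)[OF p] and cm = cot_map_simps(1-3)[OF C(1,3,2)]
  let ?x = "Cot C j x" and ?p = "Cot C j p"
  let ?s = "\<lambda>y. Assoc V k j y \<cdot> (Sym V j k \<odot> Id V y) \<cdot> inv_arr V (Assoc V j k y)"
  have s: "is_iso V (?s y)" "?s y \<in> Arr V" "Dom V (?s y) = j \<otimes> (k \<otimes> y)" "Cod V (?s y) = k \<otimes> (j \<otimes> y)"
    if "y \<in> Ob V" for y
    using x k that by (auto intro!: is_iso_Comp)
  \<comment> \<open>Applying the two counits in either order gives the same result up to
    \<open>?s\<close>. Both halves of the universal property then follow by cancelling, respectively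
    factoring, twice.\<close>
  have key: "ecomp C z ?x x (Counit C j x) (ecomp C z ?p ?x (cot_map V C j p x \<cdot> \<kappa>) h)
     = ecomp C z p x \<kappa> (ecomp C z ?p p (Counit C j p) h) \<cdot> ?s (Dom V h)"
    if z: "z \<in> VOb C" and h: "h \<in> Arr V" "Cod V h = VHom C z ?p" for z h
  proof -
    have "ecomp C z ?x x (Counit C j x) (ecomp C z ?p ?x (cot_map V C j p x \<cdot> \<kappa>) h)
      = ecomp C z ?p x (ecomp C ?p ?x x (Counit C j x) (cot_map V C j p x \<cdot> \<kappa>)) h \<cdot> inv_arr V (Assoc V j k (Dom V h))"
      using C(1) x y k cm z h by (simp add: ecomp_assoc')
    also have "\<dots> = ecomp C z ?p x (ecomp C ?p p x \<kappa> (Counit C j p) \<cdot> Sym V j k) h \<cdot> inv_arr V (Assoc V j k (Dom V h))"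
      using k by (simp add: ecomp_Counit_cot_map[OF C(1,3,2)])
    also have "\<dots> = ecomp C z p x \<kappa> (ecomp C z ?p p (Counit C j p) h) \<cdot> ?s (Dom V h)"
      using C(1) x y k z h by (simp add: ecomp_Comp_left ecomp_assoc)
    finally show ?thesis .
  qed
  show ?thesis
  proof (rule is_cotensorI)
    show "cot_map V C j p x \<cdot> \<kappa> \<in> Hom V k (VHom C ?p ?x)"
      using cm k by (simp add: in_Hom)
  next
    fix z g h
    assume z: "z \<in> VOb C" and g: "g \<in> Arr V" "Cod V g = VHom C z ?p" and h: "h \<in> Arr V" "Cod V h = VHom C z ?p"
      and gh: "Dom V g = Dom V h"
      and eq: "ecomp C z ?p ?x (cot_map V C j p x \<cdot> \<kappa>) g = ecomp C z ?p ?x (cot_map V C j p x \<cdot> \<kappa>) h"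
    have "ecomp C z p x \<kappa> (ecomp C z ?p p (Counit C j p) g) \<cdot> ?s (Dom V h)
      = ecomp C z p x \<kappa> (ecomp C z ?p p (Counit C j p) h) \<cdot> ?s (Dom V h)"
      using key[OF z g] key[OF z h] eq gh by simp
    then have "ecomp C z p x \<kappa> (ecomp C z ?p p (Counit C j p) g) = ecomp C z p x \<kappa> (ecomp C z ?p p (Counit C j p) h)"
      by (rule iso_cancel_right[rotated]) (use s[of "Dom V h"] C(1) x y k g h z gh in auto)
    then have "ecomp C z ?p p (Counit C j p) g = ecomp C z ?p p (Counit C j p) h"
      by (rule cotensor_cancel[OF C(1) p z, rotated -1]) (use C(1) x y k g h z gh in auto)
    then show "g = h"
      by (rule cotensor_cancel[OF C(1,3) z, rotated -1]) (use g h gh in auto)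
  next
    fix z y m
    assume z: "z \<in> VOb C" and y': "y \<in> Ob V" and m: "m \<in> Hom V (k \<otimes> y) (VHom C z ?x)"
    have m': "m \<in> Arr V" "Dom V m = k \<otimes> y" "Cod V m = VHom C z ?x"
      using m by (auto simp: in_Hom)
    let ?m = "ecomp C z ?x x (Counit C j x) m"
    note s = s[OF y']
    have m2: "?m \<in> Arr V" "Dom V ?m = j \<otimes> (k \<otimes> y)" "Cod V ?m = VHom C z x"
      using C(1) x m' z by auto
    have "?m \<cdot> inv_arr V (?s y) \<in> Hom V (k \<otimes> (j \<otimes> y)) (VHom C z x)"
      unfolding in_Hom using m2 s by (simp del: assoc)
    then obtain h1 where h1: "h1 \<in> Hom V (j \<otimes> y) (VHom C z p)" "ecomp C z p x \<kappa> h1 = ?m \<cdot> inv_arr V (?s y)"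
      by (rule cotensor_factor[OF C(1) p z, rotated]) (use x y' in auto)
    obtain h where h: "h \<in> Hom V y (VHom C z ?p)" "ecomp C z ?p p (Counit C j p) h = h1"
      by (rule cotensor_factor[OF C(1,3) z y' h1(1)])
    have h': "h \<in> Arr V" "Cod V h = VHom C z ?p" "Dom V h = y"
      using h by (auto simp: in_Hom)
    have "ecomp C z ?x x (Counit C j x) (ecomp C z ?p ?x (cot_map V C j p x \<cdot> \<kappa>) h) = (?m \<cdot> inv_arr V (?s y)) \<cdot> ?s y"
      unfolding key[OF z h'(1,2)] h h1(2) h' ..
    also have "\<dots> = ?m"
      using m2 s by (subst assoc) (auto simp del: assoc)
    finally have "ecomp C z ?p ?x (cot_map V C j p x \<cdot> \<kappa>) h = m"
      by (rule cotensor_cancel[OF C(1,2) z, rotated -1]) (use C(1) x y k cm m' h' z in auto)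
    then show "\<exists>h \<in> Hom V y (VHom C z ?p). ecomp C z ?p ?x (cot_map V C j p x \<cdot> \<kappa>) h = m"
      using h by blast
  qed (use C(1) x y k in auto)
qed

end

section \<open>Theories and ends\<close>

locale admissible_vcategory = symmetric_monoidal_closed_category V
  for V :: "('o, 'm) smcat" (structure) +
  fixes J :: "'o set" and C :: "('c, 'o, 'm) cvcat"
  assumes arities_J: "system_of_arities V J"
    and C [simp]: "vcategory V C"
    and admissible: "admissible V J C"
begin

lemma arities_simps [simp]: "\<I> \<in> J" "j \<in> J \<Longrightarrow> j \<in> Ob V"
  using arities_J by (auto simp: system_of_arities_def)

lemma cotensors [simp]: "has_cotensors V J C"
  using admissible by (simp add: admissible_def)

lemma C_cotensor:
  assumes "j \<in> J" "x \<in> VOb C"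
  shows "is_cotensor V C j x (Cot C j x) (Counit C j x)"
  by (rule has_cotensors_simps(1)[OF cotensors assms(2,1)])

lemma Cot_simps [simp]:
  assumes "x \<in> VOb C"
  shows "Cot C \<I> x = x" "Counit C \<I> x = VId C x"
    "j \<in> J \<Longrightarrow> Cot C j x \<in> VOb C" "j \<in> J \<Longrightarrow> Counit C j x \<in> Arr V"
    "j \<in> J \<Longrightarrow> Dom V (Counit C j x) = j" "j \<in> J \<Longrightarrow> Cod V (Counit C j x) = VHom C (Cot C j x) x"
  using has_cotensors_simps(2,3)[OF cotensors assms] is_cotensor_simps[OF C_cotensor[OF _ assms]] by auto

lemma cot_map_C_simps [simp]:
  assumes "j \<in> J" "x \<in> VOb C" "y \<in> VOb C"
  shows "cot_map V C j x y \<in> Arr V" "Dom V (cot_map V C j x y) = VHom C x y"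
    "Cod V (cot_map V C j x y) = VHom C (Cot C j x) (Cot C j y)"
  using cot_map_simps[OF C C_cotensor[OF assms(1,2)] C_cotensor[OF assms(1,3)]] by auto

lemma cot_map_C_VId [simp]:
  assumes "j \<in> J" "x \<in> VOb C"
  shows "cot_map V C j x x \<cdot> VId C x = VId C (Cot C j x)"
  by (rule cot_map_VId[OF C C_cotensor[OF assms]])

lemma ecomp_Counit:
  assumes "j \<in> J" "x \<in> VOb C" "y \<in> VOb C" "h \<in> Arr V" "Cod V h = VHom C x y"
  shows "ecomp C (Cot C j x) (Cot C j y) y (Counit C j y) (cot_map V C j x y \<cdot> h)
      = ecomp C (Cot C j x) x y h (Counit C j x) \<cdot> Sym V j (Dom V h)"
  by (rule ecomp_Counit_cot_map[OF C C_cotensor[OF assms(1,2)] C_cotensor[OF assms(1,3)] assms(4,5)])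

lemma cot_map_C_ecomp:
  assumes "j \<in> J" "x \<in> VOb C" "y \<in> VOb C" "z \<in> VOb C"
    "h \<in> Arr V" "Cod V h = VHom C x y" "g \<in> Arr V" "Cod V g = VHom C y z"
  shows "cot_map V C j x z \<cdot> ecomp C x y z g h
    = ecomp C (Cot C j x) (Cot C j y) (Cot C j z) (cot_map V C j y z \<cdot> g) (cot_map V C j x y \<cdot> h)"
  by (rule cot_map_ecomp[OF C C_cotensor[OF assms(1,2)] C_cotensor[OF assms(1,3)] C_cotensor[OF assms(1,4)] assms(5-)])

text \<open>This is where the normalization \<open>[\<I>,x] = x\<close> with identity counit enters:
  cancelling that counit leaves only the unit coherence \<open>RUnit_Sym\<close>.\<close>

lemma cot_map_Unit:
  assumes xy: "x \<in> VOb C" "y \<in> VOb C"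
  shows "cot_map V C \<I> x y = Id V (VHom C x y)"
proof -
  have "ecomp C x y y (VId C y) (cot_map V C \<I> x y)
    = ecomp C x y y (VId C y) (Id V (VHom C x y))"
    using ecomp_Counit[of \<I> x y "Id V (VHom C x y)"] cot_map_C_simps[of \<I> x y] xy
    by (simp add: ecomp_Id_right ecomp_Id_left RUnit_Sym)
  from cotensor_cancel[OF C C_cotensor[of \<I> y], of x "cot_map V C \<I> x y" "Id V (VHom C x y)"] this
  show ?thesis
    using cot_map_C_simps[of \<I> x y] xy by simp
qed

section \<open>Theories and their morphisms in terms of generators\<close>

lemma is_theory_simps:
  assumes "is_theory V J T"
  shows "vcategory V T" "VOb T = J" "j \<in> J \<Longrightarrow> is_cotensor V T j \<I> j (Gen T j)" "Gen T \<I> = VId T \<I>"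
    "j \<in> J \<Longrightarrow> Gen T j \<in> Arr V" "j \<in> J \<Longrightarrow> Dom V (Gen T j) = j" "j \<in> J \<Longrightarrow> Cod V (Gen T j) = VHom T j \<I>"
  using assms by (auto simp: is_theory_def dest: is_cotensor_simps)

lemma tau_simps:
  assumes T: "is_theory V J T" and jk: "j \<in> J" "k \<in> J"
  shows "tau V T j k \<in> Arr V" "Dom V (tau V T j k) = IHom V k j" "Cod V (tau V T j k) = VHom T j k"
    "ecomp T j k \<I> (Gen T k) (tau V T j k) = Gen T j \<cdot> Ev V k j \<cdot> Sym V k (IHom V k j)"
proof -
  note t = is_theory_simps[OF T] 
  note cot = is_cotensor_simps[OF t(3)[OF jk(2)]]
  let ?c = "cot_cmp V T k \<I> k (Gen T k) j" and ?m = "Gen T j \<cdot> Ev V k j"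
  let ?t = "transpose V (IHom V k j) k (VHom T j \<I>) ?m"
  have j: "j \<in> VOb T"
    using jk t(2) by simp
  note cmp = cot_cmp_simps[OF t(1) cot(1-3) j cot(4)] cot(8)[OF j]
  have m: "?m \<in> Arr V" "Dom V ?m = IHom V k j \<otimes> k" "Cod V ?m = VHom T j \<I>"
    using t(5-7) jk by auto
  have tr: "?t \<in> Arr V" "Dom V ?t = IHom V k j" "Cod V ?t = IHom V k (VHom T j \<I>)"
    "Ev V k (VHom T j \<I>) \<cdot> (?t \<odot> Id V k) = ?m"
    using m jk t(1,2) by (auto simp: transpose_simps simp del: assoc)
  have eq: "tau V T j k = inv_arr V ?c \<cdot> ?t"
    by (simp add: tau_def)
  show ts: "tau V T j k \<in> Arr V" "Dom V (tau V T j k) = IHom V k j" "Cod V (tau V T j k) = VHom T j k"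
    unfolding eq using cmp tr by simp_all
  have "ecomp T j k \<I> (Gen T k) (tau V T j k) \<cdot> Sym V (IHom V k j) k = ?m"
    unfolding eq using Ev_cot_cmp[OF t(1) cot(1-3) j cot(4), of "inv_arr V ?c \<cdot> ?t"] cmp tr by simp
  then have "(ecomp T j k \<I> (Gen T k) (tau V T j k) \<cdot> Sym V (IHom V k j) k) \<cdot> Sym V k (IHom V k j)
     = ?m \<cdot> Sym V k (IHom V k j)"
    by (rule arg_cong)
  then show "ecomp T j k \<I> (Gen T k) (tau V T j k) = Gen T j \<cdot> Ev V k j \<cdot> Sym V k (IHom V k j)"
    using t(1,2,5-7) jk ts by simp
qed

text \<open>The transpose of \<open>RUnit V j\<close> is the canonical arrow
  \<open>j \<rightarrow> [\<I>,j]\<close>. Hence compatibility with \<open>tau\<close>, by which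
  theory morphisms are defined, implies preservation of generators.\<close>

lemma Gen_eq_tau:
  assumes T: "is_theory V J T" and j: "j \<in> J"
  shows "Gen T j = tau V T j \<I> \<cdot> transpose V j \<I> j (RUnit V j)"
proof -
  note t = is_theory_simps[OF T] and ts = tau_simps[OF T j, of \<I>]
  let ?t = "transpose V j \<I> j (RUnit V j)"
  have tr: "?t \<in> Arr V" "Dom V ?t = j" "Cod V ?t = IHom V \<I> j" "Ev V \<I> j \<cdot> (?t \<odot> Id V \<I>) = RUnit V j"
    using j by (auto simp: transpose_simps)
  have "tau V T j \<I> \<cdot> LUnit V (IHom V \<I> j) = Gen T j \<cdot> Ev V \<I> j \<cdot> Sym V \<I> (IHom V \<I> j)"
    using ts t(1,2,4) j by (simp add: ecomp_Id_left)
  then have "(tau V T j \<I> \<cdot> LUnit V (IHom V \<I> j)) \<cdot> (Id V \<I> \<odot> ?t)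
    = (Gen T j \<cdot> Ev V \<I> j \<cdot> Sym V \<I> (IHom V \<I> j)) \<cdot> (Id V \<I> \<odot> ?t)"
    by (rule arg_cong)
  then have "tau V T j \<I> \<cdot> (?t \<cdot> LUnit V j) = Gen T j \<cdot> ((Ev V \<I> j \<cdot> (?t \<odot> Id V \<I>)) \<cdot> Sym V \<I> j)"
    using ts(1-3) tr(1-3) t(1,2,5-7) j by (simp add: LUnit_nat Sym_nat)
  then have "(tau V T j \<I> \<cdot> ?t) \<cdot> LUnit V j = Gen T j \<cdot> LUnit V j"
    unfolding tr(4) using ts(1-3) tr(1-3) t(1,2,5-7) j by (simp add: RUnit_Sym)
  then show ?thesis
    by (rule iso_cancel_right[rotated, OF sym]) (use ts(1-3) tr(1-3) t(1,2,5-7) j in auto)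
qed

lemma theory_morphismD:
  assumes "theory_morphism V J T U M"
  shows "vfunctor V T U M" "j \<in> J \<Longrightarrow> FOb M j = j"
    "\<lbrakk>j \<in> J; k \<in> J\<rbrakk> \<Longrightarrow> FHom M j k \<cdot> tau V T j k = tau V U j k"
  using assms by (auto simp: theory_morphism_def)

lemma theory_morphism_simps:
  assumes "is_theory V J T" "theory_morphism V J T U M" "j \<in> J" "k \<in> J"
  shows "FHom M j k \<in> Arr V" "Dom V (FHom M j k) = VHom T j k" "Cod V (FHom M j k) = VHom U j k"
  using is_theory_simps(2)[OF assms(1)] theory_morphismD(2)[OF assms(2)]
    vfunctor_simps(3-5)[OF theory_morphismD(1)[OF assms(2)], of j k] assms(3,4) by auto

lemma theory_morphism_Gen:
  assumes T: "is_theory V J T" "is_theory V J U" "theory_morphism V J T U M" and j: "j \<in> J"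
  shows "FHom M j \<I> \<cdot> Gen T j = Gen U j"
proof -
  note m = theory_morphism_simps[OF T(1,3) j, of \<I>] and ts = tau_simps[OF T(1) j, of \<I>]
  have tr: "transpose V j \<I> j (RUnit V j) \<in> Arr V" "Cod V (transpose V j \<I> j (RUnit V j)) = IHom V \<I> j"
    using j by (auto simp: transpose_simps)
  have "FHom M j \<I> \<cdot> Gen T j = (FHom M j \<I> \<cdot> tau V T j \<I>) \<cdot> transpose V j \<I> j (RUnit V j)"
    unfolding Gen_eq_tau[OF T(1) j] using m ts tr by simp
  then show ?thesis
    by (simp only: theory_morphismD(3)[OF T(3) j arities_simps(1)] Gen_eq_tau[OF T(2) j])
qed

text \<open>Generators suffice because arrows into \<open>U(j,k)\<close> are determined by their
  composite with \<open>Gen U k\<close>, and on both sides of the \<open>tau\<close> equation that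
  composite is evaluation followed by \<open>Gen U j\<close>. Later theory morphisms are verified in
  this form.\<close>

lemma theory_morphismI:
  assumes T: "is_theory V J T" "is_theory V J U" and M: "vfunctor V T U M"
    and Ob: "\<And>j. j \<in> J \<Longrightarrow> FOb M j = j" and Gen: "\<And>j. j \<in> J \<Longrightarrow> FHom M j \<I> \<cdot> Gen T j = Gen U j"
  shows "theory_morphism V J T U M"
  unfolding theory_morphism_def
proof (intro conjI ballI M Ob)
  fix j k assume jk: "j \<in> J" "k \<in> J"
  note t = is_theory_simps[OF T(1)] and u = is_theory_simps[OF T(2)]
  note tt = tau_simps[OF T(1) jk] and tu = tau_simps[OF T(2) jk]
  have "ecomp U j k \<I> (Gen U k) (FHom M j k \<cdot> tau V T j k) = FHom M j \<I> \<cdot> ecomp T j k \<I> (Gen T k) (tau V T j k)"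
    using vfunctor_ecomp[OF t(1) u(1) M, of j k \<I> "tau V T j k" "Gen T k"] jk t(2,5-7) tt(1-3) Ob Gen
    by simp
  also have "\<dots> = (FHom M j \<I> \<cdot> Gen T j) \<cdot> (Ev V k j \<cdot> Sym V k (IHom V k j))"
    unfolding tt(4) using vfunctor_simps(3-5)[OF M, of j \<I>] Ob t(2,5-7) jk by simp
  also have "\<dots> = ecomp U j k \<I> (Gen U k) (tau V U j k)"
    unfolding Gen[OF jk(1)] tu(4) ..
  finally show "FHom M j k \<cdot> tau V T j k = tau V U j k"
    by (rule cotensor_cancel[OF u(1) u(3)[OF jk(2)], rotated -1])
      (use tt(1-3) tu(1-3) u(2) jk vfunctor_simps(3-5)[OF M, of j k] Ob t(2) in auto)
qed

section \<open>Natural families and the hom-objects of \<open>T-Alg(C)\<close>\<close>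

lemma vnat_familyI:
  assumes "vcategory V T" "vfunctor V T C A" "vfunctor V T C B" "\<alpha> \<in> extensional (VOb T)"
    "\<And>j. j \<in> VOb T \<Longrightarrow> \<alpha> j \<in> Hom V x (VHom C (FOb A j) (FOb B j))"
    "\<And>j k. \<lbrakk>j \<in> VOb T; k \<in> VOb T\<rbrakk> \<Longrightarrow> ecomp C (FOb A j) (FOb A k) (FOb B k) (\<alpha> k) (FHom A j k)
        = ecomp C (FOb A j) (FOb B j) (FOb B k) (FHom B j k) (\<alpha> j) \<cdot> Sym V x (VHom T j k)"
  shows "vnat_family V T C A B x \<alpha>"
  unfolding vnat_family_def
proof (intro conjI ballI assms)
  fix j k assume jk: "j \<in> VOb T" "k \<in> VOb T"
  have *: "\<alpha> j \<in> Arr V" "Dom V (\<alpha> j) = x" "Cod V (\<alpha> j) = VHom C (FOb A j) (FOb B j)"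
    using assms(5)[OF jk(1)] by (auto simp: in_Hom)
  then have "x \<in> Ob V"
    by auto
  then show "VComp C (FOb A j) (FOb A k) (FOb B k) \<cdot> \<alpha> k \<odot> FHom A j k =
       VComp C (FOb A j) (FOb B j) (FOb B k) \<cdot> FHom B j k \<odot> \<alpha> j \<cdot> Sym V x (VHom T j k)"
    using assms(6)[OF jk] assms(1-3) jk * by (simp add: ecomp_def)
qed

lemma vnat_family_simps:
  assumes "vnat_family V T C A B x \<alpha>" "j \<in> VOb T"
  shows "\<alpha> j \<in> Arr V" "Dom V (\<alpha> j) = x" "Cod V (\<alpha> j) = VHom C (FOb A j) (FOb B j)"
proof -
  have "\<alpha> j \<in> Hom V x (VHom C (FOb A j) (FOb B j))"
    using assms unfolding vnat_family_def by blast
  then show "\<alpha> j \<in> Arr V" "Dom V (\<alpha> j) = x" "Cod V (\<alpha> j) = VHom C (FOb A j) (FOb B j)"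
    by (auto simp: in_Hom)
qed

text \<open>Naturality tested on a generalized element \<open>t\<close> of \<open>T(j,k)\<close>.
  Taking a generator for \<open>t\<close> brings in the cotensor counits.\<close>

lemma vnat_family_ecomp:
  assumes "vcategory V T" "vfunctor V T C A" "vfunctor V T C B"
    "vnat_family V T C A B x \<alpha>" "j \<in> VOb T" "k \<in> VOb T" "t \<in> Arr V" "Cod V t = VHom T j k"
  shows "ecomp C (FOb A j) (FOb A k) (FOb B k) (\<alpha> k) (FHom A j k \<cdot> t)
    = ecomp C (FOb A j) (FOb B j) (FOb B k) (FHom B j k \<cdot> t) (\<alpha> j) \<cdot> Sym V x (Dom V t)"
proof -
  note j = vnat_family_simps[OF assms(4,5)] and k = vnat_family_simps[OF assms(4,6)]
  have x: "x \<in> Ob V"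
    using j by auto
  have "VComp C (FOb A j) (FOb A k) (FOb B k) \<cdot> (\<alpha> k \<odot> FHom A j k) =
        VComp C (FOb A j) (FOb B j) (FOb B k) \<cdot> (FHom B j k \<odot> \<alpha> j) \<cdot> Sym V x (VHom T j k)"
    using assms(4-6) unfolding vnat_family_def by blast
  then have eq: "ecomp C (FOb A j) (FOb A k) (FOb B k) (\<alpha> k) (FHom A j k) =
        ecomp C (FOb A j) (FOb B j) (FOb B k) (FHom B j k) (\<alpha> j) \<cdot> Sym V x (VHom T j k)"
    unfolding ecomp_def using assms(1-3,5,6) j k x by simp
  have "ecomp C (FOb A j) (FOb A k) (FOb B k) (\<alpha> k) (FHom A j k \<cdot> t)
    = ecomp C (FOb A j) (FOb A k) (FOb B k) (\<alpha> k) (FHom A j k) \<cdot> (Id V x \<odot> t)"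
    using assms(1-3,5-) k by (simp add: ecomp_Comp_right)
  also have "\<dots> = ecomp C (FOb A j) (FOb B j) (FOb B k) (FHom B j k \<cdot> t) (\<alpha> j) \<cdot> Sym V x (Dom V t)"
    unfolding eq using assms(1-3,5-) j x by (simp add: Sym_nat ecomp_Comp_reduce)
  finally show ?thesis .
qed

lemma is_algebra_simps:
  assumes "is_algebra V J C T A"
  shows "vfunctor V T C A" "preserves_cotensors V J T C A"
  using assms by (auto simp: is_algebra_def)

text \<open>Admissibility supplies an end for any two algebras, so the choice made by
  \<open>hom_end\<close> is a genuine end.\<close>

lemma is_hom_end_end:
  assumes "is_theory V J T" "is_algebra V J C T A" "is_algebra V J C T B"
  shows "is_hom_end V T C A B (end_obj V T C A B) (end_proj V T C A B)"
proof -
  have "\<exists>E. is_hom_end V T C A B (fst E) (snd E)"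
    using admissible assms unfolding admissible_def by (metis fst_conv snd_conv)
  then show ?thesis
    unfolding end_obj_def end_proj_def hom_end_def by (rule someI_ex)
qed

lemma end_obj_Ob:
  assumes "is_theory V J T" "is_algebra V J C T A" "is_algebra V J C T B"
  shows "end_obj V T C A B \<in> Ob V"
  using is_hom_end_end[OF assms] by (simp add: is_hom_end_def)

lemma end_proj_family:
  assumes "is_theory V J T" "is_algebra V J C T A" "is_algebra V J C T B"
  shows "vnat_family V T C A B (end_obj V T C A B) (end_proj V T C A B)"
  using is_hom_end_end[OF assms] unfolding is_hom_end_def by blast

lemma end_proj_simps:
  assumes "is_theory V J T" "is_algebra V J C T A" "is_algebra V J C T B" "j \<in> J"
  shows "end_proj V T C A B j \<in> Arr V" "Dom V (end_proj V T C A B j) = end_obj V T C A B"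
    "Cod V (end_proj V T C A B j) = VHom C (FOb A j) (FOb B j)"
  using vnat_family_simps[OF end_proj_family[OF assms(1-3)]] assms(4) is_theory_simps(2)[OF assms(1)] by auto

lemma end_lift_simps:
  assumes T: "is_theory V J T" "is_algebra V J C T A" "is_algebra V J C T B"
    and f: "vnat_family V T C A B x \<alpha>"
  shows "end_lift V T C A B x \<alpha> \<in> Arr V" "Dom V (end_lift V T C A B x \<alpha>) = x"
    "Cod V (end_lift V T C A B x \<alpha>) = end_obj V T C A B"
    "j \<in> J \<Longrightarrow> end_proj V T C A B j \<cdot> end_lift V T C A B x \<alpha> = \<alpha> j"
proof -
  have "\<alpha> \<I> \<in> Hom V x (VHom C (FOb A \<I>) (FOb B \<I>))"
    using f is_theory_simps(2)[OF T(1)] arities_simps(1) unfolding vnat_family_def by blast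
  then have "x \<in> Ob V"
    using Hom_ObD by blast
  then have "\<exists>!h. h \<in> Hom V x (end_obj V T C A B) \<and> (\<forall>j \<in> VOb T. end_proj V T C A B j \<cdot> h = \<alpha> j)"
    using is_hom_end_end[OF T] f unfolding is_hom_end_def by blast
  from theI'[OF this, folded end_lift_def]
  show "end_lift V T C A B x \<alpha> \<in> Arr V" "Dom V (end_lift V T C A B x \<alpha>) = x"
    "Cod V (end_lift V T C A B x \<alpha>) = end_obj V T C A B"
    "j \<in> J \<Longrightarrow> end_proj V T C A B j \<cdot> end_lift V T C A B x \<alpha> = \<alpha> j"
    using is_theory_simps(2)[OF T(1)] by (auto simp: in_Hom)
qed

lemma vnat_family_Comp:
  assumes "vcategory V T" "vfunctor V T C A" "vfunctor V T C B" "vnat_family V T C A B x \<alpha>"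
    and h: "h \<in> Arr V" "Cod V h = x"
  shows "vnat_family V T C A B (Dom V h) (\<lambda>j \<in> VOb T. \<alpha> j \<cdot> h)"
proof (rule vnat_familyI[OF assms(1-3)])
  fix j k assume jk: "j \<in> VOb T" "k \<in> VOb T"
  note j = vnat_family_simps[OF assms(4) jk(1)] and k = vnat_family_simps[OF assms(4) jk(2)]
  have x: "x \<in> Ob V"
    using h by auto
  show "(\<lambda>j \<in> VOb T. \<alpha> j \<cdot> h) j \<in> Hom V (Dom V h) (VHom C (FOb A j) (FOb B j))"
    using h j jk by (simp add: in_Hom)
  have eq: "ecomp C (FOb A j) (FOb A k) (FOb B k) (\<alpha> k) (FHom A j k)
    = ecomp C (FOb A j) (FOb B j) (FOb B k) (FHom B j k) (\<alpha> j) \<cdot> Sym V x (VHom T j k)"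
    using vnat_family_ecomp[OF assms(1-4) jk, of "Id V (VHom T j k)"] assms(1-3) jk by simp
  have "ecomp C (FOb A j) (FOb A k) (FOb B k) (\<alpha> k \<cdot> h) (FHom A j k)
    = ecomp C (FOb A j) (FOb A k) (FOb B k) (\<alpha> k) (FHom A j k) \<cdot> (h \<odot> Id V (VHom T j k))"
    using assms(1-3) jk h k by (simp add: ecomp_Comp_left)
  also have "\<dots> = ecomp C (FOb A j) (FOb B j) (FOb B k) (FHom B j k) (\<alpha> j \<cdot> h) \<cdot> Sym V (Dom V h) (VHom T j k)"
    unfolding eq using assms(1-3) jk h j x by (simp add: Sym_nat ecomp_Comp_reduce)
  finally show "ecomp C (FOb A j) (FOb A k) (FOb B k) ((\<lambda>j \<in> VOb T. \<alpha> j \<cdot> h) k) (FHom A j k)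
    = ecomp C (FOb A j) (FOb B j) (FOb B k) (FHom B j k) ((\<lambda>j \<in> VOb T. \<alpha> j \<cdot> h) j) \<cdot> Sym V (Dom V h) (VHom T j k)"
    using jk by simp
qed auto

lemma end_cancel:
  assumes T: "is_theory V J T" "is_algebra V J C T A" "is_algebra V J C T B"
    and g: "g \<in> Arr V" "Cod V g = end_obj V T C A B" and h: "h \<in> Arr V" "Cod V h = end_obj V T C A B"
    and eq: "Dom V g = Dom V h" "\<And>j. j \<in> J \<Longrightarrow> end_proj V T C A B j \<cdot> g = end_proj V T C A B j \<cdot> h"
  shows "g = h"
proof -
  let ?\<alpha> = "\<lambda>j \<in> VOb T. end_proj V T C A B j \<cdot> h"
  have "vnat_family V T C A B (Dom V h) ?\<alpha>"
    using vnat_family_Comp is_theory_simps(1)[OF T(1)] is_algebra_simps(1) T(2,3) end_proj_family[OF T] h by blast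
  moreover have "Dom V h \<in> Ob V"
    using h by simp
  ultimately have "\<exists>!f. f \<in> Hom V (Dom V h) (end_obj V T C A B) \<and>
      (\<forall>j \<in> VOb T. end_proj V T C A B j \<cdot> f = ?\<alpha> j)"
    using is_hom_end_end[OF T] unfolding is_hom_end_def by blast
  moreover have "g \<in> Hom V (Dom V h) (end_obj V T C A B) \<and> (\<forall>j \<in> VOb T. end_proj V T C A B j \<cdot> g = ?\<alpha> j)"
    using g eq is_theory_simps(2)[OF T(1)] by (simp add: in_Hom)
  moreover have "h \<in> Hom V (Dom V h) (end_obj V T C A B) \<and> (\<forall>j \<in> VOb T. end_proj V T C A B j \<cdot> h = ?\<alpha> j)"
    using h by (simp add: in_Hom)
  ultimately show ?thesis
    by blast
qed

lemma algebra_Gen_cotensor: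
  assumes "is_theory V J T" "is_algebra V J C T A" "j \<in> J"
  shows "is_cotensor V C j (FOb A \<I>) (FOb A j) (FHom A j \<I> \<cdot> Gen T j)"
  using is_algebra_simps(2)[OF assms(2)] is_theory_simps(3)[OF assms(1,3)] assms(3)
  unfolding preserves_cotensors_def by blast

text \<open>
  Since algebras send the generators to cotensor counits, a natural family is determined by its
  component at \<open>\<I>\<close>.
\<close>

lemma end_cancel_Unit:
  assumes T: "is_theory V J T" "is_algebra V J C T A" "is_algebra V J C T B"
    and g: "g \<in> Arr V" "Cod V g = end_obj V T C A B" and h: "h \<in> Arr V" "Cod V h = end_obj V T C A B"
    and eq: "Dom V g = Dom V h" "end_proj V T C A B \<I> \<cdot> g = end_proj V T C A B \<I> \<cdot> h"
  shows "g = h"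
proof (rule end_cancel[OF T g h eq(1)])
  fix j assume j: "j \<in> J"
  note t = is_theory_simps[OF T(1)] and A = is_algebra_simps[OF T(2)] and B = is_algebra_simps[OF T(3)]
  note pj = end_proj_simps[OF T j] and pI = end_proj_simps[OF T arities_simps(1)]
  note cot = algebra_Gen_cotensor[OF T(1,3) j]
  have key: "ecomp C (FOb A j) (FOb B j) (FOb B \<I>) (FHom B j \<I> \<cdot> Gen T j) (end_proj V T C A B j \<cdot> f)
     = ecomp C (FOb A j) (FOb A \<I>) (FOb B \<I>) (end_proj V T C A B \<I> \<cdot> f) (FHom A j \<I> \<cdot> Gen T j) \<cdot> Sym V j (Dom V f)"
    if f: "f \<in> Arr V" "Cod V f = end_obj V T C A B" for f
    using vnat_family_ecomp[OF t(1) A(1) B(1) vnat_family_Comp[OF t(1) A(1) B(1) end_proj_family[OF T] f],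
        of j \<I> "Gen T j"] t j A(1) B(1) pj pI f
    by simp
  show "end_proj V T C A B j \<cdot> g = end_proj V T C A B j \<cdot> h"
    by (rule cotensor_cancel[OF C cot, rotated -1]) (use key[OF g] key[OF h] eq A(1) g h pj j t(2) in auto)
qed

end

section \<open>Commutant theories\<close>

context admissible_vcategory
begin

lemma alg_cot_simps [simp]:
  "k \<in> VOb T \<Longrightarrow> FOb (alg_cot V T C j A) k = Cot C j (FOb A k)"
  "\<lbrakk>k \<in> VOb T; l \<in> VOb T\<rbrakk> \<Longrightarrow> FHom (alg_cot V T C j A) k l = cot_map V C j (FOb A k) (FOb A l) \<cdot> FHom A k l"
  by (auto simp: alg_cot_def)

lemma vfunctor_alg_cot:
  assumes T: "vcategory V T" and A: "vfunctor V T C A" and j: "j \<in> J"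
  shows "vfunctor V T C (alg_cot V T C j A)"
proof (rule vfunctorI)
  fix a b c assume abc: "a \<in> VOb T" "b \<in> VOb T" "c \<in> VOb T"
  have "FHom A a c \<cdot> VComp T a b c = ecomp C (FOb A a) (FOb A b) (FOb A c) (FHom A b c) (FHom A a b)"
    using vfunctorD(5)[OF A] abc by blast
  then have "cot_map V C j (FOb A a) (FOb A c) \<cdot> (FHom A a c \<cdot> VComp T a b c)
    = ecomp C (Cot C j (FOb A a)) (Cot C j (FOb A b)) (Cot C j (FOb A c))
       (cot_map V C j (FOb A b) (FOb A c) \<cdot> FHom A b c) (cot_map V C j (FOb A a) (FOb A b) \<cdot> FHom A a b)"
    using A j abc by (simp add: cot_map_C_ecomp)
  then show "FHom (alg_cot V T C j A) a c \<cdot> VComp T a b c = ecomp C (FOb (alg_cot V T C j A) a)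
     (FOb (alg_cot V T C j A) b) (FOb (alg_cot V T C j A) c) (FHom (alg_cot V T C j A) b c)
     (FHom (alg_cot V T C j A) a b)"
    using T A j abc by simp
next
  fix a assume "a \<in> VOb T"
  then show "FHom (alg_cot V T C j A) a a \<cdot> VId T a = VId C (FOb (alg_cot V T C j A) a)"
    using T A j by simp
qed (use T A j in \<open>auto simp: alg_cot_def in_Hom\<close>)

lemma is_algebra_alg_cot:
  assumes T: "is_theory V J T" and A: "is_algebra V J C T A" and j: "j \<in> J"
  shows "is_algebra V J C T (alg_cot V T C j A)"
  unfolding is_algebra_def
proof (intro conjI vfunctor_alg_cot is_theory_simps(1)[OF T] is_algebra_simps(1)[OF A] j)
  note A1 = is_algebra_simps(1)[OF A]
  show "preserves_cotensors V J T C (alg_cot V T C j A)"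
    unfolding preserves_cotensors_def
  proof (intro ballI allI impI)
    fix k x p \<kappa> assume k: "k \<in> J" and cot: "is_cotensor V T k x p \<kappa>"
    note c = is_cotensor_simps[OF cot]
    have "is_cotensor V C k (FOb A x) (FOb A p) (FHom A p x \<cdot> \<kappa>)"
      using is_algebra_simps(2)[OF A] k cot unfolding preserves_cotensors_def by blast
    from cot_map_is_cotensor[OF C C_cotensor[OF j] C_cotensor[OF j] this]
    have "is_cotensor V C k (Cot C j (FOb A x)) (Cot C j (FOb A p))
      (cot_map V C j (FOb A p) (FOb A x) \<cdot> FHom A p x \<cdot> \<kappa>)"
      using A1 c by simp
    then show "is_cotensor V C k (FOb (alg_cot V T C j A) x) (FOb (alg_cot V T C j A) p)
      (FHom (alg_cot V T C j A) p x \<cdot> \<kappa>)"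
      using A1 c(2,3,5-7) j by simp
  qed
qed

text \<open>A literal equality, thanks to \<open>cot_map_Unit\<close>. It lets the counit
  \<open>[j,A] \<rightarrow> A\<close> be read as an arrow into \<open>[\<I>,A]\<close>, that is, as
  a generator of the commutant theory with target \<open>\<I>\<close>.\<close>

lemma alg_cot_Unit:
  assumes "vcategory V T" "vfunctor V T C A"
  shows "alg_cot V T C \<I> A = A"
  by (rule vfun_eqI[OF vfunctor_alg_cot[OF assms arities_simps(1)] assms(2)])
    (use assms in \<open>auto simp: cot_map_Unit\<close>)

lemma vnat_family_VId:
  assumes "vcategory V T" "vfunctor V T C A"
  shows "vnat_family V T C A A \<I> (\<lambda>j \<in> VOb T. VId C (FOb A j))"
  by (rule vnat_familyI) (use assms in \<open>auto simp: in_Hom ecomp_Id_left ecomp_Id_right RUnit_Sym\<close>)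

text \<open>Naturality of \<open>\<alpha>\<close> moves the parameter \<open>T(j,k)\<close> past
  \<open>x\<close>, naturality of \<open>\<beta>\<close> moves it past \<open>y\<close>, and
  \<open>hexagon_inv\<close> says that the two moves together are the symmetry past
  \<open>y \<otimes> x\<close>.\<close>

lemma vnat_family_ecomp_family:
  assumes T: "vcategory V T" and A: "vfunctor V T C A" "vfunctor V T C B" "vfunctor V T C D"
    and \<alpha>: "vnat_family V T C A B x \<alpha>" and \<beta>: "vnat_family V T C B D y \<beta>"
    and xy: "x \<in> Ob V" "y \<in> Ob V"
  shows "vnat_family V T C A D (y \<otimes> x) (\<lambda>j \<in> VOb T. ecomp C (FOb A j) (FOb B j) (FOb D j) (\<beta> j) (\<alpha> j))"
proof (rule vnat_familyI)
  fix j k assume jk: "j \<in> VOb T" "k \<in> VOb T"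
  let ?t = "VHom T j k"
  note a = vnat_family_simps[OF \<alpha> jk(1)] vnat_family_simps[OF \<alpha> jk(2)]
  note b = vnat_family_simps[OF \<beta> jk(1)] vnat_family_simps[OF \<beta> jk(2)]
  note na = vnat_family_ecomp[OF T A(1,2) \<alpha> jk, of "Id V ?t"]
  note nb = vnat_family_ecomp[OF T A(2,3) \<beta> jk, of "Id V ?t"]
  have "ecomp C (FOb A j) (FOb A k) (FOb D k) (ecomp C (FOb A k) (FOb B k) (FOb D k) (\<beta> k) (\<alpha> k)) (FHom A j k)
    = ecomp C (FOb A j) (FOb B k) (FOb D k) (\<beta> k) (ecomp C (FOb A j) (FOb A k) (FOb B k) (\<alpha> k) (FHom A j k))
      \<cdot> Assoc V y x ?t"
    using T A jk a b by (simp add: ecomp_assoc)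
  also have "\<dots> = ecomp C (FOb A j) (FOb B k) (FOb D k) (\<beta> k)
      (ecomp C (FOb A j) (FOb B j) (FOb B k) (FHom B j k) (\<alpha> j)) \<cdot> (Id V y \<odot> Sym V x ?t) \<cdot> Assoc V y x ?t"
    using T A jk a b xy na by (simp add: ecomp_Comp_right)
  also have "\<dots> = ecomp C (FOb A j) (FOb B j) (FOb D k) (ecomp C (FOb B j) (FOb B k) (FOb D k) (\<beta> k) (FHom B j k)) (\<alpha> j)
      \<cdot> inv_arr V (Assoc V y ?t x) \<cdot> (Id V y \<odot> Sym V x ?t) \<cdot> Assoc V y x ?t"
    using T A jk a b xy by (simp add: ecomp_assoc')
  also have "\<dots> = ecomp C (FOb A j) (FOb B j) (FOb D k) (ecomp C (FOb B j) (FOb D j) (FOb D k) (FHom D j k) (\<beta> j)) (\<alpha> j)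
      \<cdot> (Sym V y ?t \<odot> Id V x) \<cdot> inv_arr V (Assoc V y ?t x) \<cdot> (Id V y \<odot> Sym V x ?t) \<cdot> Assoc V y x ?t"
    using T A jk a b xy nb by (simp add: ecomp_Comp_left)
  also have "\<dots> = ecomp C (FOb A j) (FOb D j) (FOb D k) (FHom D j k) (ecomp C (FOb A j) (FOb B j) (FOb D j) (\<beta> j) (\<alpha> j))
      \<cdot> Assoc V ?t y x \<cdot> (Sym V y ?t \<odot> Id V x) \<cdot> inv_arr V (Assoc V y ?t x) \<cdot> (Id V y \<odot> Sym V x ?t) \<cdot> Assoc V y x ?t"
    using T A jk a b xy by (simp add: ecomp_assoc)
  also have "\<dots> = ecomp C (FOb A j) (FOb D j) (FOb D k) (FHom D j k) (ecomp C (FOb A j) (FOb B j) (FOb D j) (\<beta> j) (\<alpha> j))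
      \<cdot> Sym V (y \<otimes> x) ?t"
    using T jk xy by (simp add: hexagon_inv)
  finally show "ecomp C (FOb A j) (FOb A k) (FOb D k)
     ((\<lambda>j \<in> VOb T. ecomp C (FOb A j) (FOb B j) (FOb D j) (\<beta> j) (\<alpha> j)) k) (FHom A j k) =
    ecomp C (FOb A j) (FOb D j) (FOb D k) (FHom D j k)
     ((\<lambda>j \<in> VOb T. ecomp C (FOb A j) (FOb B j) (FOb D j) (\<beta> j) (\<alpha> j)) j) \<cdot> Sym V (y \<otimes> x) ?t"
    using jk by simp
next
  fix j assume j: "j \<in> VOb T"
  show "(\<lambda>j \<in> VOb T. ecomp C (FOb A j) (FOb B j) (FOb D j) (\<beta> j) (\<alpha> j)) j
    \<in> Hom V (y \<otimes> x) (VHom C (FOb A j) (FOb D j))"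
    using vnat_family_simps[OF \<alpha> j] vnat_family_simps[OF \<beta> j] T A j by (simp add: in_Hom)
qed (use T A in auto)

lemma vnat_family_Counit:
  assumes T: "vcategory V T" and A: "vfunctor V T C A" and j: "j \<in> J"
  shows "vnat_family V T C (alg_cot V T C j A) A j (\<lambda>k \<in> VOb T. Counit C j (FOb A k))"
  by (rule vnat_familyI[OF T vfunctor_alg_cot[OF assms] A])
    (use assms in \<open>auto simp: in_Hom ecomp_Counit\<close>)

section \<open>The enriched category of \<open>T\<close>-algebras and the commutant theory\<close>

lemma TAlg_simps:
  "VOb (TAlg V J C T) = {A. is_algebra V J C T A}"
  "VHom (TAlg V J C T) A B = end_obj V T C A B"
  "Cot (TAlg V J C T) j A = alg_cot V T C j A"
  by (auto simp: TAlg_def)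

lemma TAlg_VId:
  assumes "is_theory V J T" "is_algebra V J C T A"
  shows "VId (TAlg V J C T) A \<in> Arr V" "Dom V (VId (TAlg V J C T) A) = \<I>"
    "Cod V (VId (TAlg V J C T) A) = end_obj V T C A A"
    "j \<in> J \<Longrightarrow> end_proj V T C A A j \<cdot> VId (TAlg V J C T) A = VId C (FOb A j)"
  using end_lift_simps[OF assms assms(2) vnat_family_VId] is_theory_simps(1,2)[OF assms(1)]
    is_algebra_simps(1)[OF assms(2)]
  by (auto simp: TAlg_def)

lemma TAlg_VComp:
  assumes T: "is_theory V J T" and A: "is_algebra V J C T A" "is_algebra V J C T B" "is_algebra V J C T D"
  shows "VComp (TAlg V J C T) A B D \<in> Arr V"
    "Dom V (VComp (TAlg V J C T) A B D) = end_obj V T C B D \<otimes> end_obj V T C A B"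
    "Cod V (VComp (TAlg V J C T) A B D) = end_obj V T C A D"
    "j \<in> J \<Longrightarrow> end_proj V T C A D j \<cdot> VComp (TAlg V J C T) A B D
      = ecomp C (FOb A j) (FOb B j) (FOb D j) (end_proj V T C B D j) (end_proj V T C A B j)"
proof -
  have eq: "VComp (TAlg V J C T) A B D = end_lift V T C A D (end_obj V T C B D \<otimes> end_obj V T C A B)
     (\<lambda>j \<in> VOb T. ecomp C (FOb A j) (FOb B j) (FOb D j) (end_proj V T C B D j) (end_proj V T C A B j))"
    by (simp add: TAlg_def ecomp_def)
  note l = end_lift_simps[OF T A(1,3) vnat_family_ecomp_family[OF is_theory_simps(1)[OF T]
    is_algebra_simps(1)[OF A(1)] is_algebra_simps(1)[OF A(2)] is_algebra_simps(1)[OF A(3)]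
    end_proj_family[OF T A(1,2)] end_proj_family[OF T A(2,3)] end_obj_Ob[OF T A(1,2)] end_obj_Ob[OF T A(2,3)]]]
  show "VComp (TAlg V J C T) A B D \<in> Arr V"
    "Dom V (VComp (TAlg V J C T) A B D) = end_obj V T C B D \<otimes> end_obj V T C A B"
    "Cod V (VComp (TAlg V J C T) A B D) = end_obj V T C A D"
    "j \<in> J \<Longrightarrow> end_proj V T C A D j \<cdot> VComp (TAlg V J C T) A B D
      = ecomp C (FOb A j) (FOb B j) (FOb D j) (end_proj V T C B D j) (end_proj V T C A B j)"
    unfolding eq using l is_theory_simps(2)[OF T] by auto
qed

lemma TAlg_Counit:
  assumes T: "is_theory V J T" and A: "is_algebra V J C T A" and j: "j \<in> J"
  shows "Counit (TAlg V J C T) j A \<in> Arr V" "Dom V (Counit (TAlg V J C T) j A) = j"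
    "Cod V (Counit (TAlg V J C T) j A) = end_obj V T C (alg_cot V T C j A) A"
    "k \<in> J \<Longrightarrow> end_proj V T C (alg_cot V T C j A) A k \<cdot> Counit (TAlg V J C T) j A = Counit C j (FOb A k)"
  using end_lift_simps[OF T is_algebra_alg_cot[OF assms] A
      vnat_family_Counit[OF is_theory_simps(1)[OF T] is_algebra_simps(1)[OF A] j]] is_theory_simps(2)[OF T]
  by (auto simp: TAlg_def)

text \<open>The projections of an end are jointly monic and turn the structure of
  \<open>TAlg\<close> into that of \<open>C\<close>, so each axiom is checked at every
  \<open>j\<close>, where it is the same axiom for \<open>C\<close>.\<close>

lemma TAlg_vcategory:
  assumes T: "is_theory V J T"
  shows "vcategory V (TAlg V J C T)"
  unfolding vcategory_def TAlg_simps
proof (intro conjI ballI; (unfold mem_Collect_eq)?)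
  fix A B D E
  assume A: "is_algebra V J C T A" "is_algebra V J C T B" "is_algebra V J C T D" "is_algebra V J C T E"
  let ?K = "TAlg V J C T" let ?e = "end_obj V T C"
  note AE = TAlg_VComp[OF T A(1,2,4)] TAlg_VComp[OF T A(2,3,4)] TAlg_VComp[OF T A(1,3,4)] TAlg_VComp[OF T A(1,2,3)]
  note e = end_obj_Ob[OF T A(1,2)] end_obj_Ob[OF T A(2,3)] end_obj_Ob[OF T A(3,4)]
  note f = is_algebra_simps(1)[OF A(1)] is_algebra_simps(1)[OF A(2)] is_algebra_simps(1)[OF A(3)] is_algebra_simps(1)[OF A(4)]
  show "VComp ?K A B E \<cdot> VComp ?K B D E \<odot> Id V (?e A B) =
    VComp ?K A D E \<cdot> Id V (?e D E) \<odot> VComp ?K A B D \<cdot> Assoc V (?e D E) (?e B D) (?e A B)"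
  proof (rule end_cancel[OF T A(1,4)])
    fix j assume j: "j \<in> J"
    note p = end_proj_simps[OF T A(1,2) j] end_proj_simps[OF T A(2,3) j] end_proj_simps[OF T A(3,4) j]
      end_proj_simps[OF T A(1,3) j] end_proj_simps[OF T A(2,4) j] end_proj_simps[OF T A(1,4) j]
    have jT: "j \<in> VOb T"
      using j is_theory_simps(2)[OF T] by simp
    let ?p = "\<lambda>A B. end_proj V T C A B j"
    have "?p A E \<cdot> (VComp ?K A B E \<cdot> (VComp ?K B D E \<odot> Id V (?e A B)))
      = ecomp C (FOb A j) (FOb B j) (FOb E j) (?p B E) (?p A B) \<cdot> (VComp ?K B D E \<odot> Id V (?e A B))"
      by (rule comp_reduce[OF AE(4)[OF j]]) (use AE e p in auto)
    also have "\<dots> = ecomp C (FOb A j) (FOb B j) (FOb E j) (?p B E \<cdot> VComp ?K B D E) (?p A B)"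
      using p AE(1-3,5-7) f jT by (simp add: ecomp_Comp_left)
    also have "\<dots> = ecomp C (FOb A j) (FOb D j) (FOb E j) (?p D E) (?p A D \<cdot> VComp ?K A B D)
        \<cdot> Assoc V (?e D E) (?e B D) (?e A B)"
      unfolding AE(8)[OF j] AE(16)[OF j] using p f jT by (simp add: ecomp_assoc)
    also have "\<dots> = ecomp C (FOb A j) (FOb D j) (FOb E j) (?p D E) (?p A D)
        \<cdot> ((Id V (?e D E) \<odot> VComp ?K A B D) \<cdot> Assoc V (?e D E) (?e B D) (?e A B))"
      using p AE(13-15) f jT e by (simp add: ecomp_Comp_right)
    also have "\<dots> = ?p A E \<cdot> (VComp ?K A D E \<cdot> ((Id V (?e D E) \<odot> VComp ?K A B D) \<cdot> Assoc V (?e D E) (?e B D) (?e A B)))"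
      by (rule comp_reduce[OF AE(12)[OF j], symmetric]) (use AE e p in auto)
    finally show "?p A E \<cdot> (VComp ?K A B E \<cdot> (VComp ?K B D E \<odot> Id V (?e A B))) = \<dots>" .
  qed (use AE e in auto)
next
  fix A B assume A: "is_algebra V J C T A" "is_algebra V J C T B"
  let ?K = "TAlg V J C T" let ?e = "end_obj V T C"
  note c = TAlg_VComp[OF T A(1,2,2)] TAlg_VComp[OF T A(1,1,2)] and i = TAlg_VId[OF T A(1)] TAlg_VId[OF T A(2)]
  note e = end_obj_Ob[OF T A(1,2)]
  note f = is_algebra_simps(1)[OF A(1)] is_algebra_simps(1)[OF A(2)] 
  show "VComp ?K A B B \<cdot> VId ?K B \<odot> Id V (?e A B) = LUnit V (?e A B)"
  proof (rule end_cancel[OF T A])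
    fix j assume j: "j \<in> J"
    note p = end_proj_simps[OF T A(1,2) j] end_proj_simps[OF T A(2,2) j]
    have jT: "j \<in> VOb T"
      using j is_theory_simps(2)[OF T] by simp
    have "end_proj V T C A B j \<cdot> (VComp ?K A B B \<cdot> (VId ?K B \<odot> Id V (?e A B)))
      = ecomp C (FOb A j) (FOb B j) (FOb B j) (end_proj V T C B B j) (end_proj V T C A B j)
        \<cdot> (VId ?K B \<odot> Id V (?e A B))"
      by (rule comp_reduce[OF c(4)[OF j]]) (use c i e p in auto)
    also have "\<dots> = end_proj V T C A B j \<cdot> LUnit V (?e A B)"
      using p i(5-8) j f jT e by (simp add: ecomp_Comp ecomp_Id_left)
    finally show "end_proj V T C A B j \<cdot> (VComp ?K A B B \<cdot> (VId ?K B \<odot> Id V (?e A B)))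
      = end_proj V T C A B j \<cdot> LUnit V (?e A B)" .
  qed (use c i e in auto)
  show "VComp ?K A A B \<cdot> Id V (?e A B) \<odot> VId ?K A = RUnit V (?e A B)"
  proof (rule end_cancel[OF T A])
    fix j assume j: "j \<in> J"
    note p = end_proj_simps[OF T A(1,2) j] end_proj_simps[OF T A(1,1) j]
    have jT: "j \<in> VOb T"
      using j is_theory_simps(2)[OF T] by simp
    have "end_proj V T C A B j \<cdot> (VComp ?K A A B \<cdot> (Id V (?e A B) \<odot> VId ?K A))
      = ecomp C (FOb A j) (FOb A j) (FOb B j) (end_proj V T C A B j) (end_proj V T C A A j)
        \<cdot> (Id V (?e A B) \<odot> VId ?K A)"
      by (rule comp_reduce[OF c(8)[OF j]]) (use c i e p in auto)
    also have "\<dots> = end_proj V T C A B j \<cdot> RUnit V (?e A B)"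
      using p i(1-4) j f jT e by (simp add: ecomp_Comp ecomp_Id_right)
    finally show "end_proj V T C A B j \<cdot> (VComp ?K A A B \<cdot> (Id V (?e A B) \<odot> VId ?K A))
      = end_proj V T C A B j \<cdot> RUnit V (?e A B)" .
  qed (use c i e in auto)
qed (use TAlg_VId[OF T] TAlg_VComp[OF T] end_obj_Ob[OF T] in \<open>auto simp: in_Hom\<close>)

lemma commutant_theory_simps:
  "VOb (commutant_theory V J C (T, A)) = J"
  "VHom (commutant_theory V J C (T, A)) j k = end_obj V T C (alg_cot V T C j A) (alg_cot V T C k A)"
  "VId (commutant_theory V J C (T, A)) j = VId (TAlg V J C T) (alg_cot V T C j A)"
  "VComp (commutant_theory V J C (T, A)) j k l
    = VComp (TAlg V J C T) (alg_cot V T C j A) (alg_cot V T C k A) (alg_cot V T C l A)"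
  "Gen (commutant_theory V J C (T, A)) j = Counit (TAlg V J C T) j A"
  by (auto simp: commutant_theory_def Let_def TAlg_simps)

text \<open>The commutant theory is the full image of \<open>j \<mapsto> [j,A]\<close> in
  \<open>TAlg\<close>, so its axioms are those of \<open>TAlg\<close> at the objects
  \<open>[j,A]\<close>.\<close>

lemma commutant_theory_vcategory:
  assumes T: "is_theory V J T" "is_algebra V J C T A"
  shows "vcategory V (commutant_theory V J C (T, A))"
  using TAlg_vcategory[OF T(1)] is_algebra_alg_cot[OF T]
  unfolding vcategory_def commutant_theory_simps TAlg_simps by simp

end

section \<open>Conjugation by isomorphisms\<close>

context symmetric_monoidal_closed_category
begin

text \<open>Used with \<open>v\<close> an isomorphism \<open>b \<rightarrow> b'\<close> and
  \<open>u\<close> the inverse of an isomorphism \<open>a \<rightarrow> a'\<close>, so that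
  generalized elements of \<open>C(a,b)\<close> are carried to \<open>C(a',b')\<close>.\<close>

definition conjugate :: "('c, 'o, 'm, 'z) vcat_scheme \<Rightarrow> 'c \<Rightarrow> 'c \<Rightarrow> 'c \<Rightarrow> 'c \<Rightarrow> 'm \<Rightarrow> 'm \<Rightarrow> 'm \<Rightarrow> 'm" where
  "conjugate C a b a' b' v u h = ract C a' a b' (lact C a b b' v h) u"

lemma conjugate_simps [simp]:
  assumes "vcategory V C" "a \<in> VOb C" "b \<in> VOb C" "a' \<in> VOb C" "b' \<in> VOb C"
    "h \<in> Arr V" "Cod V h = VHom C a b" "v \<in> Arr V" "Dom V v = \<I>" "Cod V v = VHom C b b'"
    "u \<in> Arr V" "Dom V u = \<I>" "Cod V u = VHom C a' a"
  shows "conjugate C a b a' b' v u h \<in> Arr V" "Dom V (conjugate C a b a' b' v u h) = Dom V h"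
    "Cod V (conjugate C a b a' b' v u h) = VHom C a' b'"
  using assms by (auto simp: conjugate_def)

lemma conjugate_Comp:
  assumes "vcategory V C" "a \<in> VOb C" "b \<in> VOb C" "a' \<in> VOb C" "b' \<in> VOb C"
    "h \<in> Arr V" "Cod V h = VHom C a b" "v \<in> Arr V" "Dom V v = \<I>" "Cod V v = VHom C b b'"
    "u \<in> Arr V" "Dom V u = \<I>" "Cod V u = VHom C a' a" "w \<in> Arr V" "Cod V w = Dom V h"
  shows "conjugate C a b a' b' v u h \<cdot> w = conjugate C a b a' b' v u (h \<cdot> w)"
  using assms by (simp add: conjugate_def ract_Comp lact_Comp)

text \<open>At the middle object \<open>w'\<close> meets \<open>w\<close> and they cancel.
  Functoriality and naturality of everything obtained by conjugation rest on this.\<close>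

lemma conjugate_ecomp:
  assumes C: "vcategory V C" "a \<in> VOb C" "b \<in> VOb C" "c \<in> VOb C" "a' \<in> VOb C" "b' \<in> VOb C" "c' \<in> VOb C"
    and h: "h \<in> Arr V" "Cod V h = VHom C a b" and g: "g \<in> Arr V" "Cod V g = VHom C b c"
    and w: "vinverse C b b' w w'"
    and v: "v \<in> Arr V" "Dom V v = \<I>" "Cod V v = VHom C c c'"
    and u: "u \<in> Arr V" "Dom V u = \<I>" "Cod V u = VHom C a' a"
  shows "ecomp C a' b' c' (conjugate C b c b' c' v w' g) (conjugate C a b a' b' w u h)
    = conjugate C a c a' c' v u (ecomp C a b c g h)"
proof -
  note w' = vinverse_simps[OF w]
  have *: "ecomp C a' b' c' (ract C b' b c' g1 w') (ract C a' a b' h1 u)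
     = ract C a' a c' (ecomp C a b c' g1 (lact C a b' b w' h1)) u"
    if "g1 \<in> Arr V" "Cod V g1 = VHom C b c'" "h1 \<in> Arr V" "Cod V h1 = VHom C a b'" for g1 h1
    using that C w' u by (simp add: ecomp_ract ecomp_ract_lact)
  have "ecomp C a' b' c' (conjugate C b c b' c' v w' g) (conjugate C a b a' b' w u h)
    = ract C a' a c' (ecomp C a b c' (lact C b c c' v g) (lact C a b' b w' (lact C a b b' w h))) u"
    unfolding conjugate_def by (rule *) (use C h g w' v u in simp_all)
  also have "lact C a b' b w' (lact C a b b' w h) = h"
    using C h by (intro vinverse_lact[OF C(1) w]) auto
  also have "ecomp C a b c' (lact C b c c' v g) h = lact C a c c' v (ecomp C a b c g h)"
    using C h g v by (simp add: ecomp_lact)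
  finally show ?thesis
    by (simp add: conjugate_def)
qed

lemma conjugate_VId:
  assumes "vcategory V C" "a \<in> VOb C" "a' \<in> VOb C" "vinverse C a a' u u'"
  shows "conjugate C a a a' a' u u' (VId C a) = VId C a'"
proof -
  note u = vinverse_simps[OF assms(4)]
  have "lact C a a a' u (VId C a) = u"
    using assms u by (subst lact_eq_ract) auto
  moreover have "ract C a' a a' u u' = lact C a' a a' u u'"
    using u by (intro lact_eq_ract[symmetric]) auto
  ultimately show ?thesis
    using assms(4) by (simp add: conjugate_def vinverse_def)
qed

lemma conjugate_inverse:
  assumes "vcategory V C" "a \<in> VOb C" "b \<in> VOb C" "a' \<in> VOb C" "b' \<in> VOb C"
    "h \<in> Arr V" "Cod V h = VHom C a b" "vinverse C a a' u u'" "vinverse C b b' v v'"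
  shows "conjugate C a' b' a b v' u (conjugate C a b a' b' v u' h) = h"
  using assms vinverse_simps[OF assms(8)] vinverse_simps[OF assms(9)]
    vinverse_ract[OF assms(1,8,2,4)] vinverse_lact[OF assms(1,9,3,5)]
  by (simp add: conjugate_def lact_ract)

lemma vinverse_unique:
  assumes C: "vcategory V C" "a \<in> VOb C" "b \<in> VOb C" and "vinverse C a b u v" "vinverse C a b u v'"
  shows "v = v'"
proof -
  note v = vinverse_simps[OF assms(4)] vinverse_simps[OF assms(5)]
  have "v = lact C b a a (lact C a b a v' u) v"
    using assms(5) C v by (simp add: vinverse_def)
  also have "\<dots> = lact C b b a v' (lact C b a b u v)"
    using C v by (simp add: lact_lact)
  also have "\<dots> = v'"
    using assms(4) C v by (simp add: vinverse_def lact_eq_ract)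
  finally show ?thesis .
qed

lemma vinverse_lact_lact:
  assumes C: "vcategory V C" "a \<in> VOb C" "b \<in> VOb C" "c \<in> VOb C"
    and u: "vinverse C a b u u'" and v: "vinverse C b c v v'"
  shows "vinverse C a c (lact C a b c v u) (lact C c b a u' v')"
proof -
  note uv = vinverse_simps[OF u] vinverse_simps[OF v]
  have 1: "lact C a c a (lact C c b a u' v') (lact C a b c v u) = VId C a" if "vinverse C a b u u'" "vinverse C b c v v'"
    "a \<in> VOb C" "b \<in> VOb C" "c \<in> VOb C" for a b c u u' v v'
  proof -
    note uv = vinverse_simps[OF that(1)] vinverse_simps[OF that(2)]
    have "lact C a c a (lact C c b a u' v') (lact C a b c v u) = lact C a b a u' (lact C a c b v' (lact C a b c v u))"
      using C(1) that(3-) uv by (simp add: lact_lact[of C a c b a])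
    also have "lact C a c b v' (lact C a b c v u) = u"
      using that(3-) uv by (intro vinverse_lact[OF C(1) that(2)]) auto
    finally show ?thesis
      using that(1) by (simp add: vinverse_def)
  qed
  show ?thesis
    unfolding vinverse_def
    using 1[OF u v C(2-)] 1[OF vinverse_sym[OF v] vinverse_sym[OF u]] C uv by (simp add: in_Hom)
qed

lemma vinverse_VId: "\<lbrakk>vcategory V C; a \<in> VOb C\<rbrakk> \<Longrightarrow> vinverse C a a (VId C a) (VId C a)"
  by (simp add: vinverse_def in_Hom)

text \<open>A factorization through the conjugated counit is one through \<open>\<kappa>\<close>
  with the isomorphisms undone on either side. It carries preservation of cotensors from a functor
  to its conjugates.\<close>

lemma is_cotensor_conjugate:
  assumes C: "vcategory V C" and k: "is_cotensor V C j x p \<kappa>" and x': "x' \<in> VOb C" "p' \<in> VOb C"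
    and u: "vinverse C x x' u u'" and v: "vinverse C p p' v v'"
  shows "is_cotensor V C j x' p' (conjugate C p x p' x' u v' \<kappa>)"
proof -
  note c = is_cotensor_simps(1-3,5-7)[OF k] and uv = vinverse_simps[OF u] vinverse_simps[OF v]
  have key: "ecomp C z p' x' (conjugate C p x p' x' u v' \<kappa>) h
    = lact C z x x' u (ecomp C z p x \<kappa> (lact C z p' p v' h))"
    if "z \<in> VOb C" "h \<in> Arr V" "Cod V h = VHom C z p'" for z h
    unfolding conjugate_def using that C c uv x' by (simp add: ecomp_ract_lact ecomp_lact)
  show ?thesis
  proof (rule is_cotensorI[OF C])
    fix z g h
    assume z: "z \<in> VOb C" and g: "g \<in> Arr V" "Cod V g = VHom C z p'" and h: "h \<in> Arr V" "Cod V h = VHom C z p'"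
      and gh: "Dom V g = Dom V h"
      and eq: "ecomp C z p' x' (conjugate C p x p' x' u v' \<kappa>) g = ecomp C z p' x' (conjugate C p x p' x' u v' \<kappa>) h"
    have "lact C z x' x u' (lact C z x x' u (ecomp C z p x \<kappa> (lact C z p' p v' g)))
      = lact C z x' x u' (lact C z x x' u (ecomp C z p x \<kappa> (lact C z p' p v' h)))"
      using eq key[OF z g] key[OF z h] by simp
    then have "ecomp C z p x \<kappa> (lact C z p' p v' g) = ecomp C z p x \<kappa> (lact C z p' p v' h)"
      using C c uv x' z g h vinverse_lact[OF C u] by simp
    then have "lact C z p' p v' g = lact C z p' p v' h"
      by (rule cotensor_cancel[OF C k z, rotated -1]) (use C c uv x' z g h gh in auto)
    then have "lact C z p p' v (lact C z p' p v' g) = lact C z p p' v (lact C z p' p v' h)"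
      by simp
    then show "g = h"
      using C c uv x' z g h vinverse_lact[OF C vinverse_sym[OF v]] by simp
  next
    fix z y m
    assume z: "z \<in> VOb C" and y: "y \<in> Ob V" and m: "m \<in> Hom V (j \<otimes> y) (VHom C z x')"
    have m': "m \<in> Arr V" "Dom V m = j \<otimes> y" "Cod V m = VHom C z x'"
      using m by (auto simp: in_Hom)
    have "lact C z x' x u' m \<in> Hom V (j \<otimes> y) (VHom C z x)"
      using C c uv x' z m' by (simp add: in_Hom)
    then obtain h where h: "h \<in> Hom V y (VHom C z p)" "ecomp C z p x \<kappa> h = lact C z x' x u' m"
      by (rule cotensor_factor[OF C k z y])
    have h': "h \<in> Arr V" "Dom V h = y" "Cod V h = VHom C z p"
      using h by (auto simp: in_Hom)
    have "ecomp C z p' x' (conjugate C p x p' x' u v' \<kappa>) (lact C z p p' v h) = m"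
      using C c uv x' z h' h(2) m' vinverse_lact[OF C v] vinverse_lact[OF C vinverse_sym[OF u]] by (simp add: key)
    moreover have "lact C z p p' v h \<in> Hom V y (VHom C z p')"
      using C c uv x' z h' by (simp add: in_Hom)
    ultimately show "\<exists>h \<in> Hom V y (VHom C z p'). ecomp C z p' x' (conjugate C p x p' x' u v' \<kappa>) h = m"
      by blast
  qed (use C c uv x' in \<open>auto simp: in_Hom\<close>)
qed

text \<open>Generators are not mentioned, so that the relation makes sense between a theory and an
  enriched category not yet known to be one; the theory structure is then carried across.\<close>

definition io_iso :: "('c, 'o, 'm, 'y) vcat_scheme \<Rightarrow> ('c, 'o, 'm, 'z) vcat_scheme \<Rightarrow>
  ('c, 'c, 'm) vfun \<Rightarrow> ('c, 'c, 'm) vfun \<Rightarrow> bool" where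
  "io_iso S T M N \<longleftrightarrow> VOb S = VOb T \<and> vfunctor V S T M \<and> vfunctor V T S N \<and>
    (\<forall>j \<in> VOb S. FOb M j = j \<and> FOb N j = j) \<and>
    (\<forall>j \<in> VOb S. \<forall>k \<in> VOb S. FHom N j k \<cdot> FHom M j k = Id V (VHom S j k) \<and>
       FHom M j k \<cdot> FHom N j k = Id V (VHom T j k))"

lemma io_isoD:
  assumes "io_iso S T M N"
  shows "VOb T = VOb S" "vfunctor V S T M" "vfunctor V T S N"
    "j \<in> VOb S \<Longrightarrow> FOb M j = j" "j \<in> VOb S \<Longrightarrow> FOb N j = j"
    "\<lbrakk>j \<in> VOb S; k \<in> VOb S\<rbrakk> \<Longrightarrow> FHom M j k \<in> Arr V \<and> Dom V (FHom M j k) = VHom S j k \<and> Cod V (FHom M j k) = VHom T j k"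
    "\<lbrakk>j \<in> VOb S; k \<in> VOb S\<rbrakk> \<Longrightarrow> FHom N j k \<in> Arr V \<and> Dom V (FHom N j k) = VHom T j k \<and> Cod V (FHom N j k) = VHom S j k"
    "\<lbrakk>j \<in> VOb S; k \<in> VOb S\<rbrakk> \<Longrightarrow> FHom N j k \<cdot> FHom M j k = Id V (VHom S j k)"
    "\<lbrakk>j \<in> VOb S; k \<in> VOb S\<rbrakk> \<Longrightarrow> FHom M j k \<cdot> FHom N j k = Id V (VHom T j k)"
proof -
  show *: "VOb T = VOb S" "vfunctor V S T M" "vfunctor V T S N"
    "j \<in> VOb S \<Longrightarrow> FOb M j = j" "j \<in> VOb S \<Longrightarrow> FOb N j = j"
    "\<lbrakk>j \<in> VOb S; k \<in> VOb S\<rbrakk> \<Longrightarrow> FHom N j k \<cdot> FHom M j k = Id V (VHom S j k)"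
    "\<lbrakk>j \<in> VOb S; k \<in> VOb S\<rbrakk> \<Longrightarrow> FHom M j k \<cdot> FHom N j k = Id V (VHom T j k)" for j k
    using assms by (auto simp only: io_iso_def)
  show "\<lbrakk>j \<in> VOb S; k \<in> VOb S\<rbrakk> \<Longrightarrow> FHom M j k \<in> Arr V \<and> Dom V (FHom M j k) = VHom S j k \<and> Cod V (FHom M j k) = VHom T j k"
    "\<lbrakk>j \<in> VOb S; k \<in> VOb S\<rbrakk> \<Longrightarrow> FHom N j k \<in> Arr V \<and> Dom V (FHom N j k) = VHom T j k \<and> Cod V (FHom N j k) = VHom S j k"
    using vfunctor_simps(3-5)[OF *(2), of j k] vfunctor_simps(3-5)[OF *(3), of j k] *(1,4,5) by auto
qed

lemma io_iso_sym: "io_iso S T M N \<Longrightarrow> io_iso T S N M"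
  unfolding io_iso_def by simp

text \<open>\<open>M\<close> is invertible on hom-objects and compatible with composition, so
  factorizations in \<open>T\<close> correspond to factorizations in \<open>S\<close>.\<close>

lemma io_iso_cotensor:
  assumes S: "vcategory V S" "vcategory V T" and M: "io_iso S T M N" and k: "is_cotensor V S j x p \<kappa>"
  shows "is_cotensor V T j x p (FHom M p x \<cdot> \<kappa>)"
proof -
  note m = io_isoD[OF M] and c = is_cotensor_simps(1-3,5-7)[OF k]
  have keyN: "FHom N z x \<cdot> ecomp T z p x (FHom M p x \<cdot> \<kappa>) h = ecomp S z p x \<kappa> (FHom N z p \<cdot> h)"
    if "z \<in> VOb S" "h \<in> Arr V" "Cod V h = VHom T z p" for z h
    using vfunctor_ecomp[OF S(2,1) m(3), of z p x h "FHom M p x \<cdot> \<kappa>"] that m(1,4-) c comp_reduce[OF m(8), of p x \<kappa>]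
    by simp
  have keyM: "FHom M z x \<cdot> ecomp S z p x \<kappa> h = ecomp T z p x (FHom M p x \<cdot> \<kappa>) (FHom M z p \<cdot> h)"
    if "z \<in> VOb S" "h \<in> Arr V" "Cod V h = VHom S z p" for z h
    using vfunctor_ecomp[OF S m(2), of z p x h \<kappa>] that m(1,4-) c by simp
  show ?thesis
  proof (rule is_cotensorI[OF S(2)])
    fix z g h
    assume z: "z \<in> VOb T" and g: "g \<in> Arr V" "Cod V g = VHom T z p" and h: "h \<in> Arr V" "Cod V h = VHom T z p"
      and gh: "Dom V g = Dom V h"
      and eq: "ecomp T z p x (FHom M p x \<cdot> \<kappa>) g = ecomp T z p x (FHom M p x \<cdot> \<kappa>) h"
    have z': "z \<in> VOb S"
      using z m(1) by simp
    have "ecomp S z p x \<kappa> (FHom N z p \<cdot> g) = ecomp S z p x \<kappa> (FHom N z p \<cdot> h)"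
      using eq keyN[OF z' g] keyN[OF z' h] by simp
    then have "FHom N z p \<cdot> g = FHom N z p \<cdot> h"
      by (rule cotensor_cancel[OF S(1) k z', rotated -1]) (use m(7)[OF z' c(3)] g h gh in auto)
    then have "FHom M z p \<cdot> (FHom N z p \<cdot> g) = FHom M z p \<cdot> (FHom N z p \<cdot> h)"
      by simp
    then show "g = h"
      using comp_reduce[OF m(9)[OF z' c(3)], of g] comp_reduce[OF m(9)[OF z' c(3)], of h]
        m(6)[OF z' c(3)] m(7)[OF z' c(3)] g h by simp
  next
    fix z y n
    assume z: "z \<in> VOb T" and y: "y \<in> Ob V" and n: "n \<in> Hom V (j \<otimes> y) (VHom T z x)"
    have z': "z \<in> VOb S"
      using z m(1) by simp
    have n': "n \<in> Arr V" "Dom V n = j \<otimes> y" "Cod V n = VHom T z x"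
      using n by (auto simp: in_Hom)
    have "FHom N z x \<cdot> n \<in> Hom V (j \<otimes> y) (VHom S z x)"
      using m(7)[OF z' c(2)] n' by (simp add: in_Hom)
    then obtain h where h: "h \<in> Hom V y (VHom S z p)" "ecomp S z p x \<kappa> h = FHom N z x \<cdot> n"
      by (rule cotensor_factor[OF S(1) k z' y])
    have h': "h \<in> Arr V" "Dom V h = y" "Cod V h = VHom S z p"
      using h by (auto simp: in_Hom)
    have "ecomp T z p x (FHom M p x \<cdot> \<kappa>) (FHom M z p \<cdot> h) = n"
      using keyM[OF z' h'(1,3)] h(2) comp_reduce[OF m(9)[OF z' c(2)], of n] m(6)[OF z' c(2)] m(7)[OF z' c(2)] n' by simp
    moreover have "FHom M z p \<cdot> h \<in> Hom V y (VHom T z p)"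
      using m(6)[OF z' c(3)] h' by (simp add: in_Hom)
    ultimately show "\<exists>h \<in> Hom V y (VHom T z p). ecomp T z p x (FHom M p x \<cdot> \<kappa>) h = n"
      by blast
  qed (use m(1) m(6)[OF c(3) c(2)] c in \<open>auto simp: in_Hom\<close>)
qed

section \<open>Identities, vertical composites and whiskering of transformations\<close>

lemma vnat_iso_VId_graph:
  assumes A: "\<forall>a \<in> VOb A. \<forall>b \<in> VOb A. VHom A a b \<in> Ob V"
    and B: "vcategory V B" "vfunctor V A B F"
  shows "vnat_iso V A B F F (\<lambda>a \<in> VOb A. VId B (FOb F a))"
proof -
  have "vnat V A B F F (\<lambda>a \<in> VOb A. VId B (FOb F a))"
    unfolding vnat_iff_graph[OF A B B(2)] using B by (simp add: in_Hom)
  moreover have "vinverse B (FOb F a) (FOb F a) (VId B (FOb F a)) (VId B (FOb F a))" if "a \<in> VOb A" for a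
    by (rule vinverse_VId[OF B(1) vfunctor_simps(1)[OF B(2) that]])
  ultimately show ?thesis
    unfolding vnat_iso_iff_graph[OF A B B(2)] by (intro exI[of _ "\<lambda>a \<in> VOb A. VId B (FOb F a)"]) simp
qed

lemma vnat_lact:
  assumes A: "vcategory V A" "vcategory V B" "vfunctor V A B F" "vfunctor V A B G" "vfunctor V A B H"
    and \<alpha>: "vnat V A B F G \<alpha>" and \<beta>: "vnat V A B G H \<beta>"
  shows "vnat V A B F H (\<lambda>a \<in> VOb A. lact B (FOb F a) (FOb G a) (FOb H a) (\<beta> a) (\<alpha> a))"
  unfolding vnat_iff[OF A(1-3,5)]
proof (intro conjI ballI)
  fix a b assume ab: "a \<in> VOb A" "b \<in> VOb A"
  note s = vnat_simps[OF \<alpha> ab(1)] vnat_simps[OF \<alpha> ab(2)] vnat_simps[OF \<beta> ab(1)] vnat_simps[OF \<beta> ab(2)]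
  have "lact B (FOb F a) (FOb F b) (FOb H b) (lact B (FOb F b) (FOb G b) (FOb H b) (\<beta> b) (\<alpha> b)) (FHom F a b)
    = lact B (FOb F a) (FOb G b) (FOb H b) (\<beta> b) (lact B (FOb F a) (FOb F b) (FOb G b) (\<alpha> b) (FHom F a b))"
    using A ab s by (simp add: lact_lact)
  also have "\<dots> = ract B (FOb F a) (FOb G a) (FOb H b) (lact B (FOb G a) (FOb G b) (FOb H b) (\<beta> b) (FHom G a b)) (\<alpha> a)"
    using A ab s by (simp add: vnat_eq[OF A(1-4) \<alpha> ab] lact_ract)
  also have "\<dots> = ract B (FOb F a) (FOb H a) (FOb H b) (FHom H a b) (lact B (FOb F a) (FOb G a) (FOb H a) (\<beta> a) (\<alpha> a))"
    using A ab s by (simp add: vnat_eq[OF A(1,2,4,5) \<beta> ab] ract_ract)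
  finally show "lact B (FOb F a) (FOb F b) (FOb H b) ((\<lambda>a \<in> VOb A. lact B (FOb F a) (FOb G a) (FOb H a) (\<beta> a) (\<alpha> a)) b) (FHom F a b)
    = ract B (FOb F a) (FOb H a) (FOb H b) (FHom H a b) ((\<lambda>a \<in> VOb A. lact B (FOb F a) (FOb G a) (FOb H a) (\<beta> a) (\<alpha> a)) a)"
    using ab by simp
next
  fix a assume a: "a \<in> VOb A"
  show "(\<lambda>a \<in> VOb A. lact B (FOb F a) (FOb G a) (FOb H a) (\<beta> a) (\<alpha> a)) a \<in> Hom V \<I> (VHom B (FOb F a) (FOb H a))"
    using A a vnat_simps[OF \<alpha> a] vnat_simps[OF \<beta> a] by (simp add: in_Hom)
qed auto

lemma vnat_vcomp:
  assumes A: "vcategory V A" "vcategory V B" "vcategory V C" "vfunctor V A B F" "vfunctor V B C G" "vfunctor V B C H"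
    and \<beta>: "vnat V B C G H \<beta>"
  shows "vnat V A C (vcomp V A G F) (vcomp V A H F) (\<lambda>a \<in> VOb A. \<beta> (FOb F a))"
  unfolding vnat_iff[OF A(1,3) vfunctor_vcomp[OF A(1-5)] vfunctor_vcomp[OF A(1-4,6)]]
proof (intro conjI ballI)
  fix a b assume ab: "a \<in> VOb A" "b \<in> VOb A"
  have Fab: "FOb F a \<in> VOb B" "FOb F b \<in> VOb B"
    using A ab by auto
  note s = vnat_simps[OF \<beta> Fab(1)] vnat_simps[OF \<beta> Fab(2)]
  have "lact C (FOb G (FOb F a)) (FOb G (FOb F b)) (FOb H (FOb F b)) (\<beta> (FOb F b)) (FHom G (FOb F a) (FOb F b) \<cdot> FHom F a b)
    = lact C (FOb G (FOb F a)) (FOb G (FOb F b)) (FOb H (FOb F b)) (\<beta> (FOb F b)) (FHom G (FOb F a) (FOb F b)) \<cdot> FHom F a b"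
    using A ab s by (simp add: lact_Comp)
  also have "\<dots> = ract C (FOb G (FOb F a)) (FOb H (FOb F a)) (FOb H (FOb F b)) (FHom H (FOb F a) (FOb F b) \<cdot> FHom F a b) (\<beta> (FOb F a))"
    using A ab s by (simp add: vnat_eq[OF A(2,3,5,6) \<beta> Fab] ract_Comp)
  finally show "lact C (FOb (vcomp V A G F) a) (FOb (vcomp V A G F) b) (FOb (vcomp V A H F) b)
      ((\<lambda>a \<in> VOb A. \<beta> (FOb F a)) b) (FHom (vcomp V A G F) a b)
    = ract C (FOb (vcomp V A G F) a) (FOb (vcomp V A H F) a) (FOb (vcomp V A H F) b)
      (FHom (vcomp V A H F) a b) ((\<lambda>a \<in> VOb A. \<beta> (FOb F a)) a)"
    using ab by simp
next
  fix a assume a: "a \<in> VOb A"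
  then have "FOb F a \<in> VOb B"
    using A by auto
  then show "(\<lambda>a \<in> VOb A. \<beta> (FOb F a)) a \<in> Hom V \<I> (VHom C (FOb (vcomp V A G F) a) (FOb (vcomp V A H F) a))"
    using a vnat_simps[OF \<beta>] by (simp add: in_Hom)
qed auto

end

section \<open>The category of algebras\<close>

context admissible_vcategory
begin

definition algebra_morphism ::
  "('o, 'm) jtheory \<Rightarrow> ('o, 'c, 'm) vfun \<Rightarrow> ('o, 'o, 'm) vfun \<Rightarrow> ('o \<Rightarrow> 'm) \<Rightarrow>
   ('o, 'm) jtheory \<Rightarrow> ('o, 'c, 'm) vfun \<Rightarrow> bool" where
  "algebra_morphism T A M f U B \<longleftrightarrow>
     is_theory V J T \<and> is_algebra V J C T A \<and> is_theory V J U \<and> is_algebra V J C U B \<and>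
     theory_morphism V J T U M \<and> vnat_iso V T C A (vcomp V T B M) f"

text \<open>
  Unlike in \<open>Alg\<close>, arrows need not restrict to identities on carriers: an isomorphism of bifold algebras
  only induces isomorphisms of faces over a common isomorphism of carriers.
\<close>

definition algebras :: "(('c, 'o, 'm) algebra, ('c, 'o, 'm) alg_arrow) category" where
  "algebras = (Alg V J C undefined)
     \<lparr>Ob := {A. algebra V J C A},
      Arr := {((T, A), (M, f), (U, B)) | T A M f U B. algebra_morphism T A M f U B}\<rparr>"

definition carrier_part :: "('c, 'o, 'm) alg_arrow \<Rightarrow> 'm" where
  "carrier_part = (\<lambda>(_, (_, f), _). f \<I>)"

lemma algebra_iff: "algebra V J C (T, A) \<longleftrightarrow> is_theory V J T \<and> is_algebra V J C T A"
  by (simp add: algebra_def)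

lemma algebras_simps:
  "X \<in> Ob algebras \<longleftrightarrow> algebra V J C X"
  "((T, A), (M, f), (U, B)) \<in> Arr algebras \<longleftrightarrow> algebra_morphism T A M f U B"
  "Dom algebras (X, h, Y) = X"
  "Cod algebras (X, h, Y) = Y"
  "Id algebras (T, A) = ((T, A), (vid V T, (\<lambda>j \<in> J. VId C (FOb A j))), (T, A))"
  "Comp algebras ((U, B), (M', f'), (W, E)) ((T, A), (M, f), Y) =
    ((T, A), (vcomp V T M' M, (\<lambda>j \<in> J. ucomp V C (FOb A j) (FOb B (FOb M j)) (FOb E (FOb M' (FOb M j)))
                     (f' (FOb M j)) (f j))), (W, E))"
  by (auto simp: algebras_def Alg_def)

lemma algebra_morphism_simps:
  assumes "algebra_morphism T A M f U B"
  shows "is_theory V J T" "is_algebra V J C T A" "is_theory V J U" "is_algebra V J C U B"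
    "theory_morphism V J T U M" "vnat_iso V T C A (vcomp V T B M) f"
    "vcategory V T" "VOb T = J" "vcategory V U" "VOb U = J" "vfunctor V T C A" "vfunctor V U C B"
    "vfunctor V T U M" "vfunctor V T C (vcomp V T B M)" "j \<in> J \<Longrightarrow> FOb M j = j"
proof -
  show *: "is_theory V J T" "is_algebra V J C T A" "is_theory V J U" "is_algebra V J C U B"
    "theory_morphism V J T U M" "vnat_iso V T C A (vcomp V T B M) f"
    using assms by (auto simp only: algebra_morphism_def)
  show **: "vcategory V T" "VOb T = J" "vcategory V U" "VOb U = J" "vfunctor V T C A" "vfunctor V U C B"
    "vfunctor V T U M" "j \<in> J \<Longrightarrow> FOb M j = j"
    using *(1-5) is_theory_simps(1,2) is_algebra_simps(1) theory_morphismD(1,2) by blast+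
  show "vfunctor V T C (vcomp V T B M)"
    using ** by (meson vfunctor_vcomp C)
qed

lemma algebra_morphism_component:
  assumes "algebra_morphism T A M f U B"
  obtains g where "g \<in> extensional J" "vnat V T C A (vcomp V T B M) f" "vnat V T C (vcomp V T B M) A g"
    "\<And>j. j \<in> J \<Longrightarrow> vinverse C (FOb A j) (FOb B j) (f j) (g j)"
proof -
  note s = algebra_morphism_simps[OF assms]
  obtain g where g: "vnat V T C A (vcomp V T B M) f" "vnat V T C (vcomp V T B M) A g"
    "\<forall>j \<in> VOb T. vinverse C (FOb A j) (FOb (vcomp V T B M) j) (f j) (g j)"
    using s(6) unfolding vnat_iso_iff[OF s(7) C s(11,14)] by blast
  have "vinverse C (FOb A j) (FOb B j) (f j) (g j)" if "j \<in> J" for j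
    using g(3) s(8,15) that by simp
  then show ?thesis
    using that[of g] g vnat_ext[OF g(2)] s(8) by simp
qed

lemma algebra_morphism_f_simps:
  assumes "algebra_morphism T A M f U B" "j \<in> J"
  shows "f j \<in> Arr V" "Dom V (f j) = \<I>" "Cod V (f j) = VHom C (FOb A j) (FOb B j)"
    "FOb A j \<in> VOb C" "FOb B j \<in> VOb C"
proof -
  obtain g where "vinverse C (FOb A j) (FOb B j) (f j) (g j)"
    using algebra_morphism_component[OF assms(1)] assms(2) by blast
  from vinverse_simps(1-3)[OF this]
  show "f j \<in> Arr V" "Dom V (f j) = \<I>" "Cod V (f j) = VHom C (FOb A j) (FOb B j)"
    by auto
  show "FOb A j \<in> VOb C" "FOb B j \<in> VOb C"
    using vfunctor_simps(1)[OF algebra_morphism_simps(11)[OF assms(1)], of j]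
      vfunctor_simps(1)[OF algebra_morphism_simps(12)[OF assms(1)], of j]
      algebra_morphism_simps(8,10)[OF assms(1)] assms(2) by auto
qed

lemma theory_morphism_vcomp:
  assumes "is_theory V J T" "is_theory V J U" "is_theory V J W"
    "theory_morphism V J T U M" "theory_morphism V J U W N"
  shows "theory_morphism V J T W (vcomp V T N M)"
proof (rule theory_morphismI[OF assms(1,3)])
  note t = is_theory_simps[OF assms(1)] is_theory_simps[OF assms(2)] is_theory_simps[OF assms(3)]
  note m = theory_morphismD[OF assms(4)] theory_morphismD[OF assms(5)]
  show "vfunctor V T W (vcomp V T N M)"
    using t m by (meson vfunctor_vcomp)
  fix j assume j: "j \<in> J"
  show "FOb (vcomp V T N M) j = j"
    using t(2) m j by simp
  have "FHom N j \<I> \<cdot> (FHom M j \<I> \<cdot> Gen T j) = Gen W j"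
    using theory_morphism_Gen[OF assms(1,2,4) j] theory_morphism_Gen[OF assms(2,3,5) j] by simp
  then show "FHom (vcomp V T N M) j \<I> \<cdot> Gen T j = Gen W j"
    using t(2,5-7) m(2,5) j theory_morphism_simps[OF assms(1,4) j] theory_morphism_simps[OF assms(2,5) j]
    by simp
qed

lemma theory_morphism_vid:
  assumes "is_theory V J T"
  shows "theory_morphism V J T T (vid V T)"
  by (rule theory_morphismI[OF assms assms vfunctor_vid])
    (use is_theory_simps[OF assms] in auto)

lemma vnat_iso_VId:
  assumes "vcategory V A" "vcategory V B" "vfunctor V A B F"
  shows "vnat_iso V A B F F (\<lambda>a \<in> VOb A. VId B (FOb F a))"
  by (rule vnat_iso_VId_graph) (use assms in auto)

lemma algebra_morphism_Id:
  assumes "is_theory V J T" "is_algebra V J C T A"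
  shows "algebra_morphism T A (vid V T) (\<lambda>j \<in> J. VId C (FOb A j)) T A"
  unfolding algebra_morphism_def
  using assms theory_morphism_vid[OF assms(1)] is_theory_simps[OF assms(1)] is_algebra_simps[OF assms(2)]
    vnat_iso_VId[of T C A] by (simp add: vcomp_vid(1)[of T C A])

lemma algebra_morphism_Comp_eq:
  assumes f: "algebra_morphism T A M f U B" and f': "algebra_morphism U B M' f' W E"
  shows "(\<lambda>j \<in> J. ucomp V C (FOb A j) (FOb B (FOb M j)) (FOb E (FOb M' (FOb M j))) (f' (FOb M j)) (f j))
    = (\<lambda>j \<in> J. lact C (FOb A j) (FOb B j) (FOb E j) (f' j) (f j))"
proof (rule restrict_ext)
  fix j assume j: "j \<in> J"
  then show "ucomp V C (FOb A j) (FOb B (FOb M j)) (FOb E (FOb M' (FOb M j))) (f' (FOb M j)) (f j)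
    = lact C (FOb A j) (FOb B j) (FOb E j) (f' j) (f j)"
    using algebra_morphism_simps(15)[OF f j] algebra_morphism_simps(15)[OF f' j]
      algebra_morphism_f_simps[OF f j] algebra_morphism_f_simps[OF f' j] by (simp add: ucomp_eq_lact)
qed

text \<open>The natural part is the vertical composite of \<open>f\<close> with \<open>f'\<close>
  whiskered by \<open>M\<close>; its inverse composes the inverses in the opposite order.\<close>

lemma algebra_morphism_Comp:
  assumes f: "algebra_morphism T A M f U B" and f': "algebra_morphism U B M' f' W E"
  shows "algebra_morphism T A (vcomp V T M' M)
     (\<lambda>j \<in> J. lact C (FOb A j) (FOb B j) (FOb E j) (f' j) (f j)) W E"
proof -
  note s = algebra_morphism_simps[OF f] and s' = algebra_morphism_simps[OF f']
  obtain g where g: "vnat V T C A (vcomp V T B M) f" "vnat V T C (vcomp V T B M) A g"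
    "\<And>j. j \<in> J \<Longrightarrow> vinverse C (FOb A j) (FOb B j) (f j) (g j)"
    using algebra_morphism_component[OF f] by blast
  obtain g' where g': "vnat V U C B (vcomp V U E M') f'" "vnat V U C (vcomp V U E M') B g'"
    "\<And>j. j \<in> J \<Longrightarrow> vinverse C (FOb B j) (FOb E j) (f' j) (g' j)"
    using algebra_morphism_component[OF f'] by blast
  have EMM: "vcomp V T (vcomp V U E M') M = vcomp V T E (vcomp V T M' M)"
    by (rule vcomp_assoc[OF s(7) s'(7) s'(9) C s(13) s'(13) s'(12)])
  have EM: "vfunctor V T C (vcomp V T E (vcomp V T M' M))"
    by (rule vfunctor_vcomp[OF s(7) s'(9) C _ s'(12)]) (rule vfunctor_vcomp[OF s(7,9) s'(9) s(13) s'(13)])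
  have Ob: "FOb (vcomp V T B M) j = FOb B j" "FOb (vcomp V T E (vcomp V T M' M)) j = FOb E j" if "j \<in> J" for j
    using that s(8,15) s'(15) by simp_all
  \<comment> \<open>\<open>M\<close> is the identity on objects, so whiskering by it does not change
    components.\<close>
  have restr: "(\<lambda>j \<in> VOb T. h (FOb M j)) = (\<lambda>j \<in> J. h j)" for h :: "'o \<Rightarrow> 'm"
    unfolding s(8) by (rule restrict_ext) (simp add: s(15))
  have n: "vnat V T C (vcomp V T B M) (vcomp V T E (vcomp V T M' M)) (\<lambda>j \<in> J. f' j)"
    "vnat V T C (vcomp V T E (vcomp V T M' M)) (vcomp V T B M) (\<lambda>j \<in> J. g' j)"
    using vnat_vcomp[OF s(7) s'(7) C s(13) s(12) s'(14) g'(1)] vnat_vcomp[OF s(7) s'(7) C s(13) s'(14) s(12) g'(2)]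
    unfolding EMM restr by simp_all
  have eq: "(\<lambda>j \<in> VOb T. lact C (FOb A j) (FOb (vcomp V T B M) j) (FOb (vcomp V T E (vcomp V T M' M)) j) ((\<lambda>j \<in> J. f' j) j) (f j))
     = (\<lambda>j \<in> J. lact C (FOb A j) (FOb B j) (FOb E j) (f' j) (f j))"
    "(\<lambda>j \<in> VOb T. lact C (FOb (vcomp V T E (vcomp V T M' M)) j) (FOb (vcomp V T B M) j) (FOb A j) (g j) ((\<lambda>j \<in> J. g' j) j))
     = (\<lambda>j \<in> J. lact C (FOb E j) (FOb B j) (FOb A j) (g j) (g' j))"
    unfolding s(8) by (rule restrict_ext, simp add: Ob)+
  have "vnat_iso V T C A (vcomp V T E (vcomp V T M' M)) (\<lambda>j \<in> J. lact C (FOb A j) (FOb B j) (FOb E j) (f' j) (f j))"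
    unfolding vnat_iso_iff[OF s(7) C s(11) EM]
  proof (intro exI conjI ballI)
    show "vnat V T C A (vcomp V T E (vcomp V T M' M)) (\<lambda>j \<in> J. lact C (FOb A j) (FOb B j) (FOb E j) (f' j) (f j))"
      using vnat_lact[OF s(7) C s(11,14) EM g(1) n(1)] unfolding eq .
    show "vnat V T C (vcomp V T E (vcomp V T M' M)) A (\<lambda>j \<in> J. lact C (FOb E j) (FOb B j) (FOb A j) (g j) (g' j))"
      using vnat_lact[OF s(7) C EM s(14,11) n(2) g(2)] unfolding eq .
    fix j assume "j \<in> VOb T"
    then have j: "j \<in> J"
      using s(8) by simp
    show "vinverse C (FOb A j) (FOb (vcomp V T E (vcomp V T M' M)) j)
      ((\<lambda>j \<in> J. lact C (FOb A j) (FOb B j) (FOb E j) (f' j) (f j)) j)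
      ((\<lambda>j \<in> J. lact C (FOb E j) (FOb B j) (FOb A j) (g j) (g' j)) j)"
      using vinverse_lact_lact[OF C _ _ _ g(3)[OF j] g'(3)[OF j]]
        algebra_morphism_f_simps(4,5)[OF f j] algebra_morphism_f_simps(5)[OF f' j] j Ob[OF j] by simp
  qed
  then show ?thesis
    unfolding algebra_morphism_def
    using s(1-3,5) s'(3-5) theory_morphism_vcomp[OF s(1,3) s'(3) s(5) s'(5)] by blast
qed

lemma algebras_Comp:
  assumes f: "algebra_morphism T A M f U B" and f': "algebra_morphism U B M' f' W E"
  shows "Comp algebras ((U, B), (M', f'), (W, E)) ((T, A), (M, f), (U, B)) =
    ((T, A), (vcomp V T M' M, (\<lambda>j \<in> J. lact C (FOb A j) (FOb B j) (FOb E j) (f' j) (f j))), (W, E))"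
  by (simp add: algebras_simps algebra_morphism_Comp_eq[OF assms])

lemma algebras_HomE:
  assumes "h \<in> Hom algebras X Y"
  obtains T A M f U B where "X = (T, A)" "Y = (U, B)" "h = ((T, A), (M, f), (U, B))" "algebra_morphism T A M f U B"
  using assms by (auto simp: Hom_def algebras_def Alg_def)

lemma algebras_HomI:
  "algebra_morphism T A M f U B \<Longrightarrow> ((T, A), (M, f), (U, B)) \<in> Hom algebras (T, A) (U, B)"
  by (simp add: Hom_def algebras_simps)

lemma algebra_morphism_ext:
  assumes "algebra_morphism T A M f U B"
  shows "f \<in> extensional J"
  using algebra_morphism_component[OF assms] vnat_ext algebra_morphism_simps(8)[OF assms] by metis

lemma category_algebras: "category algebras"
proof
  fix f :: "('c, 'o, 'm) alg_arrow" assume f: "f \<in> Arr algebras"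
  then have "f \<in> Hom algebras (Dom algebras f) (Cod algebras f)"
    by (simp add: Hom_def)
  then obtain T A M \<alpha> U B where f: "f = ((T, A), (M, \<alpha>), (U, B))" "algebra_morphism T A M \<alpha> U B"
    by (rule algebras_HomE)
  show "Dom algebras f \<in> Ob algebras" "Cod algebras f \<in> Ob algebras"
    using algebra_morphism_simps(1-4)[OF f(2)] by (simp_all add: f(1) algebras_simps algebra_iff)
next
  fix a :: "('c, 'o, 'm) algebra" assume "a \<in> Ob algebras"
  then show "Id algebras a \<in> Hom algebras a a"
    using algebra_morphism_Id by (cases a) (auto simp: algebras_simps algebra_iff intro: algebras_HomI)
next
  fix f g a b c assume f: "f \<in> Hom algebras a b" and g: "g \<in> Hom algebras b c"
  obtain T A M \<alpha> U B where f: "a = (T, A)" "b = (U, B)" "f = ((T, A), (M, \<alpha>), (U, B))" "algebra_morphism T A M \<alpha> U B"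
    using f by (rule algebras_HomE)
  obtain M' \<alpha>' W E where g: "c = (W, E)" "g = ((U, B), (M', \<alpha>'), (W, E))" "algebra_morphism U B M' \<alpha>' W E"
    using g f(2) by (auto elim: algebras_HomE)
  show "Comp algebras g f \<in> Hom algebras a c"
    using algebra_morphism_Comp[OF f(4) g(3)]
    by (simp add: f(1,3) g(1,2) algebras_Comp[OF f(4) g(3)] algebras_HomI)
next
  fix f a b assume f: "f \<in> Hom algebras a b"
  obtain T A M \<alpha> U B where f: "a = (T, A)" "b = (U, B)" "f = ((T, A), (M, \<alpha>), (U, B))" "algebra_morphism T A M \<alpha> U B"
    using f by (rule algebras_HomE)
  note s = algebra_morphism_simps[OF f(4)]
  have 1: "(\<lambda>j \<in> J. lact C (FOb A j) (FOb B j) (FOb B j) ((\<lambda>j \<in> J. VId C (FOb B j)) j) (\<alpha> j)) = \<alpha>"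
    by (rule extensionalityI[OF _ algebra_morphism_ext[OF f(4)]])
      (use algebra_morphism_f_simps[OF f(4)] in auto)
  have 2: "(\<lambda>j \<in> J. lact C (FOb A j) (FOb A j) (FOb B j) (\<alpha> j) ((\<lambda>j \<in> J. VId C (FOb A j)) j)) = \<alpha>"
    by (rule extensionalityI[OF _ algebra_morphism_ext[OF f(4)]])
      (use algebra_morphism_f_simps[OF f(4)] in \<open>auto simp: lact_eq_ract\<close>)
  show "Comp algebras (Id algebras b) f = f"
    unfolding f(2,3) algebras_simps(5) algebras_Comp[OF f(4) algebra_morphism_Id[OF s(3,4)]]
      vcomp_vid(2)[OF s(7,9,13)] 1 ..
  show "Comp algebras f (Id algebras a) = f"
    unfolding f(1,3) algebras_simps(5) algebras_Comp[OF algebra_morphism_Id[OF s(1,2)] f(4)]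
      vcomp_vid(1)[OF s(7,9,13)] 2 ..
next
  fix f g h a b c d assume f: "f \<in> Hom algebras a b" and g: "g \<in> Hom algebras b c" and h: "h \<in> Hom algebras c d"
  obtain T A M \<alpha> U B where f: "a = (T, A)" "b = (U, B)" "f = ((T, A), (M, \<alpha>), (U, B))" "algebra_morphism T A M \<alpha> U B"
    using f by (rule algebras_HomE)
  obtain M' \<alpha>' W E where g: "c = (W, E)" "g = ((U, B), (M', \<alpha>'), (W, E))" "algebra_morphism U B M' \<alpha>' W E"
    using g f(2) by (auto elim: algebras_HomE)
  obtain M'' \<alpha>'' W' E' where h: "h = ((W, E), (M'', \<alpha>''), (W', E'))" "algebra_morphism W E M'' \<alpha>'' W' E'"
    using h g(1) by (auto elim: algebras_HomE)
  note gf = algebra_morphism_Comp[OF f(4) g(3)] and hg = algebra_morphism_Comp[OF g(3) h(2)]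
  have M: "vcomp V T (vcomp V U M'' M') M = vcomp V T M'' (vcomp V T M' M)"
    using algebra_morphism_simps[OF f(4)] algebra_morphism_simps[OF g(3)] algebra_morphism_simps[OF h(2)]
    by (intro vcomp_assoc) auto
  have \<alpha>: "(\<lambda>j \<in> J. lact C (FOb A j) (FOb B j) (FOb E' j)
       ((\<lambda>j \<in> J. lact C (FOb B j) (FOb E j) (FOb E' j) (\<alpha>'' j) (\<alpha>' j)) j) (\<alpha> j))
    = (\<lambda>j \<in> J. lact C (FOb A j) (FOb E j) (FOb E' j) (\<alpha>'' j)
       ((\<lambda>j \<in> J. lact C (FOb A j) (FOb B j) (FOb E j) (\<alpha>' j) (\<alpha> j)) j))"
  proof (rule restrict_ext)
    fix j assume j: "j \<in> J"
    then show "lact C (FOb A j) (FOb B j) (FOb E' j)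
       ((\<lambda>j \<in> J. lact C (FOb B j) (FOb E j) (FOb E' j) (\<alpha>'' j) (\<alpha>' j)) j) (\<alpha> j)
      = lact C (FOb A j) (FOb E j) (FOb E' j) (\<alpha>'' j)
       ((\<lambda>j \<in> J. lact C (FOb A j) (FOb B j) (FOb E j) (\<alpha>' j) (\<alpha> j)) j)"
      using algebra_morphism_f_simps[OF f(4) j] algebra_morphism_f_simps[OF g(3) j] algebra_morphism_f_simps[OF h(2) j]
      by (simp add: lact_lact)
  qed
  show "Comp algebras (Comp algebras h g) f = Comp algebras h (Comp algebras g f)"
    unfolding f(3) g(2) h(1) algebras_Comp[OF f(4) g(3)] algebras_Comp[OF g(3) h(2)]
      algebras_Comp[OF f(4) hg] algebras_Comp[OF gf h(2)] M \<alpha> ..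
qed

sublocale algebras: category algebras
  by (rule category_algebras)

text \<open>Isomorphism of algebras with a record of its effect on carriers; isomorphism in
  \<open>Alg\<close> is the case of an identity. Keeping \<open>\<phi>\<close> makes it possible to
  say that two isomorphisms lie over the same change of carrier.\<close>

definition carrier_iso :: "('c, 'o, 'm) algebra \<Rightarrow> 'm \<Rightarrow> ('c, 'o, 'm) algebra \<Rightarrow> bool" where
  "carrier_iso X \<phi> Y \<longleftrightarrow> (\<exists>h \<in> Hom algebras X Y. is_iso algebras h \<and> carrier_part h = \<phi>)"

lemma carrier_iso_trans:
  assumes "carrier_iso X \<phi> Y" "carrier_iso Y \<psi> Z"
  shows "carrier_iso X (lact C (carrier V X) (carrier V Y) (carrier V Z) \<psi> \<phi>) Z"
proof -
  obtain f where f: "f \<in> Hom algebras X Y" "is_iso algebras f" "carrier_part f = \<phi>"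
    using assms(1) by (auto simp: carrier_iso_def)
  obtain g where g: "g \<in> Hom algebras Y Z" "is_iso algebras g" "carrier_part g = \<psi>"
    using assms(2) by (auto simp: carrier_iso_def)
  obtain T A M \<alpha> U B where f': "X = (T, A)" "Y = (U, B)" "f = ((T, A), (M, \<alpha>), (U, B))" "algebra_morphism T A M \<alpha> U B"
    using f(1) by (rule algebras_HomE)
  obtain M' \<alpha>' W E where g': "Z = (W, E)" "g = ((U, B), (M', \<alpha>'), (W, E))" "algebra_morphism U B M' \<alpha>' W E"
    using g(1) f'(2) by (auto elim: algebras_HomE)
  have "carrier_part (Comp algebras g f) = lact C (carrier V X) (carrier V Y) (carrier V Z) \<psi> \<phi>"
    unfolding f'(3) g'(2) algebras_Comp[OF f'(4) g'(3)] using f(3) g(3)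
    by (simp add: carrier_part_def f'(1-3) g'(1,2) carrier_def)
  moreover have "Comp algebras g f \<in> Hom algebras X Z"
    using f(1) g(1) by (rule algebras.Comp_in)
  moreover have "is_iso algebras (Comp algebras g f)"
    using f(1,2) g(1,2) by (intro algebras.is_iso_Comp) (auto simp: algebras.in_Hom)
  ultimately show ?thesis
    unfolding carrier_iso_def by blast
qed

lemma carrier_iso_sym:
  assumes "carrier_iso X \<phi> Y"
  obtains \<psi> where "carrier_iso Y \<psi> X" "vinverse C (carrier V X) (carrier V Y) \<phi> \<psi>"
proof -
  obtain f where f: "f \<in> Hom algebras X Y" "is_iso algebras f" "carrier_part f = \<phi>"
    using assms(1) by (auto simp: carrier_iso_def)
  have g: "inv_arr algebras f \<in> Hom algebras Y X"
    using f(1,2) by (simp add: algebras.in_Hom)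
  obtain T A M \<alpha> U B where f': "X = (T, A)" "Y = (U, B)" "f = ((T, A), (M, \<alpha>), (U, B))" "algebra_morphism T A M \<alpha> U B"
    using f(1) by (rule algebras_HomE)
  obtain M' \<alpha>' where g': "inv_arr algebras f = ((U, B), (M', \<alpha>'), (T, A))" "algebra_morphism U B M' \<alpha>' T A"
    using g f'(1,2) by (auto elim: algebras_HomE)
  have "Comp algebras (inv_arr algebras f) f = Id algebras X" "Comp algebras f (inv_arr algebras f) = Id algebras Y"
    using f(1,2) by (simp_all add: algebras.in_Hom)
  then have "(\<lambda>j \<in> J. lact C (FOb A j) (FOb B j) (FOb A j) (\<alpha>' j) (\<alpha> j)) = (\<lambda>j \<in> J. VId C (FOb A j))"
    "(\<lambda>j \<in> J. lact C (FOb B j) (FOb A j) (FOb B j) (\<alpha> j) (\<alpha>' j)) = (\<lambda>j \<in> J. VId C (FOb B j))"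
    unfolding g'(1) unfolding f'(1-3) algebras_Comp[OF f'(4) g'(2)] algebras_Comp[OF g'(2) f'(4)] algebras_simps(5) by simp_all
  from fun_cong[OF this(1), of \<I>] fun_cong[OF this(2), of \<I>]
  have "vinverse C (carrier V X) (carrier V Y) \<phi> (carrier_part (inv_arr algebras f))"
    unfolding vinverse_def g'(1)
    using f(3) algebra_morphism_f_simps(1-3)[OF f'(4), of \<I>] algebra_morphism_f_simps(1-3)[OF g'(2), of \<I>]
    by (simp add: carrier_def carrier_part_def f'(1-3) in_Hom)
  moreover have "carrier_iso Y (carrier_part (inv_arr algebras f)) X"
    unfolding carrier_iso_def using f(2) g by (intro bexI[of _ "inv_arr algebras f"]) auto
  ultimately show ?thesis
    using that by blast
qed

lemma Alg_simps:
  "X \<in> Ob (Alg V J C c) \<longleftrightarrow> algebra V J C X \<and> carrier V X = c"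
  "((T, A), (M, f), (U, B)) \<in> Arr (Alg V J C c) \<longleftrightarrow>
     algebra_morphism T A M f U B \<and> carrier V (T, A) = c \<and> carrier V (U, B) = c \<and> f \<I> = VId C c"
  "Dom (Alg V J C c) = Dom algebras" "Cod (Alg V J C c) = Cod algebras"
  "Id (Alg V J C c) = Id algebras" "Comp (Alg V J C c) = Comp algebras"
  by (auto simp: Alg_def algebras_def algebra_morphism_def algebra_def)

lemma Alg_Hom_iff:
  "h \<in> Hom (Alg V J C c) X Y \<longleftrightarrow>
     h \<in> Hom algebras X Y \<and> carrier V X = c \<and> carrier V Y = c \<and> carrier_part h = VId C c"
proof -
  obtain T A M f U B where h: "h = ((T, A), (M, f), (U, B))"
    by (metis surj_pair)
  show ?thesis
    unfolding h Hom_def mem_Collect_eq Alg_simps algebras_simps by (auto simp: carrier_part_def)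
qed

lemma carrier_VOb: "algebra V J C X \<Longrightarrow> carrier V X \<in> VOb C"
  using vfunctor_simps(1)[OF is_algebra_simps(1)] is_theory_simps(2)
  by (cases X) (auto simp: carrier_def algebra_iff)

text \<open>\<open>Alg\<close> has fewer arrows than \<open>algebras\<close>, so inverses must be
  seen to stay inside: the inverse of an arrow with identity carrier part again has identity carrier
  part.\<close>

lemma isomorphic_Alg_iff:
  "isomorphic (Alg V J C c) X Y \<longleftrightarrow> carrier V X = c \<and> carrier V Y = c \<and> carrier_iso X (VId C c) Y"
proof
  assume "isomorphic (Alg V J C c) X Y"
  then obtain f g where f: "f \<in> Hom (Alg V J C c) X Y" "inverse_arrows (Alg V J C c) f g"
    unfolding isomorphic_def is_iso_def by blast
  then have "f \<in> Hom algebras X Y" "carrier V X = c" "carrier V Y = c" "carrier_part f = VId C c"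
    by (auto simp: Alg_Hom_iff)
  moreover from this f(2) have "inverse_arrows algebras f g"
    unfolding inverse_arrows_def Alg_simps Alg_Hom_iff by (auto simp: Hom_def)
  ultimately show "carrier V X = c \<and> carrier V Y = c \<and> carrier_iso X (VId C c) Y"
    unfolding carrier_iso_def is_iso_def by blast
next
  assume *: "carrier V X = c \<and> carrier V Y = c \<and> carrier_iso X (VId C c) Y"
  then obtain f where f: "f \<in> Hom algebras X Y" "is_iso algebras f" "carrier_part f = VId C c"
    by (auto simp: carrier_iso_def)
  have XY: "algebra V J C X" "algebra V J C Y"
    using f(1) algebras.Hom_ObD algebras_simps(1) by blast+
  let ?g = "inv_arr algebras f"
  have g: "?g \<in> Hom algebras Y X" "is_iso algebras ?g"
    using f(1,2) by (simp_all add: algebras.in_Hom)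
  obtain T A M \<alpha> U B where f': "X = (T, A)" "Y = (U, B)" "f = ((T, A), (M, \<alpha>), (U, B))" "algebra_morphism T A M \<alpha> U B"
    using f(1) by (rule algebras_HomE)
  obtain M' \<alpha>' where g': "?g = ((U, B), (M', \<alpha>'), (T, A))" "algebra_morphism U B M' \<alpha>' T A"
    using g(1) f'(1,2) by (auto elim: algebras_HomE)
  have "Comp algebras ?g f = Id algebras X"
    using f(1,2) by (simp add: algebras.in_Hom)
  then have "(\<lambda>j \<in> J. lact C (FOb A j) (FOb B j) (FOb A j) (\<alpha>' j) (\<alpha> j)) = (\<lambda>j \<in> J. VId C (FOb A j))"
    unfolding g'(1) unfolding f'(1-3) algebras_Comp[OF f'(4) g'(2)] algebras_simps(5) by simp
  from fun_cong[OF this, of \<I>] have "lact C c c c (carrier_part ?g) (VId C c) = VId C c"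
    using * f(3) unfolding g'(1) by (simp add: carrier_def carrier_part_def f'(1-3))
  moreover have "lact C c c c (carrier_part ?g) (VId C c) = carrier_part ?g"
    using algebra_morphism_f_simps[OF g'(2), of \<I>] * unfolding g'(1)
    by (simp add: carrier_part_def lact_eq_ract f'(1,2) carrier_def)
  ultimately have "?g \<in> Hom (Alg V J C c) Y X"
    using g(1) * by (simp add: Alg_Hom_iff)
  then have "inverse_arrows (Alg V J C c) f ?g"
    using f(1,2,3) * Alg_Hom_iff[of f c X Y] algebras.inverse_arrows_inv_arr[OF f(2)]
    unfolding inverse_arrows_def Alg_simps by (auto simp: Hom_def)
  then show "isomorphic (Alg V J C c) X Y"
    unfolding isomorphic_def is_iso_def Alg_simps using XY * f Alg_Hom_iff[of f c X Y] by blast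
qed

section \<open>Commutants of isomorphic algebras\<close>

text \<open>An isomorphism of \<open>algebras\<close> unfolded, with theory part and natural part
  inverted separately; \<open>carrier_isoE\<close> and \<open>carrier_isoI\<close> translate.
  Conjugation needs the inverse components \<open>g\<close> explicitly.\<close>

definition algebra_iso ::
  "('o, 'm) jtheory \<Rightarrow> ('o, 'c, 'm) vfun \<Rightarrow> ('o, 'o, 'm) vfun \<Rightarrow> ('o \<Rightarrow> 'm) \<Rightarrow>
   ('o, 'm) jtheory \<Rightarrow> ('o, 'c, 'm) vfun \<Rightarrow> ('o, 'o, 'm) vfun \<Rightarrow> ('o \<Rightarrow> 'm) \<Rightarrow> bool" where
  "algebra_iso T A M f U B N g \<longleftrightarrow>
     algebra_morphism T A M f U B \<and> algebra_morphism U B N g T A \<and> io_iso T U M N \<and>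
     (\<forall>j \<in> J. vinverse C (FOb A j) (FOb B j) (f j) (g j))"

lemma algebra_iso_sym: "algebra_iso T A M f U B N g \<Longrightarrow> algebra_iso U B N g T A M f"
  unfolding algebra_iso_def by (auto intro: io_iso_sym vinverse_sym)

text \<open>The natural part of an algebra morphism is invertible by definition, so it is enough to
  invert the theory part. That \<open>N\<close> preserves generators follows from \<open>M\<close>
  doing so.\<close>

lemma algebra_isoI:
  assumes f: "algebra_morphism T A M f U B" and M: "io_iso T U M N"
  obtains g where "algebra_iso T A M f U B N g"
proof -
  note s = algebra_morphism_simps[OF f] and m = io_isoD[OF M]
  obtain g where g: "g \<in> extensional J" "vnat V T C A (vcomp V T B M) f" "vnat V T C (vcomp V T B M) A g"
    "\<And>j. j \<in> J \<Longrightarrow> vinverse C (FOb A j) (FOb B j) (f j) (g j)"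
    using algebra_morphism_component[OF f] by blast
  have N: "theory_morphism V J U T N"
  proof (rule theory_morphismI[OF s(3,1) m(3)])
    fix j assume j: "j \<in> J"
    then have jT: "j \<in> VOb T" "\<I> \<in> VOb T"
      using s(8) by auto
    show "FOb N j = j"
      using m(5)[OF jT(1)] .
    have "FHom N j \<I> \<cdot> (FHom M j \<I> \<cdot> Gen T j) = Id V (VHom T j \<I>) \<cdot> Gen T j"
      by (rule comp_reduce[OF m(8)[OF jT]]) (use m(6,7)[OF jT] is_theory_simps(5-7)[OF s(1) j] in auto)
    then show "FHom N j \<I> \<cdot> Gen U j = Gen T j"
      using is_theory_simps(5-7)[OF s(1) j] by (simp add: theory_morphism_Gen[OF s(1,3,5) j])
  qed
  have MN: "vcomp V U M N = vid V U"
    by (rule vfun_eqI[OF vfunctor_vcomp[OF s(9,7,9) m(3,2)] vfunctor_vid[OF s(9)]])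
      (use m(4,5,9) s(8,10) in auto)
  have AN: "vfunctor V U C (vcomp V U A N)"
    by (rule vfunctor_vcomp[OF s(9,7) C m(3) s(11)])
  \<comment> \<open>Whiskering by \<open>N\<close> turns \<open>B M\<close> back into
    \<open>B\<close>, so the inverse of \<open>f : A \<rightarrow> B M\<close> becomes a
    transformation \<open>B \<rightarrow> A N\<close>.\<close>
  have BMN: "vcomp V U (vcomp V T B M) N = B"
    unfolding vcomp_assoc[OF s(9,7,9) C m(3) s(13,12)] MN by (rule vcomp_vid(1)[OF s(9) C s(12)])
  have restr: "(\<lambda>j \<in> VOb U. h (FOb N j)) = h" if "h \<in> extensional J" for h :: "'o \<Rightarrow> 'm"
    by (rule extensionalityI[of _ J]) (use that s(8,10) m(5) in auto)
  have "vnat V U C (vcomp V U (vcomp V T B M) N) (vcomp V U A N) (\<lambda>j \<in> VOb U. g (FOb N j))"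
    "vnat V U C (vcomp V U A N) (vcomp V U (vcomp V T B M) N) (\<lambda>j \<in> VOb U. f (FOb N j))"
    by (rule vnat_vcomp[OF s(9,7) C m(3) s(14,11) g(3)], rule vnat_vcomp[OF s(9,7) C m(3) s(11,14) g(2)])
  then have n: "vnat V U C B (vcomp V U A N) g" "vnat V U C (vcomp V U A N) B f"
    unfolding BMN restr[OF g(1)] restr[OF algebra_morphism_ext[OF f]] by auto
  have "vnat_iso V U C B (vcomp V U A N) g"
    unfolding vnat_iso_iff[OF s(9) C s(12) AN]
    using n vinverse_sym[OF g(4)] s(8,10) m(5) by (intro exI[of _ f]) auto
  then have "algebra_morphism U B N g T A"
    unfolding algebra_morphism_def using s(1-4) N by blast
  then have "algebra_iso T A M f U B N g"
    unfolding algebra_iso_def using f M g(4) by blast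
  then show ?thesis
    by (rule that)
qed

lemma algebra_iso_inverse:
  assumes "algebra_iso T A M f U B N g"
  shows "Comp algebras ((U, B), (N, g), (T, A)) ((T, A), (M, f), (U, B)) = Id algebras (T, A)"
proof -
  have f: "algebra_morphism T A M f U B" and g: "algebra_morphism U B N g T A" and M: "io_iso T U M N"
    and fg: "\<And>j. j \<in> J \<Longrightarrow> vinverse C (FOb A j) (FOb B j) (f j) (g j)"
    using assms by (auto simp: algebra_iso_def)
  note s = algebra_morphism_simps[OF f] and m = io_isoD[OF M]
  have "vcomp V T N M = vid V T"
    by (rule vfun_eqI[OF vfunctor_vcomp[OF s(7,9,7) m(2,3)] vfunctor_vid[OF s(7)]])
      (use m(4,5,8) s(8,10) in auto)
  moreover have "(\<lambda>j \<in> J. lact C (FOb A j) (FOb B j) (FOb A j) (g j) (f j)) = (\<lambda>j \<in> J. VId C (FOb A j))"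
    by (rule restrict_ext) (use fg in \<open>auto simp: vinverse_def\<close>)
  ultimately show ?thesis
    unfolding algebras_Comp[OF f g] algebras_simps(5) by simp
qed

lemma carrier_isoI:
  assumes "algebra_iso T A M f U B N g"
  shows "carrier_iso (T, A) (f \<I>) (U, B)"
proof -
  have f: "algebra_morphism T A M f U B" and g: "algebra_morphism U B N g T A"
    using assms by (auto simp: algebra_iso_def)
  have "is_iso algebras ((T, A), (M, f), (U, B))"
    by (rule algebras.is_isoI(1)[where g = "((U, B), (N, g), (T, A))"])
      (use f g algebra_iso_inverse[OF assms] algebra_iso_inverse[OF algebra_iso_sym[OF assms]]
       in \<open>simp_all add: algebras_simps(2-4)\<close>)
  then show ?thesis
    unfolding carrier_iso_def using algebras_HomI[OF f] by (intro bexI) (auto simp: carrier_part_def)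
qed

lemma carrier_isoE:
  assumes "carrier_iso X \<phi> Y"
  obtains T A M f U B N g where "X = (T, A)" "Y = (U, B)" "algebra_iso T A M f U B N g" "f \<I> = \<phi>"
proof -
  obtain h where h: "h \<in> Hom algebras X Y" "is_iso algebras h" "carrier_part h = \<phi>"
    using assms(1) by (auto simp: carrier_iso_def)
  obtain T A M f U B where f: "X = (T, A)" "Y = (U, B)" "h = ((T, A), (M, f), (U, B))" "algebra_morphism T A M f U B"
    using h(1) by (rule algebras_HomE)
  have "inv_arr algebras h \<in> Hom algebras Y X"
    using h(1,2) by (simp add: algebras.in_Hom)
  then obtain N g where g: "inv_arr algebras h = ((U, B), (N, g), (T, A))" "algebra_morphism U B N g T A"
    using f(1,2) by (auto elim: algebras_HomE)
  have "Comp algebras (inv_arr algebras h) h = Id algebras X" "Comp algebras h (inv_arr algebras h) = Id algebras Y"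
    using h(1,2) by (simp_all add: algebras.in_Hom)
  then have eq: "vcomp V T N M = vid V T" "vcomp V U M N = vid V U"
    "(\<lambda>j \<in> J. lact C (FOb A j) (FOb B j) (FOb A j) (g j) (f j)) = (\<lambda>j \<in> J. VId C (FOb A j))"
    "(\<lambda>j \<in> J. lact C (FOb B j) (FOb A j) (FOb B j) (f j) (g j)) = (\<lambda>j \<in> J. VId C (FOb B j))"
    unfolding g(1) unfolding f(1-3) algebras_Comp[OF f(4) g(2)] algebras_Comp[OF g(2) f(4)] algebras_simps(5) by simp_all
  have "vinverse C (FOb A j) (FOb B j) (f j) (g j)" if j: "j \<in> J" for j
    unfolding vinverse_def
    using fun_cong[OF eq(3), of j] fun_cong[OF eq(4), of j] j
      algebra_morphism_f_simps(1-3)[OF f(4) j] algebra_morphism_f_simps(1-3)[OF g(2) j] by (simp add: in_Hom)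
  moreover have "io_iso T U M N"
    unfolding io_iso_def
  proof (intro conjI ballI)
    fix j k assume j: "j \<in> VOb T" and k: "k \<in> VOb T"
    note s = algebra_morphism_simps[OF f(4)] and s' = algebra_morphism_simps[OF g(2)]
    show "FOb M j = j" "FOb N j = j"
      using s(8,15) s'(15) j by auto
    have "FHom (vcomp V T N M) j k = Id V (VHom T j k)" "FHom (vcomp V U M N) j k = Id V (VHom U j k)"
      unfolding eq(1,2) using j k s(8,10) by simp_all
    then show "FHom N j k \<cdot> FHom M j k = Id V (VHom T j k)" "FHom M j k \<cdot> FHom N j k = Id V (VHom U j k)"
      using j k s(8,10,15) s'(15) by simp_all
  qed (use algebra_morphism_simps[OF f(4)] algebra_morphism_simps[OF g(2)] in auto)
  ultimately have "algebra_iso T A M f U B N g"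
    unfolding algebra_iso_def using f(4) g(2) by blast
  then show ?thesis
    using that[OF f(1,2)] h(3) by (simp add: f(3) carrier_part_def)
qed

section \<open>Transport of natural families along an isomorphism of algebras\<close>

lemma cot_map_C_lact:
  assumes "j \<in> J" "x \<in> VOb C" "y \<in> VOb C" "z \<in> VOb C"
    "f \<in> Arr V" "Cod V f = VHom C x y" "g \<in> Arr V" "Dom V g = \<I>" "Cod V g = VHom C y z"
  shows "cot_map V C j x z \<cdot> lact C x y z g f
    = lact C (Cot C j x) (Cot C j y) (Cot C j z) (cot_map V C j y z \<cdot> g) (cot_map V C j x y \<cdot> f)"
  using assms comp_reduce[OF cot_map_C_ecomp[OF assms(1-7,9)]] by (simp add: lact_def)

lemma cot_map_C_ract:
  assumes "j \<in> J" "x \<in> VOb C" "y \<in> VOb C" "z \<in> VOb C"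
    "f \<in> Arr V" "Dom V f = \<I>" "Cod V f = VHom C x y" "g \<in> Arr V" "Cod V g = VHom C y z"
  shows "cot_map V C j x z \<cdot> ract C x y z g f
    = ract C (Cot C j x) (Cot C j y) (Cot C j z) (cot_map V C j y z \<cdot> g) (cot_map V C j x y \<cdot> f)"
  using assms comp_reduce[OF cot_map_C_ecomp[OF assms(1-5,7-)]] by (simp add: ract_def)

lemma cot_map_C_conjugate:
  assumes "j \<in> J" "a \<in> VOb C" "b \<in> VOb C" "a' \<in> VOb C" "b' \<in> VOb C"
    "h \<in> Arr V" "Cod V h = VHom C a b" "v \<in> Arr V" "Dom V v = \<I>" "Cod V v = VHom C b b'"
    "u \<in> Arr V" "Dom V u = \<I>" "Cod V u = VHom C a' a"
  shows "cot_map V C j a' b' \<cdot> conjugate C a b a' b' v u h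
    = conjugate C (Cot C j a) (Cot C j b) (Cot C j a') (Cot C j b') (cot_map V C j b b' \<cdot> v)
       (cot_map V C j a' a \<cdot> u) (cot_map V C j a b \<cdot> h)"
  unfolding conjugate_def using assms by (simp add: cot_map_C_lact cot_map_C_ract)

lemma vinverse_cot_map:
  assumes "j \<in> J" "a \<in> VOb C" "b \<in> VOb C" "vinverse C a b u v"
  shows "vinverse C (Cot C j a) (Cot C j b) (cot_map V C j a b \<cdot> u) (cot_map V C j b a \<cdot> v)"
  using assms vinverse_simps[OF assms(4)] cot_map_C_lact[of j a b a u v] cot_map_C_lact[of j b a b v u]
  by (simp add: vinverse_def in_Hom)

text \<open>Functors and family are conjugated by the same pointwise isomorphisms, so
  \<open>conjugate_ecomp\<close> exhibits each side of the new naturality square as a conjugate of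
  the corresponding old side, restricted along \<open>N\<close> on hom-objects.\<close>

lemma vnat_family_conjugate:
  assumes T: "vcategory V T" "vcategory V U" "io_iso T U M N"
    and F: "vfunctor V T C P" "vfunctor V T C Q" "vfunctor V U C P'" "vfunctor V U C Q'"
    and p: "\<And>i. i \<in> VOb T \<Longrightarrow> vinverse C (FOb P i) (FOb P' i) (p i) (p' i)"
    and q: "\<And>i. i \<in> VOb T \<Longrightarrow> vinverse C (FOb Q i) (FOb Q' i) (q i) (q' i)"
    and P': "\<And>i l. \<lbrakk>i \<in> VOb T; l \<in> VOb T\<rbrakk> \<Longrightarrow> FHom P' i l =
      conjugate C (FOb P i) (FOb P l) (FOb P' i) (FOb P' l) (p l) (p' i) (FHom P i l \<cdot> FHom N i l)"
    and Q': "\<And>i l. \<lbrakk>i \<in> VOb T; l \<in> VOb T\<rbrakk> \<Longrightarrow> FHom Q' i l =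
      conjugate C (FOb Q i) (FOb Q l) (FOb Q' i) (FOb Q' l) (q l) (q' i) (FHom Q i l \<cdot> FHom N i l)"
    and \<alpha>: "vnat_family V T C P Q x \<alpha>"
  shows "vnat_family V U C P' Q' x
    (\<lambda>i \<in> VOb U. conjugate C (FOb P i) (FOb Q i) (FOb P' i) (FOb Q' i) (q i) (p' i) (\<alpha> i))"
proof (rule vnat_familyI[OF T(2) F(3,4)])
  note m = io_isoD[OF T(3)]
  fix i l assume "i \<in> VOb U" "l \<in> VOb U"
  then have il: "i \<in> VOb T" "l \<in> VOb T" and il': "i \<in> VOb U" "l \<in> VOb U"
    using m(1) by auto
  note pq = vinverse_simps[OF p[OF il(1)]] vinverse_simps[OF p[OF il(2)]]
    vinverse_simps[OF q[OF il(1)]] vinverse_simps[OF q[OF il(2)]]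
  note a = vnat_family_simps[OF \<alpha> il(1)] vnat_family_simps[OF \<alpha> il(2)] and n = m(7)[OF il]
  have Ob: "FOb P i \<in> VOb C" "FOb P l \<in> VOb C" "FOb Q i \<in> VOb C" "FOb Q l \<in> VOb C"
    "FOb P' i \<in> VOb C" "FOb P' l \<in> VOb C" "FOb Q' i \<in> VOb C" "FOb Q' l \<in> VOb C"
    using F il il' by (auto intro: vfunctor_simps(1))
  have P: "FHom P i l \<cdot> FHom N i l \<in> Arr V" "Dom V (FHom P i l \<cdot> FHom N i l) = VHom U i l"
    "Cod V (FHom P i l \<cdot> FHom N i l) = VHom C (FOb P i) (FOb P l)"
    using vfunctor_simps(3-5)[OF F(1) il] n by auto
  have Q: "FHom Q i l \<cdot> FHom N i l \<in> Arr V" "Dom V (FHom Q i l \<cdot> FHom N i l) = VHom U i l"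
    "Cod V (FHom Q i l \<cdot> FHom N i l) = VHom C (FOb Q i) (FOb Q l)"
    using vfunctor_simps(3-5)[OF F(2) il] n by auto
  let ?c = "\<lambda>i. conjugate C (FOb P i) (FOb Q i) (FOb P' i) (FOb Q' i) (q i) (p' i) (\<alpha> i)"
  have x: "x \<in> Ob V"
    using a by auto
  have "ecomp C (FOb P' i) (FOb P' l) (FOb Q' l) (?c l) (FHom P' i l)
    = conjugate C (FOb P i) (FOb Q l) (FOb P' i) (FOb Q' l) (q l) (p' i)
       (ecomp C (FOb P i) (FOb P l) (FOb Q l) (\<alpha> l) (FHom P i l \<cdot> FHom N i l))"
    unfolding P'[OF il] by (rule conjugate_ecomp) (use Ob P a pq p[OF il(2)] in auto)
  also have "\<dots> = conjugate C (FOb P i) (FOb Q l) (FOb P' i) (FOb Q' l) (q l) (p' i)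
       (ecomp C (FOb P i) (FOb Q i) (FOb Q l) (FHom Q i l \<cdot> FHom N i l) (\<alpha> i) \<cdot> Sym V x (VHom U i l))"
    using vnat_family_ecomp[OF T(1) F(1,2) \<alpha> il, of "FHom N i l"] n by simp
  also have "\<dots> = conjugate C (FOb P i) (FOb Q l) (FOb P' i) (FOb Q' l) (q l) (p' i)
       (ecomp C (FOb P i) (FOb Q i) (FOb Q l) (FHom Q i l \<cdot> FHom N i l) (\<alpha> i)) \<cdot> Sym V x (VHom U i l)"
    by (rule conjugate_Comp[symmetric]) (use Ob Q a pq x T(2) il' in auto)
  also have "\<dots> = ecomp C (FOb P' i) (FOb Q' i) (FOb Q' l) (FHom Q' i l) (?c i) \<cdot> Sym V x (VHom U i l)"
    unfolding Q'[OF il] by (subst conjugate_ecomp) (use Ob Q a pq q[OF il(1)] in auto)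
  finally show "ecomp C (FOb P' i) (FOb P' l) (FOb Q' l) ((\<lambda>i \<in> VOb U. ?c i) l) (FHom P' i l)
    = ecomp C (FOb P' i) (FOb Q' i) (FOb Q' l) (FHom Q' i l) ((\<lambda>i \<in> VOb U. ?c i) i) \<cdot> Sym V x (VHom U i l)"
    using il' by simp
next
  fix i assume i': "i \<in> VOb U"
  then have i: "i \<in> VOb T"
    using io_isoD(1)[OF T(3)] by simp
  have Ob: "FOb P i \<in> VOb C" "FOb Q i \<in> VOb C" "FOb P' i \<in> VOb C" "FOb Q' i \<in> VOb C"
    using F i i' by (auto intro: vfunctor_simps(1))
  show "(\<lambda>i \<in> VOb U. conjugate C (FOb P i) (FOb Q i) (FOb P' i) (FOb Q' i) (q i) (p' i) (\<alpha> i)) i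
    \<in> Hom V x (VHom C (FOb P' i) (FOb Q' i))"
    using i' Ob vinverse_simps[OF p[OF i]] vinverse_simps[OF q[OF i]] vnat_family_simps[OF \<alpha> i]
    by (simp add: in_Hom)
qed auto

text \<open>Naturality of \<open>f\<close> read as a formula for \<open>B\<close> in terms of
  \<open>A\<close>; precomposing with \<open>N\<close> removes the theory part from
  \<open>B M\<close>.\<close>

lemma algebra_iso_FHom:
  assumes iso: "algebra_iso T A M f U B N g" and i: "i \<in> J" and l: "l \<in> J"
  shows "FHom B i l = conjugate C (FOb A i) (FOb A l) (FOb B i) (FOb B l) (f l) (g i) (FHom A i l \<cdot> FHom N i l)"
proof -
  have f: "algebra_morphism T A M f U B" and g: "algebra_morphism U B N g T A" and M: "io_iso T U M N"
    and fg: "\<And>j. j \<in> J \<Longrightarrow> vinverse C (FOb A j) (FOb B j) (f j) (g j)"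
    using iso by (auto simp: algebra_iso_def)
  note s = algebra_morphism_simps[OF f] and m = io_isoD[OF M]
  have il: "i \<in> VOb T" "l \<in> VOb T" "i \<in> VOb U" "l \<in> VOb U"
    using i l s(8,10) by auto
  obtain g' where "vnat V T C A (vcomp V T B M) f"
    using algebra_morphism_component[OF f] by blast
  then have "ract C (FOb (vcomp V T B M) i) (FOb A i) (FOb (vcomp V T B M) l)
      (lact C (FOb A i) (FOb A l) (FOb (vcomp V T B M) l) (f l) (FHom A i l)) (g i) = FHom (vcomp V T B M) i l"
    by (intro vnat_iso_conj[OF s(7) C s(11,14)]) (use fg s(8,15) i l in auto)
  then have *: "conjugate C (FOb A i) (FOb A l) (FOb B i) (FOb B l) (f l) (g i) (FHom A i l) = FHom B i l \<cdot> FHom M i l"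
    using il s(15) i l by (simp add: conjugate_def)
  have "FHom B i l = FHom B i l \<cdot> (FHom M i l \<cdot> FHom N i l)"
    using m(9)[OF il(1,2)] vfunctor_simps(3-5)[OF s(12) il(3,4)] by simp
  also have "\<dots> = conjugate C (FOb A i) (FOb A l) (FOb B i) (FOb B l) (f l) (g i) (FHom A i l) \<cdot> FHom N i l"
    unfolding * using m(6,7)[OF il(1,2)] vfunctor_simps(3-5)[OF s(12) il(3,4)] by simp
  also have "\<dots> = conjugate C (FOb A i) (FOb A l) (FOb B i) (FOb B l) (f l) (g i) (FHom A i l \<cdot> FHom N i l)"
    by (rule conjugate_Comp)
      (use s(11) il m(7)[OF il(1,2)] algebra_morphism_f_simps[OF f i] algebra_morphism_f_simps[OF f l]
        vinverse_simps[OF fg[OF i]] in auto)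
  finally show ?thesis .
qed

text \<open>
  The commutant theories of isomorphic algebras \<open>(T,A)\<close> and \<open>(U,B)\<close> are compared by conjugating families
  \<open>[j,A] \<rightarrow> [k,A]\<close> with the isomorphisms \<open>[j,f]\<close> and \<open>[k,f]\<close>.
\<close>

definition transfer_family ::
  "('o, 'c, 'm) vfun \<Rightarrow> ('o \<Rightarrow> 'm) \<Rightarrow> ('o, 'c, 'm) vfun \<Rightarrow> ('o \<Rightarrow> 'm) \<Rightarrow> 'o \<Rightarrow> 'o \<Rightarrow> 'o \<Rightarrow> 'm \<Rightarrow> 'm" where
  "transfer_family A f B g j k i =
     conjugate C (Cot C j (FOb A i)) (Cot C k (FOb A i)) (Cot C j (FOb B i)) (Cot C k (FOb B i))
       (cot_map V C k (FOb A i) (FOb B i) \<cdot> f i) (cot_map V C j (FOb B i) (FOb A i) \<cdot> g i)"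

definition transfer ::
  "('o, 'm) jtheory \<Rightarrow> ('o, 'c, 'm) vfun \<Rightarrow> ('o \<Rightarrow> 'm) \<Rightarrow> ('o, 'm) jtheory \<Rightarrow> ('o, 'c, 'm) vfun \<Rightarrow>
   ('o \<Rightarrow> 'm) \<Rightarrow> 'o \<Rightarrow> 'o \<Rightarrow> 'm" where
  "transfer T A f U B g j k =
     end_lift V U C (alg_cot V U C j B) (alg_cot V U C k B) (end_obj V T C (alg_cot V T C j A) (alg_cot V T C k A))
       (\<lambda>i \<in> VOb U. transfer_family A f B g j k i (end_proj V T C (alg_cot V T C j A) (alg_cot V T C k A) i))"

context
  fixes T A M f U B N g
  assumes iso: "algebra_iso T A M f U B N g"
begin

lemma algebra_iso_simps:
  "algebra_morphism T A M f U B" "algebra_morphism U B N g T A" "io_iso T U M N"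
  "j \<in> J \<Longrightarrow> vinverse C (FOb A j) (FOb B j) (f j) (g j)"
  "j \<in> J \<Longrightarrow> FOb A j \<in> VOb C" "j \<in> J \<Longrightarrow> FOb B j \<in> VOb C"
  "\<lbrakk>j \<in> J; i \<in> J\<rbrakk> \<Longrightarrow> vinverse C (Cot C j (FOb A i)) (Cot C j (FOb B i))
     (cot_map V C j (FOb A i) (FOb B i) \<cdot> f i) (cot_map V C j (FOb B i) (FOb A i) \<cdot> g i)"
proof -
  show *: "algebra_morphism T A M f U B" "algebra_morphism U B N g T A" "io_iso T U M N"
    "j \<in> J \<Longrightarrow> vinverse C (FOb A j) (FOb B j) (f j) (g j)" for j
    using iso by (auto simp: algebra_iso_def)
  show **: "j \<in> J \<Longrightarrow> FOb A j \<in> VOb C" "j \<in> J \<Longrightarrow> FOb B j \<in> VOb C" for j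
    using algebra_morphism_f_simps[OF *(1)] by auto
  show "\<lbrakk>j \<in> J; i \<in> J\<rbrakk> \<Longrightarrow> vinverse C (Cot C j (FOb A i)) (Cot C j (FOb B i))
     (cot_map V C j (FOb A i) (FOb B i) \<cdot> f i) (cot_map V C j (FOb B i) (FOb A i) \<cdot> g i)"
    using vinverse_cot_map * ** by blast
qed

lemma transfer_family_vnat:
  assumes j: "j \<in> J" and k: "k \<in> J"
    and \<alpha>: "vnat_family V T C (alg_cot V T C j A) (alg_cot V T C k A) x \<alpha>"
  shows "vnat_family V U C (alg_cot V U C j B) (alg_cot V U C k B) x
     (\<lambda>i \<in> VOb U. transfer_family A f B g j k i (\<alpha> i))"
proof -
  note s = algebra_morphism_simps[OF algebra_iso_simps(1)] and m = io_isoD[OF algebra_iso_simps(3)]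
  \<comment> \<open>Cotensoring by \<open>j\<close> preserves conjugation, so the formula for
    \<open>B\<close> passes to \<open>[j,B]\<close> with \<open>[j,f]\<close> in place of
    \<open>f\<close>.\<close>
  have conj: "FHom (alg_cot V U C j B) i l = conjugate C (FOb (alg_cot V T C j A) i) (FOb (alg_cot V T C j A) l)
      (FOb (alg_cot V U C j B) i) (FOb (alg_cot V U C j B) l)
      (cot_map V C j (FOb A l) (FOb B l) \<cdot> f l) (cot_map V C j (FOb B i) (FOb A i) \<cdot> g i)
      (FHom (alg_cot V T C j A) i l \<cdot> FHom N i l)" if j: "j \<in> J" and il: "i \<in> VOb T" "l \<in> VOb T" for j i l
  proof -
    have ilJ: "i \<in> J" "l \<in> J" and ilU: "i \<in> VOb U" "l \<in> VOb U"
      using il s(8,10) by auto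
    have "cot_map V C j (FOb B i) (FOb B l) \<cdot> FHom B i l =
      conjugate C (Cot C j (FOb A i)) (Cot C j (FOb A l)) (Cot C j (FOb B i)) (Cot C j (FOb B l))
       (cot_map V C j (FOb A l) (FOb B l) \<cdot> f l) (cot_map V C j (FOb B i) (FOb A i) \<cdot> g i)
       (cot_map V C j (FOb A i) (FOb A l) \<cdot> (FHom A i l \<cdot> FHom N i l))"
      unfolding algebra_iso_FHom[OF iso ilJ]
      by (rule cot_map_C_conjugate)
        (use j algebra_iso_simps(5,6) ilJ vinverse_simps[OF algebra_iso_simps(4)] vfunctor_simps(3-5)[OF s(11) il] m(7)[OF il] in auto)
    then show ?thesis
      using il ilU algebra_iso_simps(5)[OF ilJ(1)] algebra_iso_simps(5)[OF ilJ(2)] j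
        vfunctor_simps(3-5)[OF s(11) il] m(7)[OF il] by simp
  qed
  have "vnat_family V U C (alg_cot V U C j B) (alg_cot V U C k B) x
    (\<lambda>i \<in> VOb U. conjugate C (FOb (alg_cot V T C j A) i) (FOb (alg_cot V T C k A) i) (FOb (alg_cot V U C j B) i)
      (FOb (alg_cot V U C k B) i) (cot_map V C k (FOb A i) (FOb B i) \<cdot> f i)
      (cot_map V C j (FOb B i) (FOb A i) \<cdot> g i) (\<alpha> i))"
    by (rule vnat_family_conjugate[OF s(7,9) algebra_iso_simps(3) vfunctor_alg_cot[OF s(7,11) j] vfunctor_alg_cot[OF s(7,11) k]
      vfunctor_alg_cot[OF s(9,12) j] vfunctor_alg_cot[OF s(9,12) k] _ _ conj[OF j] conj[OF k] \<alpha>])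
      (use algebra_iso_simps(7) j k s(8,10) in auto)
  moreover have "(\<lambda>i \<in> VOb U. conjugate C (FOb (alg_cot V T C j A) i) (FOb (alg_cot V T C k A) i) (FOb (alg_cot V U C j B) i)
      (FOb (alg_cot V U C k B) i) (cot_map V C k (FOb A i) (FOb B i) \<cdot> f i)
      (cot_map V C j (FOb B i) (FOb A i) \<cdot> g i) (\<alpha> i)) = (\<lambda>i \<in> VOb U. transfer_family A f B g j k i (\<alpha> i))"
    by (rule restrict_ext) (simp add: transfer_family_def s(8,10))
  ultimately show ?thesis
    by simp
qed

lemma transfer_simps:
  assumes j: "j \<in> J" and k: "k \<in> J"
  shows "transfer T A f U B g j k \<in> Arr V"
    "Dom V (transfer T A f U B g j k) = end_obj V T C (alg_cot V T C j A) (alg_cot V T C k A)"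
    "Cod V (transfer T A f U B g j k) = end_obj V U C (alg_cot V U C j B) (alg_cot V U C k B)"
    "i \<in> J \<Longrightarrow> end_proj V U C (alg_cot V U C j B) (alg_cot V U C k B) i \<cdot> transfer T A f U B g j k
      = transfer_family A f B g j k i (end_proj V T C (alg_cot V T C j A) (alg_cot V T C k A) i)"
proof -
  note s = algebra_morphism_simps[OF algebra_iso_simps(1)]
  note alg = is_algebra_alg_cot[OF s(1,2)] and alg' = is_algebra_alg_cot[OF s(3,4)]
  note l = end_lift_simps[OF s(3) alg'[OF j] alg'[OF k]
    transfer_family_vnat[OF j k end_proj_family[OF s(1) alg[OF j] alg[OF k]]]]
  show "transfer T A f U B g j k \<in> Arr V"
    "Dom V (transfer T A f U B g j k) = end_obj V T C (alg_cot V T C j A) (alg_cot V T C k A)"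
    "Cod V (transfer T A f U B g j k) = end_obj V U C (alg_cot V U C j B) (alg_cot V U C k B)"
    "i \<in> J \<Longrightarrow> end_proj V U C (alg_cot V U C j B) (alg_cot V U C k B) i \<cdot> transfer T A f U B g j k
      = transfer_family A f B g j k i (end_proj V T C (alg_cot V T C j A) (alg_cot V T C k A) i)"
    unfolding transfer_def using l s(10) by auto
qed

end

end

section \<open>Comparison of the commutants of isomorphic algebras\<close>

context admissible_vcategory
begin

lemma commutant_simps:
  "commutant V J C (T, A) = (commutant_theory V J C (T, A), snd (commutant V J C (T, A)))"
  "j \<in> J \<Longrightarrow> FOb (snd (commutant V J C (T, A))) j = Cot C j (FOb A \<I>)"
  "\<lbrakk>j \<in> J; k \<in> J\<rbrakk> \<Longrightarrow> FHom (snd (commutant V J C (T, A))) j k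
     = end_proj V T C (alg_cot V T C j A) (alg_cot V T C k A) \<I>"
  by (auto simp: commutant_def)

lemma commutant_theory_VId:
  assumes T: "is_theory V J T" "is_algebra V J C T A" and j: "j \<in> J"
  shows "VId (commutant_theory V J C (T, A)) j \<in> Arr V"
    "Dom V (VId (commutant_theory V J C (T, A)) j) = \<I>"
    "Cod V (VId (commutant_theory V J C (T, A)) j) = VHom (commutant_theory V J C (T, A)) j j"
    "i \<in> J \<Longrightarrow> end_proj V T C (alg_cot V T C j A) (alg_cot V T C j A) i \<cdot> VId (commutant_theory V J C (T, A)) j
      = VId C (Cot C j (FOb A i))"
  using TAlg_VId[OF T(1) is_algebra_alg_cot[OF T j]] is_theory_simps(2)[OF T(1)]
  by (simp_all add: commutant_theory_simps)

lemma commutant_theory_VComp: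
  assumes T: "is_theory V J T" "is_algebra V J C T A" and j: "j \<in> J" "k \<in> J" "l \<in> J"
  shows "VComp (commutant_theory V J C (T, A)) j k l \<in> Arr V"
    "Dom V (VComp (commutant_theory V J C (T, A)) j k l)
      = VHom (commutant_theory V J C (T, A)) k l \<otimes> VHom (commutant_theory V J C (T, A)) j k"
    "Cod V (VComp (commutant_theory V J C (T, A)) j k l) = VHom (commutant_theory V J C (T, A)) j l"
    "i \<in> J \<Longrightarrow> end_proj V T C (alg_cot V T C j A) (alg_cot V T C l A) i \<cdot> VComp (commutant_theory V J C (T, A)) j k l
      = ecomp C (Cot C j (FOb A i)) (Cot C k (FOb A i)) (Cot C l (FOb A i))
          (end_proj V T C (alg_cot V T C k A) (alg_cot V T C l A) i)
          (end_proj V T C (alg_cot V T C j A) (alg_cot V T C k A) i)"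
  using TAlg_VComp[OF T(1) is_algebra_alg_cot[OF T j(1)] is_algebra_alg_cot[OF T j(2)] is_algebra_alg_cot[OF T j(3)]]
    is_theory_simps(2)[OF T(1)]
  by (simp_all add: commutant_theory_simps)

lemma commutant_theory_Gen:
  assumes T: "is_theory V J T" "is_algebra V J C T A" and j: "j \<in> J"
  shows "Gen (commutant_theory V J C (T, A)) j \<in> Arr V"
    "Dom V (Gen (commutant_theory V J C (T, A)) j) = j"
    "Cod V (Gen (commutant_theory V J C (T, A)) j) = VHom (commutant_theory V J C (T, A)) j \<I>"
    "i \<in> J \<Longrightarrow> end_proj V T C (alg_cot V T C j A) (alg_cot V T C \<I> A) i \<cdot> Gen (commutant_theory V J C (T, A)) j
      = Counit C j (FOb A i)"
  using TAlg_Counit[OF T j] is_theory_simps(1,2)[OF T(1)] is_algebra_simps(1)[OF T(2)]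
  by (simp_all add: commutant_theory_simps alg_cot_Unit)

lemma commutant_proj:
  assumes T: "is_theory V J T" "is_algebra V J C T A" and j: "j \<in> J" "k \<in> J" and i: "i \<in> J"
  shows "end_proj V T C (alg_cot V T C j A) (alg_cot V T C k A) i \<in> Arr V"
    "Dom V (end_proj V T C (alg_cot V T C j A) (alg_cot V T C k A) i) = VHom (commutant_theory V J C (T, A)) j k"
    "Cod V (end_proj V T C (alg_cot V T C j A) (alg_cot V T C k A) i) = VHom C (Cot C j (FOb A i)) (Cot C k (FOb A i))"
  using end_proj_simps[OF T(1) is_algebra_alg_cot[OF T j(1)] is_algebra_alg_cot[OF T j(2)] i]
    is_theory_simps(2)[OF T(1)] i
  by (simp_all add: commutant_theory_simps)

lemma algebra_VOb:
  assumes "is_theory V J T" "is_algebra V J C T A" "i \<in> J"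
  shows "FOb A i \<in> VOb C"
  using vfunctor_simps(1)[OF is_algebra_simps(1)[OF assms(2)]] is_theory_simps(2)[OF assms(1)] assms(3) by auto

lemma commutant_vfunctor:
  assumes T: "is_theory V J T" "is_algebra V J C T A"
  shows "vfunctor V (commutant_theory V J C (T, A)) C (snd (commutant V J C (T, A)))"
proof (rule vfunctorI)
  let ?P = "snd (commutant V J C (T, A))"
  have I: "FOb A \<I> \<in> VOb C"
    by (rule algebra_VOb[OF T arities_simps(1)])
  show "FOb ?P \<in> VOb (commutant_theory V J C (T, A)) \<rightarrow>\<^sub>E VOb C"
    using I by (auto simp: commutant_def commutant_theory_simps)
  show "a \<notin> VOb (commutant_theory V J C (T, A)) \<or> b \<notin> VOb (commutant_theory V J C (T, A)) \<Longrightarrow> FHom ?P a b = undefined" for a b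
    by (auto simp: commutant_def commutant_theory_simps)
next
  fix a b assume "a \<in> VOb (commutant_theory V J C (T, A))" "b \<in> VOb (commutant_theory V J C (T, A))"
  then show "FHom (snd (commutant V J C (T, A))) a b \<in> Hom V (VHom (commutant_theory V J C (T, A)) a b)
      (VHom C (FOb (snd (commutant V J C (T, A))) a) (FOb (snd (commutant V J C (T, A))) b))"
    using commutant_proj[OF T _ _ arities_simps(1)]
    by (simp add: in_Hom commutant_simps(2,3) commutant_theory_simps(1))
next
  fix a assume "a \<in> VOb (commutant_theory V J C (T, A))"
  then show "FHom (snd (commutant V J C (T, A))) a a \<cdot> VId (commutant_theory V J C (T, A)) a
    = VId C (FOb (snd (commutant V J C (T, A))) a)"
    using commutant_theory_VId(4)[OF T, of a \<I>] by (simp add: commutant_simps(2,3) commutant_theory_simps(1))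
next
  fix a b c assume "a \<in> VOb (commutant_theory V J C (T, A))" "b \<in> VOb (commutant_theory V J C (T, A))"
    "c \<in> VOb (commutant_theory V J C (T, A))"
  then show "FHom (snd (commutant V J C (T, A))) a c \<cdot> VComp (commutant_theory V J C (T, A)) a b c
    = ecomp C (FOb (snd (commutant V J C (T, A))) a) (FOb (snd (commutant V J C (T, A))) b)
      (FOb (snd (commutant V J C (T, A))) c) (FHom (snd (commutant V J C (T, A))) b c)
      (FHom (snd (commutant V J C (T, A))) a b)"
    using commutant_theory_VComp(4)[OF T, of a b c \<I>] by (simp add: commutant_simps(2,3) commutant_theory_simps(1))
qed

lemma commutant_cancel:
  assumes T: "is_theory V J T" "is_algebra V J C T A" and j: "j \<in> J" "k \<in> J"
    and g: "g \<in> Arr V" "Cod V g = VHom (commutant_theory V J C (T, A)) j k"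
    and h: "h \<in> Arr V" "Cod V h = VHom (commutant_theory V J C (T, A)) j k"
    and eq: "Dom V g = Dom V h" "\<And>i. i \<in> J \<Longrightarrow> end_proj V T C (alg_cot V T C j A) (alg_cot V T C k A) i \<cdot> g
       = end_proj V T C (alg_cot V T C j A) (alg_cot V T C k A) i \<cdot> h"
  shows "g = h"
  by (rule end_cancel[OF T(1) is_algebra_alg_cot[OF T j(1)] is_algebra_alg_cot[OF T j(2)]])
    (use g h eq in \<open>auto simp: commutant_theory_simps\<close>)

lemma transfer_family_Comp:
  assumes iso: "algebra_iso T A M f U B N g" and j: "j \<in> J" "k \<in> J" "i \<in> J"
    and h: "h \<in> Arr V" "Cod V h = VHom C (Cot C j (FOb A i)) (Cot C k (FOb A i))" "w \<in> Arr V" "Cod V w = Dom V h"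
  shows "transfer_family A f B g j k i h \<cdot> w = transfer_family A f B g j k i (h \<cdot> w)"
  unfolding transfer_family_def
  by (rule conjugate_Comp) (use h j algebra_iso_simps(5,6)[OF iso] vinverse_simps[OF algebra_iso_simps(7)[OF iso]] in auto)

lemma transfer_family_inverse:
  assumes iso: "algebra_iso T A M f U B N g" and j: "j \<in> J" "k \<in> J" "i \<in> J"
    and h: "h \<in> Arr V" "Cod V h = VHom C (Cot C j (FOb A i)) (Cot C k (FOb A i))"
  shows "transfer_family B g A f j k i (transfer_family A f B g j k i h) = h"
  unfolding transfer_family_def
  by (rule conjugate_inverse[OF C _ _ _ _ h algebra_iso_simps(7)[OF iso j(1,3)] algebra_iso_simps(7)[OF iso j(2,3)]])
    (use j algebra_iso_simps(5,6)[OF iso] in auto)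

definition transfer_fun ::
  "('o, 'm) jtheory \<Rightarrow> ('o, 'c, 'm) vfun \<Rightarrow> ('o \<Rightarrow> 'm) \<Rightarrow> ('o, 'm) jtheory \<Rightarrow> ('o, 'c, 'm) vfun \<Rightarrow>
   ('o \<Rightarrow> 'm) \<Rightarrow> ('o, 'o, 'm) vfun" where
  "transfer_fun T A f U B g = \<lparr>FOb = (\<lambda>j \<in> J. j),
     FHom = (\<lambda>j k. if j \<in> J \<and> k \<in> J then transfer T A f U B g j k else undefined)\<rparr>"

context
  fixes T A M f U B N g
  assumes iso: "algebra_iso T A M f U B N g"
begin

private abbreviation "S \<equiv> commutant_theory V J C (T, A)"
private abbreviation "S' \<equiv> commutant_theory V J C (U, B)"
private abbreviation "P \<equiv> snd (commutant V J C (T, A))"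
private abbreviation "P' \<equiv> snd (commutant V J C (U, B))"
private abbreviation "F \<equiv> transfer_fun T A f U B g"
private abbreviation "\<pi> j k i \<equiv> end_proj V T C (alg_cot V T C j A) (alg_cot V T C k A) i"
private abbreviation "\<pi>' j k i \<equiv> end_proj V U C (alg_cot V U C j B) (alg_cot V U C k B) i"

lemma source_algebra: "is_theory V J T" "is_algebra V J C T A" and target_algebra: "is_theory V J U" "is_algebra V J C U B"
  using algebra_morphism_simps(1-4)[OF algebra_iso_simps(1)[OF iso]] by auto

lemma transfer_fun_simps:
  assumes "j \<in> J"
  shows "FOb F j = j" "k \<in> J \<Longrightarrow> FHom F j k \<in> Arr V" "k \<in> J \<Longrightarrow> Dom V (FHom F j k) = VHom S j k"
    "k \<in> J \<Longrightarrow> Cod V (FHom F j k) = VHom S' j k"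
    "\<lbrakk>k \<in> J; i \<in> J\<rbrakk> \<Longrightarrow> \<pi>' j k i \<cdot> FHom F j k = transfer_family A f B g j k i (\<pi> j k i)"
  using transfer_simps[OF iso assms] assms by (auto simp: transfer_fun_def commutant_theory_simps)

lemma transfer_fun_Comp:
  assumes j: "j \<in> J" "k \<in> J" "i \<in> J" and h: "h \<in> Arr V" "Cod V h = VHom S j k"
  shows "\<pi>' j k i \<cdot> (FHom F j k \<cdot> h) = transfer_family A f B g j k i (\<pi> j k i \<cdot> h)"
proof -
  note p = commutant_proj[OF source_algebra j] and p' = commutant_proj[OF target_algebra j] and t = transfer_fun_simps[OF j(1)]
  have "\<pi>' j k i \<cdot> (FHom F j k \<cdot> h) = transfer_family A f B g j k i (\<pi> j k i) \<cdot> h"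
    by (rule comp_reduce[OF t(5)]) (use j h p p' t(2-4) in auto)
  also have "\<dots> = transfer_family A f B g j k i (\<pi> j k i \<cdot> h)"
    by (rule transfer_family_Comp[OF iso j]) (use p h in auto)
  finally show ?thesis .
qed

text \<open>Equality in the commutant theory of \<open>(U,B)\<close> is tested on projections, where
  the claim becomes compatibility of conjugation with identities and composites in
  \<open>C\<close>.\<close>

lemma transfer_fun_vfunctor: "vfunctor V S S' F"
proof (rule vfunctorI)
  fix a assume "a \<in> VOb S"
  then have a: "a \<in> J"
    by (simp add: commutant_theory_simps)
  have "FHom F a a \<cdot> VId S a = VId S' a"
  proof (rule commutant_cancel[OF target_algebra a a])
    fix i assume i: "i \<in> J"
    have "\<pi>' a a i \<cdot> (FHom F a a \<cdot> VId S a) = transfer_family A f B g a a i (VId C (Cot C a (FOb A i)))"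
      using transfer_fun_Comp[OF a a i, of "VId S a"] commutant_theory_VId[OF source_algebra a] i by simp
    also have "\<dots> = VId C (Cot C a (FOb B i))"
      unfolding transfer_family_def
      by (rule conjugate_VId) (use algebra_iso_simps(5-7)[OF iso] a i in auto)
    finally show "\<pi>' a a i \<cdot> (FHom F a a \<cdot> VId S a) = \<pi>' a a i \<cdot> VId S' a"
      using commutant_theory_VId[OF target_algebra a] i by simp
  qed (use commutant_theory_VId(1-3)[OF source_algebra a] commutant_theory_VId(1-3)[OF target_algebra a] transfer_fun_simps(2-4)[OF a a] in auto)
  then show "FHom F a a \<cdot> VId S a = VId S' (FOb F a)"
    using transfer_fun_simps(1)[OF a] by simp
next
  fix a b c assume "a \<in> VOb S" "b \<in> VOb S" "c \<in> VOb S"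
  then have abc: "a \<in> J" "b \<in> J" "c \<in> J"
    by (simp_all add: commutant_theory_simps)
  note c1 = commutant_theory_VComp[OF source_algebra abc] and c2 = commutant_theory_VComp[OF target_algebra abc]
  note t = transfer_fun_simps(2-4)[OF abc(1,2)] transfer_fun_simps(2-4)[OF abc(2,3)] transfer_fun_simps(2-4)[OF abc(1,3)]
  have "FHom F a c \<cdot> VComp S a b c = VComp S' a b c \<cdot> (FHom F b c \<odot> FHom F a b)"
  proof (rule commutant_cancel[OF target_algebra abc(1,3)])
    fix i assume i: "i \<in> J"
    note p = commutant_proj[OF source_algebra abc(1,2) i] commutant_proj[OF source_algebra abc(2,3) i]
    note p' = commutant_proj[OF target_algebra abc(1,2) i] commutant_proj[OF target_algebra abc(2,3) i] commutant_proj[OF target_algebra abc(1,3) i]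
    let ?x = "\<lambda>j. Cot C j (FOb A i)" and ?y = "\<lambda>j. Cot C j (FOb B i)"
    have Ob: "?x j \<in> VOb C" "?y j \<in> VOb C" if "j \<in> J" for j
      using algebra_iso_simps(5,6)[OF iso i] that by auto
    have "\<pi>' a c i \<cdot> (VComp S' a b c \<cdot> (FHom F b c \<odot> FHom F a b))
      = ecomp C (?y a) (?y b) (?y c) (\<pi>' b c i) (\<pi>' a b i) \<cdot> (FHom F b c \<odot> FHom F a b)"
      by (rule comp_reduce[OF c2(4)[OF i]]) (use c2(1-3) t p' in auto)
    also have "\<dots> = ecomp C (?y a) (?y b) (?y c) (\<pi>' b c i \<cdot> FHom F b c) (\<pi>' a b i \<cdot> FHom F a b)"
      by (rule ecomp_Comp) (use Ob abc t p' in auto)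
    also have "\<dots> = ecomp C (?y a) (?y b) (?y c) (transfer_family A f B g b c i (\<pi> b c i)) (transfer_family A f B g a b i (\<pi> a b i))"
      using transfer_fun_simps(5)[OF abc(1,2) i] transfer_fun_simps(5)[OF abc(2,3) i] by simp
    also have "\<dots> = transfer_family A f B g a c i (ecomp C (?x a) (?x b) (?x c) (\<pi> b c i) (\<pi> a b i))"
      unfolding transfer_family_def
      by (rule conjugate_ecomp[OF C])
        (use Ob abc p algebra_iso_simps(7)[OF iso _ i] vinverse_simps[OF algebra_iso_simps(7)[OF iso _ i]] in auto)
    also have "\<dots> = \<pi>' a c i \<cdot> (FHom F a c \<cdot> VComp S a b c)"
      using transfer_fun_Comp[OF abc(1,3) i, of "VComp S a b c"] c1 i by simp
    finally show "\<pi>' a c i \<cdot> (FHom F a c \<cdot> VComp S a b c) = \<pi>' a c i \<cdot> (VComp S' a b c \<cdot> (FHom F b c \<odot> FHom F a b))"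
      by simp
  qed (use c1(1-3) c2(1-3) t in auto)
  then show "FHom F a c \<cdot> VComp S a b c = ecomp S' (FOb F a) (FOb F b) (FOb F c) (FHom F b c) (FHom F a b)"
    using transfer_fun_simps(1) abc by (simp add: ecomp_def)
qed (use transfer_fun_simps in \<open>auto simp: in_Hom commutant_theory_simps(1) transfer_fun_def\<close>)

text \<open>The components of generators are cotensor counits, and these are natural: the counit at
  \<open>B i\<close> after \<open>[j,f i]\<close> is \<open>f i\<close> after the counit at
  \<open>A i\<close>. Conjugation therefore carries one counit to the other.\<close>

lemma transfer_fun_Gen:
  assumes j: "j \<in> J"
  shows "FHom F j \<I> \<cdot> Gen S j = Gen S' j"
proof (rule commutant_cancel[OF target_algebra j arities_simps(1)])
  fix i assume i: "i \<in> J"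
  note Ob = algebra_iso_simps(5,6)[OF iso i] and v = algebra_iso_simps(4)[OF iso i] and vj = algebra_iso_simps(7)[OF iso j i]
  note f = vinverse_simps[OF v] and fj = vinverse_simps[OF vj]
  let ?c = "cot_map V C j (FOb A i) (FOb B i) \<cdot> f i" and ?d = "cot_map V C j (FOb B i) (FOb A i) \<cdot> g i"
  have "ract C (Cot C j (FOb A i)) (Cot C j (FOb B i)) (FOb B i) (Counit C j (FOb B i)) ?c
    = lact C (Cot C j (FOb A i)) (FOb A i) (FOb B i) (f i) (Counit C j (FOb A i))"
    using ecomp_Counit[OF j Ob f(1,3)] Ob j f LUnit_inv_nat
    by (simp add: ract_def lact_def is_iso_Comp flip: LUnit_Sym)
  then have "ract C (Cot C j (FOb B i)) (Cot C j (FOb A i)) (FOb B i)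
      (lact C (Cot C j (FOb A i)) (FOb A i) (FOb B i) (f i) (Counit C j (FOb A i))) ?d
    = ract C (Cot C j (FOb B i)) (Cot C j (FOb A i)) (FOb B i)
      (ract C (Cot C j (FOb A i)) (Cot C j (FOb B i)) (FOb B i) (Counit C j (FOb B i)) ?c) ?d"
    by simp
  also have "\<dots> = Counit C j (FOb B i)"
    by (rule vinverse_ract[OF C vinverse_sym[OF vj]]) (use Ob j in auto)
  finally have "transfer_family A f B g j \<I> i (Counit C j (FOb A i)) = Counit C j (FOb B i)"
    using Ob f by (simp add: transfer_family_def conjugate_def cot_map_Unit)
  then show "\<pi>' j \<I> i \<cdot> (FHom F j \<I> \<cdot> Gen S j) = \<pi>' j \<I> i \<cdot> Gen S' j"
    using transfer_fun_Comp[OF j arities_simps(1) i, of "Gen S j"] commutant_theory_Gen[OF source_algebra j]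
      commutant_theory_Gen[OF target_algebra j] i by simp
qed (use commutant_theory_Gen(1-3)[OF source_algebra j] commutant_theory_Gen(1-3)[OF target_algebra j] transfer_fun_simps(2-4)[OF j arities_simps(1)] in auto)

end

lemma transfer_fun_inverse:
  assumes iso: "algebra_iso T A M f U B N g" and j: "j \<in> J" "k \<in> J"
  shows "FHom (transfer_fun U B g T A f) j k \<cdot> FHom (transfer_fun T A f U B g) j k
    = Id V (VHom (commutant_theory V J C (T, A)) j k)"
proof -
  note source_algebra = source_algebra[OF iso] and iso' = algebra_iso_sym[OF iso]
  note t = transfer_fun_simps(2-4)[OF iso j] and t' = transfer_fun_simps(2-4)[OF iso' j]
  have Ob: "VHom (commutant_theory V J C (T, A)) j k \<in> Ob V"
    using t by (metis Dom_Ob)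
  show ?thesis
  proof (rule commutant_cancel[OF source_algebra j])
    fix i assume i: "i \<in> J"
    note p = commutant_proj[OF source_algebra j i]
    have "end_proj V T C (alg_cot V T C j A) (alg_cot V T C k A) i \<cdot>
        (FHom (transfer_fun U B g T A f) j k \<cdot> FHom (transfer_fun T A f U B g) j k)
      = transfer_family B g A f j k i (transfer_family A f B g j k i (end_proj V T C (alg_cot V T C j A) (alg_cot V T C k A) i))"
      using transfer_fun_Comp[OF iso' j i t(1)] t transfer_fun_simps(5)[OF iso j i] by simp
    also have "\<dots> = end_proj V T C (alg_cot V T C j A) (alg_cot V T C k A) i"
      by (rule transfer_family_inverse[OF iso j i]) (use p in auto)
    finally show "end_proj V T C (alg_cot V T C j A) (alg_cot V T C k A) i \<cdot>
        (FHom (transfer_fun U B g T A f) j k \<cdot> FHom (transfer_fun T A f U B g) j k)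
      = end_proj V T C (alg_cot V T C j A) (alg_cot V T C k A) i \<cdot> Id V (VHom (commutant_theory V J C (T, A)) j k)"
      using p by simp
  qed (use t t' Ob in auto)
qed

lemma transfer_fun_io_iso:
  assumes iso: "algebra_iso T A M f U B N g"
  shows "io_iso (commutant_theory V J C (T, A)) (commutant_theory V J C (U, B))
    (transfer_fun T A f U B g) (transfer_fun U B g T A f)"
  unfolding io_iso_def
  using transfer_fun_vfunctor[OF iso] transfer_fun_vfunctor[OF algebra_iso_sym[OF iso]]
    transfer_fun_inverse[OF iso] transfer_fun_inverse[OF algebra_iso_sym[OF iso]]
    transfer_fun_simps(1)[OF iso] transfer_fun_simps(1)[OF algebra_iso_sym[OF iso]]
  by (simp add: commutant_theory_simps(1))

text \<open>Transfer is an identity-on-objects isomorphism that preserves generators and conjugates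
  the action on carriers. So the property of being an algebra, assumed of the first commutant,
  passes to the second along with the comparison. In the applications the first commutant is
  isomorphic to a given algebra, which provides the assumption.\<close>

lemma commutant_carrier_iso:
  assumes iso: "algebra_iso T A M f U B N g" and alg: "algebra V J C (commutant V J C (T, A))"
  shows "carrier_iso (commutant V J C (T, A)) (f \<I>) (commutant V J C (U, B))"
proof -
  let ?S = "commutant_theory V J C (T, A)" and ?S' = "commutant_theory V J C (U, B)"
  let ?P = "snd (commutant V J C (T, A))" and ?P' = "snd (commutant V J C (U, B))"
  let ?F = "transfer_fun T A f U B g" and ?G = "transfer_fun U B g T A f"
  note source_algebra = source_algebra[OF iso] and target_algebra = target_algebra[OF iso] and io = transfer_fun_io_iso[OF iso] and S_Ob = commutant_theory_simps(1)
  note Ob = algebra_iso_simps(5,6)[OF iso arities_simps(1)]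
  have "algebra V J C (?S, ?P)"
    unfolding commutant_simps(1)[symmetric] by (rule alg)
  then have S: "is_theory V J ?S" "is_algebra V J C ?S ?P"
    by (auto simp: algebra_iff)
  note s = is_theory_simps[OF S(1)] and S'c = commutant_theory_vcategory[OF target_algebra]
  note t = transfer_fun_simps[OF iso] and t' = transfer_fun_simps[OF algebra_iso_sym[OF iso]]
  have S': "is_theory V J ?S'"
    unfolding is_theory_def
  proof (intro conjI ballI S'c S_Ob)
    fix j assume j: "j \<in> J"
    show "is_cotensor V ?S' j \<I> j (Gen ?S' j)"
      using io_iso_cotensor[OF s(1) S'c io s(3)[OF j]] transfer_fun_Gen[OF iso j] by simp
  next
    show "Gen ?S' \<I> = VId ?S' \<I>"
      using transfer_fun_Gen[OF iso arities_simps(1)] vfunctor_simps(2)[OF transfer_fun_vfunctor[OF iso], of \<I>]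
        t(1)[OF arities_simps(1)] by (simp add: s(4) S_Ob)
  qed
  \<comment> \<open>These components are \<open>[j,f \<I>]\<close>; at \<open>j = \<I>\<close> this
    is \<open>f \<I>\<close>, because designated cotensors by \<open>\<I>\<close> are
    trivial.\<close>
  let ?h = "\<lambda>j \<in> J. cot_map V C j (FOb A \<I>) (FOb B \<I>) \<cdot> f \<I>"
  let ?k = "\<lambda>j \<in> J. cot_map V C j (FOb B \<I>) (FOb A \<I>) \<cdot> g \<I>"
  have hk: "vinverse C (Cot C j (FOb A \<I>)) (Cot C j (FOb B \<I>)) (?h j) (?k j)" if "j \<in> J" for j
    using algebra_iso_simps(7)[OF iso that arities_simps(1)] that by simp
  have FHom: "FHom ?P' j k \<cdot> (FHom ?F j k \<cdot> w) = conjugate C (Cot C j (FOb A \<I>)) (Cot C k (FOb A \<I>))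
      (Cot C j (FOb B \<I>)) (Cot C k (FOb B \<I>)) (?h k) (?k j) (FHom ?P j k \<cdot> w)"
    if "j \<in> J" "k \<in> J" "w \<in> Arr V" "Cod V w = VHom ?S j k" for j k w
    using transfer_fun_Comp[OF iso that(1,2) arities_simps(1) that(3,4)] that
    by (simp add: commutant_simps(3) transfer_family_def)
  have P': "is_algebra V J C ?S' ?P'"
    unfolding is_algebra_def preserves_cotensors_def
  proof (intro conjI ballI allI impI commutant_vfunctor[OF target_algebra])
    \<comment> \<open>A cotensor in the second theory is carried back to the first by
      \<open>?G\<close>, preserved there by \<open>?P\<close>, and conjugated by \<open>?h\<close>
      into the cotensor required of \<open>?P'\<close>.\<close>
    fix j x p \<kappa> assume j: "j \<in> J" and cot: "is_cotensor V ?S' j x p \<kappa>"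
    note c = is_cotensor_simps(1-3,5-7)[OF cot]
    have xp: "x \<in> J" "p \<in> J"
      using c by (auto simp: S_Ob)
    have "is_cotensor V ?S j x p (FHom ?G p x \<cdot> \<kappa>)"
      by (rule io_iso_cotensor[OF S'c s(1) io_iso_sym[OF io] cot])
    then have "is_cotensor V C j (FOb ?P x) (FOb ?P p) (FHom ?P p x \<cdot> (FHom ?G p x \<cdot> \<kappa>))"
      using is_algebra_simps(2)[OF S(2)] j unfolding preserves_cotensors_def by blast
    then have "is_cotensor V C j (Cot C x (FOb A \<I>)) (Cot C p (FOb A \<I>)) (FHom ?P p x \<cdot> (FHom ?G p x \<cdot> \<kappa>))"
      using xp by (simp add: commutant_simps(2))
    from is_cotensor_conjugate[OF C this _ _ hk[OF xp(1)] hk[OF xp(2)]]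
    have "is_cotensor V C j (Cot C x (FOb B \<I>)) (Cot C p (FOb B \<I>))
      (FHom ?P' p x \<cdot> (FHom ?F p x \<cdot> (FHom ?G p x \<cdot> \<kappa>)))"
      using xp Ob c(4-6) t'(2-4)[OF xp(2,1)] by (simp add: FHom)
    moreover have "FHom ?F p x \<cdot> (FHom ?G p x \<cdot> \<kappa>) = \<kappa>"
      using comp_reduce[OF transfer_fun_inverse[OF algebra_iso_sym[OF iso] xp(2,1)], of \<kappa>] c t(2-4)[OF xp(2,1)] t'(2-4)[OF xp(2,1)]
      by simp
    ultimately show "is_cotensor V C j (FOb ?P' x) (FOb ?P' p) (FHom ?P' p x \<cdot> \<kappa>)"
      using xp by (simp add: commutant_simps(2))
  qed
  have F: "theory_morphism V J ?S ?S' ?F"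
    by (rule theory_morphismI[OF S(1) S' transfer_fun_vfunctor[OF iso] t(1) transfer_fun_Gen[OF iso]])
  have P'F: "vfunctor V ?S C (vcomp V ?S ?P' ?F)"
    by (rule vfunctor_vcomp[OF s(1) S'c C transfer_fun_vfunctor[OF iso] commutant_vfunctor[OF target_algebra]])
  have vi: "vinverse C (FOb ?P a) (FOb (vcomp V ?S ?P' ?F) a) (?h a) (?k a)" if "a \<in> VOb ?S" for a
  proof -
    have "a \<in> J"
      using that by (simp add: S_Ob)
    then show ?thesis
      using hk[of a] that t(1)[of a] by (simp only: commutant_simps(2) vcomp_simps)
  qed
  have n: "vnat V ?S C ?P (vcomp V ?S ?P' ?F) ?h"
    unfolding vnat_iff[OF s(1) C commutant_vfunctor[OF source_algebra] P'F]
  proof (intro conjI ballI)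
    fix a b assume "a \<in> VOb ?S" "b \<in> VOb ?S"
    then have ab: "a \<in> J" "b \<in> J" and abS: "a \<in> VOb ?S" "b \<in> VOb ?S"
      by (auto simp: S_Ob)
    note h = vinverse_simps[OF hk[OF ab(1)]] vinverse_simps[OF hk[OF ab(2)]]
    note p = commutant_proj[OF source_algebra ab arities_simps(1), folded commutant_simps(3)[OF ab]]
    have ObV: "VHom ?S a b \<in> Ob V"
      using p by (metis Dom_Ob)
    have "FHom ?P' a b \<cdot> FHom ?F a b = conjugate C (Cot C a (FOb A \<I>)) (Cot C b (FOb A \<I>))
      (Cot C a (FOb B \<I>)) (Cot C b (FOb B \<I>)) (?h b) (?k a) (FHom ?P a b)"
      using FHom[OF ab, of "Id V (VHom ?S a b)"] ObV t(2-4)[OF ab] p(1,2) by simp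
    then have "ract C (Cot C a (FOb A \<I>)) (Cot C a (FOb B \<I>)) (Cot C b (FOb B \<I>)) (FHom ?P' a b \<cdot> FHom ?F a b) (?h a)
      = lact C (Cot C a (FOb A \<I>)) (Cot C b (FOb A \<I>)) (Cot C b (FOb B \<I>)) (?h b) (FHom ?P a b)"
      unfolding conjugate_def using ab Ob p h vinverse_ract[OF C hk[OF ab(1)]] by (simp del: restrict_apply)
    then show "lact C (FOb ?P a) (FOb ?P b) (FOb (vcomp V ?S ?P' ?F) b) (?h b) (FHom ?P a b)
      = ract C (FOb ?P a) (FOb (vcomp V ?S ?P' ?F) a) (FOb (vcomp V ?S ?P' ?F) b) (FHom (vcomp V ?S ?P' ?F) a b) (?h a)"
      using abS ab t(1) by (simp add: commutant_simps(2))
  next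
    fix a assume "a \<in> VOb ?S"
    from vi[OF this] show "?h a \<in> Hom V \<I> (VHom C (FOb ?P a) (FOb (vcomp V ?S ?P' ?F) a))"
      by (simp add: vinverse_def)
  qed (auto simp: S_Ob)
  have n': "vnat V ?S C (vcomp V ?S ?P' ?F) ?P ?k"
    by (rule vnat_inverse[OF s(1) C commutant_vfunctor[OF source_algebra] P'F n vi]) (simp_all only: S_Ob restrict_extensional)
  have "vnat_iso V ?S C ?P (vcomp V ?S ?P' ?F) ?h"
    unfolding vnat_iso_iff[OF s(1) C commutant_vfunctor[OF source_algebra] P'F] using n n' vi by blast
  then have "algebra_morphism ?S ?P ?F ?h ?S' ?P'"
    unfolding algebra_morphism_def using S S' P' F by blast
  then obtain h' where "algebra_iso ?S ?P ?F ?h ?S' ?P' ?G h'"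
    by (rule algebra_isoI[OF _ io])
  then have "carrier_iso (?S, ?P) (?h \<I>) (?S', ?P')"
    by (rule carrier_isoI)
  moreover have "?h \<I> = f \<I>"
    using vinverse_simps[OF algebra_iso_simps(4)[OF iso arities_simps(1)]] Ob by (simp add: cot_map_Unit)
  ultimately show ?thesis
    by (simp add: commutant_simps(1)[symmetric])
qed

lemma carrier_iso_commutant:
  assumes "carrier_iso X \<phi> Y" "algebra V J C (commutant V J C X)"
  shows "carrier_iso (commutant V J C X) \<phi> (commutant V J C Y)"
  using assms carrier_isoE[OF assms(1)] commutant_carrier_iso by metis

text \<open>
  A morphism into a commutant is determined by its component at \<open>\<I>\<close>: the other components are
  recovered from the cotensor counits, and the \<open>\<V>\<close>-functor \<open>A\<^sup>\<bottom>\<close> is faithful.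
\<close>

lemma into_commutant_unique:
  assumes T: "is_theory V J T" "is_algebra V J C T A"
    and f: "algebra_morphism U B M f (commutant_theory V J C (T, A)) (snd (commutant V J C (T, A)))"
    and g: "algebra_morphism U B N g (commutant_theory V J C (T, A)) (snd (commutant V J C (T, A)))"
    and eq: "f \<I> = g \<I>"
  shows "M = N \<and> f = g"
proof
  let ?S = "commutant_theory V J C (T, A)" and ?P = "snd (commutant V J C (T, A))"
  have Ob: "FOb A \<I> \<in> VOb C"
    by (rule algebra_VOb[OF T arities_simps(1)])
  \<comment> \<open>Naturality of \<open>f\<close> at the generator \<open>Gen U j\<close>: the
    theory morphism sends it to a generator of the commutant, whose component at \<open>\<I>\<close>
    is the designated counit. The right-hand side involves \<open>f\<close> only through
    \<open>f \<I>\<close>, so cancelling the counit determines \<open>f j\<close>.\<close>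
  have key: "ract C (FOb B j) (Cot C j (FOb A \<I>)) (FOb A \<I>) (Counit C j (FOb A \<I>)) (f j)
    = lact C (FOb B j) (FOb B \<I>) (FOb A \<I>) (f \<I>) (FHom B j \<I> \<cdot> Gen U j)"
    if f: "algebra_morphism U B M f ?S ?P" and j: "j \<in> J" for M f j
  proof -
    note s = algebra_morphism_simps[OF f] and fj = algebra_morphism_f_simps[OF f j] and fI = algebra_morphism_f_simps[OF f arities_simps(1)]
    have jU: "j \<in> VOb U" "\<I> \<in> VOb U"
      using j s(8) by auto
    obtain g where "vnat V U C B (vcomp V U ?P M) f"
      using algebra_morphism_component[OF f] by blast
    from vnat_eq[OF s(7) C s(11) s(14) this jU]
    have "lact C (FOb B j) (FOb B \<I>) (FOb A \<I>) (f \<I>) (FHom B j \<I>)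
      = ract C (FOb B j) (Cot C j (FOb A \<I>)) (FOb A \<I>) (FHom ?P j \<I> \<cdot> FHom M j \<I>) (f j)"
      using jU j s(15) Ob by (simp add: commutant_simps(2))
    then have "lact C (FOb B j) (FOb B \<I>) (FOb A \<I>) (f \<I>) (FHom B j \<I>) \<cdot> Gen U j
      = ract C (FOb B j) (Cot C j (FOb A \<I>)) (FOb A \<I>) (FHom ?P j \<I> \<cdot> FHom M j \<I>) (f j) \<cdot> Gen U j"
      by (rule arg_cong)
    moreover have "lact C (FOb B j) (FOb B \<I>) (FOb A \<I>) (f \<I>) (FHom B j \<I>) \<cdot> Gen U j
      = lact C (FOb B j) (FOb B \<I>) (FOb A \<I>) (f \<I>) (FHom B j \<I> \<cdot> Gen U j)"
      by (rule lact_Comp)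
        (use s(11) jU is_theory_simps(5-7)[OF s(1) j] fI fj Ob in \<open>auto simp: commutant_simps(2)\<close>)
    moreover have "ract C (FOb B j) (Cot C j (FOb A \<I>)) (FOb A \<I>) (FHom ?P j \<I> \<cdot> FHom M j \<I>) (f j) \<cdot> Gen U j
      = ract C (FOb B j) (Cot C j (FOb A \<I>)) (FOb A \<I>) ((FHom ?P j \<I> \<cdot> FHom M j \<I>) \<cdot> Gen U j) (f j)"
      by (rule ract_Comp)
        (use j is_theory_simps(5-7)[OF s(1) j] fj Ob theory_morphism_simps[OF s(1,5) j, of \<I>]
          commutant_proj[OF T j arities_simps(1) arities_simps(1)] in \<open>auto simp: commutant_simps(2,3)\<close>)
    moreover have "(FHom ?P j \<I> \<cdot> FHom M j \<I>) \<cdot> Gen U j = FHom ?P j \<I> \<cdot> (FHom M j \<I> \<cdot> Gen U j)"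
      by (rule assoc)
        (use j is_theory_simps(5-7)[OF s(1) j] theory_morphism_simps[OF s(1,5) j, of \<I>]
          commutant_proj[OF T j arities_simps(1) arities_simps(1)] in \<open>auto simp: commutant_simps(3)\<close>)
    moreover have "FHom ?P j \<I> \<cdot> (FHom M j \<I> \<cdot> Gen U j) = Counit C j (FOb A \<I>)"
      using theory_morphism_Gen[OF s(1,3,5) j] commutant_theory_Gen(4)[OF T j arities_simps(1)] j
      by (simp add: commutant_simps(3))
    ultimately show ?thesis
      by simp
  qed
  note sf = algebra_morphism_simps[OF f] and sg = algebra_morphism_simps[OF g]
  have fg: "f j = g j" if j: "j \<in> J" for j
  proof -
    note fj = algebra_morphism_f_simps[OF f j] and gj = algebra_morphism_f_simps[OF g j]
    have P: "FOb ?P j = Cot C j (FOb A \<I>)"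
      using j by (simp add: commutant_simps(2))
    have "ecomp C (FOb B j) (Cot C j (FOb A \<I>)) (FOb A \<I>) (Counit C j (FOb A \<I>)) (f j) \<cdot> inv_arr V (RUnit V j)
      = ecomp C (FOb B j) (Cot C j (FOb A \<I>)) (FOb A \<I>) (Counit C j (FOb A \<I>)) (g j) \<cdot> inv_arr V (RUnit V j)"
      using key[OF f j] key[OF g j] eq Ob j by (simp add: ract_def)
    then have "ecomp C (FOb B j) (Cot C j (FOb A \<I>)) (FOb A \<I>) (Counit C j (FOb A \<I>)) (f j)
      = ecomp C (FOb B j) (Cot C j (FOb A \<I>)) (FOb A \<I>) (Counit C j (FOb A \<I>)) (g j)"
      by (rule iso_cancel_right[rotated]) (use Ob fj gj j P in auto)
    then show ?thesis
      by (rule cotensor_cancel[OF C C_cotensor[OF j Ob], rotated -1]) (use fj gj P in auto)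
  qed
  show "f = g"
    by (rule extensionalityI[OF algebra_morphism_ext[OF f] algebra_morphism_ext[OF g] fg])
  show "M = N"
  proof (rule vfun_eqI[OF sf(13) sg(13)])
    fix j k assume "j \<in> VOb U" "k \<in> VOb U"
    then have j: "j \<in> J" and k: "k \<in> J" and jk: "j \<in> VOb U" "k \<in> VOb U"
      using sf(8) by auto
    \<comment> \<open>Naturality solved for the composite of \<open>?P\<close> with
      \<open>M\<close>; the right-hand side does not depend on \<open>M\<close>. Since
      \<open>f = g\<close>, the composites with \<open>M\<close> and \<open>N\<close> agree, and
      \<open>end_cancel_Unit\<close> removes \<open>?P\<close>, whose hom maps are the projections
      at \<open>\<I>\<close>.\<close>
    have conj: "FHom ?P j k \<cdot> FHom M j k = ract C (FOb ?P j) (FOb B j) (FOb ?P k)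
       (lact C (FOb B j) (FOb B k) (FOb ?P k) (f k) (FHom B j k)) (f' j)"
      if f: "algebra_morphism U B M f ?S ?P" and f': "\<And>j. j \<in> J \<Longrightarrow> vinverse C (FOb B j) (FOb ?P j) (f j) (f' j)" for M f f'
    proof -
      note s = algebra_morphism_simps[OF f]
      have "vnat V U C B (vcomp V U ?P M) f"
        using algebra_morphism_component[OF f] by blast
      then have "ract C (FOb (vcomp V U ?P M) j) (FOb B j) (FOb (vcomp V U ?P M) k)
         (lact C (FOb B j) (FOb B k) (FOb (vcomp V U ?P M) k) (f k) (FHom B j k)) (f' j) = FHom (vcomp V U ?P M) j k"
        by (intro vnat_iso_conj[OF s(7) C s(11,14) _ _ jk]) (use f' s(8,15) in auto)
      then show ?thesis
        using jk s(15)[OF j] s(15)[OF k] by simp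
    qed
    obtain f' where "\<And>j. j \<in> J \<Longrightarrow> vinverse C (FOb B j) (FOb ?P j) (f j) (f' j)"
      using algebra_morphism_component[OF f] by blast
    from conj[OF f this] conj[OF g[folded \<open>f = g\<close>] this]
    have "FHom ?P j k \<cdot> FHom M j k = FHom ?P j k \<cdot> FHom N j k"
      by simp
    then show "FHom M j k = FHom N j k"
      unfolding commutant_simps(3)[OF j k]
      by (rule end_cancel_Unit[OF T(1) is_algebra_alg_cot[OF T j] is_algebra_alg_cot[OF T k], rotated -1])
        (use theory_morphism_simps[OF sf(1,5) j k] theory_morphism_simps[OF sg(1,5) j k]
         in \<open>simp_all add: commutant_theory_simps(2)\<close>)
  qed (use sf(8,15) sg(15) in auto)
qed

end

section \<open>Tensor products of enriched categories\<close>

context symmetric_monoidal_closed_category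
begin

lemma middle_simps [simp]:
  assumes "w \<in> Ob V" "x \<in> Ob V" "y \<in> Ob V" "z \<in> Ob V"
  shows "middle V w x y z \<in> Arr V" "Dom V (middle V w x y z) = (w \<otimes> x) \<otimes> (y \<otimes> z)"
    "Cod V (middle V w x y z) = (w \<otimes> y) \<otimes> (x \<otimes> z)"
  using assms by (auto simp: middle_def)

lemma middle_nat:
  assumes f: "f \<in> Arr V" "g \<in> Arr V" "h \<in> Arr V" "k \<in> Arr V"
    "Cod V f = w" "Cod V g = x" "Cod V h = y" "Cod V k = z"
  shows "middle V w x y z \<cdot> ((f \<odot> g) \<odot> (h \<odot> k))
    = ((f \<odot> h) \<odot> (g \<odot> k)) \<cdot> middle V (Dom V f) (Dom V g) (Dom V h) (Dom V k)"
proof -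
  have Ob: "w \<in> Ob V" "x \<in> Ob V" "y \<in> Ob V" "z \<in> Ob V"
    using f by auto
  let ?s = "\<lambda>x y z. Assoc V y x z \<cdot> (Sym V x y \<odot> Id V z) \<cdot> inv_arr V (Assoc V x y z)"
  have s: "?s x y z \<in> Arr V" "Dom V (?s x y z) = x \<otimes> (y \<otimes> z)" "Cod V (?s x y z) = y \<otimes> (x \<otimes> z)"
    if "x \<in> Ob V" "y \<in> Ob V" "z \<in> Ob V" for x y z
    using that by auto
  have inner: "?s x y z \<cdot> (g \<odot> (h \<odot> k)) = (h \<odot> (g \<odot> k)) \<cdot> ?s (Dom V g) (Dom V h) (Dom V k)"
  proof -
    have "?s x y z \<cdot> (g \<odot> (h \<odot> k))
      = Assoc V y x z \<cdot> ((Sym V x y \<odot> Id V z) \<cdot> (((g \<odot> h) \<odot> k) \<cdot> inv_arr V (Assoc V (Dom V g) (Dom V h) (Dom V k))))"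
      using f Ob by (simp add: Assoc_inv_nat)
    also have "\<dots> = Assoc V y x z \<cdot> ((((h \<odot> g) \<odot> k) \<cdot> (Sym V (Dom V g) (Dom V h) \<odot> Id V (Dom V k)))
        \<cdot> inv_arr V (Assoc V (Dom V g) (Dom V h) (Dom V k)))"
      using f Ob by (simp add: ichg Sym_nat)
    also have "\<dots> = (h \<odot> (g \<odot> k)) \<cdot> ?s (Dom V g) (Dom V h) (Dom V k)"
      using f Ob comp_reduce[OF Assoc_nat[of h g k y x z]] by (simp add: interchange_reduce[symmetric])
    finally show ?thesis .
  qed
  have "middle V w x y z \<cdot> ((f \<odot> g) \<odot> (h \<odot> k))
    = inv_arr V (Assoc V w y (x \<otimes> z)) \<cdot> ((Id V w \<odot> ?s x y z) \<cdot> ((f \<odot> (g \<odot> (h \<odot> k)))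
       \<cdot> Assoc V (Dom V f) (Dom V g) (Dom V h \<otimes> Dom V k)))"
    unfolding middle_def using f Ob s[OF Ob(2,3,4)] by (simp add: Assoc_nat)
  also have "\<dots> = inv_arr V (Assoc V w y (x \<otimes> z)) \<cdot> ((f \<odot> (?s x y z \<cdot> (g \<odot> (h \<odot> k))))
       \<cdot> Assoc V (Dom V f) (Dom V g) (Dom V h \<otimes> Dom V k))"
    using f Ob s[OF Ob(2,3,4)] by (simp add: interchange_reduce del: assoc)
  also have "\<dots> = inv_arr V (Assoc V w y (x \<otimes> z)) \<cdot> ((f \<odot> (h \<odot> (g \<odot> k)))
      \<cdot> ((Id V (Dom V f) \<odot> ?s (Dom V g) (Dom V h) (Dom V k)) \<cdot> Assoc V (Dom V f) (Dom V g) (Dom V h \<otimes> Dom V k)))"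
    unfolding inner using f Ob s[of "Dom V g" "Dom V h" "Dom V k"] by (simp add: interchange_reduce del: assoc)
  also have "\<dots> = ((f \<odot> h) \<odot> (g \<odot> k)) \<cdot> middle V (Dom V f) (Dom V g) (Dom V h) (Dom V k)"
    unfolding middle_def using f Ob s[of "Dom V g" "Dom V h" "Dom V k"]
      comp_reduce[OF Assoc_inv_nat[of f h "g \<odot> k" w y "x \<otimes> z"],
        of "(Id V (Dom V f) \<odot> ?s (Dom V g) (Dom V h) (Dom V k)) \<cdot> Assoc V (Dom V f) (Dom V g) (Dom V h \<otimes> Dom V k)"]
    by simp
  finally show ?thesis .
qed

lemma Sym_RUnit_inv:
  assumes "y \<in> Ob V"
  shows "Sym V \<I> y \<cdot> inv_arr V (LUnit V y) = inv_arr V (RUnit V y)"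
    "Sym V y \<I> \<cdot> inv_arr V (RUnit V y) = inv_arr V (LUnit V y)"
proof -
  have "inv_arr V (LUnit V y \<cdot> Sym V y \<I>) = inv_arr V (RUnit V y)"
    using assms by (simp add: LUnit_Sym)
  then show *: "Sym V \<I> y \<cdot> inv_arr V (LUnit V y) = inv_arr V (RUnit V y)"
    using assms by (simp add: is_iso_Comp)
  show "Sym V y \<I> \<cdot> inv_arr V (RUnit V y) = inv_arr V (LUnit V y)"
    using assms by (simp flip: *)
qed

lemma LUnit_Tens_inv':
  assumes "x \<in> Ob V" "y \<in> Ob V"
  shows "inv_arr V (Assoc V \<I> x y) \<cdot> inv_arr V (LUnit V (x \<otimes> y)) = inv_arr V (LUnit V x) \<odot> Id V y"
  using assms by (simp flip: LUnit_Tens_inv)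

text \<open>The coherence behind restricting a functor of two variables: with the second variable
  held at an identity, two insertions of the unit must combine into one after the middle
  interchange. The triangle and the symmetry with \<open>\<I>\<close> achieve this.\<close>

lemma middle_RUnit:
  assumes [simp]: "w \<in> Ob V" "y \<in> Ob V"
  shows "middle V w \<I> y \<I> \<cdot> (inv_arr V (RUnit V w) \<odot> inv_arr V (RUnit V y))
    = (Id V (w \<otimes> y) \<odot> inv_arr V (LUnit V \<I>)) \<cdot> inv_arr V (RUnit V (w \<otimes> y))"
proof -
  let ?s = "Assoc V y \<I> \<I> \<cdot> (Sym V \<I> y \<odot> Id V \<I>) \<cdot> inv_arr V (Assoc V \<I> y \<I>)"
  have s: "?s \<in> Arr V" "Dom V ?s = \<I> \<otimes> (y \<otimes> \<I>)" "Cod V ?s = y \<otimes> (\<I> \<otimes> \<I>)"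
    by auto
  have 1: "Assoc V w \<I> (y \<otimes> \<I>) \<cdot> (inv_arr V (RUnit V w) \<odot> inv_arr V (RUnit V y))
    = Id V w \<odot> (inv_arr V (LUnit V (y \<otimes> \<I>)) \<cdot> inv_arr V (RUnit V y))"
  proof -
    have "Assoc V w \<I> (y \<otimes> \<I>) \<cdot> (inv_arr V (RUnit V w) \<odot> inv_arr V (RUnit V y))
      = Assoc V w \<I> (y \<otimes> \<I>) \<cdot> ((inv_arr V (RUnit V w) \<odot> Id V (y \<otimes> \<I>)) \<cdot> (Id V w \<odot> inv_arr V (RUnit V y)))"
      by (simp add: ichg)
    also have "\<dots> = (Id V w \<odot> inv_arr V (LUnit V (y \<otimes> \<I>))) \<cdot> (Id V w \<odot> inv_arr V (RUnit V y))"
      by (rule comp_reduce[OF triangle_inv]) auto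
    finally show ?thesis
      by (simp add: ichg)
  qed
  have 2: "?s \<cdot> (inv_arr V (LUnit V (y \<otimes> \<I>)) \<cdot> inv_arr V (RUnit V y))
    = (Id V y \<odot> inv_arr V (LUnit V \<I>)) \<cdot> inv_arr V (RUnit V y)"
  proof -
    have "?s \<cdot> (inv_arr V (LUnit V (y \<otimes> \<I>)) \<cdot> inv_arr V (RUnit V y))
      = Assoc V y \<I> \<I> \<cdot> ((Sym V \<I> y \<odot> Id V \<I>) \<cdot> ((inv_arr V (LUnit V y) \<odot> Id V \<I>) \<cdot> inv_arr V (RUnit V y)))"
      using comp_reduce[OF LUnit_Tens_inv'[of y \<I>], of "inv_arr V (RUnit V y)"] by simp
    also have "\<dots> = Assoc V y \<I> \<I> \<cdot> ((inv_arr V (RUnit V y) \<odot> Id V \<I>) \<cdot> inv_arr V (RUnit V y))"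
      by (simp add: ichg Sym_RUnit_inv)
    also have "\<dots> = (Id V y \<odot> inv_arr V (LUnit V \<I>)) \<cdot> inv_arr V (RUnit V y)"
      by (rule comp_reduce[OF triangle_inv]) auto
    finally show ?thesis .
  qed
  have "middle V w \<I> y \<I> \<cdot> (inv_arr V (RUnit V w) \<odot> inv_arr V (RUnit V y))
    = inv_arr V (Assoc V w y (\<I> \<otimes> \<I>)) \<cdot> ((Id V w \<odot> ?s) \<cdot>
       (Assoc V w \<I> (y \<otimes> \<I>) \<cdot> (inv_arr V (RUnit V w) \<odot> inv_arr V (RUnit V y))))"
    unfolding middle_def by simp
  also have "\<dots> = inv_arr V (Assoc V w y (\<I> \<otimes> \<I>)) \<cdot> (Id V w \<odot> ((Id V y \<odot> inv_arr V (LUnit V \<I>)) \<cdot> inv_arr V (RUnit V y)))"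
    unfolding 1 2[symmetric] using s by (simp add: interchange del: assoc)
  also have "\<dots> = inv_arr V (Assoc V w y (\<I> \<otimes> \<I>)) \<cdot> ((Id V w \<odot> (Id V y \<odot> inv_arr V (LUnit V \<I>))) \<cdot> (Id V w \<odot> inv_arr V (RUnit V y)))"
    by (simp add: ichg)
  also have "\<dots> = (((Id V w \<odot> Id V y) \<odot> inv_arr V (LUnit V \<I>)) \<cdot> inv_arr V (Assoc V w y \<I>)) \<cdot> (Id V w \<odot> inv_arr V (RUnit V y))"
    using comp_reduce[OF Assoc_inv_nat[of "Id V w" "Id V y" "inv_arr V (LUnit V \<I>)" w y "\<I> \<otimes> \<I>"],
        of "Id V w \<odot> inv_arr V (RUnit V y)"] by simp
  finally show ?thesis
    by (simp add: RUnit_Tens_inv)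
qed

lemma middle_LUnit:
  assumes [simp]: "x \<in> Ob V" "z \<in> Ob V"
  shows "middle V \<I> x \<I> z \<cdot> (inv_arr V (LUnit V x) \<odot> inv_arr V (LUnit V z))
    = (inv_arr V (LUnit V \<I>) \<odot> Id V (x \<otimes> z)) \<cdot> inv_arr V (LUnit V (x \<otimes> z))"
proof -
  let ?s = "Assoc V \<I> x z \<cdot> (Sym V x \<I> \<odot> Id V z) \<cdot> inv_arr V (Assoc V x \<I> z)"
  have s: "?s \<in> Arr V" "Dom V ?s = x \<otimes> (\<I> \<otimes> z)" "Cod V ?s = \<I> \<otimes> (x \<otimes> z)"
    by auto
  have 1: "Assoc V \<I> x (\<I> \<otimes> z) \<cdot> (inv_arr V (LUnit V x) \<odot> inv_arr V (LUnit V z))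
    = (Id V \<I> \<odot> (Id V x \<odot> inv_arr V (LUnit V z))) \<cdot> inv_arr V (LUnit V (x \<otimes> z))"
  proof -
    have "Assoc V \<I> x (\<I> \<otimes> z) \<cdot> (inv_arr V (LUnit V x) \<odot> inv_arr V (LUnit V z))
      = Assoc V \<I> x (\<I> \<otimes> z) \<cdot> ((inv_arr V (LUnit V x) \<odot> Id V (\<I> \<otimes> z)) \<cdot> (Id V x \<odot> inv_arr V (LUnit V z)))"
      by (simp add: ichg)
    also have "\<dots> = inv_arr V (LUnit V (x \<otimes> (\<I> \<otimes> z))) \<cdot> (Id V x \<odot> inv_arr V (LUnit V z))"
      by (rule comp_reduce[OF LUnit_Tens_inv]) auto
    finally show ?thesis
      by (simp add: LUnit_inv_nat)
  qed
  have 2: "?s \<cdot> (Id V x \<odot> inv_arr V (LUnit V z)) = inv_arr V (LUnit V (x \<otimes> z))"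
  proof -
    have "?s \<cdot> (Id V x \<odot> inv_arr V (LUnit V z))
      = Assoc V \<I> x z \<cdot> ((Sym V x \<I> \<odot> Id V z) \<cdot> (inv_arr V (RUnit V x) \<odot> Id V z))"
      by (simp flip: triangle_inv)
    also have "\<dots> = inv_arr V (LUnit V (x \<otimes> z))"
      by (simp add: ichg Sym_RUnit_inv LUnit_Tens_inv)
    finally show ?thesis .
  qed
  have "middle V \<I> x \<I> z \<cdot> (inv_arr V (LUnit V x) \<odot> inv_arr V (LUnit V z))
    = inv_arr V (Assoc V \<I> \<I> (x \<otimes> z)) \<cdot> ((Id V \<I> \<odot> ?s) \<cdot>
       (Assoc V \<I> x (\<I> \<otimes> z) \<cdot> (inv_arr V (LUnit V x) \<odot> inv_arr V (LUnit V z))))"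
    unfolding middle_def by simp
  also have "\<dots> = inv_arr V (Assoc V \<I> \<I> (x \<otimes> z)) \<cdot> ((Id V \<I> \<odot> inv_arr V (LUnit V (x \<otimes> z))) \<cdot> inv_arr V (LUnit V (x \<otimes> z)))"
    unfolding 1 2[symmetric] using s by (simp add: interchange_reduce del: assoc)
  also have "\<dots> = (inv_arr V (RUnit V \<I>) \<odot> Id V (x \<otimes> z)) \<cdot> inv_arr V (LUnit V (x \<otimes> z))"
    by (simp flip: triangle_inv)
  finally show ?thesis
    by (simp add: LUnit_Unit)
qed

section \<open>Functors of two variables and their partial functors\<close>

lemma vtensor_simps [simp]:
  "VOb (vtensor V A B) = VOb A \<times> VOb B"
  "VHom (vtensor V A B) (a, b) (a', b') = VHom A a a' \<otimes> VHom B b b'"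
  "VId (vtensor V A B) (a, b) = (VId A a \<odot> VId B b) \<cdot> inv_arr V (LUnit V \<I>)"
  "VComp (vtensor V A B) (a, b) (a', b') (a'', b'') = (VComp A a a' a'' \<odot> VComp B b b' b'')
       \<cdot> middle V (VHom A a' a'') (VHom B b' b'') (VHom A a a') (VHom B b b')"
  by (simp_all add: vtensor_def)

lemma vfun_tensor_simps [simp]:
  "\<lbrakk>a \<in> VOb A; b \<in> VOb B\<rbrakk> \<Longrightarrow> FOb (vfun_tensor V A B F G) (a, b) = (FOb F a, FOb G b)"
  "\<lbrakk>a \<in> VOb A; b \<in> VOb B; a' \<in> VOb A; b' \<in> VOb B\<rbrakk>
    \<Longrightarrow> FHom (vfun_tensor V A B F G) (a, b) (a', b') = FHom F a a' \<odot> FHom G b b'"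
  by (simp_all add: vfun_tensor_def)

lemma fix_right_simps [simp]:
  "a \<in> VOb A \<Longrightarrow> FOb (fix_right V A B F b) a = FOb F (a, b)"
  "\<lbrakk>a \<in> VOb A; a' \<in> VOb A\<rbrakk> \<Longrightarrow> FHom (fix_right V A B F b) a a' =
     FHom F (a, b) (a', b) \<cdot> (Id V (VHom A a a') \<odot> VId B b) \<cdot> inv_arr V (RUnit V (VHom A a a'))"
  by (simp_all add: fix_right_def)

lemma fix_left_simps [simp]:
  "b \<in> VOb B \<Longrightarrow> FOb (fix_left V A B F a) b = FOb F (a, b)"
  "\<lbrakk>b \<in> VOb B; b' \<in> VOb B\<rbrakk> \<Longrightarrow> FHom (fix_left V A B F a) b b' =
     FHom F (a, b) (a, b') \<cdot> (VId A a \<odot> Id V (VHom B b b')) \<cdot> inv_arr V (LUnit V (VHom B b b'))"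
  by (simp_all add: fix_left_def)

lemma bifunctor_simps:
  assumes "vfunctor V (vtensor V A B) C F" "a \<in> VOb A" "b \<in> VOb B"
  shows "FOb F (a, b) \<in> VOb C"
    "FHom F (a, b) (a, b) \<cdot> ((VId A a \<odot> VId B b) \<cdot> inv_arr V (LUnit V \<I>)) = VId C (FOb F (a, b))"
    "\<lbrakk>a' \<in> VOb A; b' \<in> VOb B\<rbrakk> \<Longrightarrow> FHom F (a, b) (a', b') \<in> Arr V"
    "\<lbrakk>a' \<in> VOb A; b' \<in> VOb B\<rbrakk> \<Longrightarrow> Dom V (FHom F (a, b) (a', b')) = VHom A a a' \<otimes> VHom B b b'"
    "\<lbrakk>a' \<in> VOb A; b' \<in> VOb B\<rbrakk> \<Longrightarrow> Cod V (FHom F (a, b) (a', b')) = VHom C (FOb F (a, b)) (FOb F (a', b'))"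
  using vfunctor_simps[OF assms(1), of "(a, b)"] assms(2,3) by auto

lemma bifunctor_Comp:
  assumes A: "vcategory V A" "vcategory V B" "vcategory V C" and F: "vfunctor V (vtensor V A B) C F"
    and a: "a \<in> VOb A" "a' \<in> VOb A" "a'' \<in> VOb A" and b: "b \<in> VOb B" "b' \<in> VOb B" "b'' \<in> VOb B"
    and f: "f \<in> Arr V" "Cod V f = VHom A a a' \<otimes> VHom B b b'" and g: "g \<in> Arr V" "Cod V g = VHom A a' a'' \<otimes> VHom B b' b''"
  shows "ecomp C (FOb F (a, b)) (FOb F (a', b')) (FOb F (a'', b'')) (FHom F (a', b') (a'', b'') \<cdot> g) (FHom F (a, b) (a', b') \<cdot> f)
    = FHom F (a, b) (a'', b'') \<cdot> ((VComp A a a' a'' \<odot> VComp B b b' b'')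
       \<cdot> (middle V (VHom A a' a'') (VHom B b' b'') (VHom A a a') (VHom B b b') \<cdot> (g \<odot> f)))"
proof -
  note s = bifunctor_simps(1)[OF F a(1) b(1)] bifunctor_simps(1)[OF F a(2) b(2)] bifunctor_simps(1)[OF F a(3) b(3)]
    bifunctor_simps(3-5)[OF F a(1) b(1) a(2) b(2)] bifunctor_simps(3-5)[OF F a(2) b(2) a(3) b(3)]
    bifunctor_simps(3-5)[OF F a(1) b(1) a(3) b(3)]
  have "FHom F (a, b) (a'', b'') \<cdot> ((VComp A a a' a'' \<odot> VComp B b b' b'')
       \<cdot> middle V (VHom A a' a'') (VHom B b' b'') (VHom A a a') (VHom B b b'))
    = ecomp C (FOb F (a, b)) (FOb F (a', b')) (FOb F (a'', b'')) (FHom F (a', b') (a'', b'')) (FHom F (a, b) (a', b'))"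
    using vfunctorD(5)[OF F] a b by auto
  from comp_reduce[OF this, of "g \<odot> f"] show ?thesis
    using A a b f g s by (simp add: ecomp_Comp)
qed

text \<open>The partial functor is \<open>F\<close> after
  \<open>t \<mapsto> t \<odot> VId B b\<close>. Through the middle interchange, compatibility with
  composition reduces to \<open>middle_RUnit\<close> and to \<open>VId B b\<close> composed with
  itself being \<open>VId B b\<close>.\<close>

lemma vfunctor_fix_right:
  assumes A: "vcategory V A" "vcategory V B" "vcategory V C" and F: "vfunctor V (vtensor V A B) C F" and b: "b \<in> VOb B"
  shows "vfunctor V A C (fix_right V A B F b)"
proof (rule vfunctorI)
  fix a assume a: "a \<in> VOb A"
  note s = bifunctor_simps[OF F a b]
  show "FHom (fix_right V A B F b) a a \<cdot> VId A a = VId C (FOb (fix_right V A B F b) a)"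
    using A a b s(2) s(3-5)[OF a b] by (simp add: RUnit_inv_nat ichg LUnit_Unit)
next
  fix a c assume ac: "a \<in> VOb A" "c \<in> VOb A"
  note s = bifunctor_simps[OF F ac(1) b]
  show "FHom (fix_right V A B F b) a c \<in> Hom V (VHom A a c) (VHom C (FOb (fix_right V A B F b) a) (FOb (fix_right V A B F b) c))"
    using A ac b s(3-5)[OF ac(2) b] by (simp add: in_Hom)
next
  fix a c d assume a: "a \<in> VOb A" "c \<in> VOb A" "d \<in> VOb A"
  let ?i = "\<lambda>a c. (Id V (VHom A a c) \<odot> VId B b) \<cdot> inv_arr V (RUnit V (VHom A a c))"
  have i: "?i a c \<in> Arr V" "Dom V (?i a c) = VHom A a c" "Cod V (?i a c) = VHom A a c \<otimes> VHom B b b"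
    if "a \<in> VOb A" "c \<in> VOb A" for a c
    using that A b by auto
  note s = bifunctor_simps(3-5)[OF F a(1) b a(3) b]
  have "ecomp C (FOb F (a, b)) (FOb F (c, b)) (FOb F (d, b)) (FHom F (c, b) (d, b) \<cdot> ?i c d) (FHom F (a, b) (c, b) \<cdot> ?i a c)
    = FHom F (a, b) (d, b) \<cdot> ((VComp A a c d \<odot> VComp B b b b)
       \<cdot> (middle V (VHom A c d) (VHom B b b) (VHom A a c) (VHom B b b) \<cdot> (?i c d \<odot> ?i a c)))"
    by (rule bifunctor_Comp[OF A F a b b b]) (use i a in auto)
  also have "middle V (VHom A c d) (VHom B b b) (VHom A a c) (VHom B b b) \<cdot> (?i c d \<odot> ?i a c)
    = (middle V (VHom A c d) (VHom B b b) (VHom A a c) (VHom B b b)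
       \<cdot> ((Id V (VHom A c d) \<odot> VId B b) \<odot> (Id V (VHom A a c) \<odot> VId B b)))
      \<cdot> (inv_arr V (RUnit V (VHom A c d)) \<odot> inv_arr V (RUnit V (VHom A a c)))"
    using A a b by (simp add: interchange)
  also have "\<dots> = (Id V (VHom A c d \<otimes> VHom A a c) \<odot> (VId B b \<odot> VId B b))
      \<cdot> (middle V (VHom A c d) \<I> (VHom A a c) \<I> \<cdot> (inv_arr V (RUnit V (VHom A c d)) \<odot> inv_arr V (RUnit V (VHom A a c))))"
    using A a b by (simp add: middle_nat)
  also have "\<dots> = (Id V (VHom A c d \<otimes> VHom A a c) \<odot> ((VId B b \<odot> VId B b) \<cdot> inv_arr V (LUnit V \<I>)))
      \<cdot> inv_arr V (RUnit V (VHom A c d \<otimes> VHom A a c))"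
    using A a b by (simp add: middle_RUnit ichg)
  also have "(VComp A a c d \<odot> VComp B b b b) \<cdot> \<dots>
    = (VComp A a c d \<odot> (VComp B b b b \<cdot> (VId B b \<odot> VId B b) \<cdot> inv_arr V (LUnit V \<I>)))
      \<cdot> inv_arr V (RUnit V (VHom A c d \<otimes> VHom A a c))"
    using A a b by (simp add: ichg)
  also have "VComp B b b b \<cdot> (VId B b \<odot> VId B b) \<cdot> inv_arr V (LUnit V \<I>) = VId B b"
    using lact_Id[OF A(2) b b, of "VId B b"] A b by (simp add: lact_def ecomp_def)
  also have "(VComp A a c d \<odot> VId B b) \<cdot> inv_arr V (RUnit V (VHom A c d \<otimes> VHom A a c)) = ?i a d \<cdot> VComp A a c d"
    using A a b by (simp add: RUnit_inv_nat ichg)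
  finally show "FHom (fix_right V A B F b) a d \<cdot> VComp A a c d
    = ecomp C (FOb (fix_right V A B F b) a) (FOb (fix_right V A B F b) c) (FOb (fix_right V A B F b) d)
       (FHom (fix_right V A B F b) c d) (FHom (fix_right V A B F b) a c)"
    using A a b s i[OF a(1,3)] by simp
qed (use bifunctor_simps(1)[OF F _ b] in \<open>auto simp: fix_right_def\<close>)

lemma vfunctor_fix_left:
  assumes A: "vcategory V A" "vcategory V B" "vcategory V C" and F: "vfunctor V (vtensor V A B) C F" and a: "a \<in> VOb A"
  shows "vfunctor V B C (fix_left V A B F a)"
proof (rule vfunctorI)
  fix b assume b: "b \<in> VOb B"
  note s = bifunctor_simps[OF F a b]
  show "FHom (fix_left V A B F a) b b \<cdot> VId B b = VId C (FOb (fix_left V A B F a) b)"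
    using A a b s(2) s(3-5)[OF a b] by (simp add: LUnit_inv_nat ichg)
next
  fix b c assume bc: "b \<in> VOb B" "c \<in> VOb B"
  note s = bifunctor_simps[OF F a bc(1)]
  show "FHom (fix_left V A B F a) b c \<in> Hom V (VHom B b c) (VHom C (FOb (fix_left V A B F a) b) (FOb (fix_left V A B F a) c))"
    using A bc a s(3-5)[OF a bc(2)] by (simp add: in_Hom)
next
  fix b c d assume b: "b \<in> VOb B" "c \<in> VOb B" "d \<in> VOb B"
  let ?i = "\<lambda>b c. (VId A a \<odot> Id V (VHom B b c)) \<cdot> inv_arr V (LUnit V (VHom B b c))"
  have i: "?i b c \<in> Arr V" "Dom V (?i b c) = VHom B b c" "Cod V (?i b c) = VHom A a a \<otimes> VHom B b c"
    if "b \<in> VOb B" "c \<in> VOb B" for b c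
    using that A a by auto
  note s = bifunctor_simps(3-5)[OF F a b(1) a b(3)]
  have "ecomp C (FOb F (a, b)) (FOb F (a, c)) (FOb F (a, d)) (FHom F (a, c) (a, d) \<cdot> ?i c d) (FHom F (a, b) (a, c) \<cdot> ?i b c)
    = FHom F (a, b) (a, d) \<cdot> ((VComp A a a a \<odot> VComp B b c d)
       \<cdot> (middle V (VHom A a a) (VHom B c d) (VHom A a a) (VHom B b c) \<cdot> (?i c d \<odot> ?i b c)))"
    by (rule bifunctor_Comp[OF A F a a a b]) (use i b in auto)
  also have "middle V (VHom A a a) (VHom B c d) (VHom A a a) (VHom B b c) \<cdot> (?i c d \<odot> ?i b c)
    = (middle V (VHom A a a) (VHom B c d) (VHom A a a) (VHom B b c)
       \<cdot> ((VId A a \<odot> Id V (VHom B c d)) \<odot> (VId A a \<odot> Id V (VHom B b c))))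
      \<cdot> (inv_arr V (LUnit V (VHom B c d)) \<odot> inv_arr V (LUnit V (VHom B b c)))"
    using A a b by (simp add: interchange)
  also have "\<dots> = ((VId A a \<odot> VId A a) \<odot> Id V (VHom B c d \<otimes> VHom B b c))
      \<cdot> (middle V \<I> (VHom B c d) \<I> (VHom B b c) \<cdot> (inv_arr V (LUnit V (VHom B c d)) \<odot> inv_arr V (LUnit V (VHom B b c))))"
    using A a b by (simp add: middle_nat)
  also have "\<dots> = (((VId A a \<odot> VId A a) \<cdot> inv_arr V (LUnit V \<I>)) \<odot> Id V (VHom B c d \<otimes> VHom B b c))
      \<cdot> inv_arr V (LUnit V (VHom B c d \<otimes> VHom B b c))"
    using A a b by (simp add: middle_LUnit ichg)
  also have "(VComp A a a a \<odot> VComp B b c d) \<cdot> \<dots>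
    = ((VComp A a a a \<cdot> (VId A a \<odot> VId A a) \<cdot> inv_arr V (LUnit V \<I>)) \<odot> VComp B b c d)
      \<cdot> inv_arr V (LUnit V (VHom B c d \<otimes> VHom B b c))"
    using A a b by (simp add: ichg)
  also have "VComp A a a a \<cdot> (VId A a \<odot> VId A a) \<cdot> inv_arr V (LUnit V \<I>) = VId A a"
    using lact_Id[OF A(1) a a, of "VId A a"] A a by (simp add: lact_def ecomp_def)
  also have "(VId A a \<odot> VComp B b c d) \<cdot> inv_arr V (LUnit V (VHom B c d \<otimes> VHom B b c)) = ?i b d \<cdot> VComp B b c d"
    using A a b by (simp add: LUnit_inv_nat ichg)
  finally show "FHom (fix_left V A B F a) b d \<cdot> VComp B b c d
    = ecomp C (FOb (fix_left V A B F a) b) (FOb (fix_left V A B F a) c) (FOb (fix_left V A B F a) d)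
       (FHom (fix_left V A B F a) c d) (FHom (fix_left V A B F a) b c)"
    using A a b s i[OF b(1,3)] by simp
qed (use bifunctor_simps(1)[OF F a] in \<open>auto simp: fix_left_def\<close>)

text \<open>A cross-morphism is a transformation on \<open>T \<otimes> U'\<close>, so both of its
  ends are functors reindexed in this way, each of them in a single variable.\<close>

abbreviation bicomp where
  "bicomp A B F M N \<equiv> vcomp V (vtensor V A B) F (vfun_tensor V A B M N)"

lemma vfunctor_bicomp:
  assumes A: "vcategory V A" "vcategory V B" "vcategory V A'" "vcategory V B'" "vcategory V C"
    and F: "vfunctor V (vtensor V A' B') C F" and M: "vfunctor V A A' M" "vfunctor V B B' N"
  shows "vfunctor V (vtensor V A B) C (bicomp A B F M N)"
proof (rule vfunctorI)
  fix p assume "p \<in> VOb (vtensor V A B)"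
  then obtain a b where p: "p = (a, b)" and ab: "a \<in> VOb A" "b \<in> VOb B"
    by auto
  have ab': "FOb M a \<in> VOb A'" "FOb N b \<in> VOb B'"
    using M ab by auto
  note s = bifunctor_simps[OF F ab']
  note m = vfunctor_simps(2-5)[OF M(1) ab(1)] vfunctor_simps(2-5)[OF M(2) ab(2)]
  show "FHom (bicomp A B F M N) p p \<cdot> VId (vtensor V A B) p = VId C (FOb (bicomp A B F M N) p)"
    using A ab ab' s(2) s(3-5)[OF ab'] m by (simp add: p ichg)
next
  fix p q r assume "p \<in> VOb (vtensor V A B)" "q \<in> VOb (vtensor V A B)" "r \<in> VOb (vtensor V A B)"
  then obtain a b a' b' a'' b'' where p: "p = (a, b)" "q = (a', b')" "r = (a'', b'')"
    and a: "a \<in> VOb A" "a' \<in> VOb A" "a'' \<in> VOb A" and b: "b \<in> VOb B" "b' \<in> VOb B" "b'' \<in> VOb B"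
    by auto
  have fa: "FOb M a \<in> VOb A'" "FOb M a' \<in> VOb A'" "FOb M a'' \<in> VOb A'"
    and fb: "FOb N b \<in> VOb B'" "FOb N b' \<in> VOb B'" "FOb N b'' \<in> VOb B'"
    using M a b by auto
  note m = vfunctor_simps(3-5)[OF M(1) a(1,2)] vfunctor_simps(3-5)[OF M(1) a(2,3)] vfunctor_simps(3-5)[OF M(1) a(1,3)]
    vfunctor_simps(3-5)[OF M(2) b(1,2)] vfunctor_simps(3-5)[OF M(2) b(2,3)] vfunctor_simps(3-5)[OF M(2) b(1,3)]
  note s = bifunctor_simps(3-5)[OF F fa(1) fb(1) fa(3) fb(3)]
  have cM: "FHom M a a'' \<cdot> VComp A a a' a'' = VComp A' (FOb M a) (FOb M a') (FOb M a'') \<cdot> (FHom M a' a'' \<odot> FHom M a a')"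
    using vfunctorD(5)[OF M(1)] a unfolding ecomp_def by blast
  have cN: "FHom N b b'' \<cdot> VComp B b b' b'' = VComp B' (FOb N b) (FOb N b') (FOb N b'') \<cdot> (FHom N b' b'' \<odot> FHom N b b')"
    using vfunctorD(5)[OF M(2)] b unfolding ecomp_def by blast
  let ?F = "\<lambda>a b a' b'. FHom F (FOb M a, FOb N b) (FOb M a', FOb N b')"
  let ?O = "\<lambda>a b. FOb F (FOb M a, FOb N b)"
  have "ecomp C (?O a b) (?O a' b') (?O a'' b'') (?F a' b' a'' b'' \<cdot> (FHom M a' a'' \<odot> FHom N b' b''))
      (?F a b a' b' \<cdot> (FHom M a a' \<odot> FHom N b b'))
    = ?F a b a'' b'' \<cdot> ((VComp A' (FOb M a) (FOb M a') (FOb M a'') \<odot> VComp B' (FOb N b) (FOb N b') (FOb N b''))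
      \<cdot> (middle V (VHom A' (FOb M a') (FOb M a'')) (VHom B' (FOb N b') (FOb N b''))
          (VHom A' (FOb M a) (FOb M a')) (VHom B' (FOb N b) (FOb N b'))
        \<cdot> ((FHom M a' a'' \<odot> FHom N b' b'') \<odot> (FHom M a a' \<odot> FHom N b b'))))"
    by (rule bifunctor_Comp[OF A(3-5) F fa fb]) (use m in auto)
  also have "\<dots> = ?F a b a'' b'' \<cdot> (((VComp A' (FOb M a) (FOb M a') (FOb M a'') \<cdot> (FHom M a' a'' \<odot> FHom M a a'))
        \<odot> (VComp B' (FOb N b) (FOb N b') (FOb N b'') \<cdot> (FHom N b' b'' \<odot> FHom N b b')))
      \<cdot> middle V (VHom A a' a'') (VHom B b' b'') (VHom A a a') (VHom B b b'))"
    using A a b fa fb m by (simp add: middle_nat ichg)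
  also have "\<dots> = (?F a b a'' b'' \<cdot> (FHom M a a'' \<odot> FHom N b b''))
      \<cdot> ((VComp A a a' a'' \<odot> VComp B b b' b'') \<cdot> middle V (VHom A a' a'') (VHom B b' b'') (VHom A a a') (VHom B b b'))"
    unfolding cM[symmetric] cN[symmetric] using A a b m s by (simp add: ichg)
  finally show "FHom (bicomp A B F M N) p r \<cdot> VComp (vtensor V A B) p q r =
     ecomp C (FOb (bicomp A B F M N) p) (FOb (bicomp A B F M N) q) (FOb (bicomp A B F M N) r)
       (FHom (bicomp A B F M N) q r) (FHom (bicomp A B F M N) p q)"
    unfolding p using a b by simp
next
  fix p q assume "p \<in> VOb (vtensor V A B)" "q \<in> VOb (vtensor V A B)"
  then obtain a b a' b' where p: "p = (a, b)" "q = (a', b')"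
    and a: "a \<in> VOb A" "a' \<in> VOb A" and b: "b \<in> VOb B" "b' \<in> VOb B"
    by auto
  have fa: "FOb M a \<in> VOb A'" "FOb M a' \<in> VOb A'" and fb: "FOb N b \<in> VOb B'" "FOb N b' \<in> VOb B'"
    using M a b by auto
  show "FHom (bicomp A B F M N) p q \<in> Hom V (VHom (vtensor V A B) p q)
      (VHom C (FOb (bicomp A B F M N) p) (FOb (bicomp A B F M N) q))"
    unfolding p in_Hom
    using a b vfunctor_simps(3-5)[OF M(1) a] vfunctor_simps(3-5)[OF M(2) b] bifunctor_simps(3-5)[OF F fa(1) fb(1) fa(2) fb(2)]
    by simp
next
  show "FOb (bicomp A B F M N) \<in> VOb (vtensor V A B) \<rightarrow>\<^sub>E VOb C"
    using bifunctor_simps(1)[OF F] M by (auto simp: vcomp_def vfun_tensor_def)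
qed (auto simp: vcomp_def)

lemma bicomp_vid:
  assumes A: "vcategory V A" "vcategory V B" "vcategory V C" and F: "vfunctor V (vtensor V A B) C F"
  shows "bicomp A B F (vid V A) (vid V B) = F"
proof (rule vfun_eqI[OF vfunctor_bicomp[OF A(1,2,1-3) F vfunctor_vid[OF A(1)] vfunctor_vid[OF A(2)]] F])
  fix p q assume "p \<in> VOb (vtensor V A B)" "q \<in> VOb (vtensor V A B)"
  then obtain a b a' b' where p: "p = (a, b)" "q = (a', b')"
    and a: "a \<in> VOb A" "a' \<in> VOb A" and b: "b \<in> VOb B" "b' \<in> VOb B"
    by auto
  show "FHom (bicomp A B F (vid V A) (vid V B)) p q = FHom F p q"
    unfolding p using A a b bifunctor_simps(3-5)[OF F a(1) b(1) a(2) b(2)] by simp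
qed auto

lemma bicomp_bicomp:
  assumes A: "vcategory V A" "vcategory V B" "vcategory V A'" "vcategory V B'" "vcategory V A''" "vcategory V B''" "vcategory V C"
    and F: "vfunctor V (vtensor V A'' B'') C F" and M: "vfunctor V A' A'' M" "vfunctor V B' B'' N"
    and M': "vfunctor V A A' M'" "vfunctor V B B' N'"
  shows "bicomp A B (bicomp A' B' F M N) M' N' = bicomp A B F (vcomp V A M M') (vcomp V B N N')"
proof (rule vfun_eqI)
  show "vfunctor V (vtensor V A B) C (bicomp A B (bicomp A' B' F M N) M' N')"
    using A F M M' by (meson vfunctor_bicomp)
  show "vfunctor V (vtensor V A B) C (bicomp A B F (vcomp V A M M') (vcomp V B N N'))"
    using A F M M' by (meson vfunctor_bicomp vfunctor_vcomp)
next
  fix p assume "p \<in> VOb (vtensor V A B)"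
  then obtain a b where p: "p = (a, b)" and ab: "a \<in> VOb A" "b \<in> VOb B"
    by auto
  have ab': "FOb M' a \<in> VOb A'" "FOb N' b \<in> VOb B'"
    using M' ab by auto
  show "FOb (bicomp A B (bicomp A' B' F M N) M' N') p = FOb (bicomp A B F (vcomp V A M M') (vcomp V B N N')) p"
    unfolding p using ab ab' by simp
next
  fix p q assume "p \<in> VOb (vtensor V A B)" "q \<in> VOb (vtensor V A B)"
  then obtain a b c d where p: "p = (a, b)" "q = (c, d)" and ab: "a \<in> VOb A" "b \<in> VOb B" "c \<in> VOb A" "d \<in> VOb B"
    by auto
  have ab': "FOb M' a \<in> VOb A'" "FOb N' b \<in> VOb B'" "FOb M' c \<in> VOb A'" "FOb N' d \<in> VOb B'"
    using M' ab by auto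
  have ab'': "FOb M (FOb M' a) \<in> VOb A''" "FOb N (FOb N' b) \<in> VOb B''" "FOb M (FOb M' c) \<in> VOb A''" "FOb N (FOb N' d) \<in> VOb B''"
    using M ab' by auto
  show "FHom (bicomp A B (bicomp A' B' F M N) M' N') p q = FHom (bicomp A B F (vcomp V A M M') (vcomp V B N N')) p q"
    unfolding p using ab ab' bifunctor_simps(3-5)[OF F ab'']
      vfunctor_simps(3-5)[OF M'(1) ab(1,3)] vfunctor_simps(3-5)[OF M'(2) ab(2,4)]
      vfunctor_simps(3-5)[OF M(1) ab'(1,3)] vfunctor_simps(3-5)[OF M(2) ab'(2,4)]
    by (simp add: interchange)
qed

text \<open>\<open>N\<close> preserves the identity of \<open>b\<close>, so once \<open>b\<close> is
  fixed only the object \<open>FOb N b\<close> remains of it. This is how the faces of a reindexed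
  functor are computed.\<close>

lemma fix_right_bicomp:
  assumes A: "vcategory V A" "vcategory V B" "vcategory V A'" "vcategory V B'" "vcategory V C"
    and F: "vfunctor V (vtensor V A' B') C F" and M: "vfunctor V A A' M" "vfunctor V B B' N" and b: "b \<in> VOb B"
  shows "fix_right V A B (bicomp A B F M N) b = vcomp V A (fix_right V A' B' F (FOb N b)) M"
proof (rule vfun_eqI)
  have b': "FOb N b \<in> VOb B'"
    using M b by auto
  show "vfunctor V A C (fix_right V A B (bicomp A B F M N) b)"
    by (rule vfunctor_fix_right[OF A(1,2,5) vfunctor_bicomp[OF A F M] b])
  show "vfunctor V A C (vcomp V A (fix_right V A' B' F (FOb N b)) M)"
    by (rule vfunctor_vcomp[OF A(1,3,5) M(1) vfunctor_fix_right[OF A(3-5) F b']])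
  fix a c assume ac: "a \<in> VOb A" "c \<in> VOb A"
  have ac': "FOb M a \<in> VOb A'" "FOb M c \<in> VOb A'"
    using M ac by auto
  show "FHom (fix_right V A B (bicomp A B F M N) b) a c = FHom (vcomp V A (fix_right V A' B' F (FOb N b)) M) a c"
    using A ac ac' b b' bifunctor_simps(3-5)[OF F ac'(1) b' ac'(2) b']
      vfunctor_simps(3-5)[OF M(1) ac] vfunctor_simps(2-5)[OF M(2) b]
    by (simp add: ichg RUnit_inv_nat)
next
  fix a assume a: "a \<in> VOb A"
  then have "FOb M a \<in> VOb A'"
    using M by auto
  then show "FOb (fix_right V A B (bicomp A B F M N) b) a = FOb (vcomp V A (fix_right V A' B' F (FOb N b)) M) a"
    using a b by simp
qed

lemma fix_left_bicomp:
  assumes A: "vcategory V A" "vcategory V B" "vcategory V A'" "vcategory V B'" "vcategory V C"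
    and F: "vfunctor V (vtensor V A' B') C F" and M: "vfunctor V A A' M" "vfunctor V B B' N" and a: "a \<in> VOb A"
  shows "fix_left V A B (bicomp A B F M N) a = vcomp V B (fix_left V A' B' F (FOb M a)) N"
proof (rule vfun_eqI)
  have a': "FOb M a \<in> VOb A'"
    using M a by auto
  show "vfunctor V B C (fix_left V A B (bicomp A B F M N) a)"
    by (rule vfunctor_fix_left[OF A(1,2,5) vfunctor_bicomp[OF A F M] a])
  show "vfunctor V B C (vcomp V B (fix_left V A' B' F (FOb M a)) N)"
    by (rule vfunctor_vcomp[OF A(2,4,5) M(2) vfunctor_fix_left[OF A(3-5) F a']])
  fix b c assume bc: "b \<in> VOb B" "c \<in> VOb B"
  have bc': "FOb N b \<in> VOb B'" "FOb N c \<in> VOb B'"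
    using M bc by auto
  show "FHom (fix_left V A B (bicomp A B F M N) a) b c = FHom (vcomp V B (fix_left V A' B' F (FOb M a)) N) b c"
    using A bc bc' a a' bifunctor_simps(3-5)[OF F a' bc'(1) a' bc'(2)]
      vfunctor_simps(3-5)[OF M(2) bc] vfunctor_simps(2-5)[OF M(1) a]
    by (simp add: ichg LUnit_inv_nat)
next
  fix b assume b: "b \<in> VOb B"
  then have "FOb N b \<in> VOb B'"
    using M by auto
  then show "FOb (fix_left V A B (bicomp A B F M N) a) b = FOb (vcomp V B (fix_left V A' B' F (FOb M a)) N) b"
    using a b by simp
qed

section \<open>Faces of bifold algebras\<close>

lemma vtensor_VHom_Ob:
  assumes "vcategory V A" "vcategory V B"
  shows "\<forall>p \<in> VOb (vtensor V A B). \<forall>q \<in> VOb (vtensor V A B). VHom (vtensor V A B) p q \<in> Ob V"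
  using assms by auto

text \<open>Naturality in both variables, precomposed with
  \<open>t \<mapsto> t \<odot> VId B b\<close>.\<close>

lemma vnat_fix_right:
  assumes A: "vcategory V A" "vcategory V B" "vcategory V C"
    and F: "vfunctor V (vtensor V A B) C F" "vfunctor V (vtensor V A B) C G"
    and f: "vnat V (vtensor V A B) C F G f" and b: "b \<in> VOb B"
  shows "vnat V A C (fix_right V A B F b) (fix_right V A B G b) (\<lambda>a \<in> VOb A. f (a, b))"
  unfolding vnat_iff[OF A(1,3) vfunctor_fix_right[OF A F(1) b] vfunctor_fix_right[OF A F(2) b]]
proof (intro conjI ballI)
  fix a c assume ac: "a \<in> VOb A" "c \<in> VOb A"
  have ab: "(a, b) \<in> VOb (vtensor V A B)" "(c, b) \<in> VOb (vtensor V A B)"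
    using ac b by auto
  note s = bifunctor_simps(1)[OF F(1) ac(1) b] bifunctor_simps(1)[OF F(1) ac(2) b]
    bifunctor_simps(1)[OF F(2) ac(1) b] bifunctor_simps(1)[OF F(2) ac(2) b]
    bifunctor_simps(3-5)[OF F(1) ac(1) b ac(2) b] bifunctor_simps(3-5)[OF F(2) ac(1) b ac(2) b]
    vnat_simps[OF f ab(1)] vnat_simps[OF f ab(2)]
  let ?i = "(Id V (VHom A a c) \<odot> VId B b) \<cdot> inv_arr V (RUnit V (VHom A a c))"
  have i: "?i \<in> Arr V" "Dom V ?i = VHom A a c" "Cod V ?i = VHom A a c \<otimes> VHom B b b"
    using A ac b by auto
  have "lact C (FOb F (a, b)) (FOb F (c, b)) (FOb G (c, b)) (f (c, b)) (FHom F (a, b) (c, b)) \<cdot> ?i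
    = ract C (FOb F (a, b)) (FOb G (a, b)) (FOb G (c, b)) (FHom G (a, b) (c, b)) (f (a, b)) \<cdot> ?i"
    using vnat_iff_graph[OF vtensor_VHom_Ob[OF A(1,2)] A(3) F] f ab by simp
  moreover have "lact C (FOb F (a, b)) (FOb F (c, b)) (FOb G (c, b)) (f (c, b)) (FHom F (a, b) (c, b)) \<cdot> ?i
    = lact C (FOb F (a, b)) (FOb F (c, b)) (FOb G (c, b)) (f (c, b)) (FHom F (a, b) (c, b) \<cdot> ?i)"
    by (rule lact_Comp) (use A s i in auto)
  moreover have "ract C (FOb F (a, b)) (FOb G (a, b)) (FOb G (c, b)) (FHom G (a, b) (c, b)) (f (a, b)) \<cdot> ?i
    = ract C (FOb F (a, b)) (FOb G (a, b)) (FOb G (c, b)) (FHom G (a, b) (c, b) \<cdot> ?i) (f (a, b))"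
    by (rule ract_Comp) (use A s i in auto)
  ultimately show "lact C (FOb (fix_right V A B F b) a) (FOb (fix_right V A B F b) c) (FOb (fix_right V A B G b) c)
     ((\<lambda>a \<in> VOb A. f (a, b)) c) (FHom (fix_right V A B F b) a c)
    = ract C (FOb (fix_right V A B F b) a) (FOb (fix_right V A B G b) a) (FOb (fix_right V A B G b) c)
     (FHom (fix_right V A B G b) a c) ((\<lambda>a \<in> VOb A. f (a, b)) a)"
    using ac by simp
next
  fix a assume a: "a \<in> VOb A"
  then have "(a, b) \<in> VOb (vtensor V A B)"
    using b by simp
  then show "(\<lambda>a \<in> VOb A. f (a, b)) a \<in> Hom V \<I> (VHom C (FOb (fix_right V A B F b) a) (FOb (fix_right V A B G b) a))"
    using vnat_simps[OF f] a by (simp add: in_Hom)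
qed auto

lemma vnat_fix_left:
  assumes A: "vcategory V A" "vcategory V B" "vcategory V C"
    and F: "vfunctor V (vtensor V A B) C F" "vfunctor V (vtensor V A B) C G"
    and f: "vnat V (vtensor V A B) C F G f" and a: "a \<in> VOb A"
  shows "vnat V B C (fix_left V A B F a) (fix_left V A B G a) (\<lambda>b \<in> VOb B. f (a, b))"
  unfolding vnat_iff[OF A(2,3) vfunctor_fix_left[OF A F(1) a] vfunctor_fix_left[OF A F(2) a]]
proof (intro conjI ballI)
  fix b c assume bc: "b \<in> VOb B" "c \<in> VOb B"
  have ab: "(a, b) \<in> VOb (vtensor V A B)" "(a, c) \<in> VOb (vtensor V A B)"
    using bc a by auto
  note s = bifunctor_simps(1)[OF F(1) a bc(1)] bifunctor_simps(1)[OF F(1) a bc(2)]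
    bifunctor_simps(1)[OF F(2) a bc(1)] bifunctor_simps(1)[OF F(2) a bc(2)]
    bifunctor_simps(3-5)[OF F(1) a bc(1) a bc(2)] bifunctor_simps(3-5)[OF F(2) a bc(1) a bc(2)]
    vnat_simps[OF f ab(1)] vnat_simps[OF f ab(2)]
  let ?i = "(VId A a \<odot> Id V (VHom B b c)) \<cdot> inv_arr V (LUnit V (VHom B b c))"
  have i: "?i \<in> Arr V" "Dom V ?i = VHom B b c" "Cod V ?i = VHom A a a \<otimes> VHom B b c"
    using A bc a by auto
  have "lact C (FOb F (a, b)) (FOb F (a, c)) (FOb G (a, c)) (f (a, c)) (FHom F (a, b) (a, c)) \<cdot> ?i
    = ract C (FOb F (a, b)) (FOb G (a, b)) (FOb G (a, c)) (FHom G (a, b) (a, c)) (f (a, b)) \<cdot> ?i"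
    using vnat_iff_graph[OF vtensor_VHom_Ob[OF A(1,2)] A(3) F] f ab by simp
  moreover have "lact C (FOb F (a, b)) (FOb F (a, c)) (FOb G (a, c)) (f (a, c)) (FHom F (a, b) (a, c)) \<cdot> ?i
    = lact C (FOb F (a, b)) (FOb F (a, c)) (FOb G (a, c)) (f (a, c)) (FHom F (a, b) (a, c) \<cdot> ?i)"
    by (rule lact_Comp) (use A s i in auto)
  moreover have "ract C (FOb F (a, b)) (FOb G (a, b)) (FOb G (a, c)) (FHom G (a, b) (a, c)) (f (a, b)) \<cdot> ?i
    = ract C (FOb F (a, b)) (FOb G (a, b)) (FOb G (a, c)) (FHom G (a, b) (a, c) \<cdot> ?i) (f (a, b))"
    by (rule ract_Comp) (use A s i in auto)
  ultimately show "lact C (FOb (fix_left V A B F a) b) (FOb (fix_left V A B F a) c) (FOb (fix_left V A B G a) c)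
     ((\<lambda>b \<in> VOb B. f (a, b)) c) (FHom (fix_left V A B F a) b c)
    = ract C (FOb (fix_left V A B F a) b) (FOb (fix_left V A B G a) b) (FOb (fix_left V A B G a) c)
     (FHom (fix_left V A B G a) b c) ((\<lambda>b \<in> VOb B. f (a, b)) b)"
    using bc by simp
next
  fix b assume b: "b \<in> VOb B"
  then have "(a, b) \<in> VOb (vtensor V A B)"
    using a by simp
  then show "(\<lambda>b \<in> VOb B. f (a, b)) b \<in> Hom V \<I> (VHom C (FOb (fix_left V A B F a) b) (FOb (fix_left V A B G a) b))"
    using vnat_simps[OF f] b by (simp add: in_Hom)
qed auto

lemma vnat_iso_fix:
  assumes A: "vcategory V A" "vcategory V B" "vcategory V C"
    and F: "vfunctor V (vtensor V A B) C F" "vfunctor V (vtensor V A B) C G"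
    and f: "vnat_iso V (vtensor V A B) C F G f"
  shows "b \<in> VOb B \<Longrightarrow> vnat_iso V A C (fix_right V A B F b) (fix_right V A B G b) (\<lambda>a \<in> VOb A. f (a, b))"
    "a \<in> VOb A \<Longrightarrow> vnat_iso V B C (fix_left V A B F a) (fix_left V A B G a) (\<lambda>b \<in> VOb B. f (a, b))"
proof -
  obtain g where g: "vnat V (vtensor V A B) C F G f" "vnat V (vtensor V A B) C G F g"
    "\<forall>p \<in> VOb (vtensor V A B). vinverse C (FOb F p) (FOb G p) (f p) (g p)"
    using f vnat_iso_iff_graph[OF vtensor_VHom_Ob[OF A(1,2)] A(3) F] by blast
  show "vnat_iso V A C (fix_right V A B F b) (fix_right V A B G b) (\<lambda>a \<in> VOb A. f (a, b))" if b: "b \<in> VOb B"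
    unfolding vnat_iso_iff[OF A(1,3) vfunctor_fix_right[OF A F(1) b] vfunctor_fix_right[OF A F(2) b]]
    using vnat_fix_right[OF A F g(1) b] vnat_fix_right[OF A F(2,1) g(2) b] g(3) b
    by (intro exI[of _ "\<lambda>a \<in> VOb A. g (a, b)"]) simp
  show "vnat_iso V B C (fix_left V A B F a) (fix_left V A B G a) (\<lambda>b \<in> VOb B. f (a, b))" if a: "a \<in> VOb A"
    unfolding vnat_iso_iff[OF A(2,3) vfunctor_fix_left[OF A F(1) a] vfunctor_fix_left[OF A F(2) a]]
    using vnat_fix_left[OF A F g(1) a] vnat_fix_left[OF A F(2,1) g(2) a] g(3) a
    by (intro exI[of _ "\<lambda>b \<in> VOb B. g (a, b)"]) simp
qed

end

section \<open>Bifold algebras and their isomorphisms\<close>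

context admissible_vcategory
begin

lemma bifold_algebra_simps:
  assumes "bifold_algebra V J C (T, U, F)"
  shows "is_theory V J T" "is_theory V J U" "vfunctor V (vtensor V T U) C F"
    "k \<in> J \<Longrightarrow> preserves_cotensors V J T C (fix_right V T U F k)"
    "j \<in> J \<Longrightarrow> preserves_cotensors V J U C (fix_left V T U F j)"
    "vcategory V T" "vcategory V U" "VOb T = J" "VOb U = J"
proof -
  show *: "is_theory V J T" "is_theory V J U" "vfunctor V (vtensor V T U) C F"
    "k \<in> J \<Longrightarrow> preserves_cotensors V J T C (fix_right V T U F k)"
    "j \<in> J \<Longrightarrow> preserves_cotensors V J U C (fix_left V T U F j)"
    using assms by (simp_all add: bifold_algebra_def)
  show "vcategory V T" "vcategory V U" "VOb T = J" "VOb U = J"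
    using is_theory_simps(1,2) *(1,2) by auto
qed

lemma face_simps:
  "left_face V (T, U, F) = (T, fix_right V T U F \<I>)"
  "right_face V (T, U, F) = (U, fix_left V T U F \<I>)"
  "bcarrier V (T, U, F) = FOb F (\<I>, \<I>)"
  by (simp_all add: left_face_def right_face_def bcarrier_def)

lemma is_algebra_faces:
  assumes D: "bifold_algebra V J C (T, U, F)"
  shows "is_algebra V J C T (fix_right V T U F \<I>)" "is_algebra V J C U (fix_left V T U F \<I>)"
proof -
  note d = bifold_algebra_simps[OF D]
  show "is_algebra V J C T (fix_right V T U F \<I>)"
    unfolding is_algebra_def
    using d(4)[OF arities_simps(1)] vfunctor_fix_right[OF d(6,7) C d(3), of \<I>] d(9) by simp
  show "is_algebra V J C U (fix_left V T U F \<I>)"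
    unfolding is_algebra_def
    using d(5)[OF arities_simps(1)] vfunctor_fix_left[OF d(6,7) C d(3), of \<I>] d(8) by simp
qed

lemma algebra_faces:
  assumes "bifold_algebra V J C D"
  shows "algebra V J C (left_face V D)" "algebra V J C (right_face V D)"
    "carrier V (left_face V D) = bcarrier V D" "carrier V (right_face V D) = bcarrier V D"
    "bcarrier V D \<in> VOb C"
proof -
  obtain T U F where D: "D = (T, U, F)"
    by (metis surj_pair)
  note d = bifold_algebra_simps[OF assms[unfolded D]] and f = is_algebra_faces[OF assms[unfolded D]]
  show "algebra V J C (left_face V D)" "algebra V J C (right_face V D)"
    using d f by (simp_all add: D face_simps algebra_iff)
  show "carrier V (left_face V D) = bcarrier V D" "carrier V (right_face V D) = bcarrier V D"
    using d(8,9) by (simp_all add: D face_simps carrier_def)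
  show "bcarrier V D \<in> VOb C"
    using bifunctor_simps(1)[OF d(3)] d(8,9) by (simp add: D face_simps)
qed

lemma BAlg_simps:
  "Ob (BAlg V J C) = {D. bifold_algebra V J C D}"
  "((T, U, F), (M, N, f), (T', U', F')) \<in> Arr (BAlg V J C) \<longleftrightarrow>
       bifold_algebra V J C (T, U, F) \<and> bifold_algebra V J C (T', U', F') \<and>
       theory_morphism V J T T' M \<and> theory_morphism V J U' U N \<and>
       vnat_iso V (vtensor V T U') C (bicomp T U' F (vid V T) N) (bicomp T U' F' M (vid V U')) f"
  "Dom (BAlg V J C) (X, h, Y) = X"
  "Cod (BAlg V J C) (X, h, Y) = Y"
  "Id (BAlg V J C) (T, U, F) = ((T, U, F), (vid V T, vid V U, (\<lambda>p \<in> J \<times> J. VId C (FOb F p))), (T, U, F))"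
  "Comp (BAlg V J C) ((T', U', F'), (M', N', f'), (T'', U'', F'')) ((T, U, F), (M, N, f), Y) =
    ((T, U, F),
        (vcomp V T M' M, vcomp V U'' N N',
         (\<lambda>(j, k) \<in> J \<times> J.
            ucomp V C (FOb F (j, FOb N (FOb N' k))) (FOb F' (FOb M j, FOb N' k))
                    (FOb F'' (FOb M' (FOb M j), k))
              (f' (FOb M j, k)) (f (j, FOb N' k)))),
        (T'', U'', F''))"
  by (simp_all add: BAlg_def)

lemma io_isoI:
  assumes T: "is_theory V J T" "is_theory V J U" and M: "theory_morphism V J T U M" "theory_morphism V J U T N"
    and eq: "vcomp V T N M = vid V T" "vcomp V U M N = vid V U"
  shows "io_iso T U M N"
  unfolding io_iso_def
proof (intro conjI ballI)
  note t = is_theory_simps(2)[OF T(1)] is_theory_simps(2)[OF T(2)]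
  note m = theory_morphismD(1,2)[OF M(1)] theory_morphismD(1,2)[OF M(2)]
  fix j k assume jk: "j \<in> VOb T" "k \<in> VOb T"
  show "FOb M j = j" "FOb N j = j"
    using m t jk by auto
  have "FHom (vcomp V T N M) j k = Id V (VHom T j k)" "FHom (vcomp V U M N) j k = Id V (VHom U j k)"
    unfolding eq using jk t by simp_all
  then show "FHom N j k \<cdot> FHom M j k = Id V (VHom T j k)" "FHom M j k \<cdot> FHom N j k = Id V (VHom U j k)"
    using jk t m(2,4) by simp_all
qed (use is_theory_simps(2)[OF T(1)] is_theory_simps(2)[OF T(2)] theory_morphismD(1)[OF M(1)] theory_morphismD(1)[OF M(2)] in auto)

text \<open>Both comparisons are read off from the single family \<open>f\<close> by fixing one
  variable at \<open>\<I>\<close>, so they share the carrier part \<open>f (\<I>, \<I>)\<close>. One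
  \<open>\<phi>\<close> for both faces is what allows relations between the faces to be
  transported.\<close>

lemma BAlg_iso_faces:
  assumes h: "h \<in> Arr (BAlg V J C)" "is_iso (BAlg V J C) h"
  obtains \<phi> where "carrier_iso (left_face V (Dom (BAlg V J C) h)) \<phi> (left_face V (Cod (BAlg V J C) h))"
    "carrier_iso (right_face V (Dom (BAlg V J C) h)) \<phi> (right_face V (Cod (BAlg V J C) h))"
proof -
  obtain T U F M N f T' U' F' where h': "h = ((T, U, F), (M, N, f), (T', U', F'))"
    by (metis surj_pair)
  \<comment> \<open>The theory parts of the inverse arrow invert \<open>M\<close> and
    \<open>N\<close>; invertibility of \<open>f\<close> belongs to the definition of arrows.\<close>
  obtain k where k: "inverse_arrows (BAlg V J C) h k"
    using h(2) by (auto simp: is_iso_def)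
  have "k \<in> Arr (BAlg V J C)" "Dom (BAlg V J C) k = (T', U', F')" "Cod (BAlg V J C) k = (T, U, F)"
    using k by (auto simp: inverse_arrows_def Hom_def h' BAlg_simps)
  then obtain M' N' f' where k': "k = ((T', U', F'), (M', N', f'), (T, U, F))"
    by (metis surj_pair BAlg_simps(3,4))
  have D: "bifold_algebra V J C (T, U, F)" "bifold_algebra V J C (T', U', F')"
    and M: "theory_morphism V J T T' M" "theory_morphism V J U' U N"
    and f: "vnat_iso V (vtensor V T U') C (bicomp T U' F (vid V T) N) (bicomp T U' F' M (vid V U')) f"
    using h(1) unfolding h' BAlg_simps by auto
  have M': "theory_morphism V J T' T M'" "theory_morphism V J U U' N'"
    using \<open>k \<in> Arr (BAlg V J C)\<close> unfolding k' BAlg_simps by auto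
  note d = bifold_algebra_simps[OF D(1)] and d' = bifold_algebra_simps[OF D(2)]
  note m = theory_morphismD(1,2)[OF M(1)] theory_morphismD(1,2)[OF M(2)]
  have "Comp (BAlg V J C) k h = Id (BAlg V J C) (T, U, F)" "Comp (BAlg V J C) h k = Id (BAlg V J C) (T', U', F')"
    using k by (auto simp: inverse_arrows_def h' BAlg_simps(3,4))
  then have "vcomp V T M' M = vid V T" "vcomp V T' M M' = vid V T'" "vcomp V U N N' = vid V U" "vcomp V U' N' N = vid V U'"
    unfolding h' k' BAlg_simps by auto
  then have io: "io_iso T T' M M'" "io_iso U' U N N'"
    using io_isoI d(1,2) d'(1,2) M M' by blast+
  note fF = vfunctor_bicomp[OF d(6) d'(7) d(6,7) C d(3) vfunctor_vid[OF d(6)] m(3)]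
  note fF' = vfunctor_bicomp[OF d(6) d'(7) d'(6,7) C d'(3) m(1) vfunctor_vid[OF d'(7)]]
  have I: "\<I> \<in> VOb T" "\<I> \<in> VOb U" "\<I> \<in> VOb T'" "\<I> \<in> VOb U'"
    using d(8,9) d'(8,9) by auto
  have "vnat_iso V T C (fix_right V T U F \<I>) (vcomp V T (fix_right V T' U' F' \<I>) M) (\<lambda>j \<in> VOb T. f (j, \<I>))"
    using vnat_iso_fix(1)[OF d(6) d'(7) C fF fF' f I(4)]
    unfolding fix_right_bicomp[OF d(6) d'(7) d(6,7) C d(3) vfunctor_vid[OF d(6)] m(3) I(4)]
      fix_right_bicomp[OF d(6) d'(7) d'(6,7) C d'(3) m(1) vfunctor_vid[OF d'(7)] I(4)]
    using m(4)[OF arities_simps(1)] I vcomp_vid(1)[OF d(6) C vfunctor_fix_right[OF d(6,7) C d(3) I(2)]] by simp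
  then have l: "algebra_morphism T (fix_right V T U F \<I>) M (\<lambda>j \<in> VOb T. f (j, \<I>)) T' (fix_right V T' U' F' \<I>)"
    unfolding algebra_morphism_def using d(1) d'(1) M(1) is_algebra_faces(1)[OF D(1)] is_algebra_faces(1)[OF D(2)] by blast
  obtain g where "algebra_iso T (fix_right V T U F \<I>) M (\<lambda>j \<in> VOb T. f (j, \<I>)) T' (fix_right V T' U' F' \<I>) M' g"
    by (rule algebra_isoI[OF l io(1)])
  from carrier_isoI[OF this] have left: "carrier_iso (left_face V (T, U, F)) (f (\<I>, \<I>)) (left_face V (T', U', F'))"
    using I by (simp add: face_simps)
  let ?r = "fix_left V T U F \<I>" and ?r' = "fix_left V T' U' F' \<I>"
  have r: "vfunctor V U C ?r" "vfunctor V U' C ?r'" "vfunctor V U' C (vcomp V U' ?r N)"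
    using vfunctor_fix_left[OF d(6,7) C d(3) I(1)] vfunctor_fix_left[OF d'(6,7) C d'(3) I(3)]
      vfunctor_vcomp[OF d'(7) d(7) C m(3)] by auto
  \<comment> \<open>On right faces \<open>f\<close> starts at \<open>?r\<close> reindexed along
    \<open>N : U' \<rightarrow> U\<close>. As an algebra morphism over \<open>N\<close> must end
    there, it is the inverse \<open>g\<close> that provides one, from the target face to the source
    face.\<close>
  have "vnat_iso V U' C (vcomp V U' ?r N) ?r' (\<lambda>j \<in> VOb U'. f (\<I>, j))"
    using vnat_iso_fix(2)[OF d(6) d'(7) C fF fF' f I(1)]
    unfolding fix_left_bicomp[OF d(6) d'(7) d(6,7) C d(3) vfunctor_vid[OF d(6)] m(3) I(1)]
      fix_left_bicomp[OF d(6) d'(7) d'(6,7) C d'(3) m(1) vfunctor_vid[OF d'(7)] I(1)]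
    using m(2)[OF arities_simps(1)] I vcomp_vid(1)[OF d'(7) C r(2)] by simp
  then obtain g where g: "vnat V U' C (vcomp V U' ?r N) ?r' (\<lambda>j \<in> VOb U'. f (\<I>, j))" "vnat V U' C ?r' (vcomp V U' ?r N) g"
    "\<forall>j \<in> VOb U'. vinverse C (FOb (vcomp V U' ?r N) j) (FOb ?r' j) ((\<lambda>j \<in> VOb U'. f (\<I>, j)) j) (g j)"
    unfolding vnat_iso_iff[OF d'(7) C r(3,2)] by blast
  have "vnat_iso V U' C ?r' (vcomp V U' ?r N) g"
    unfolding vnat_iso_iff[OF d'(7) C r(2,3)]
    by (intro exI conjI ballI, rule g(2), rule g(1), rule vinverse_sym, rule bspec[OF g(3)])
  then have "algebra_morphism U' ?r' N g U ?r"
    unfolding algebra_morphism_def using d(2) d'(2) M(2) is_algebra_faces(2)[OF D(1)] is_algebra_faces(2)[OF D(2)] by blast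
  then obtain g' where "algebra_iso U' ?r' N g U ?r N' g'"
    by (rule algebra_isoI[OF _ io(2)])
  from carrier_isoI[OF this] have "carrier_iso (right_face V (T', U', F')) (g \<I>) (right_face V (T, U, F))"
    by (simp add: face_simps)
  then obtain \<psi> where \<psi>: "carrier_iso (right_face V (T, U, F)) \<psi> (right_face V (T', U', F'))"
    "vinverse C (bcarrier V (T', U', F')) (bcarrier V (T, U, F)) (g \<I>) \<psi>"
    using carrier_iso_sym algebra_faces(4)[OF D(1)] algebra_faces(4)[OF D(2)] by metis
  \<comment> \<open>Turning the comparison around produced some \<open>\<psi>\<close>. Both
    \<open>\<psi>\<close> and \<open>f (\<I>, \<I>)\<close> are inverse to \<open>g \<I>\<close>,
    hence equal.\<close>
  have "vinverse C (bcarrier V (T', U', F')) (bcarrier V (T, U, F)) (g \<I>) (f (\<I>, \<I>))"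
    using vinverse_sym bspec[OF g(3) I(4)] I m(4)[OF arities_simps(1)] by (simp add: face_simps)
  then have "\<psi> = f (\<I>, \<I>)"
    using vinverse_unique[OF C algebra_faces(5)[OF D(2)] algebra_faces(5)[OF D(1)] \<psi>(2)] by blast
  with that[of "f (\<I>, \<I>)"] left \<psi>(1) show ?thesis
    by (simp add: h' BAlg_simps(3,4))
qed

section \<open>Balanced bifold algebras\<close>

lemma carrier_isoD:
  assumes "carrier_iso X \<phi> Y"
  shows "algebra V J C X" "algebra V J C Y" "\<phi> \<in> Arr V" "Dom V \<phi> = \<I>" "Cod V \<phi> = VHom C (carrier V X) (carrier V Y)"
    "carrier V X \<in> VOb C" "carrier V Y \<in> VOb C"
proof -
  obtain T A M f U B N g where *: "X = (T, A)" "Y = (U, B)" "algebra_iso T A M f U B N g" "f \<I> = \<phi>"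
    using assms by (rule carrier_isoE)
  then have f: "algebra_morphism T A M f U B"
    by (simp add: algebra_iso_def)
  show XY: "algebra V J C X" "algebra V J C Y"
    using algebra_morphism_simps(1-4)[OF f] by (simp_all add: * algebra_iff)
  show "\<phi> \<in> Arr V" "Dom V \<phi> = \<I>" "Cod V \<phi> = VHom C (carrier V X) (carrier V Y)"
    using algebra_morphism_f_simps(1-3)[OF f arities_simps(1)] *(4) by (simp_all add: *(1,2) carrier_def)
  show "carrier V X \<in> VOb C" "carrier V Y \<in> VOb C"
    using carrier_VOb XY by auto
qed

lemma isomorphic_Alg_refl:
  assumes "algebra V J C X" "carrier V X = c"
  shows "isomorphic (Alg V J C c) X X"
proof -
  obtain T A where X: "X = (T, A)"
    by (metis surj_pair)
  have "Id algebras X \<in> Hom algebras X X" "is_iso algebras (Id algebras X)"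
    using assms(1) algebras.Id_in[of X] by (auto simp: algebras_simps(1))
  moreover have "carrier_part (Id algebras X) = VId C c"
    using assms(2) by (simp add: X algebras_simps carrier_part_def carrier_def)
  ultimately show ?thesis
    unfolding isomorphic_Alg_iff carrier_iso_def using assms(2) by blast
qed

lemma isomorphic_Alg_sym:
  assumes "isomorphic (Alg V J C c) X Y"
  shows "isomorphic (Alg V J C c) Y X"
proof -
  have *: "carrier V X = c" "carrier V Y = c" "carrier_iso X (VId C c) Y"
    using assms by (auto simp: isomorphic_Alg_iff)
  have c: "c \<in> VOb C"
    using carrier_isoD(6)[OF *(3)] *(1) by simp
  obtain \<psi> where \<psi>: "carrier_iso Y \<psi> X" "vinverse C c c (VId C c) \<psi>"
    using carrier_iso_sym[OF *(3)] * by metis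
  then show ?thesis
    unfolding isomorphic_Alg_iff using vinverse_unique[OF C c c \<psi>(2) vinverse_VId[OF C c]] * by simp
qed

lemma isomorphic_Alg_trans:
  assumes "isomorphic (Alg V J C c) X Y" "isomorphic (Alg V J C c) Y Z"
  shows "isomorphic (Alg V J C c) X Z"
proof -
  have *: "carrier V X = c" "carrier V Y = c" "carrier V Z = c" "carrier_iso X (VId C c) Y" "carrier_iso Y (VId C c) Z"
    using assms by (auto simp: isomorphic_Alg_iff)
  have "c \<in> VOb C"
    using carrier_isoD(6)[OF *(4)] *(1) by simp
  then show ?thesis
    unfolding isomorphic_Alg_iff using carrier_iso_trans[OF *(4,5)] * by simp
qed

lemma carrier_commutant:
  assumes "algebra V J C X"
  shows "carrier V (commutant V J C X) = carrier V X"
proof -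
  obtain T A where X: "X = (T, A)"
    by (metis surj_pair)
  have "FOb A \<I> \<in> VOb C"
    using carrier_VOb[OF assms] by (simp add: X carrier_def)
  then show ?thesis
    using commutant_simps(2)[OF arities_simps(1), of T A] by (simp add: X carrier_def)
qed

lemma isomorphic_Alg_commutant:
  assumes "isomorphic (Alg V J C c) X Y" "algebra V J C (commutant V J C X)"
  shows "isomorphic (Alg V J C c) (commutant V J C X) (commutant V J C Y)"
proof -
  have *: "carrier V X = c" "carrier V Y = c" "carrier_iso X (VId C c) Y"
    using assms by (auto simp: isomorphic_Alg_iff)
  then show ?thesis
    unfolding isomorphic_Alg_iff
    using carrier_iso_commutant[OF *(3) assms(2)] carrier_commutant carrier_isoD(1,2)[OF *(3)] by simp
qed

text \<open>The common carrier part \<open>\<phi>\<close> cancels against its inverse.\<close>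

lemma isomorphic_Alg_transport:
  assumes X: "carrier_iso X \<phi> X'" and Y: "carrier_iso Y \<phi> Y'" and XY: "isomorphic (Alg V J C c) X Y"
    and c: "carrier V X' = c'" "carrier V Y' = c'"
  shows "isomorphic (Alg V J C c') X' Y'"
proof -
  have *: "carrier V X = c" "carrier V Y = c" "carrier_iso X (VId C c) Y"
    using XY by (auto simp: isomorphic_Alg_iff)
  obtain \<psi> where \<psi>: "carrier_iso X' \<psi> X" "vinverse C (carrier V X) (carrier V X') \<phi> \<psi>"
    using carrier_iso_sym[OF X] by blast
  note s = vinverse_simps[OF \<psi>(2)] carrier_isoD(6,7)[OF X]
  have "carrier_iso X' (lact C c' c c' \<phi> (lact C c' c c (VId C c) \<psi>)) Y'"
    using carrier_iso_trans[OF carrier_iso_trans[OF \<psi>(1) *(3)] Y] * c by simp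
  moreover have "lact C c' c c' \<phi> (lact C c' c c (VId C c) \<psi>) = VId C c'"
    using s \<psi>(2) * c by (simp add: vinverse_def)
  ultimately show ?thesis
    unfolding isomorphic_Alg_iff using c by simp
qed

lemma isomorphic_AlgD:
  assumes "isomorphic (Alg V J C c) X Y"
  shows "algebra V J C X" "algebra V J C Y" "carrier V X = c" "carrier V Y = c"
  using assms unfolding isomorphic_def Alg_simps by auto

text \<open>Each of the three defining isomorphisms joins algebras that are compared over the same
  \<open>\<phi>\<close>, so \<open>isomorphic_Alg_transport\<close> applies. The commutants of the
  faces of \<open>D\<close> are algebras, as \<open>carrier_iso_commutant\<close> requires, because
  they are isomorphic to faces.\<close>

lemma balanced_bifold_iso:
  assumes D: "balanced_bifold V J C D" and E: "bifold_algebra V J C E"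
    and l: "carrier_iso (left_face V D) \<phi> (left_face V E)" and r: "carrier_iso (right_face V D) \<phi> (right_face V E)"
  shows "balanced_bifold V J C E"
proof -
  have d: "bifold_algebra V J C D"
    "isomorphic (Alg V J C (bcarrier V D)) (right_face V D) (commutant V J C (left_face V D))"
    "isomorphic (Alg V J C (bcarrier V D)) (left_face V D) (commutant V J C (right_face V D))"
    "isomorphic (Alg V J C (bcarrier V D)) (left_face V D) (right_face V D)"
    using D by (auto simp: balanced_bifold_def commutant_bifold_def)
  note e = algebra_faces[OF E]
  note c = carrier_commutant[OF e(1)] carrier_commutant[OF e(2)]
  note cl = carrier_iso_commutant[OF l isomorphic_AlgD(2)[OF d(2)]] and cr = carrier_iso_commutant[OF r isomorphic_AlgD(2)[OF d(3)]]
  have "isomorphic (Alg V J C (bcarrier V E)) (right_face V E) (commutant V J C (left_face V E))"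
    "isomorphic (Alg V J C (bcarrier V E)) (left_face V E) (commutant V J C (right_face V E))"
    "isomorphic (Alg V J C (bcarrier V E)) (left_face V E) (right_face V E)"
    using isomorphic_Alg_transport[OF r cl d(2)] isomorphic_Alg_transport[OF l cr d(3)]
      isomorphic_Alg_transport[OF l r d(4)] e c by auto
  then show ?thesis
    using E by (simp add: balanced_bifold_def commutant_bifold_def)
qed

section \<open>Rigidity of algebras isomorphic to a commutant\<close>

lemma Alg_Comp:
  assumes f: "f \<in> Hom (Alg V J C c) X Y" and g: "g \<in> Hom (Alg V J C c) Y Z"
  shows "Comp algebras g f \<in> Hom (Alg V J C c) X Z"
proof -
  have f1: "f \<in> Hom algebras X Y" "carrier V X = c" "carrier V Y = c" "carrier_part f = VId C c"
    and g1: "g \<in> Hom algebras Y Z" "carrier V Z = c" "carrier_part g = VId C c"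
    using f g by (auto simp: Alg_Hom_iff)
  obtain T A M \<alpha> U B where f': "X = (T, A)" "Y = (U, B)" "f = ((T, A), (M, \<alpha>), (U, B))" "algebra_morphism T A M \<alpha> U B"
    using f1(1) by (rule algebras_HomE)
  obtain M' \<alpha>' W E where g': "Z = (W, E)" "g = ((U, B), (M', \<alpha>'), (W, E))" "algebra_morphism U B M' \<alpha>' W E"
    using g1(1) f'(2) by (auto elim: algebras_HomE)
  have c: "c \<in> VOb C"
    using algebra_morphism_f_simps(4)[OF f'(4) arities_simps(1)] f1(2) by (simp add: f'(1) carrier_def)
  have "carrier_part (Comp algebras g f) = lact C c c c (VId C c) (VId C c)"
    unfolding f'(3) g'(2) algebras_Comp[OF f'(4) g'(3)] using f1(2-4) g1(2,3)
    by (simp add: carrier_part_def f'(1-3) g'(1,2) carrier_def)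
  then have "carrier_part (Comp algebras g f) = VId C c"
    using c by simp
  then show ?thesis
    using algebras.Comp_in[OF f1(1) g1(1)] f1 g1 by (simp add: Alg_Hom_iff)
qed

lemma into_commutant_Hom_unique:
  assumes Z: "algebra V J C Z" and f: "f \<in> Hom (Alg V J C c) X (commutant V J C Z)"
    and g: "g \<in> Hom (Alg V J C c) X (commutant V J C Z)"
  shows "f = g"
proof -
  obtain T A where Z': "Z = (T, A)"
    by (metis surj_pair)
  have T: "is_theory V J T" "is_algebra V J C T A"
    using Z by (auto simp: Z' algebra_iff)
  let ?S = "commutant_theory V J C (T, A)" and ?P = "snd (commutant V J C (T, A))"
  have eq: "commutant V J C Z = (?S, ?P)"
    unfolding Z' by (rule commutant_simps(1))
  obtain U B where X: "X = (U, B)"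
    by (metis surj_pair)
  have "f \<in> Hom algebras (U, B) (?S, ?P)" "g \<in> Hom algebras (U, B) (?S, ?P)" "carrier_part f = carrier_part g"
    using f g by (auto simp: Alg_Hom_iff X eq)
  then obtain M \<alpha> N \<beta> where f': "f = ((U, B), (M, \<alpha>), (?S, ?P))" "algebra_morphism U B M \<alpha> ?S ?P"
    and g': "g = ((U, B), (N, \<beta>), (?S, ?P))" "algebra_morphism U B N \<beta> ?S ?P" and "\<alpha> \<I> = \<beta> \<I>"
    by (auto elim!: algebras_HomE simp: carrier_part_def)
  then show ?thesis
    using into_commutant_unique[OF T f'(2) g'(2)] by simp
qed

text \<open>For an isomorphism \<open>p\<close> from \<open>X\<close> to the commutant,
  \<open>p e\<close> and \<open>p\<close> are two morphisms into a commutant, hence equal, and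
  \<open>p\<close> cancels.\<close>

lemma endo_eq_Id:
  assumes Z: "algebra V J C Z" and X: "isomorphic (Alg V J C c) X (commutant V J C Z)" and e: "e \<in> Hom (Alg V J C c) X X"
  shows "e = Id algebras X"
proof -
  obtain p where p: "p \<in> Hom (Alg V J C c) X (commutant V J C Z)" "is_iso algebras p"
    using X unfolding isomorphic_Alg_iff carrier_iso_def by (auto simp: Alg_Hom_iff)
  have "Comp algebras p e = p"
    by (rule into_commutant_Hom_unique[OF Z Alg_Comp[OF e p(1)] p(1)])
  also have "p = Comp algebras p (Id algebras X)"
    using p(1) algebras.Id_right[of p X "commutant V J C Z"] by (simp add: Alg_Hom_iff)
  finally show ?thesis
    by (rule algebras.iso_cancel_left[OF p(2)])
      (use e p(1) algebras.Hom_ObD in \<open>auto simp: Alg_Hom_iff algebras.in_Hom\<close>)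
qed

text \<open>Both round trips are endomorphisms of algebras isomorphic to commutants, hence
  identities by \<open>endo_eq_Id\<close>.\<close>

lemma isomorphic_Alg_of_mutual:
  assumes Z: "algebra V J C Z" "algebra V J C W"
    and X: "isomorphic (Alg V J C c) X (commutant V J C Z)" and Y: "isomorphic (Alg V J C c) Y (commutant V J C W)"
    and f: "f \<in> Hom (Alg V J C c) X Y" and g: "g \<in> Hom (Alg V J C c) Y X"
  shows "isomorphic (Alg V J C c) X Y"
proof -
  have "Comp algebras g f = Id algebras X" "Comp algebras f g = Id algebras Y"
    using endo_eq_Id[OF Z(1) X Alg_Comp[OF f g]] endo_eq_Id[OF Z(2) Y Alg_Comp[OF g f]] by auto
  then have "is_iso algebras f"
    using f g by (intro algebras.is_isoI(1)[of f g]) (auto simp: Alg_Hom_iff algebras.in_Hom)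
  then show ?thesis
    unfolding isomorphic_Alg_iff carrier_iso_def using f by (auto simp: Alg_Hom_iff)
qed

lemma isomorphic_Alg_Hom:
  assumes "isomorphic (Alg V J C c) X Y"
  obtains f where "f \<in> Hom (Alg V J C c) X Y"
  using assms by (auto simp: isomorphic_def)

lemma commutative_if_balanced: "balanced V J C X \<Longrightarrow> commutative V J C X"
  unfolding balanced_def commutative_def commutes_def isomorphic_def by blast

lemma balanced_iff:
  "isomorphic (Alg V J C c) X (commutant V J C X) \<longleftrightarrow> balanced V J C X \<and> carrier V X = c"
  unfolding balanced_def isomorphic_def Alg_simps by auto

text \<open>
  The bifold algebra \<open>\<langle>D\<^sub>l,D\<^sub>l\<rangle>\<close> is obtained from \<open>D\<close> by reindexing along the isomorphism of theories
  underlying \<open>D\<^sub>l \<cong> D\<^sub>r\<close>.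
\<close>

lemma pairing_exists:
  assumes D: "bifold_algebra V J C D" and lr: "isomorphic (Alg V J C (bcarrier V D)) (left_face V D) (right_face V D)"
    and bal: "balanced V J C (left_face V D)"
  shows "\<exists>E. is_pairing V J C (left_face V D) (left_face V D) E \<and> isomorphic (BAlg V J C) D E"
proof -
  obtain T U F where D': "D = (T, U, F)"
    by (metis surj_pair)
  note d = bifold_algebra_simps[OF D[unfolded D']]
  let ?l = "fix_right V T U F \<I>" and ?r = "fix_left V T U F \<I>"
  have I: "\<I> \<in> VOb T" "\<I> \<in> VOb U"
    using d(8,9) by auto
  have c: "bcarrier V D \<in> VOb C"
    by (rule algebra_faces(5)[OF D])
  have "carrier_iso (T, ?l) (VId C (bcarrier V D)) (U, ?r)"
    using lr by (simp add: isomorphic_Alg_iff D' face_simps)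
  then obtain N f N' g where iso: "algebra_iso T ?l N f U ?r N' g" and fI: "f \<I> = VId C (bcarrier V D)"
    by (auto elim: carrier_isoE)
  have mor: "algebra_morphism T ?l N f U ?r" "algebra_morphism U ?r N' g T ?l" and io: "io_iso T U N N'"
    using iso by (auto simp: algebra_iso_def)
  note s = algebra_morphism_simps[OF mor(1)] and m = io_isoD[OF io]
  have N': "theory_morphism V J U T N'"
    using algebra_morphism_simps(5)[OF mor(2)] .
  have NN': "vcomp V U N N' = vid V U"
    by (rule vfun_eqI[OF vfunctor_vcomp[OF s(9,7,9) m(3,2)] vfunctor_vid[OF s(9)]])
      (use m(4,5,9) s(8,10) in auto)
  have N'N: "vcomp V T N' N = vid V T"
    by (rule vfun_eqI[OF vfunctor_vcomp[OF s(7,9,7) m(2,3)] vfunctor_vid[OF s(7)]])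
      (use m(4,5,8) s(8,10) in auto)
  \<comment> \<open>\<open>N : T \<rightarrow> U\<close> replaces \<open>U\<close> by
    \<open>T\<close> in the second variable, so that both faces of \<open>?E\<close> become algebras
    for the theory of the left face.\<close>
  let ?G = "bicomp T T F (vid V T) N" and ?E = "(T, T, bicomp T T F (vid V T) N)"
  have vT: "vfunctor V T T (vid V T)" and vU: "vfunctor V U U (vid V U)"
    using vfunctor_vid d(6,7) by auto
  have G: "vfunctor V (vtensor V T T) C ?G"
    by (rule vfunctor_bicomp[OF d(6,6,6,7) C d(3) vT m(2)])
  \<comment> \<open>\<open>N\<close> is the identity on objects, so \<open>F(-,k)\<close> is
    unchanged; in particular the left face of \<open>?E\<close> is literally that of
    \<open>D\<close>.\<close>
  have fr: "fix_right V T T ?G k = fix_right V T U F k" if k: "k \<in> J" for k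
  proof -
    have kT: "k \<in> VOb T" "k \<in> VOb U"
      using k d(8,9) by auto
    show ?thesis
      unfolding fix_right_bicomp[OF d(6,6,6,7) C d(3) vT m(2) kT(1)]
      using m(4)[OF kT(1)] vcomp_vid(1)[OF d(6) C vfunctor_fix_right[OF d(6,7) C d(3) kT(2)]] by simp
  qed
  have fl: "fix_left V T T ?G j = vcomp V T (fix_left V T U F j) N" if j: "j \<in> J" for j
  proof -
    have jT: "j \<in> VOb T"
      using j d(8) by auto
    show ?thesis
      unfolding fix_left_bicomp[OF d(6,6,6,7) C d(3) vT m(2) jT] using jT by simp
  qed
  have E: "bifold_algebra V J C ?E"
    unfolding bifold_algebra_def prod.case
  proof (intro conjI ballI d(1) G)
    fix k assume k: "k \<in> J"
    show "preserves_cotensors V J T C (fix_right V T T ?G k)"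
      unfolding fr[OF k] by (rule d(4)[OF k])
  next
    fix j assume j: "j \<in> J"
    show "preserves_cotensors V J T C (fix_left V T T ?G j)"
      unfolding fl[OF j] preserves_cotensors_def
    proof (intro ballI allI impI)
      fix k x p \<kappa> assume k: "k \<in> J" and cot: "is_cotensor V T k x p \<kappa>"
      note ct = is_cotensor_simps(1-3,5-7)[OF cot]
      have xp: "x \<in> VOb U" "p \<in> VOb U" and jT: "j \<in> VOb T"
        using ct m(1) j d(8) by auto
      \<comment> \<open>\<open>N\<close> preserves cotensors as an isomorphism of enriched
        categories, and \<open>F(j,-)\<close> preserves them because \<open>D\<close> is a bifold
        algebra.\<close>
      have "is_cotensor V C k (FOb (fix_left V T U F j) x) (FOb (fix_left V T U F j) p)
        (FHom (fix_left V T U F j) p x \<cdot> (FHom N p x \<cdot> \<kappa>))"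
        using io_iso_cotensor[OF d(6,7) io cot] d(5)[OF j] k unfolding preserves_cotensors_def by blast
      moreover have "FHom (fix_left V T U F j) p x \<cdot> (FHom N p x \<cdot> \<kappa>) = (FHom (fix_left V T U F j) p x \<cdot> FHom N p x) \<cdot> \<kappa>"
        by (rule assoc[symmetric])
          (use vfunctor_simps(3-5)[OF vfunctor_fix_left[OF d(6,7) C d(3) jT] xp(2,1)] m(6)[OF ct(3,2)] ct in auto)
      ultimately show "is_cotensor V C k (FOb (vcomp V T (fix_left V T U F j) N) x) (FOb (vcomp V T (fix_left V T U F j) N) p)
        (FHom (vcomp V T (fix_left V T U F j) N) p x \<cdot> \<kappa>)"
        using ct(2,3) m(4) by (simp del: fix_left_simps assoc)
    qed
  qed
  have fg: "vinverse C (FOb ?l \<I>) (FOb ?r \<I>) (f \<I>) (g \<I>)"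
    using iso by (simp add: algebra_iso_def)
  have lrI: "FOb ?l \<I> = bcarrier V D" "FOb ?r \<I> = bcarrier V D"
    using I by (simp_all add: D' face_simps)
  have gI: "g \<I> = VId C (bcarrier V D)"
    by (rule vinverse_unique[OF C c c]) (use fg vinverse_VId[OF C c] in \<open>simp_all add: lrI fI\<close>)
  obtain f' where f': "vnat V T C ?l (vcomp V T ?r N) f" "vnat V T C (vcomp V T ?r N) ?l f'"
    "\<And>j. j \<in> J \<Longrightarrow> vinverse C (FOb ?l j) (FOb ?r j) (f j) (f' j)"
    using algebra_morphism_component[OF mor(1)] by blast
  have f'I: "f' \<I> = VId C (bcarrier V D)"
    by (rule vinverse_unique[OF C c c, of "f \<I>"])
      (use f'(3)[OF arities_simps(1)] vinverse_VId[OF C c] in \<open>simp_all only: lrI fI\<close>)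
  \<comment> \<open>The right face of \<open>?E\<close> is \<open>D\<^sub>r N\<close>, and the
    inverse of \<open>f : D\<^sub>l \<rightarrow> D\<^sub>r N\<close> identifies it with the left
    face over the identity of the carrier.\<close>
  have rN: "vnat_iso V T C (vcomp V T ?r N) ?l f'"
    unfolding vnat_iso_iff[OF s(7) C s(14,11)]
    using f'(1,2) vinverse_sym[OF f'(3)] s(8,15) by (intro exI[of _ f]) auto
  have pair: "is_pairing V J C (left_face V D) (left_face V D) ?E"
  proof -
    have "vnat_iso V T C ?l ?l (\<lambda>j \<in> VOb T. VId C (FOb ?l j))"
      by (rule vnat_iso_VId[OF s(7) C s(11)])
    moreover have "(\<lambda>j \<in> VOb T. VId C (FOb ?l j)) \<I> = VId C (bcarrier V D)"
      using I lrI by simp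
    moreover have "carrier V (T, ?l) = bcarrier V D" "FOb ?G (\<I>, \<I>) = bcarrier V D"
      using lrI I m(4)[OF I(1)] by (simp_all add: carrier_def D' face_simps)
    moreover have "commutes V J C (T, ?l) (T, ?l)"
      using commutative_if_balanced[OF bal] by (simp add: commutative_def D' face_simps)
    ultimately show ?thesis
      unfolding is_pairing_def using E rN f'I
      by (auto simp: D' face_simps fr[OF arities_simps(1)] fl[OF arities_simps(1)])
  qed
  have GG: "bicomp T T ?G (vid V T) (vid V T) = ?G"
    by (rule bicomp_vid[OF d(6,6) C G])
  have FF: "bicomp T U F (vid V T) (vid V U) = F"
    by (rule bicomp_vid[OF d(6,7) C d(3)])
  have vv: "vcomp V T (vid V T) (vid V T) = vid V T"
    by (rule vcomp_vid(1)[OF d(6,6) vT])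
  \<comment> \<open>Reindexing back along \<open>N'\<close> restores \<open>F\<close> exactly. This
    is why \<open>?h\<close> and \<open>?k\<close> can have identities as natural parts, with only
    the theory parts \<open>N\<close> and \<open>N'\<close> nontrivial.\<close>
  have GN': "bicomp T U ?G (vid V T) N' = F"
    using bicomp_bicomp[OF d(6,7,6,6,6,7) C d(3) vT m(2) vT m(3)] by (simp add: vv NN' FF)
  let ?h = "(D, (vid V T, N, (\<lambda>p \<in> J \<times> J. VId C (FOb ?G p))), ?E)"
  let ?k = "(?E, (vid V T, N', (\<lambda>p \<in> J \<times> J. VId C (FOb F p))), D)"
  have J2: "VOb (vtensor V T T) = J \<times> J" "VOb (vtensor V T U) = J \<times> J"
    using d(8,9) by auto
  have "vnat_iso V (vtensor V T T) C ?G ?G (\<lambda>p \<in> J \<times> J. VId C (FOb ?G p))"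
    using vnat_iso_VId_graph[OF vtensor_VHom_Ob[OF d(6,6)] C G] unfolding J2 .
  then have h: "?h \<in> Arr (BAlg V J C)"
    unfolding D' BAlg_simps(2) GG using D[unfolded D'] E theory_morphism_vid[OF d(1)] s(5) by simp
  have "vnat_iso V (vtensor V T U) C F F (\<lambda>p \<in> J \<times> J. VId C (FOb F p))"
    using vnat_iso_VId_graph[OF vtensor_VHom_Ob[OF d(6,7)] C d(3)] unfolding J2 .
  then have k: "?k \<in> Arr (BAlg V J C)"
    unfolding D' BAlg_simps(2) GN' FF using D[unfolded D'] E theory_morphism_vid[OF d(1)] N' by simp
  have Ob: "FOb F (j, k) \<in> VOb C" if "j \<in> J" "k \<in> J" for j k
    using bifunctor_simps(1)[OF d(3)] that d(8,9) by simp
  have NJ: "FOb N j = j" "FOb N' j = j" "FOb (vid V T) j = j" "FOb ?G (i, j) = FOb F (i, j)" if "i \<in> J" "j \<in> J" for i j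
    using m(4,5) that d(8) by simp_all
  have uId: "ucomp V C c c c (VId C c) (VId C c) = VId C c" if "c \<in> VOb C" for c
    using that by (simp add: ucomp_eq_lact)
  have "Comp (BAlg V J C) ?k ?h = Id (BAlg V J C) D"
    unfolding D' BAlg_simps(5,6) vv NN' N'N
    by (auto intro!: ext simp: NJ Ob uId simp del: vcomp_simps)
  moreover have "Comp (BAlg V J C) ?h ?k = Id (BAlg V J C) ?E"
    unfolding D' BAlg_simps(5,6) vv NN' N'N
    by (auto intro!: ext simp: NJ Ob uId simp del: vcomp_simps)
  ultimately have "inverse_arrows (BAlg V J C) ?h ?k"
    using h k by (simp add: inverse_arrows_def Hom_def BAlg_simps(3,4))
  then have "is_iso (BAlg V J C) ?h"
    unfolding is_iso_def by (rule exI)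
  then have "isomorphic (BAlg V J C) D ?E"
    unfolding isomorphic_def using h D E
    by (intro conjI bexI[of _ ?h]) (auto simp: Hom_def BAlg_simps(1,3,4))
  with pair show ?thesis
    by blast
qed

text \<open>Both faces are isomorphic to \<open>A\<close> over the identity of the carrier, hence
  their commutants to that of \<open>A\<close>, which is isomorphic to \<open>A\<close> by
  balancedness. All algebras involved thus lie in one isomorphism class.\<close>

lemma pairing_balanced:
  assumes A: "balanced V J C A" and E: "is_pairing V J C A A E"
  shows "balanced_bifold V J C E"
proof -
  obtain T B where A': "A = (T, B)"
    by (metis surj_pair)
  let ?c = "bcarrier V E"
  have e: "bifold_algebra V J C E" "fst (left_face V E) = T" "fst (right_face V E) = T" "?c = carrier V A"
    and f: "\<exists>f. vnat_iso V T C (snd (left_face V E)) B f \<and> f \<I> = VId C ?c"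
    and g: "\<exists>g. vnat_iso V T C (snd (right_face V E)) B g \<and> g \<I> = VId C ?c"
    using E unfolding is_pairing_def A' prod.case by simp_all
  note fa = algebra_faces[OF e(1)]
  have bal: "isomorphic (Alg V J C ?c) A (commutant V J C A)"
    using A e(4) by (simp add: balanced_def)
  note balD = isomorphic_AlgD[OF bal]
  have B: "is_theory V J T" "is_algebra V J C T B"
    using balD(1) by (auto simp: A' algebra_iff)
  \<comment> \<open>An isomorphism of algebras for the same theory becomes one in \<open>Alg\<close>
    by taking the identity as theory part.\<close>
  have to_A: "isomorphic (Alg V J C ?c) X A"
    if X: "algebra V J C X" "carrier V X = ?c" "fst X = T" and f: "vnat_iso V T C (snd X) B f" "f \<I> = VId C ?c" for X f
  proof -
    obtain P where X': "X = (T, P)"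
      using X(3) by (cases X) auto
    have P: "is_algebra V J C T P"
      using X(1) by (simp add: X' algebra_iff)
    have "vnat_iso V T C P (vcomp V T B (vid V T)) f"
      using f(1) vcomp_vid(1)[OF is_theory_simps(1)[OF B(1)] C is_algebra_simps(1)[OF B(2)]] by (simp add: X')
    then have "algebra_morphism T P (vid V T) f T B"
      unfolding algebra_morphism_def using B P theory_morphism_vid[OF B(1)] by blast
    moreover have "io_iso T T (vid V T) (vid V T)"
      using io_isoI[OF B(1,1) theory_morphism_vid[OF B(1)] theory_morphism_vid[OF B(1)]]
        vcomp_vid(1)[OF is_theory_simps(1)[OF B(1)] is_theory_simps(1)[OF B(1)] vfunctor_vid[OF is_theory_simps(1)[OF B(1)]]]
      by simp
    ultimately obtain g where "algebra_iso T P (vid V T) f T B (vid V T) g"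
      by (rule algebra_isoI)
    from carrier_isoI[OF this] show ?thesis
      unfolding isomorphic_Alg_iff using f(2) X(2) e(4) by (simp add: X' A')
  qed
  have l: "isomorphic (Alg V J C ?c) (left_face V E) A" and r: "isomorphic (Alg V J C ?c) (right_face V E) A"
    using f g to_A fa(1-4) e(2,3) by blast+
  \<comment> \<open>Commutants are transported starting from \<open>A\<close>, where balancedness
    guarantees an algebra; hence the reversed isomorphisms.\<close>
  note cl = isomorphic_Alg_commutant[OF isomorphic_Alg_sym[OF l] balD(2)]
  note cr = isomorphic_Alg_commutant[OF isomorphic_Alg_sym[OF r] balD(2)]
  show ?thesis
    unfolding balanced_bifold_def commutant_bifold_def
    using e(1) l r cl cr bal isomorphic_Alg_trans isomorphic_Alg_sym by blast
qed

lemma balanced_bifold_BAlg_iso: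
  assumes h: "h \<in> Arr (BAlg V J C)" "is_iso (BAlg V J C) h" 
  shows "balanced_bifold V J C (Dom (BAlg V J C) h) \<longleftrightarrow> balanced_bifold V J C (Cod (BAlg V J C) h)"
proof -
  let ?D = "Dom (BAlg V J C) h" and ?E = "Cod (BAlg V J C) h"
  obtain T U F M N f T' U' F' where "h = ((T, U, F), (M, N, f), (T', U', F'))"
    by (metis surj_pair)
  then have DE: "bifold_algebra V J C ?D" "bifold_algebra V J C ?E"
    using h(1) by (auto simp: BAlg_simps)
  obtain \<phi> where \<phi>: "carrier_iso (left_face V ?D) \<phi> (left_face V ?E)" "carrier_iso (right_face V ?D) \<phi> (right_face V ?E)"
    using BAlg_iso_faces[OF h] by blast
  note d = algebra_faces[OF DE(1)] and e = algebra_faces[OF DE(2)]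
  obtain \<psi> where \<psi>: "carrier_iso (left_face V ?E) \<psi> (left_face V ?D)" "vinverse C (bcarrier V ?D) (bcarrier V ?E) \<phi> \<psi>"
    using carrier_iso_sym[OF \<phi>(1)] d(3) e(3) by metis
  obtain \<psi>' where \<psi>': "carrier_iso (right_face V ?E) \<psi>' (right_face V ?D)" "vinverse C (bcarrier V ?D) (bcarrier V ?E) \<phi> \<psi>'"
    using carrier_iso_sym[OF \<phi>(2)] d(4) e(4) by metis
  \<comment> \<open>The inverse comparisons of left and right faces lie over inverses of the same
    \<open>\<phi>\<close>, so again over one common arrow, as the converse direction
    requires.\<close>
  have "\<psi>' = \<psi>"
    by (rule vinverse_unique[OF C d(5) e(5) \<psi>'(2) \<psi>(2)])
  then show ?thesis
    using balanced_bifold_iso[OF _ DE(2) \<phi>] balanced_bifold_iso[OF _ DE(1) \<psi>(1)] \<psi>'(1) by blast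
qed

end

theorem proposition15p2:
  fixes V :: "('o, 'm) smcat" and J :: "'o set" and C :: "('c, 'o, 'm) cvcat"
  assumes "symmetric_monoidal_closed_category V"
    and "has_pullbacks V"
    and "system_of_arities V J"
    and "vcategory V C"
    and "admissible V J C"
  shows "(\<forall>D. bifold_algebra V J C D \<longrightarrow>
      (let
         P1 = balanced_bifold V J C D;
         P2 = (commutant_bifold V J C D \<and>
               commutative V J C (left_face V D) \<and> commutative V J C (right_face V D));
         P3 = (\<exists>A E. balanced V J C A \<and> is_pairing V J C A A E \<and> isomorphic (BAlg V J C) D E);
         P4 = (commutant_bifold V J C D \<and>
               balanced V J C (left_face V D) \<and> balanced V J C (right_face V D));
         P5 = (let S = {left_face V D, right_face V D,
                        commutant V J C (left_face V D), commutant V J C (right_face V D)}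
               in \<forall>X \<in> S. \<forall>Y \<in> S. isomorphic (Alg V J C (bcarrier V D)) X Y)
       in (P1 \<longleftrightarrow> P2) \<and> (P1 \<longleftrightarrow> P3) \<and> (P1 \<longleftrightarrow> P4) \<and> (P1 \<longleftrightarrow> P5)))
    \<and> replete_full_subcategory (BalBAlg V J C) (BAlg V J C)"
proof -
  interpret admissible_vcategory V J C
    using assms by (intro admissible_vcategory.intro admissible_vcategory_axioms.intro)
  have equiv: "(balanced_bifold V J C D \<longleftrightarrow> commutant_bifold V J C D \<and>
         commutative V J C (left_face V D) \<and> commutative V J C (right_face V D)) \<and>
      (balanced_bifold V J C D \<longleftrightarrow>
         (\<exists>A E. balanced V J C A \<and> is_pairing V J C A A E \<and> isomorphic (BAlg V J C) D E)) \<and>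
      (balanced_bifold V J C D \<longleftrightarrow> commutant_bifold V J C D \<and>
         balanced V J C (left_face V D) \<and> balanced V J C (right_face V D)) \<and>
      (balanced_bifold V J C D \<longleftrightarrow>
         (\<forall>X \<in> {left_face V D, right_face V D, commutant V J C (left_face V D), commutant V J C (right_face V D)}.
          \<forall>Y \<in> {left_face V D, right_face V D, commutant V J C (left_face V D), commutant V J C (right_face V D)}.
            isomorphic (Alg V J C (bcarrier V D)) X Y))"
    (is "(?P1 \<longleftrightarrow> ?P2) \<and> (?P1 \<longleftrightarrow> ?P3) \<and> (?P1 \<longleftrightarrow> ?P4) \<and> (?P1 \<longleftrightarrow> ?P5)")
    if D: "bifold_algebra V J C D" for D
  proof -
    let ?l = "left_face V D" and ?r = "right_face V D"
    let ?l' = "commutant V J C ?l" and ?r' = "commutant V J C ?r"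
    let ?iso = "isomorphic (Alg V J C (bcarrier V D))"
    note fa = algebra_faces[OF D]
    have P1: "?P1 \<longleftrightarrow> ?iso ?r ?l' \<and> ?iso ?l ?r' \<and> ?iso ?l ?r"
      using D by (simp add: balanced_bifold_def commutant_bifold_def)
    have bal: "balanced V J C ?l \<longleftrightarrow> ?iso ?l ?l'" "balanced V J C ?r \<longleftrightarrow> ?iso ?r ?r'"
      using balanced_iff fa(3,4) by auto
    have P4: "?P4 \<longleftrightarrow> ?iso ?r ?l' \<and> ?iso ?l ?r' \<and> ?iso ?l ?l' \<and> ?iso ?r ?r'"
      using D by (simp add: commutant_bifold_def bal)
    note sym = isomorphic_Alg_sym and trans = isomorphic_Alg_trans
    have P14: "?P1 \<longleftrightarrow> ?P4"
      unfolding P1 P4 using sym trans by blast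
    have P15: "?P1 \<longleftrightarrow> ?P5"
    proof
      assume ?P1
      then have 1: "?iso ?r ?l'" "?iso ?l ?r'" "?iso ?l ?r"
        using P1 by auto
      \<comment> \<open>It is enough to link every member of the set to the left face; symmetry and
        transitivity then give all pairs.\<close>
      have l: "?iso ?l X" if "X \<in> {?l, ?r, ?l', ?r'}" for X
        using that 1 trans[OF 1(3,1)] isomorphic_Alg_refl[OF fa(1,3)] by auto
      show ?P5
        using trans[OF sym[OF l] l] by blast
    next
      assume ?P5
      then show ?P1
        unfolding P1 by blast
    qed
    have P12: "?P1 \<longleftrightarrow> ?P2"
    proof
      assume ?P1
      then show ?P2
        using P14 commutative_if_balanced by blast
    next
      assume P2: ?P2
      then have 1: "?iso ?r ?l'" "?iso ?l ?r'"
        by (auto simp: commutant_bifold_def)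
      obtain h k where h: "h \<in> Hom (Alg V J C (bcarrier V D)) ?l ?l'" and k: "k \<in> Hom (Alg V J C (bcarrier V D)) ?r ?r'"
        using P2 fa(3,4) by (auto simp: commutative_def commutes_def)
      obtain p q where p: "p \<in> Hom (Alg V J C (bcarrier V D)) ?l' ?r" and q: "q \<in> Hom (Alg V J C (bcarrier V D)) ?r' ?l"
        using isomorphic_Alg_Hom[OF sym[OF 1(1)]] isomorphic_Alg_Hom[OF sym[OF 1(2)]] by metis
      \<comment> \<open>The left face is isomorphic to the commutant of the right one and vice
        versa, which explains the crossed order of the facts. The composites of \<open>h\<close>
        with \<open>p\<close> and of \<open>k\<close> with \<open>q\<close> go from the left face to
        the right one and back.\<close>
      have "?iso ?l ?r"
        by (rule isomorphic_Alg_of_mutual[OF fa(2,1) 1(2,1) Alg_Comp[OF h p] Alg_Comp[OF k q]])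
      then show ?P1
        unfolding P1 using 1 by blast
    qed
    have P13: "?P1 \<longleftrightarrow> ?P3"
    proof
      assume P: ?P1
      then have "balanced V J C ?l" "?iso ?l ?r"
        using P14 P1 by auto
      then show ?P3
        using pairing_exists[OF D] by blast
    next
      assume ?P3
      then obtain A E h where A: "balanced V J C A" "is_pairing V J C A A E"
        and h: "h \<in> Hom (BAlg V J C) D E" "is_iso (BAlg V J C) h"
        by (auto simp: isomorphic_def)
      then have "h \<in> Arr (BAlg V J C)" "Dom (BAlg V J C) h = D" "Cod (BAlg V J C) h = E"
        by (auto simp: Hom_def)
      then show ?P1
        using balanced_bifold_BAlg_iso[OF _ h(2)] pairing_balanced[OF A] by simp
    qed
    show ?thesis
      using P12 P13 P14 P15 by blast
  qed
  have "replete_full_subcategory (BalBAlg V J C) (BAlg V J C)"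
    unfolding replete_full_subcategory_def full_subcategory_def
  proof (intro conjI ballI impI)
    have Ob: "Dom (BAlg V J C) f \<in> Ob (BAlg V J C) \<and> Cod (BAlg V J C) f \<in> Ob (BAlg V J C)" if "f \<in> Arr (BAlg V J C)" for f
    proof -
      obtain T U F M N \<alpha> T' U' F' where "f = ((T, U, F), (M, N, \<alpha>), (T', U', F'))"
        by (metis surj_pair)
      then show ?thesis
        using that by (auto simp: BAlg_simps)
    qed
    show "Arr (BalBAlg V J C) = {f \<in> Arr (BAlg V J C). Dom (BAlg V J C) f \<in> Ob (BalBAlg V J C) \<and> Cod (BAlg V J C) f \<in> Ob (BalBAlg V J C)}"
      using Ob by (auto simp: BalBAlg_def full_subcat_def)
    fix f assume f: "f \<in> Arr (BAlg V J C)" "Dom (BAlg V J C) f \<in> Ob (BalBAlg V J C) \<and> is_iso (BAlg V J C) f"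
    then have "balanced_bifold V J C (Cod (BAlg V J C) f)"
      using balanced_bifold_BAlg_iso[OF f(1)] by (simp add: BalBAlg_def full_subcat_def)
    then show "Cod (BAlg V J C) f \<in> Ob (BalBAlg V J C)" "f \<in> Arr (BalBAlg V J C)"
      using f Ob[OF f(1)] by (simp_all add: BalBAlg_def full_subcat_def)
  qed (auto simp: BalBAlg_def full_subcat_def)
  then show ?thesis
    unfolding Let_def by (intro conjI[rotated] allI impI equiv)
qed

end
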